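(* Let $R$ be a commutative ring and let $\mathcal{A}$ be a full abelian subcategory of $\mathcal{F}_R$, with enough projectives and injectives, such that for all $M\in\mathrm{P}_R$ the parameterization functors $F\mapsto F^M$ and $F\mapsto F_M$ restrict to functors $\mathcal{A}\to\mathcal{A}$. Let $s$ be a positive integer. Let $F\in\mathcal{A}$ be a polynomial functor and let $G\in\mathcal{P}_{s,R}$ be a strict polynomial functor whose underlying ordinary functor is in $\mathcal{A}$. Assume that $\deg(F)<s$. (i) For all $i$, $\mathrm{Ext}^i_{\mathcal{A}}(F,G)$ is a torsion abelian group. (ii) For all primes $p$ and all $i$, the integral torsion of the $p$-primary part of $\mathrm{Ext}^i_{\mathcal{A}}(F,G)$ is bounded by $p^r$ (i.e. the $p$-primary part is killed by $p^r$) with $r=\left\lceil\frac{\deg(F)+1-\Sigma_p(s)}{p-1}\right\rceil$, where for $r\le 0$ this means that the $p$-primary part is zero. (iii) Assume furthermore that $F\in\mathcal{P}_{t,R}$ for some positive integer $t$ (i.e. $F$ is the underlying ordinary functor of an object of $\mathcal{P}_{t,R}$). For every prime $p$, if $\mathcal{I}(p,t)\cap\mathcal{I}(p,s)=\emptyset$, then the $p$-primary part of $\mathrm{Ext}^i_{\mathcal{A}}(F,G)$ is zero for all $i$.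
   Context: Let $\mathrm{P}_R$ be the category of finitely generated projective $R$-modules and $\mathcal{F}_R$ the category of all functors $\mathrm{P}_R\to R\text{-Mod}$. For $F\in\mathcal{F}_R$ and $M\in\mathrm{P}_R$, set $F_M:N\mapsto F(M\otimes_RN)$ and $F^M:N\mapsto F(\mathrm{Hom}_R(M,N))$. For an integer $s\ge 0$, the Schur category $\Gamma^s\mathrm{P}_R$ is the $R$-linear category with the same objects as $\mathrm{P}_R$, with morphisms $\mathrm{Hom}_{\Gamma^s\mathrm{P}_R}(M,N)=\mathrm{Hom}_{\mathfrak{S}_s}(M^{\otimes s},N^{\otimes s})\simeq\Gamma^s(\mathrm{Hom}_R(M,N))$ (the $\mathfrak{S}_s$-equivariant $R$-linear maps, $\mathfrak{S}_s$ permuting tensor factors; $M^{\otimes 0}=R$), and composition of equivariant maps. The category $\mathcal{P}_{s,R}$ of homogeneous strict polynomial functors of weight $s$ is the abelian category of $R$-linear functors $\Gamma^s\mathrm{P}_R\to R\text{-Mod}$. Each object of $\mathcal{P}_{s,R}$ has an underlying ordinary functor in $\mathcal{F}_R$, obtained by precomposing with the functor $\mathrm{P}_R\to\Gamma^s\mathrm{P}_R$ which is the identity on objects and $f\mapsto f^{\otimes s}$ on morphisms; it is denoted by the same letter, and $\mathrm{Ext}^i_{\mathcal{A}}(F,G)$ is computed with underlying ordinary functors. Degree (Eilenberg–Mac Lane). For $F\in\mathcal{F}_R$ the cross effects are the natural direct summands defined inductively by $\mathrm{cr}_1F(X)\oplus F(0)=F(X)$ and $\mathrm{cr}_dF(X_1,\dots,X_d)\oplus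 \mathrm{cr}_{d-1}F(X_1,X_3,\dots,X_d)\oplus \mathrm{cr}_{d-1}F(X_2,X_3,\dots,X_d)=\mathrm{cr}_{d-1}F(X_1\oplus X_2,X_3,\dots,X_d)$. $F$ is polynomial of degree $\le d$ if $\mathrm{cr}_{d+1}F=0$, and of degree $d$ if moreover $\mathrm{cr}_dF\neq 0$ (nonzero constant functors have degree $0$); the zero functor has degree $-\infty$. $\Sigma_p(s)$ denotes the sum of the digits of the $p$-adic expansion of $s$, and $\mathcal{I}(p,s)=\{n\in\mathbb{N}\mid n\equiv s \bmod (p-1),\ \Sigma_p(s)\le n\le s\}$. $\lceil x\rceil$ is the smallest integer $\ge x$. *)

theory Defs
  imports "HOL-Algebra.Module" "HOL-Algebra.AbelCoset" "HOL-Combinatorics.Permutations"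
    "HOL-Computational_Algebra.Primes" "HOL-Library.Extended_Real"
begin

section \<open>Modules\<close>

text \<open>Linear maps are taken extensional, so that equality of morphisms is equality in HOL. The
  fields \<open>mult\<close> and \<open>one\<close>, which the record \<open>module\<close> inherits from \<open>ring\<close>, play no role.\<close>

definition lin_maps :: "'r ring \<Rightarrow> ('r, 'a) module \<Rightarrow> ('r, 'b) module \<Rightarrow> ('a \<Rightarrow> 'b) set" where
  "lin_maps R M N = {f \<in> carrier M \<rightarrow>\<^sub>E carrier N.
     (\<forall>x\<in>carrier M. \<forall>y\<in>carrier M. f (x \<oplus>\<^bsub>M\<^esub> y) = f x \<oplus>\<^bsub>N\<^esub> f y) \<and>
     (\<forall>a\<in>carrier R. \<forall>x\<in>carrier M. f (a \<odot>\<^bsub>M\<^esub> x) = a \<odot>\<^bsub>N\<^esub> f x)}"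

definition hom_mod :: "'r ring \<Rightarrow> ('r, 'a) module \<Rightarrow> ('r, 'b) module \<Rightarrow> ('r, 'a \<Rightarrow> 'b) module" where
  "hom_mod R M N = \<lparr>carrier = lin_maps R M N, monoid.mult = undefined, one = undefined,
     zero = (\<lambda>x\<in>carrier M. \<zero>\<^bsub>N\<^esub>),
     add = (\<lambda>f g. \<lambda>x\<in>carrier M. f x \<oplus>\<^bsub>N\<^esub> g x),
     smult = (\<lambda>a f. \<lambda>x\<in>carrier M. a \<odot>\<^bsub>N\<^esub> f x)\<rparr>"

definition prod_mod :: "('r, 'a) module \<Rightarrow> ('r, 'b) module \<Rightarrow> ('r, 'a \<times> 'b) module" where
  "prod_mod M N = \<lparr>carrier = carrier M \<times> carrier N, monoid.mult = undefined, one = undefined,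
     zero = (\<zero>\<^bsub>M\<^esub>, \<zero>\<^bsub>N\<^esub>),
     add = (\<lambda>(x, y) (x', y'). (x \<oplus>\<^bsub>M\<^esub> x', y \<oplus>\<^bsub>N\<^esub> y')),
     smult = (\<lambda>a (x, y). (a \<odot>\<^bsub>M\<^esub> x, a \<odot>\<^bsub>N\<^esub> y))\<rparr>"

definition submod_span :: "'r ring \<Rightarrow> ('r, 'a) module \<Rightarrow> 'a set \<Rightarrow> 'a set" where
  "submod_span R M S = \<Inter>{H. submodule H R M \<and> S \<subseteq> H}"

definition quot_mod :: "('r, 'a) module \<Rightarrow> 'a set \<Rightarrow> ('r, 'a set) module" where
  "quot_mod M H = \<lparr>carrier = a_rcosets\<^bsub>M\<^esub> H, monoid.mult = undefined, one = undefined,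
     zero = H,
     add = (<+>\<^bsub>M\<^esub>),
     smult = (\<lambda>a X. \<Union>x\<in>X. H +>\<^bsub>M\<^esub> (a \<odot>\<^bsub>M\<^esub> x))\<rparr>"

definition free_mod :: "'r ring \<Rightarrow> 'x set \<Rightarrow> ('r, 'x \<Rightarrow> 'r) module" where
  "free_mod R S = \<lparr>carrier = {c \<in> S \<rightarrow>\<^sub>E carrier R. finite {x \<in> S. c x \<noteq> \<zero>\<^bsub>R\<^esub>}},
     monoid.mult = undefined, one = undefined,
     zero = (\<lambda>x\<in>S. \<zero>\<^bsub>R\<^esub>),
     add = (\<lambda>c c'. \<lambda>x\<in>S. c x \<oplus>\<^bsub>R\<^esub> c' x),
     smult = (\<lambda>a c. \<lambda>x\<in>S. a \<otimes>\<^bsub>R\<^esub> c x)\<rparr>"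

definition free_basis :: "'r ring \<Rightarrow> 'x set \<Rightarrow> 'x \<Rightarrow> ('x \<Rightarrow> 'r)" where
  "free_basis R S x = (\<lambda>y\<in>S. if y = x then \<one>\<^bsub>R\<^esub> else \<zero>\<^bsub>R\<^esub>)"

text \<open>A finitely generated projective module is a direct summand of some \<open>R\<^sup>n\<close>. The textbook
  description (finitely generated, with the lifting property) is shown to be equivalent in
  \<open>fg_projective_iff\<close> below.\<close>

definition fg_projective :: "'r ring \<Rightarrow> ('r, 'a) module \<Rightarrow> bool" where
  "fg_projective R M \<longleftrightarrow> Module.module R M \<and>
     (\<exists>n::nat. \<exists>i \<in> lin_maps R M (free_mod R {..<n}). \<exists>q \<in> lin_maps R (free_mod R {..<n}) M.
        \<forall>x\<in>carrier M. q (i x) = x)"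


section \<open>Tensor products\<close>

definition tensor_relations ::
    "'r ring \<Rightarrow> 'i set \<Rightarrow> ('i \<Rightarrow> ('r, 'a) module) \<Rightarrow> (('i \<Rightarrow> 'a) \<Rightarrow> 'r) set" where
  "tensor_relations R I M =
     (let X = (\<Pi>\<^sub>E i\<in>I. carrier (M i)); L = free_mod R X; e = free_basis R X in
      {e (x(i := a \<oplus>\<^bsub>M i\<^esub> b)) \<ominus>\<^bsub>L\<^esub> (e (x(i := a)) \<oplus>\<^bsub>L\<^esub> e (x(i := b))) | x i a b.
         x \<in> X \<and> i \<in> I \<and> a \<in> carrier (M i) \<and> b \<in> carrier (M i)} \<union>
      {e (x(i := r \<odot>\<^bsub>M i\<^esub> a)) \<ominus>\<^bsub>L\<^esub> r \<odot>\<^bsub>L\<^esub> e (x(i := a)) | x i r a.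
         x \<in> X \<and> i \<in> I \<and> r \<in> carrier R \<and> a \<in> carrier (M i)})"

text \<open>The tensor product over \<open>R\<close> of a finite family \<open>(M i)\<close>, \<open>i \<in> I\<close>; for \<open>I = {}\<close> it is free
  on the single empty tuple, i.e. \<open>R\<close>.\<close>

definition tensor :: "'r ring \<Rightarrow> 'i set \<Rightarrow> ('i \<Rightarrow> ('r, 'a) module) \<Rightarrow> ('r, (('i \<Rightarrow> 'a) \<Rightarrow> 'r) set) module"
  where
  "tensor R I M = (let L = free_mod R (\<Pi>\<^sub>E i\<in>I. carrier (M i)) in
     quot_mod L (submod_span R L (tensor_relations R I M)))"

definition pure_tensor ::
    "'r ring \<Rightarrow> 'i set \<Rightarrow> ('i \<Rightarrow> ('r, 'a) module) \<Rightarrow> ('i \<Rightarrow> 'a) \<Rightarrow> (('i \<Rightarrow> 'a) \<Rightarrow> 'r) set" where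
  "pure_tensor R I M x = (let X = (\<Pi>\<^sub>E i\<in>I. carrier (M i)); L = free_mod R X in
     submod_span R L (tensor_relations R I M) +>\<^bsub>L\<^esub> free_basis R X x)"

definition tensor_map ::
    "'r ring \<Rightarrow> 'i set \<Rightarrow> ('i \<Rightarrow> ('r, 'a) module) \<Rightarrow> ('i \<Rightarrow> ('r, 'b) module) \<Rightarrow> ('i \<Rightarrow> 'a \<Rightarrow> 'b) \<Rightarrow>
     (('i \<Rightarrow> 'a) \<Rightarrow> 'r) set \<Rightarrow> (('i \<Rightarrow> 'b) \<Rightarrow> 'r) set" where
  "tensor_map R I M N f = (THE h. h \<in> lin_maps R (tensor R I M) (tensor R I N) \<and>
     (\<forall>x \<in> (\<Pi>\<^sub>E i\<in>I. carrier (M i)). h (pure_tensor R I M x) = pure_tensor R I N (\<lambda>i\<in>I. f i (x i))))"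

abbreviation tensor_power :: "'r ring \<Rightarrow> nat \<Rightarrow> ('r, 'a) module \<Rightarrow> ('r, ((nat \<Rightarrow> 'a) \<Rightarrow> 'r) set) module"
  where "tensor_power R s M \<equiv> tensor R {..<s} (\<lambda>_. M)"

definition tensor_perm :: "'r ring \<Rightarrow> nat \<Rightarrow> ('r, 'a) module \<Rightarrow> (nat \<Rightarrow> nat) \<Rightarrow>
     ((nat \<Rightarrow> 'a) \<Rightarrow> 'r) set \<Rightarrow> ((nat \<Rightarrow> 'a) \<Rightarrow> 'r) set" where
  "tensor_perm R s M \<sigma> = (THE h. h \<in> lin_maps R (tensor_power R s M) (tensor_power R s M) \<and>
     (\<forall>x \<in> (\<Pi>\<^sub>E i\<in>{..<s}. carrier M). h (pure_tensor R {..<s} (\<lambda>_. M) x) =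
        pure_tensor R {..<s} (\<lambda>_. M) (\<lambda>i\<in>{..<s}. x (\<sigma> i))))"

abbreviation (input) two_family :: "'c \<Rightarrow> 'c \<Rightarrow> nat \<Rightarrow> 'c" where
  "two_family u v \<equiv> (\<lambda>i. if i = 0 then u else v)"

definition tensor2 :: "'r ring \<Rightarrow> ('r, 'a) module \<Rightarrow> ('r, 'a) module \<Rightarrow> ('r, ((nat \<Rightarrow> 'a) \<Rightarrow> 'r) set) module"
  where "tensor2 R M N = tensor R {..<2} (two_family M N)"


section \<open>Linear categories\<close>

text \<open>An \<open>R\<close>-linear category, with \<open>Cmp C X Y Z g f\<close> the composite of \<open>f : X \<rightarrow> Y\<close> and
  \<open>g : Y \<rightarrow> Z\<close>. The \<open>Hom C X Y\<close> need not be disjoint, so sources and targets are passed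
  explicitly.\<close>

record ('r, 'o, 'a) lincat =
  Ob :: "'o set"
  Hom :: "'o \<Rightarrow> 'o \<Rightarrow> ('r, 'a) module"
  Idn :: "'o \<Rightarrow> 'a"
  Cmp :: "'o \<Rightarrow> 'o \<Rightarrow> 'o \<Rightarrow> 'a \<Rightarrow> 'a \<Rightarrow> 'a"

abbreviation arrs :: "('r, 'o, 'a) lincat \<Rightarrow> 'o \<Rightarrow> 'o \<Rightarrow> 'a set" where
  "arrs C X Y \<equiv> carrier (Hom C X Y)"

abbreviation zero_arr :: "('r, 'o, 'a) lincat \<Rightarrow> 'o \<Rightarrow> 'o \<Rightarrow> 'a" where
  "zero_arr C X Y \<equiv> \<zero>\<^bsub>Hom C X Y\<^esub>"

locale linear_category =
  fixes R :: "'r ring" and C :: "('r, 'o, 'a) lincat"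
  assumes hom_module: "\<lbrakk>X \<in> Ob C; Y \<in> Ob C\<rbrakk> \<Longrightarrow> Module.module R (Hom C X Y)"
    and idn_arr: "X \<in> Ob C \<Longrightarrow> Idn C X \<in> arrs C X X"
    and cmp_arr: "\<lbrakk>X \<in> Ob C; Y \<in> Ob C; Z \<in> Ob C; f \<in> arrs C X Y; g \<in> arrs C Y Z\<rbrakk>
      \<Longrightarrow> Cmp C X Y Z g f \<in> arrs C X Z"
    and cmp_idn: "\<lbrakk>X \<in> Ob C; Y \<in> Ob C; f \<in> arrs C X Y\<rbrakk> \<Longrightarrow> Cmp C X X Y f (Idn C X) = f"
    and idn_cmp: "\<lbrakk>X \<in> Ob C; Y \<in> Ob C; f \<in> arrs C X Y\<rbrakk> \<Longrightarrow> Cmp C X Y Y (Idn C Y) f = f"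
    and cmp_assoc: "\<lbrakk>W \<in> Ob C; X \<in> Ob C; Y \<in> Ob C; Z \<in> Ob C;
        f \<in> arrs C W X; g \<in> arrs C X Y; h \<in> arrs C Y Z\<rbrakk>
      \<Longrightarrow> Cmp C W Y Z h (Cmp C W X Y g f) = Cmp C W X Z (Cmp C X Y Z h g) f"
    and cmp_add_left: "\<lbrakk>X \<in> Ob C; Y \<in> Ob C; Z \<in> Ob C; f \<in> arrs C X Y; g \<in> arrs C Y Z; g' \<in> arrs C Y Z\<rbrakk>
      \<Longrightarrow> Cmp C X Y Z (g \<oplus>\<^bsub>Hom C Y Z\<^esub> g') f = Cmp C X Y Z g f \<oplus>\<^bsub>Hom C X Z\<^esub> Cmp C X Y Z g' f"
    and cmp_add_right: "\<lbrakk>X \<in> Ob C; Y \<in> Ob C; Z \<in> Ob C; f \<in> arrs C X Y; f' \<in> arrs C X Y; g \<in> arrs C Y Z\<rbrakk>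
      \<Longrightarrow> Cmp C X Y Z g (f \<oplus>\<^bsub>Hom C X Y\<^esub> f') = Cmp C X Y Z g f \<oplus>\<^bsub>Hom C X Z\<^esub> Cmp C X Y Z g f'"
    and cmp_smult_left: "\<lbrakk>X \<in> Ob C; Y \<in> Ob C; Z \<in> Ob C; a \<in> carrier R; f \<in> arrs C X Y; g \<in> arrs C Y Z\<rbrakk>
      \<Longrightarrow> Cmp C X Y Z (a \<odot>\<^bsub>Hom C Y Z\<^esub> g) f = a \<odot>\<^bsub>Hom C X Z\<^esub> Cmp C X Y Z g f"
    and cmp_smult_right: "\<lbrakk>X \<in> Ob C; Y \<in> Ob C; Z \<in> Ob C; a \<in> carrier R; f \<in> arrs C X Y; g \<in> arrs C Y Z\<rbrakk>
      \<Longrightarrow> Cmp C X Y Z g (a \<odot>\<^bsub>Hom C X Y\<^esub> f) = a \<odot>\<^bsub>Hom C X Z\<^esub> Cmp C X Y Z g f"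

definition full_subcat :: "('r, 'o, 'a) lincat \<Rightarrow> 'o set \<Rightarrow> ('r, 'o, 'a) lincat" where
  "full_subcat C A = C\<lparr>Ob := A\<rparr>"

definition iso_obj :: "('r, 'o, 'a) lincat \<Rightarrow> 'o \<Rightarrow> 'o \<Rightarrow> bool" where
  "iso_obj C X Y \<longleftrightarrow> X \<in> Ob C \<and> Y \<in> Ob C \<and>
     (\<exists>f \<in> arrs C X Y. \<exists>g \<in> arrs C Y X. Cmp C X Y X g f = Idn C X \<and> Cmp C Y X Y f g = Idn C Y)"

definition monic :: "('r, 'o, 'a) lincat \<Rightarrow> 'o \<Rightarrow> 'o \<Rightarrow> 'a \<Rightarrow> bool" where
  "monic C X Y f \<longleftrightarrow> X \<in> Ob C \<and> Y \<in> Ob C \<and> f \<in> arrs C X Y \<and>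
     (\<forall>W\<in>Ob C. \<forall>g\<in>arrs C W X. \<forall>h\<in>arrs C W X. Cmp C W X Y f g = Cmp C W X Y f h \<longrightarrow> g = h)"

definition epic :: "('r, 'o, 'a) lincat \<Rightarrow> 'o \<Rightarrow> 'o \<Rightarrow> 'a \<Rightarrow> bool" where
  "epic C X Y f \<longleftrightarrow> X \<in> Ob C \<and> Y \<in> Ob C \<and> f \<in> arrs C X Y \<and>
     (\<forall>Z\<in>Ob C. \<forall>g\<in>arrs C Y Z. \<forall>h\<in>arrs C Y Z. Cmp C X Y Z g f = Cmp C X Y Z h f \<longrightarrow> g = h)"

definition is_kernel :: "('r, 'o, 'a) lincat \<Rightarrow> 'o \<Rightarrow> 'o \<Rightarrow> 'a \<Rightarrow> 'o \<Rightarrow> 'a \<Rightarrow> bool" where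
  "is_kernel C X Y f K k \<longleftrightarrow> K \<in> Ob C \<and> k \<in> arrs C K X \<and> Cmp C K X Y f k = zero_arr C K Y \<and>
     (\<forall>W\<in>Ob C. \<forall>g\<in>arrs C W X. Cmp C W X Y f g = zero_arr C W Y \<longrightarrow>
        (\<exists>!h. h \<in> arrs C W K \<and> Cmp C W K X k h = g))"

definition is_cokernel :: "('r, 'o, 'a) lincat \<Rightarrow> 'o \<Rightarrow> 'o \<Rightarrow> 'a \<Rightarrow> 'o \<Rightarrow> 'a \<Rightarrow> bool" where
  "is_cokernel C X Y f Q q \<longleftrightarrow> Q \<in> Ob C \<and> q \<in> arrs C Y Q \<and> Cmp C X Y Q q f = zero_arr C X Q \<and>
     (\<forall>Z\<in>Ob C. \<forall>g\<in>arrs C Y Z. Cmp C X Y Z g f = zero_arr C X Z \<longrightarrow>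
        (\<exists>!h. h \<in> arrs C Q Z \<and> Cmp C Y Q Z h q = g))"

definition zero_object :: "('r, 'o, 'a) lincat \<Rightarrow> 'o \<Rightarrow> bool" where
  "zero_object C Z \<longleftrightarrow> Z \<in> Ob C \<and>
     (\<forall>X\<in>Ob C. arrs C X Z = {zero_arr C X Z} \<and> arrs C Z X = {zero_arr C Z X})"

definition has_biproduct :: "('r, 'o, 'a) lincat \<Rightarrow> 'o \<Rightarrow> 'o \<Rightarrow> bool" where
  "has_biproduct C X Y \<longleftrightarrow> (\<exists>B\<in>Ob C. \<exists>i1\<in>arrs C X B. \<exists>i2\<in>arrs C Y B. \<exists>p1\<in>arrs C B X. \<exists>p2\<in>arrs C B Y.
     Cmp C X B X p1 i1 = Idn C X \<and> Cmp C Y B Y p2 i2 = Idn C Y \<and>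
     Cmp C Y B X p1 i2 = zero_arr C Y X \<and> Cmp C X B Y p2 i1 = zero_arr C X Y \<and>
     Cmp C B X B i1 p1 \<oplus>\<^bsub>Hom C B B\<^esub> Cmp C B Y B i2 p2 = Idn C B)"

locale abelian_category = linear_category +
  assumes zero_ex: "\<exists>Z. zero_object C Z"
    and biproduct_ex: "\<lbrakk>X \<in> Ob C; Y \<in> Ob C\<rbrakk> \<Longrightarrow> has_biproduct C X Y"
    and kernel_ex: "\<lbrakk>X \<in> Ob C; Y \<in> Ob C; f \<in> arrs C X Y\<rbrakk> \<Longrightarrow> \<exists>K k. is_kernel C X Y f K k"
    and cokernel_ex: "\<lbrakk>X \<in> Ob C; Y \<in> Ob C; f \<in> arrs C X Y\<rbrakk> \<Longrightarrow> \<exists>Q q. is_cokernel C X Y f Q q"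
    and monic_normal: "monic C X Y f \<Longrightarrow> \<exists>Z g. Z \<in> Ob C \<and> g \<in> arrs C Y Z \<and> is_kernel C Y Z g X f"
    and epic_normal: "epic C X Y f \<Longrightarrow> \<exists>W g. W \<in> Ob C \<and> g \<in> arrs C W X \<and> is_cokernel C W X g Y f"


section \<open>Ext groups\<close>

definition projective_obj :: "('r, 'o, 'a) lincat \<Rightarrow> 'o \<Rightarrow> bool" where
  "projective_obj C P \<longleftrightarrow> P \<in> Ob C \<and>
     (\<forall>X Y e. epic C X Y e \<longrightarrow> (\<forall>f\<in>arrs C P Y. \<exists>g\<in>arrs C P X. Cmp C P X Y e g = f))"

definition injective_obj :: "('r, 'o, 'a) lincat \<Rightarrow> 'o \<Rightarrow> bool" where
  "injective_obj C J \<longleftrightarrow> J \<in> Ob C \<and>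
     (\<forall>X Y m. monic C X Y m \<longrightarrow> (\<forall>f\<in>arrs C X J. \<exists>g\<in>arrs C Y J. Cmp C X Y J g m = f))"

definition enough_projectives :: "('r, 'o, 'a) lincat \<Rightarrow> bool" where
  "enough_projectives C \<longleftrightarrow> (\<forall>X\<in>Ob C. \<exists>P e. projective_obj C P \<and> epic C P X e)"

definition enough_injectives :: "('r, 'o, 'a) lincat \<Rightarrow> bool" where
  "enough_injectives C \<longleftrightarrow> (\<forall>X\<in>Ob C. \<exists>J m. injective_obj C J \<and> monic C X J m)"

text \<open>Exactness of \<open>X \<rightarrow> Y \<rightarrow> Z\<close> (maps \<open>f\<close>, \<open>g\<close>) in an abelian category \<open>C\<close>: \<open>g\<close> kills \<open>f\<close>, and
  \<open>f\<close> corestricts to an epimorphism onto the kernel of \<open>g\<close>, everything being taken inside \<open>C\<close>.\<close>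

definition exact_at :: "('r, 'o, 'a) lincat \<Rightarrow> 'o \<Rightarrow> 'o \<Rightarrow> 'o \<Rightarrow> 'a \<Rightarrow> 'a \<Rightarrow> bool" where
  "exact_at C X Y Z f g \<longleftrightarrow> f \<in> arrs C X Y \<and> g \<in> arrs C Y Z \<and> Cmp C X Y Z g f = zero_arr C X Z \<and>
     (\<forall>K k. is_kernel C Y Z g K k \<longrightarrow> (\<forall>h\<in>arrs C X K. Cmp C X K Y k h = f \<longrightarrow> epic C X K h))"

text \<open>The augmented complex is \<open>\<dots> \<rightarrow> P 1 \<rightarrow> P 0 \<rightarrow> X \<rightarrow> 0\<close> with \<open>d n : P (n+1) \<rightarrow> P n\<close>.\<close>

definition projective_resolution ::
    "('r, 'o, 'a) lincat \<Rightarrow> 'o \<Rightarrow> (nat \<Rightarrow> 'o) \<Rightarrow> (nat \<Rightarrow> 'a) \<Rightarrow> 'a \<Rightarrow> bool" where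
  "projective_resolution C X P d \<epsilon> \<longleftrightarrow> (\<forall>n. projective_obj C (P n)) \<and>
     epic C (P 0) X \<epsilon> \<and> exact_at C (P 1) (P 0) X (d 0) \<epsilon> \<and>
     (\<forall>n. exact_at C (P (n + 2)) (P (n + 1)) (P n) (d (n + 1)) (d n))"

definition cocycles :: "('r, 'o, 'a) lincat \<Rightarrow> (nat \<Rightarrow> 'o) \<Rightarrow> (nat \<Rightarrow> 'a) \<Rightarrow> 'o \<Rightarrow> nat \<Rightarrow> 'a set" where
  "cocycles C P d Y i = {f \<in> arrs C (P i) Y. Cmp C (P (i + 1)) (P i) Y f (d i) = zero_arr C (P (i + 1)) Y}"

fun coboundaries :: "('r, 'o, 'a) lincat \<Rightarrow> (nat \<Rightarrow> 'o) \<Rightarrow> (nat \<Rightarrow> 'a) \<Rightarrow> 'o \<Rightarrow> nat \<Rightarrow> 'a set" where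
  "coboundaries C P d Y 0 = {zero_arr C (P 0) Y}"
| "coboundaries C P d Y (Suc i) = {Cmp C (P (Suc i)) (P i) Y g (d i) | g. g \<in> arrs C (P i) Y}"

definition Ext :: "('r, 'o, 'a) lincat \<Rightarrow> nat \<Rightarrow> 'o \<Rightarrow> 'o \<Rightarrow> ('r, 'a set) module" where
  "Ext C i X Y = (let (P, d) = (SOME (P, d). \<exists>\<epsilon>. projective_resolution C X P d \<epsilon>) in
     quot_mod ((Hom C (P i) Y)\<lparr>carrier := cocycles C P d Y i\<rparr>) (coboundaries C P d Y i))"

definition torsion_group :: "('r, 'a) module \<Rightarrow> bool" where
  "torsion_group E \<longleftrightarrow> (\<forall>x\<in>carrier E. \<exists>n::nat. n > 0 \<and> [n] \<cdot>\<^bsub>E\<^esub> x = \<zero>\<^bsub>E\<^esub>)"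

definition primary_part :: "nat \<Rightarrow> ('r, 'a) module \<Rightarrow> 'a set" where
  "primary_part p E = {x \<in> carrier E. \<exists>k::nat. [(p ^ k)] \<cdot>\<^bsub>E\<^esub> x = \<zero>\<^bsub>E\<^esub>}"


section \<open>Functors\<close>

record ('o, 'a, 'p, 'b) ftr =
  fobj :: "'o \<Rightarrow> 'p"
  farr :: "'o \<Rightarrow> 'o \<Rightarrow> 'a \<Rightarrow> 'b"

definition is_functor :: "('r, 'o, 'a) lincat \<Rightarrow> ('r, 'p, 'b) lincat \<Rightarrow> ('o, 'a, 'p, 'b) ftr \<Rightarrow> bool" where
  "is_functor C D F \<longleftrightarrow>
     (\<forall>X\<in>Ob C. fobj F X \<in> Ob D) \<and>
     (\<forall>X\<in>Ob C. \<forall>Y\<in>Ob C. \<forall>f\<in>arrs C X Y. farr F X Y f \<in> arrs D (fobj F X) (fobj F Y)) \<and>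
     (\<forall>X\<in>Ob C. farr F X X (Idn C X) = Idn D (fobj F X)) \<and>
     (\<forall>X\<in>Ob C. \<forall>Y\<in>Ob C. \<forall>Z\<in>Ob C. \<forall>f\<in>arrs C X Y. \<forall>g\<in>arrs C Y Z.
        farr F X Z (Cmp C X Y Z g f) =
          Cmp D (fobj F X) (fobj F Y) (fobj F Z) (farr F Y Z g) (farr F X Y f))"

definition is_linear_functor ::
    "'r ring \<Rightarrow> ('r, 'o, 'a) lincat \<Rightarrow> ('r, 'p, 'b) lincat \<Rightarrow> ('o, 'a, 'p, 'b) ftr \<Rightarrow> bool" where
  "is_linear_functor R C D F \<longleftrightarrow> is_functor C D F \<and>
     (\<forall>X\<in>Ob C. \<forall>Y\<in>Ob C. \<forall>f\<in>arrs C X Y.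
        (\<forall>g\<in>arrs C X Y. farr F X Y (f \<oplus>\<^bsub>Hom C X Y\<^esub> g) =
           farr F X Y f \<oplus>\<^bsub>Hom D (fobj F X) (fobj F Y)\<^esub> farr F X Y g) \<and>
        (\<forall>a\<in>carrier R. farr F X Y (a \<odot>\<^bsub>Hom C X Y\<^esub> f) =
           a \<odot>\<^bsub>Hom D (fobj F X) (fobj F Y)\<^esub> farr F X Y f))"

text \<open>All functors \<open>C \<rightarrow> D\<close>, with natural transformations as morphisms.\<close>

definition functor_cat ::
    "('r, 'o, 'a) lincat \<Rightarrow> ('r, 'p, 'b) lincat \<Rightarrow> ('r, ('o, 'a, 'p, 'b) ftr, 'o \<Rightarrow> 'b) lincat" where
  "functor_cat C D = \<lparr>
     Ob = {F. is_functor C D F},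
     Hom = (\<lambda>F G. \<lparr>
       carrier = {\<alpha> \<in> (\<Pi>\<^sub>E X\<in>Ob C. arrs D (fobj F X) (fobj G X)).
         \<forall>X\<in>Ob C. \<forall>Y\<in>Ob C. \<forall>f\<in>arrs C X Y.
           Cmp D (fobj F X) (fobj F Y) (fobj G Y) (\<alpha> Y) (farr F X Y f) =
           Cmp D (fobj F X) (fobj G X) (fobj G Y) (farr G X Y f) (\<alpha> X)},
       monoid.mult = undefined, one = undefined,
       zero = (\<lambda>X\<in>Ob C. zero_arr D (fobj F X) (fobj G X)),
       add = (\<lambda>\<alpha> \<beta>. \<lambda>X\<in>Ob C. \<alpha> X \<oplus>\<^bsub>Hom D (fobj F X) (fobj G X)\<^esub> \<beta> X),
       smult = (\<lambda>a \<alpha>. \<lambda>X\<in>Ob C. a \<odot>\<^bsub>Hom D (fobj F X) (fobj G X)\<^esub> \<alpha> X)\<rparr>),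
     Idn = (\<lambda>F. \<lambda>X\<in>Ob C. Idn D (fobj F X)),
     Cmp = (\<lambda>F G H \<beta> \<alpha>. \<lambda>X\<in>Ob C. Cmp D (fobj F X) (fobj G X) (fobj H X) (\<beta> X) (\<alpha> X))\<rparr>"


section \<open>Ordinary and strict polynomial functors\<close>

definition module_cat :: "'r ring \<Rightarrow> ('r, 'a) module set \<Rightarrow> ('r, ('r, 'a) module, 'a \<Rightarrow> 'a) lincat" where
  "module_cat R S = \<lparr>Ob = S, Hom = hom_mod R, Idn = (\<lambda>M. \<lambda>x\<in>carrier M. x),
     Cmp = (\<lambda>L M N g f. compose (carrier L) g f)\<rparr>"

text \<open>The carriers of the objects of \<open>P_R\<close> are subsets of the type \<open>nat \<Rightarrow> 'r\<close>; every finitely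
  generated projective module, over whatever type, is isomorphic to one of these (being a submodule
  of some \<open>R\<^sup>n\<close>; see \<open>fg_projective_model\<close> below). The type \<open>'m\<close> of the elements of the values of
  the functors is arbitrary and plays the role of the universe in which \<open>R\<close>-modules live.\<close>

type_synonym 'r pmod = "('r, nat \<Rightarrow> 'r) module"

type_synonym ('r, 'm) pfunctor =
  "('r pmod, (nat \<Rightarrow> 'r) \<Rightarrow> (nat \<Rightarrow> 'r), ('r, 'm) module, 'm \<Rightarrow> 'm) ftr"

definition P_cat :: "'r ring \<Rightarrow> ('r, 'r pmod, (nat \<Rightarrow> 'r) \<Rightarrow> (nat \<Rightarrow> 'r)) lincat" where
  "P_cat R = module_cat R {M. fg_projective R M}"

definition Mod_cat :: "'r ring \<Rightarrow> ('r, ('r, 'm) module, 'm \<Rightarrow> 'm) lincat" where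
  "Mod_cat R = module_cat R {M. Module.module R M}"

definition F_cat :: "'r ring \<Rightarrow> ('r, ('r, 'm) pfunctor, 'r pmod \<Rightarrow> 'm \<Rightarrow> 'm) lincat" where
  "F_cat R = functor_cat (P_cat R) (Mod_cat R)"

text \<open>A chosen isomorphism \<open>model_iso R X\<close> from a finitely generated projective module \<open>X\<close> of
  any type onto an object \<open>model R X\<close> of \<open>P_R\<close>, its inverse, and the transport of linear maps. A
  functor on \<open>P_R\<close> is evaluated on such an \<open>X\<close> through this choice.\<close>

definition model_pair :: "'r ring \<Rightarrow> ('r, 'a) module \<Rightarrow> 'r pmod \<times> ('a \<Rightarrow> nat \<Rightarrow> 'r)" where
  "model_pair R X = (SOME (N, \<phi>). N \<in> Ob (P_cat R) \<and> \<phi> \<in> lin_maps R X N \<and>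
     bij_betw \<phi> (carrier X) (carrier N))"

definition model :: "'r ring \<Rightarrow> ('r, 'a) module \<Rightarrow> 'r pmod" where
  "model R X = fst (model_pair R X)"

definition model_iso :: "'r ring \<Rightarrow> ('r, 'a) module \<Rightarrow> 'a \<Rightarrow> (nat \<Rightarrow> 'r)" where
  "model_iso R X = snd (model_pair R X)"

definition model_inv :: "'r ring \<Rightarrow> ('r, 'a) module \<Rightarrow> (nat \<Rightarrow> 'r) \<Rightarrow> 'a" where
  "model_inv R X = (\<lambda>z\<in>carrier (model R X). inv_into (carrier X) (model_iso R X) z)"

definition model_map ::
    "'r ring \<Rightarrow> ('r, 'a) module \<Rightarrow> ('r, 'b) module \<Rightarrow> ('a \<Rightarrow> 'b) \<Rightarrow> (nat \<Rightarrow> 'r) \<Rightarrow> (nat \<Rightarrow> 'r)" where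
  "model_map R X Y f = (\<lambda>z\<in>carrier (model R X). model_iso R Y (f (model_inv R X z)))"

text \<open>\<open>F\<^sub>M : N \<mapsto> F (M \<otimes> N)\<close> and \<open>F\<^sup>M : N \<mapsto> F (Hom\<^sub>R(M, N))\<close>.\<close>

definition param_tensor :: "'r ring \<Rightarrow> ('r, 'm) pfunctor \<Rightarrow> 'r pmod \<Rightarrow> ('r, 'm) pfunctor" where
  "param_tensor R F M = \<lparr>
     fobj = (\<lambda>N. fobj F (model R (tensor2 R M N))),
     farr = (\<lambda>N N' f. farr F (model R (tensor2 R M N)) (model R (tensor2 R M N'))
       (model_map R (tensor2 R M N) (tensor2 R M N')
         (tensor_map R {..<2} (two_family M N) (two_family M N')
           (two_family (\<lambda>x\<in>carrier M. x) f))))\<rparr>"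

definition param_hom :: "'r ring \<Rightarrow> ('r, 'm) pfunctor \<Rightarrow> 'r pmod \<Rightarrow> ('r, 'm) pfunctor" where
  "param_hom R F M = \<lparr>
     fobj = (\<lambda>N. fobj F (model R (hom_mod R M N))),
     farr = (\<lambda>N N' f. farr F (model R (hom_mod R M N)) (model R (hom_mod R M N'))
       (model_map R (hom_mod R M N) (hom_mod R M N') (\<lambda>u. compose (carrier M) f u)))\<rparr>"

text \<open>The Schur category \<open>\<Gamma>\<^sup>s P_R\<close>.\<close>

type_synonym 'r tpow = "((nat \<Rightarrow> nat \<Rightarrow> 'r) \<Rightarrow> 'r) set"

definition Schur_cat :: "'r ring \<Rightarrow> nat \<Rightarrow> ('r, 'r pmod, 'r tpow \<Rightarrow> 'r tpow) lincat" where
  "Schur_cat R s = \<lparr>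
     Ob = Ob (P_cat R),
     Hom = (\<lambda>M N. (hom_mod R (tensor_power R s M) (tensor_power R s N))\<lparr>carrier :=
       {h \<in> lin_maps R (tensor_power R s M) (tensor_power R s N). \<forall>\<sigma>. \<sigma> permutes {..<s} \<longrightarrow>
          (\<forall>x\<in>carrier (tensor_power R s M). h (tensor_perm R s M \<sigma> x) = tensor_perm R s N \<sigma> (h x))}\<rparr>),
     Idn = (\<lambda>M. \<lambda>x\<in>carrier (tensor_power R s M). x),
     Cmp = (\<lambda>L M N g f. compose (carrier (tensor_power R s L)) g f)\<rparr>"

type_synonym ('r, 'm) strict_functor = "('r pmod, 'r tpow \<Rightarrow> 'r tpow, ('r, 'm) module, 'm \<Rightarrow> 'm) ftr"

text \<open>The category \<open>\<P>\<^sub>s\<^sub>,\<^sub>R\<close> of homogeneous strict polynomial functors of weight \<open>s\<close>.\<close>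

definition strict_poly_cat ::
    "'r ring \<Rightarrow> nat \<Rightarrow> ('r, ('r, 'm) strict_functor, 'r pmod \<Rightarrow> 'm \<Rightarrow> 'm) lincat" where
  "strict_poly_cat R s = full_subcat (functor_cat (Schur_cat R s) (Mod_cat R))
     {T. is_linear_functor R (Schur_cat R s) (Mod_cat R) T}"

definition underlying :: "'r ring \<Rightarrow> nat \<Rightarrow> ('r, 'm) strict_functor \<Rightarrow> ('r, 'm) pfunctor" where
  "underlying R s T = \<lparr>fobj = fobj T,
     farr = (\<lambda>M N f. farr T M N (tensor_map R {..<s} (\<lambda>_. M) (\<lambda>_. N) (\<lambda>_. f)))\<rparr>"


section \<open>Cross effects and degree\<close>

definition P_zero :: "'r ring \<Rightarrow> 'r pmod" where
  "P_zero R = free_mod R {}"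

definition P_sum :: "'r ring \<Rightarrow> 'r pmod \<Rightarrow> 'r pmod \<Rightarrow> 'r pmod" where
  "P_sum R X Y = model R (prod_mod X Y)"

definition P_fst :: "'r ring \<Rightarrow> 'r pmod \<Rightarrow> 'r pmod \<Rightarrow> (nat \<Rightarrow> 'r) \<Rightarrow> (nat \<Rightarrow> 'r)" where
  "P_fst R X Y = (\<lambda>z\<in>carrier (P_sum R X Y). fst (model_inv R (prod_mod X Y) z))"

definition P_snd :: "'r ring \<Rightarrow> 'r pmod \<Rightarrow> 'r pmod \<Rightarrow> (nat \<Rightarrow> 'r) \<Rightarrow> (nat \<Rightarrow> 'r)" where
  "P_snd R X Y = (\<lambda>z\<in>carrier (P_sum R X Y). snd (model_inv R (prod_mod X Y) z))"

text \<open>\<open>list_sum R X [Z\<^sub>1, \<dots>, Z\<^sub>k] = (X \<oplus> Z\<^sub>1) \<oplus> \<dots> \<oplus> Z\<^sub>k\<close>, and for \<open>f : X \<rightarrow> Y\<close> the map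
  \<open>f \<oplus> id \<oplus> \<dots> \<oplus> id\<close> between two such sums.\<close>

definition list_sum :: "'r ring \<Rightarrow> 'r pmod \<Rightarrow> 'r pmod list \<Rightarrow> 'r pmod" where
  "list_sum R X Zs = foldl (P_sum R) X Zs"

fun list_sum_map ::
    "'r ring \<Rightarrow> 'r pmod \<Rightarrow> 'r pmod \<Rightarrow> ((nat \<Rightarrow> 'r) \<Rightarrow> (nat \<Rightarrow> 'r)) \<Rightarrow> 'r pmod list \<Rightarrow> (nat \<Rightarrow> 'r) \<Rightarrow> (nat \<Rightarrow> 'r)"
  where
  "list_sum_map R X Y f [] = f"
| "list_sum_map R X Y f (Z # Zs) = list_sum_map R (P_sum R X Z) (P_sum R Y Z)
     (model_map R (prod_mod X Z) (prod_mod Y Z) (map_prod f id)) Zs"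

text \<open>\<open>cross_effect R F X [X\<^sub>2, \<dots>, X\<^sub>d]\<close> is \<open>cr\<^sub>d F (X, X\<^sub>2, \<dots>, X\<^sub>d)\<close> as a summand of
  \<open>F (X \<oplus> X\<^sub>2 \<oplus> \<dots> \<oplus> X\<^sub>d)\<close>. In each of the defining decompositions the other summands are embedded
  by the inclusions of \<open>0\<close> into \<open>X\<close>, resp. of \<open>X\<^sub>1\<close> and \<open>X\<^sub>2\<close> into \<open>X\<^sub>1 \<oplus> X\<^sub>2\<close>, so the natural
  complement is the common kernel of the maps induced by the corresponding projections.\<close>

function cross_effect :: "'r ring \<Rightarrow> ('r, 'm) pfunctor \<Rightarrow> 'r pmod \<Rightarrow> 'r pmod list \<Rightarrow> 'm set" where
  "cross_effect R F X [] =
     {x \<in> carrier (fobj F X). farr F X (P_zero R) (zero_arr (P_cat R) X (P_zero R)) x = \<zero>\<^bsub>fobj F (P_zero R)\<^esub>}"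
| "cross_effect R F X1 (X2 # Xs) =
     {x \<in> cross_effect R F (P_sum R X1 X2) Xs.
        farr F (list_sum R (P_sum R X1 X2) Xs) (list_sum R X1 Xs)
          (list_sum_map R (P_sum R X1 X2) X1 (P_fst R X1 X2) Xs) x = \<zero>\<^bsub>fobj F (list_sum R X1 Xs)\<^esub> \<and>
        farr F (list_sum R (P_sum R X1 X2) Xs) (list_sum R X2 Xs)
          (list_sum_map R (P_sum R X1 X2) X2 (P_snd R X1 X2) Xs) x = \<zero>\<^bsub>fobj F (list_sum R X2 Xs)\<^esub>}"
  by pat_completeness auto
termination by (relation "measure (\<lambda>(R, F, X, Xs). length Xs)") auto

text \<open>\<open>cr\<^sub>d F = 0\<close>, for \<open>d \<ge> 1\<close>.\<close>

definition cross_effect_vanishes :: "'r ring \<Rightarrow> ('r, 'm) pfunctor \<Rightarrow> nat \<Rightarrow> bool" where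
  "cross_effect_vanishes R F d \<longleftrightarrow>
     (\<forall>X\<in>Ob (P_cat R). \<forall>Xs. set Xs \<subseteq> Ob (P_cat R) \<and> length Xs + 1 = d \<longrightarrow>
        cross_effect R F X Xs = {\<zero>\<^bsub>fobj F (list_sum R X Xs)\<^esub>})"

definition polynomial_functor :: "'r ring \<Rightarrow> ('r, 'm) pfunctor \<Rightarrow> bool" where
  "polynomial_functor R F \<longleftrightarrow> (\<exists>d. cross_effect_vanishes R F (d + 1))"

definition zero_functor :: "'r ring \<Rightarrow> ('r, 'm) pfunctor \<Rightarrow> bool" where
  "zero_functor R F \<longleftrightarrow> (\<forall>X\<in>Ob (P_cat R). carrier (fobj F X) = {\<zero>\<^bsub>fobj F X\<^esub>})"

text \<open>Meaningful for polynomial functors only.\<close>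

definition eml_degree :: "'r ring \<Rightarrow> ('r, 'm) pfunctor \<Rightarrow> ereal" where
  "eml_degree R F = (if zero_functor R F then - \<infinity> else
     ereal (real (THE d. cross_effect_vanishes R F (d + 1) \<and>
       (d > 0 \<longrightarrow> \<not> cross_effect_vanishes R F d))))"


section \<open>Arithmetic\<close>

definition digit_sum :: "nat \<Rightarrow> nat \<Rightarrow> nat" where
  "digit_sum p s = (\<Sum>k\<le>s. s div p ^ k mod p)"

definition I_set :: "nat \<Rightarrow> nat \<Rightarrow> nat set" where
  "I_set p s = {n. n mod (p - 1) = s mod (p - 1) \<and> digit_sum p s \<le> n \<and> n \<le> s}"

text \<open>For the zero functor, of degree \<open>- \<infinity>\<close>, the bound is \<open>- \<infinity>\<close>; since all nonpositive bounds mean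
  the same it is replaced by \<open>0\<close>.\<close>

definition torsion_exponent :: "nat \<Rightarrow> nat \<Rightarrow> ereal \<Rightarrow> int" where
  "torsion_exponent p s \<delta> = (case \<delta> of
     ereal d \<Rightarrow> \<lceil>(d + 1 - real (digit_sum p s)) / (real p - 1)\<rceil> | _ \<Rightarrow> 0)"


section \<open>Facts about these notions\<close>

lemma lin_mapsI:
  assumes "f \<in> carrier M \<rightarrow>\<^sub>E carrier N"
    and "\<And>x y. x \<in> carrier M \<Longrightarrow> y \<in> carrier M \<Longrightarrow> f (x \<oplus>\<^bsub>M\<^esub> y) = f x \<oplus>\<^bsub>N\<^esub> f y"
    and "\<And>a x. a \<in> carrier R \<Longrightarrow> x \<in> carrier M \<Longrightarrow> f (a \<odot>\<^bsub>M\<^esub> x) = a \<odot>\<^bsub>N\<^esub> f x"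
  shows "f \<in> lin_maps R M N"
  using assms by (auto simp: lin_maps_def)

lemma lin_maps_carrier: "f \<in> lin_maps R M N \<Longrightarrow> x \<in> carrier M \<Longrightarrow> f x \<in> carrier N"
  by (auto simp: lin_maps_def)

lemma lin_maps_ext: "f \<in> lin_maps R M N \<Longrightarrow> f \<in> extensional (carrier M)"
  by (auto simp: lin_maps_def PiE_def)

lemma lin_maps_add:
  "f \<in> lin_maps R M N \<Longrightarrow> x \<in> carrier M \<Longrightarrow> y \<in> carrier M \<Longrightarrow> f (x \<oplus>\<^bsub>M\<^esub> y) = f x \<oplus>\<^bsub>N\<^esub> f y"
  by (auto simp: lin_maps_def)

lemma lin_maps_smult:
  "f \<in> lin_maps R M N \<Longrightarrow> a \<in> carrier R \<Longrightarrow> x \<in> carrier M \<Longrightarrow> f (a \<odot>\<^bsub>M\<^esub> x) = a \<odot>\<^bsub>N\<^esub> f x"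
  by (auto simp: lin_maps_def)

lemma lin_maps_eqI:
  "f \<in> lin_maps R M N \<Longrightarrow> g \<in> lin_maps R M N \<Longrightarrow> (\<And>x. x \<in> carrier M \<Longrightarrow> f x = g x) \<Longrightarrow> f = g"
  by (meson extensionalityI lin_maps_ext)

lemma lin_maps_compose:
  assumes "Module.module R L" "f \<in> lin_maps R L M" "g \<in> lin_maps R M N"
  shows "compose (carrier L) g f \<in> lin_maps R L N"
proof (rule lin_mapsI)
  interpret L: Module.module R L by fact
  show "compose (carrier L) g f \<in> carrier L \<rightarrow>\<^sub>E carrier N"
    using assms(2,3) by (auto simp: compose_def lin_maps_carrier)
qed (use assms in \<open>auto simp: compose_def lin_maps_add lin_maps_smult lin_maps_carrier
      Module.module.smult_closed abelian_monoid.a_closed[OF abelian_group.axioms(1)[OF module.axioms(2)]]\<close>)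

lemma lin_maps_id:
  assumes "Module.module R M" shows "(\<lambda>x\<in>carrier M. x) \<in> lin_maps R M M"
proof -
  interpret Module.module R M by fact
  show ?thesis by (rule lin_mapsI) auto
qed

lemma abelian_group_negI:
  assumes "\<And>x y. x \<in> carrier M \<Longrightarrow> y \<in> carrier M \<Longrightarrow> x \<oplus>\<^bsub>M\<^esub> y \<in> carrier M"
    and "\<zero>\<^bsub>M\<^esub> \<in> carrier M"
    and "\<And>x y z. x \<in> carrier M \<Longrightarrow> y \<in> carrier M \<Longrightarrow> z \<in> carrier M \<Longrightarrow>
       (x \<oplus>\<^bsub>M\<^esub> y) \<oplus>\<^bsub>M\<^esub> z = x \<oplus>\<^bsub>M\<^esub> (y \<oplus>\<^bsub>M\<^esub> z)"
    and "\<And>x y. x \<in> carrier M \<Longrightarrow> y \<in> carrier M \<Longrightarrow> x \<oplus>\<^bsub>M\<^esub> y = y \<oplus>\<^bsub>M\<^esub> x"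
    and "\<And>x. x \<in> carrier M \<Longrightarrow> \<zero>\<^bsub>M\<^esub> \<oplus>\<^bsub>M\<^esub> x = x"
    and "\<And>x. x \<in> carrier M \<Longrightarrow> n x \<in> carrier M \<and> n x \<oplus>\<^bsub>M\<^esub> x = \<zero>\<^bsub>M\<^esub>"
  shows "abelian_group M"
  by (rule abelian_groupI) (use assms in blast)+

lemma hom_mod_module:
  assumes "Module.module R M" "Module.module R N"
  shows "Module.module R (hom_mod R M N)"
proof -
  interpret M: Module.module R M by fact
  interpret N: Module.module R N by fact
  have car: "carrier (hom_mod R M N) = lin_maps R M N" by (simp add: hom_mod_def)
  have addc: "f \<oplus>\<^bsub>hom_mod R M N\<^esub> g \<in> lin_maps R M N" if "f \<in> lin_maps R M N" "g \<in> lin_maps R M N" for f g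
    using that by (intro lin_mapsI)
      (auto simp: hom_mod_def lin_maps_carrier lin_maps_add lin_maps_smult N.add.m_ac N.smult_r_distr)
  have smc: "a \<odot>\<^bsub>hom_mod R M N\<^esub> g \<in> lin_maps R M N" if "a \<in> carrier R" "g \<in> lin_maps R M N" for a g
    using that by (intro lin_mapsI)
      (auto simp: hom_mod_def lin_maps_carrier lin_maps_add lin_maps_smult N.smult_r_distr M.R.m_comm
         simp flip: N.smult_assoc1)
  have zc: "\<zero>\<^bsub>hom_mod R M N\<^esub> \<in> lin_maps R M N"
    by (intro lin_mapsI) (auto simp: hom_mod_def)
  have nc: "(\<lambda>x\<in>carrier M. \<ominus>\<^bsub>N\<^esub> f x) \<in> lin_maps R M N" if "f \<in> lin_maps R M N" for f
    using that by (intro lin_mapsI) (auto simp: lin_maps_carrier lin_maps_add lin_maps_smult N.smult_r_minus N.minus_add)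
  note E = extensionalityI[where A = "carrier M"] lin_maps_ext
  show ?thesis
  proof (rule moduleI)
    show "abelian_group (hom_mod R M N)"
    proof (rule abelian_group_negI[where n = "\<lambda>f. \<lambda>x\<in>carrier M. \<ominus>\<^bsub>N\<^esub> f x"], unfold car)
      fix f assume f: "f \<in> lin_maps R M N"
      have "\<zero>\<^bsub>hom_mod R M N\<^esub> \<oplus>\<^bsub>hom_mod R M N\<^esub> f \<in> lin_maps R M N" using f zc addc by blast
      from lin_maps_eqI[OF this f]
      show "\<zero>\<^bsub>hom_mod R M N\<^esub> \<oplus>\<^bsub>hom_mod R M N\<^esub> f = f"
        using f by (auto simp: hom_mod_def lin_maps_carrier)
      show "(\<lambda>x\<in>carrier M. \<ominus>\<^bsub>N\<^esub> f x) \<in> lin_maps R M N \<and>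
        (\<lambda>x\<in>carrier M. \<ominus>\<^bsub>N\<^esub> f x) \<oplus>\<^bsub>hom_mod R M N\<^esub> f = \<zero>\<^bsub>hom_mod R M N\<^esub>"
        using nc[OF f] f by (auto simp: hom_mod_def lin_maps_carrier N.l_neg restrict_def)
    qed (use addc zc in \<open>auto simp: hom_mod_def lin_maps_carrier N.add.m_ac restrict_def\<close>)
    fix g assume g: "g \<in> carrier (hom_mod R M N)"
    then have g: "g \<in> lin_maps R M N" by (simp add: car)
    have "\<one>\<^bsub>R\<^esub> \<odot>\<^bsub>hom_mod R M N\<^esub> g \<in> lin_maps R M N" using g smc by blast
    from lin_maps_eqI[OF this g]
    show "\<one>\<^bsub>R\<^esub> \<odot>\<^bsub>hom_mod R M N\<^esub> g = g"
      using g by (auto simp: hom_mod_def lin_maps_carrier)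
  qed (use smc module.axioms(1)[OF assms(1)] in \<open>auto simp: car, (auto simp: hom_mod_def lin_maps_carrier N.smult_r_distr N.smult_l_distr N.smult_assoc1 restrict_def)\<close>)
qed

lemma linear_category_module_cat:
  assumes "\<And>M. M \<in> S \<Longrightarrow> Module.module R M"
  shows "linear_category R (module_cat R S)"
proof (rule linear_category.intro, goal_cases)
  case (1 X Y)
  with assms show ?case by (simp add: module_cat_def hom_mod_module)
next
  case (2 X)
  with assms show ?case by (simp add: module_cat_def hom_mod_def lin_maps_id)
next
  case (3 X Y Z f g)
  with assms show ?case by (simp add: module_cat_def hom_mod_def lin_maps_compose)
next
  case (4 X Y f)
  then have "f \<in> extensional (carrier X)" by (simp add: module_cat_def hom_mod_def lin_maps_ext)
  then show ?case by (auto simp: module_cat_def compose_def extensional_def)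
next
  case (5 X Y f)
  then have f: "f \<in> lin_maps R X Y" by (simp add: module_cat_def hom_mod_def)
  then have "f \<in> extensional (carrier X)" by (simp add: lin_maps_ext)
  then show ?case using lin_maps_carrier[OF f] by (auto simp: module_cat_def compose_def extensional_def)
next
  case (6 W X Y Z f g h)
  then have "f \<in> lin_maps R W X" by (simp add: module_cat_def hom_mod_def)
  then show ?case by (auto simp: module_cat_def compose_def restrict_def lin_maps_carrier)
next
  case (7 X Y Z f g g')
  then have "f \<in> lin_maps R X Y" by (simp add: module_cat_def hom_mod_def)
  then show ?case by (auto simp: module_cat_def hom_mod_def compose_def restrict_def lin_maps_carrier)
next
  case (8 X Y Z f f' g)
  then have "f \<in> lin_maps R X Y" "f' \<in> lin_maps R X Y" "g \<in> lin_maps R Y Z" by (simp_all add: module_cat_def hom_mod_def)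
  then show ?case by (auto simp: module_cat_def hom_mod_def compose_def restrict_def lin_maps_carrier lin_maps_add)
next
  case (9 X Y Z a f g)
  then have "f \<in> lin_maps R X Y" "g \<in> lin_maps R Y Z" by (simp_all add: module_cat_def hom_mod_def)
  then show ?case using 9 by (auto simp: module_cat_def hom_mod_def compose_def restrict_def lin_maps_carrier)
next
  case (10 X Y Z a f g)
  then have "f \<in> lin_maps R X Y" "g \<in> lin_maps R Y Z" by (simp_all add: module_cat_def hom_mod_def)
  then show ?case using 10 by (auto simp: module_cat_def hom_mod_def compose_def restrict_def lin_maps_carrier lin_maps_smult)
qed

lemma linear_category_functor_cat:
  assumes "cring R" "linear_category R D"
  shows "linear_category R (functor_cat C D)"
proof -
  interpret D: linear_category R D by fact
  have fo: "fobj F X \<in> Ob D" if "is_functor C D F" "X \<in> Ob C" for F X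
    using that by (simp add: is_functor_def)
  have fa: "farr F X Y f \<in> arrs D (fobj F X) (fobj F Y)" if "is_functor C D F" "X \<in> Ob C" "Y \<in> Ob C" "f \<in> arrs C X Y" for F X Y f
    using that by (simp add: is_functor_def)
  have obj: "Ob (functor_cat C D) = {F. is_functor C D F}" by (simp add: functor_cat_def)
  let ?H = "Hom (functor_cat C D)"
  have mem: "\<alpha> \<in> carrier (?H F G) \<longleftrightarrow> \<alpha> \<in> extensional (Ob C) \<and> (\<forall>X\<in>Ob C. \<alpha> X \<in> arrs D (fobj F X) (fobj G X)) \<and>
      (\<forall>X\<in>Ob C. \<forall>Y\<in>Ob C. \<forall>f\<in>arrs C X Y.
           Cmp D (fobj F X) (fobj F Y) (fobj G Y) (\<alpha> Y) (farr F X Y f) =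
           Cmp D (fobj F X) (fobj G X) (fobj G Y) (farr G X Y f) (\<alpha> X))" for \<alpha> F G
    by (auto simp: functor_cat_def PiE_def)
  have addv: "(\<alpha> \<oplus>\<^bsub>?H F G\<^esub> \<beta>) = (\<lambda>X\<in>Ob C. \<alpha> X \<oplus>\<^bsub>Hom D (fobj F X) (fobj G X)\<^esub> \<beta> X)" for \<alpha> \<beta> F G
    by (simp add: functor_cat_def)
  have smv: "(a \<odot>\<^bsub>?H F G\<^esub> \<beta>) = (\<lambda>X\<in>Ob C. a \<odot>\<^bsub>Hom D (fobj F X) (fobj G X)\<^esub> \<beta> X)" for a \<beta> F G
    by (simp add: functor_cat_def)
  have zv: "\<zero>\<^bsub>?H F G\<^esub> = (\<lambda>X\<in>Ob C. zero_arr D (fobj F X) (fobj G X))" for F G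
    by (simp add: functor_cat_def)
  have idv: "Idn (functor_cat C D) F = (\<lambda>X\<in>Ob C. Idn D (fobj F X))" for F
    by (simp add: functor_cat_def)
  have cmv: "Cmp (functor_cat C D) F G K \<beta> \<alpha> = (\<lambda>X\<in>Ob C. Cmp D (fobj F X) (fobj G X) (fobj K X) (\<beta> X) (\<alpha> X))" for F G K \<alpha> \<beta>
    by (simp add: functor_cat_def)
  note V = addv smv zv idv cmv
  have md: "Module.module R (Hom D (fobj F X) (fobj G X))" if "is_functor C D F" "is_functor C D G" "X \<in> Ob C" for F G X
    using that by (intro D.hom_module fo)
  have ag: "abelian_group (Hom D X Y)" if "X \<in> Ob D" "Y \<in> Ob D" for X Y
    using D.hom_module[OF that] by (rule module.axioms(2))
  have zl: "Cmp D X Y Z (zero_arr D Y Z) f = zero_arr D X Z" if o: "X \<in> Ob D" "Y \<in> Ob D" "Z \<in> Ob D" "f \<in> arrs D X Y" for X Y Z f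
  proof -
    interpret YZ: Module.module R "Hom D Y Z" using D.hom_module o by blast
    interpret XZ: Module.module R "Hom D X Z" using D.hom_module o by blast
    have "Cmp D X Y Z (\<zero>\<^bsub>R\<^esub> \<odot>\<^bsub>Hom D Y Z\<^esub> zero_arr D Y Z) f = \<zero>\<^bsub>R\<^esub> \<odot>\<^bsub>Hom D X Z\<^esub> Cmp D X Y Z (zero_arr D Y Z) f"
      using o by (intro D.cmp_smult_left) auto
    then show ?thesis using o by (simp add: D.cmp_arr)
  qed
  have zr: "Cmp D X Y Z g (zero_arr D X Y) = zero_arr D X Z" if o: "X \<in> Ob D" "Y \<in> Ob D" "Z \<in> Ob D" "g \<in> arrs D Y Z" for X Y Z g
  proof -
    interpret XY: Module.module R "Hom D X Y" using D.hom_module o by blast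
    interpret XZ: Module.module R "Hom D X Z" using D.hom_module o by blast
    have "Cmp D X Y Z g (\<zero>\<^bsub>R\<^esub> \<odot>\<^bsub>Hom D X Y\<^esub> zero_arr D X Y) = \<zero>\<^bsub>R\<^esub> \<odot>\<^bsub>Hom D X Z\<^esub> Cmp D X Y Z g (zero_arr D X Y)"
      using o by (intro D.cmp_smult_right) auto
    then show ?thesis using o by (simp add: D.cmp_arr)
  qed
  have cl: "x \<oplus>\<^bsub>Hom D X Y\<^esub> y \<in> arrs D X Y" if "X \<in> Ob D" "Y \<in> Ob D" "x \<in> arrs D X Y" "y \<in> arrs D X Y" for X Y x y
    using ag[OF that(1,2)] that(3,4) by (simp add: abelian_group.axioms abelian_monoid.a_closed)
  have scl: "a \<odot>\<^bsub>Hom D X Y\<^esub> y \<in> arrs D X Y" if "X \<in> Ob D" "Y \<in> Ob D" "a \<in> carrier R" "y \<in> arrs D X Y" for X Y a y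
    using D.hom_module[OF that(1,2)] that(3,4) by (simp add: module.smult_closed)
  have zc: "zero_arr D X Y \<in> arrs D X Y" if "X \<in> Ob D" "Y \<in> Ob D" for X Y
    using ag[OF that(1,2)] by (simp add: abelian_group.axioms abelian_monoid.zero_closed)
  have addc: "\<alpha> \<oplus>\<^bsub>?H F G\<^esub> \<beta> \<in> carrier (?H F G)" if F: "is_functor C D F" and G: "is_functor C D G" and "\<alpha> \<in> carrier (?H F G)" "\<beta> \<in> carrier (?H F G)" for F G \<alpha> \<beta>
    using that fo[OF F] fo[OF G] fa[OF F] fa[OF G] unfolding mem addv
    by (auto simp: cl D.cmp_add_left D.cmp_add_right)
  have smc: "a \<odot>\<^bsub>?H F G\<^esub> \<beta> \<in> carrier (?H F G)" if F: "is_functor C D F" and G: "is_functor C D G" and "a \<in> carrier R" "\<beta> \<in> carrier (?H F G)" for F G a \<beta>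
    using that fo[OF F] fo[OF G] fa[OF F] fa[OF G] unfolding mem smv
    by (auto simp: scl D.cmp_smult_left D.cmp_smult_right)
  have zec: "\<zero>\<^bsub>?H F G\<^esub> \<in> carrier (?H F G)" if F: "is_functor C D F" and G: "is_functor C D G" for F G
    using that fo[OF F] fo[OF G] fa[OF F] fa[OF G] unfolding mem zv
    by (auto simp: zc zl zr)
  have eq: "\<alpha> = \<beta>" if "\<alpha> \<in> carrier (?H F G)" "\<beta> \<in> carrier (?H F G)" "\<And>X. X \<in> Ob C \<Longrightarrow> \<alpha> X = \<beta> X" for \<alpha> \<beta> F G
    using that unfolding mem by (meson extensionalityI)
  have hm: "Module.module R (?H F G)" if F: "is_functor C D F" and G: "is_functor C D G" for F G
  proof (rule moduleI)
    show "abelian_group (?H F G)"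
    proof (rule abelian_group_negI[where n = "\<lambda>\<alpha>. (\<ominus>\<^bsub>R\<^esub> \<one>\<^bsub>R\<^esub>) \<odot>\<^bsub>?H F G\<^esub> \<alpha>"])
      fix \<alpha> \<beta> \<gamma> assume a: "\<alpha> \<in> carrier (?H F G)" and b: "\<beta> \<in> carrier (?H F G)" and c: "\<gamma> \<in> carrier (?H F G)"
      show "\<alpha> \<oplus>\<^bsub>?H F G\<^esub> \<beta> \<oplus>\<^bsub>?H F G\<^esub> \<gamma> = \<alpha> \<oplus>\<^bsub>?H F G\<^esub> (\<beta> \<oplus>\<^bsub>?H F G\<^esub> \<gamma>)"
        by (rule eq[of _ F G], (intro addc smc zec F G a b c; fail)+)
          (use a b c ag[OF fo[OF F] fo[OF G]] in \<open>auto simp: V mem abelian_monoid.a_assoc abelian_group.axioms\<close>)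
    next
      fix \<alpha> \<beta> assume a: "\<alpha> \<in> carrier (?H F G)" and b: "\<beta> \<in> carrier (?H F G)"
      show "\<alpha> \<oplus>\<^bsub>?H F G\<^esub> \<beta> = \<beta> \<oplus>\<^bsub>?H F G\<^esub> \<alpha>"
        by (rule eq[of _ F G], (intro addc smc zec F G a b; fail)+)
          (use a b ag[OF fo[OF F] fo[OF G]] in \<open>auto simp: V mem abelian_monoid.a_comm abelian_group.axioms\<close>)
    next
      fix \<alpha> assume a: "\<alpha> \<in> carrier (?H F G)"
      show "\<zero>\<^bsub>?H F G\<^esub> \<oplus>\<^bsub>?H F G\<^esub> \<alpha> = \<alpha>"
        by (rule eq[of _ F G], (intro addc smc zec F G a; fail)+)
          (use a ag[OF fo[OF F] fo[OF G]] in \<open>auto simp: V mem abelian_monoid.l_zero abelian_group.axioms\<close>)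
      have m: "\<ominus>\<^bsub>R\<^esub> \<one>\<^bsub>R\<^esub> \<in> carrier R"
        using assms(1) by (simp add: cring.axioms(1) ring.ring_simprules)
      have "(\<ominus>\<^bsub>R\<^esub> \<one>\<^bsub>R\<^esub>) \<odot>\<^bsub>?H F G\<^esub> \<alpha> \<oplus>\<^bsub>?H F G\<^esub> \<alpha> = \<zero>\<^bsub>?H F G\<^esub>"
      proof (rule eq[of _ F G], intro addc smc F G a m, intro zec F G)
        fix X assume X: "X \<in> Ob C"
        interpret M: Module.module R "Hom D (fobj F X) (fobj G X)" by (rule md[OF F G X])
        have "\<alpha> X \<in> arrs D (fobj F X) (fobj G X)" using a X by (simp add: mem)
        then show "((\<ominus>\<^bsub>R\<^esub> \<one>\<^bsub>R\<^esub>) \<odot>\<^bsub>?H F G\<^esub> \<alpha> \<oplus>\<^bsub>?H F G\<^esub> \<alpha>) X = \<zero>\<^bsub>?H F G\<^esub> X"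
          using X by (simp add: V M.smult_l_minus M.M.l_neg)
      qed
      then show "(\<ominus>\<^bsub>R\<^esub> \<one>\<^bsub>R\<^esub>) \<odot>\<^bsub>?H F G\<^esub> \<alpha> \<in> carrier (?H F G) \<and>
        (\<ominus>\<^bsub>R\<^esub> \<one>\<^bsub>R\<^esub>) \<odot>\<^bsub>?H F G\<^esub> \<alpha> \<oplus>\<^bsub>?H F G\<^esub> \<alpha> = \<zero>\<^bsub>?H F G\<^esub>"
        using smc[OF F G m a] by blast
    qed (use addc zec F G in blast)+
  next
    fix a b \<alpha> \<beta> assume a: "\<alpha> \<in> carrier (?H F G)" and r: "a \<in> carrier R" "b \<in> carrier R"
    have ab: "a \<oplus>\<^bsub>R\<^esub> b \<in> carrier R" "a \<otimes>\<^bsub>R\<^esub> b \<in> carrier R"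
      using r assms(1) by (simp_all add: cring.axioms(1) ring.ring_simprules)
    show "(a \<oplus>\<^bsub>R\<^esub> b) \<odot>\<^bsub>?H F G\<^esub> \<alpha> = a \<odot>\<^bsub>?H F G\<^esub> \<alpha> \<oplus>\<^bsub>?H F G\<^esub> b \<odot>\<^bsub>?H F G\<^esub> \<alpha>"
      by (rule eq[of _ F G], (intro addc smc zec F G ab a r; fail)+)
        (use a r md[OF F G] in \<open>auto simp: V mem module.smult_l_distr\<close>)
    show "(a \<otimes>\<^bsub>R\<^esub> b) \<odot>\<^bsub>?H F G\<^esub> \<alpha> = a \<odot>\<^bsub>?H F G\<^esub> (b \<odot>\<^bsub>?H F G\<^esub> \<alpha>)"
      by (rule eq[of _ F G], (intro addc smc zec F G ab a r; fail)+)
        (use a r md[OF F G] in \<open>auto simp: V mem module.smult_assoc1\<close>)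
  next
    fix a \<alpha> \<beta> assume a: "\<alpha> \<in> carrier (?H F G)" and b: "\<beta> \<in> carrier (?H F G)" and r: "a \<in> carrier R"
    show "a \<odot>\<^bsub>?H F G\<^esub> (\<alpha> \<oplus>\<^bsub>?H F G\<^esub> \<beta>) = a \<odot>\<^bsub>?H F G\<^esub> \<alpha> \<oplus>\<^bsub>?H F G\<^esub> a \<odot>\<^bsub>?H F G\<^esub> \<beta>"
      by (rule eq[of _ F G], (intro addc smc zec F G a b r; fail)+)
        (use a b r md[OF F G] in \<open>auto simp: V mem module.smult_r_distr[where R = R]\<close>)
  next
    fix \<alpha> assume a: "\<alpha> \<in> carrier (?H F G)"
    have o: "\<one>\<^bsub>R\<^esub> \<in> carrier R" using assms(1) by (simp add: cring.axioms(1) ring.ring_simprules)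
    show "\<one>\<^bsub>R\<^esub> \<odot>\<^bsub>?H F G\<^esub> \<alpha> = \<alpha>"
      by (rule eq[of _ F G], (intro addc smc zec F G a o; fail)+)
        (use a md[OF F G] in \<open>auto simp: V mem module.smult_one\<close>)
  qed (use smc F G assms in blast)+
  have idc: "Idn (functor_cat C D) F \<in> carrier (?H F F)" if F: "is_functor C D F" for F
    using fo[OF F] fa[OF F] by (auto simp: mem V D.idn_arr D.cmp_idn D.idn_cmp)
  have cmc: "Cmp (functor_cat C D) F G K \<beta> \<alpha> \<in> carrier (?H F K)"
    if F: "is_functor C D F" and G: "is_functor C D G" and K: "is_functor C D K"
      and a: "\<alpha> \<in> carrier (?H F G)" and b: "\<beta> \<in> carrier (?H G K)" for F G K \<alpha> \<beta>
  proof -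
    have 1: "Cmp D (fobj F X) (fobj F Y) (fobj K Y) (Cmp D (fobj F Y) (fobj G Y) (fobj K Y) (\<beta> Y) (\<alpha> Y)) (farr F X Y f) =
       Cmp D (fobj F X) (fobj K X) (fobj K Y) (farr K X Y f) (Cmp D (fobj F X) (fobj G X) (fobj K X) (\<beta> X) (\<alpha> X))"
      (is "?l = ?r") if X: "X \<in> Ob C" and Y: "Y \<in> Ob C" and f: "f \<in> arrs C X Y" for X Y f
    proof -
      note [simp] = fo[OF F X] fo[OF F Y] fo[OF G X] fo[OF G Y] fo[OF K X] fo[OF K Y] fa[OF F X Y f] fa[OF G X Y f] fa[OF K X Y f]
      have [simp]: "\<alpha> X \<in> arrs D (fobj F X) (fobj G X)" "\<alpha> Y \<in> arrs D (fobj F Y) (fobj G Y)"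
         "\<beta> X \<in> arrs D (fobj G X) (fobj K X)" "\<beta> Y \<in> arrs D (fobj G Y) (fobj K Y)"
        using a b X Y by (auto simp: mem)
      have "?l = Cmp D (fobj F X) (fobj G Y) (fobj K Y) (\<beta> Y) (Cmp D (fobj F X) (fobj F Y) (fobj G Y) (\<alpha> Y) (farr F X Y f))"
        by (rule D.cmp_assoc[symmetric]) simp_all
      also have "\<dots> = Cmp D (fobj F X) (fobj G Y) (fobj K Y) (\<beta> Y) (Cmp D (fobj F X) (fobj G X) (fobj G Y) (farr G X Y f) (\<alpha> X))"
        using a X Y f by (simp add: mem)
      also have "\<dots> = Cmp D (fobj F X) (fobj G X) (fobj K Y) (Cmp D (fobj G X) (fobj G Y) (fobj K Y) (\<beta> Y) (farr G X Y f)) (\<alpha> X)"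
        by (rule D.cmp_assoc) simp_all
      also have "\<dots> = Cmp D (fobj F X) (fobj G X) (fobj K Y) (Cmp D (fobj G X) (fobj K X) (fobj K Y) (farr K X Y f) (\<beta> X)) (\<alpha> X)"
        using b X Y f by (simp add: mem)
      also have "\<dots> = ?r"
        by (rule D.cmp_assoc[symmetric]) simp_all
      finally show ?thesis .
    qed
    have 2: "Cmp D (fobj F X) (fobj G X) (fobj K X) (\<beta> X) (\<alpha> X) \<in> arrs D (fobj F X) (fobj K X)" if "X \<in> Ob C" for X
      using a b that fo[OF F] fo[OF G] fo[OF K] by (intro D.cmp_arr) (auto simp: mem)
    show ?thesis using 1 2 by (simp add: mem V)
  qed
  show ?thesis
  proof (rule linear_category.intro, unfold obj mem_Collect_eq, goal_cases)
    case (4 X Y f)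
    then show ?case
      by (intro eq[of _ X Y] cmc idc) (use 4 fo in \<open>auto simp: V mem D.cmp_idn\<close>)
  next
    case (5 X Y f)
    then show ?case
      by (intro eq[of _ X Y] cmc idc) (use 5 fo in \<open>auto simp: V mem D.idn_cmp\<close>)
  next
    case (6 W X Y Z f g h)
    then show ?case
      by (intro eq[of _ W Z]) (intro cmc; assumption | use 6 fo in \<open>auto simp: V mem D.cmp_assoc\<close>)+
  next
    case (7 X Y Z f g g')
    then show ?case
      by (intro eq[of _ X Z]) (intro cmc addc; assumption | use 7 fo in \<open>auto simp: V mem D.cmp_add_left\<close>)+
  next
    case (8 X Y Z f f' g)
    then show ?case
      by (intro eq[of _ X Z]) (intro cmc addc; assumption | use 8 fo in \<open>auto simp: V mem D.cmp_add_right\<close>)+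
  next
    case (9 X Y Z a f g)
    then show ?case
      by (intro eq[of _ X Z]) (intro cmc smc; assumption | use 9 fo in \<open>auto simp: V mem D.cmp_smult_left\<close>)+
  next
    case (10 X Y Z a f g)
    then show ?case
      by (intro eq[of _ X Z]) (intro cmc smc; assumption | use 10 fo in \<open>auto simp: V mem D.cmp_smult_right\<close>)+
  qed (use hm idc cmc in blast)+
qed

lemma free_mod_carrier: "c \<in> carrier (free_mod R S) \<longleftrightarrow>
    c \<in> S \<rightarrow>\<^sub>E carrier R \<and> finite {x \<in> S. c x \<noteq> \<zero>\<^bsub>R\<^esub>}"
  by (simp add: free_mod_def)

lemma free_mod_module:
  assumes "cring R" shows "Module.module R (free_mod R S)"
proof -
  interpret R: cring R by fact
  let ?L = "free_mod R S"
  have fin: "finite {x \<in> S. c x \<oplus>\<^bsub>R\<^esub> c' x \<noteq> \<zero>\<^bsub>R\<^esub>}"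
    if "finite {x \<in> S. c x \<noteq> \<zero>\<^bsub>R\<^esub>}" "finite {x \<in> S. c' x \<noteq> \<zero>\<^bsub>R\<^esub>}" for c c'
    by (rule finite_subset[OF _ finite_UnI[OF that]]) auto
  have addc: "c \<oplus>\<^bsub>?L\<^esub> c' \<in> carrier ?L" if "c \<in> carrier ?L" "c' \<in> carrier ?L" for c c'
    using that fin[of c c'] by (auto simp: free_mod_def PiE_iff cong: conj_cong)
  have smc: "a \<odot>\<^bsub>?L\<^esub> c \<in> carrier ?L" if "a \<in> carrier R" "c \<in> carrier ?L" for a c
  proof -
    have "finite {x \<in> S. a \<otimes>\<^bsub>R\<^esub> c x \<noteq> \<zero>\<^bsub>R\<^esub>}"
      by (rule finite_subset[of _ "{x \<in> S. c x \<noteq> \<zero>\<^bsub>R\<^esub>}"]) (use that in \<open>auto simp: free_mod_def\<close>)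
    then show ?thesis using that by (auto simp: free_mod_def PiE_iff cong: conj_cong)
  qed
  have zc: "\<zero>\<^bsub>?L\<^esub> \<in> carrier ?L" by (auto simp: free_mod_def cong: conj_cong)
  have mc: "\<ominus>\<^bsub>R\<^esub> \<one>\<^bsub>R\<^esub> \<in> carrier R" by simp
  have eq: "c = c'" if "c \<in> carrier ?L" "c' \<in> carrier ?L" "\<And>x. x \<in> S \<Longrightarrow> c x = c' x" for c c'
    by (rule PiE_ext[of _ S "\<lambda>_. carrier R"]) (use that in \<open>auto simp: free_mod_def\<close>)
  have V: "(c \<oplus>\<^bsub>?L\<^esub> c') x = c x \<oplus>\<^bsub>R\<^esub> c' x" "(a \<odot>\<^bsub>?L\<^esub> c) x = a \<otimes>\<^bsub>R\<^esub> c x" "\<zero>\<^bsub>?L\<^esub> x = \<zero>\<^bsub>R\<^esub>" if "x \<in> S" for c c' x a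
    using that by (auto simp: free_mod_def)
  have car: "c x \<in> carrier R" if "c \<in> carrier ?L" "x \<in> S" for c x
    using that by (auto simp: free_mod_def)
  show ?thesis
  proof (rule moduleI)
    show "abelian_group ?L"
    proof (rule abelian_group_negI[where n = "\<lambda>c. (\<ominus>\<^bsub>R\<^esub> \<one>\<^bsub>R\<^esub>) \<odot>\<^bsub>?L\<^esub> c"])
      fix c assume c: "c \<in> carrier ?L"
      have "(\<ominus>\<^bsub>R\<^esub> \<one>\<^bsub>R\<^esub>) \<odot>\<^bsub>?L\<^esub> c \<oplus>\<^bsub>?L\<^esub> c = \<zero>\<^bsub>?L\<^esub>"
        by (rule eq, intro addc smc mc c, rule zc) (use c in \<open>simp add: V car R.l_minus R.l_neg\<close>)
      then show "(\<ominus>\<^bsub>R\<^esub> \<one>\<^bsub>R\<^esub>) \<odot>\<^bsub>?L\<^esub> c \<in> carrier ?L \<and> (\<ominus>\<^bsub>R\<^esub> \<one>\<^bsub>R\<^esub>) \<odot>\<^bsub>?L\<^esub> c \<oplus>\<^bsub>?L\<^esub> c = \<zero>\<^bsub>?L\<^esub>"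
        using smc[OF mc c] by blast
    qed (use addc zc in \<open>auto intro!: eq simp: V car R.a_ac\<close>)
  qed (use smc addc assms in \<open>auto intro!: eq simp: V car R.l_distr R.r_distr R.m_assoc\<close>)
qed

lemma free_basis_carrier: "cring R \<Longrightarrow> x \<in> S \<Longrightarrow> free_basis R S x \<in> carrier (free_mod R S)"
proof -
  assume R: "cring R" and x: "x \<in> S"
  interpret cring R by fact
  have "finite {y \<in> S. free_basis R S x y \<noteq> \<zero>\<^bsub>R\<^esub>}"
    by (rule finite_subset[of _ "{x}"]) (auto simp: free_basis_def)
  then show ?thesis by (auto simp: free_mod_carrier free_basis_def)
qed

lemma free_mod_induct [consumes 2, case_names zero step]:
  assumes R: "cring R" and c: "c \<in> carrier (free_mod R S)"
    and z: "P \<zero>\<^bsub>free_mod R S\<^esub>"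
    and st: "\<And>a x c. a \<in> carrier R \<Longrightarrow> x \<in> S \<Longrightarrow> c \<in> carrier (free_mod R S) \<Longrightarrow> P c \<Longrightarrow>
       P (a \<odot>\<^bsub>free_mod R S\<^esub> free_basis R S x \<oplus>\<^bsub>free_mod R S\<^esub> c)"
  shows "P c"
proof -
  interpret cring R by fact
  let ?L = "free_mod R S"
  have "\<forall>c \<in> carrier ?L. {x \<in> S. c x \<noteq> \<zero>\<^bsub>R\<^esub>} = A \<longrightarrow> P c" if "finite A" for A
    using that
  proof (induction A)
    case empty
    have "c = \<zero>\<^bsub>?L\<^esub>" if "c \<in> carrier ?L" "{x \<in> S. c x \<noteq> \<zero>\<^bsub>R\<^esub>} = {}" for c
      by (rule PiE_ext[of _ S "\<lambda>_. carrier R"]) (use that in \<open>auto simp: free_mod_def\<close>)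
    then show ?case using z by blast
  next
    case (insert x A)
    show ?case
    proof (intro ballI impI)
      fix c assume c: "c \<in> carrier ?L" and s: "{x \<in> S. c x \<noteq> \<zero>\<^bsub>R\<^esub>} = insert x A"
      then have x: "x \<in> S" by blast
      define c' where "c' = c(x := \<zero>\<^bsub>R\<^esub>)"
      have s': "{x \<in> S. c' x \<noteq> \<zero>\<^bsub>R\<^esub>} = A" using s insert.hyps by (auto simp: c'_def)
      have c': "c' \<in> carrier ?L"
        using c x insert.hyps s' by (auto simp: free_mod_carrier c'_def PiE_iff extensional_def)
      have "c = c x \<odot>\<^bsub>?L\<^esub> free_basis R S x \<oplus>\<^bsub>?L\<^esub> c'"
      proof (rule extensionalityI[of _ S])
        show "c \<in> extensional S" using c by (auto simp: free_mod_carrier PiE_def)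
        show "c x \<odot>\<^bsub>?L\<^esub> free_basis R S x \<oplus>\<^bsub>?L\<^esub> c' \<in> extensional S" by (auto simp: free_mod_def)
        fix y assume y: "y \<in> S"
        then have "c y \<in> carrier R" "c x \<in> carrier R" using c x by (auto simp: free_mod_carrier)
        then show "c y = (c x \<odot>\<^bsub>?L\<^esub> free_basis R S x \<oplus>\<^bsub>?L\<^esub> c') y"
          using y by (auto simp: free_mod_def free_basis_def c'_def)
      qed
      moreover have "P c'" using insert.IH c' s' by blast
      moreover have "c x \<in> carrier R" using c x by (auto simp: free_mod_carrier)
      ultimately show "P c" using st[OF _ x c'] by metis
    qed
  qed
  moreover have "finite {x \<in> S. c x \<noteq> \<zero>\<^bsub>R\<^esub>}" using c by (simp add: free_mod_carrier)
  ultimately show ?thesis using c by blast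
qed

lemma lin_maps_zero:
  assumes "Module.module R M" "Module.module R N" "f \<in> lin_maps R M N"
  shows "f \<zero>\<^bsub>M\<^esub> = \<zero>\<^bsub>N\<^esub>"
proof -
  interpret M: Module.module R M by fact
  interpret N: Module.module R N by fact
  have "f (\<zero>\<^bsub>R\<^esub> \<odot>\<^bsub>M\<^esub> \<zero>\<^bsub>M\<^esub>) = \<zero>\<^bsub>R\<^esub> \<odot>\<^bsub>N\<^esub> f \<zero>\<^bsub>M\<^esub>"
    using assms(3) by (intro lin_maps_smult) auto
  then show ?thesis using lin_maps_carrier[OF assms(3)] by simp
qed

lemma free_mod_lin_eqI:
  assumes R: "cring R" and N: "Module.module R N"
    and f: "f \<in> lin_maps R (free_mod R S) N" and g: "g \<in> lin_maps R (free_mod R S) N"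
    and eq: "\<And>x. x \<in> S \<Longrightarrow> f (free_basis R S x) = g (free_basis R S x)"
  shows "f = g"
proof (rule lin_maps_eqI[OF f g])
  interpret L: Module.module R "free_mod R S" using free_mod_module[OF R] .
  fix c assume "c \<in> carrier (free_mod R S)"
  with R show "f c = g c"
  proof (induction rule: free_mod_induct)
    case zero
    show ?case by (metis lin_maps_zero[OF L.module_axioms N] f g)
  next
    case (step a x c)
    then show ?case
      using f g eq by (simp add: lin_maps_add lin_maps_smult free_basis_carrier[OF R])
  qed
qed

lemma free_mod_lin_ex:
  assumes R: "cring R" and N: "Module.module R N" and y: "\<And>x. x \<in> S \<Longrightarrow> y x \<in> carrier N"
  shows "\<exists>h \<in> lin_maps R (free_mod R S) N. \<forall>x\<in>S. h (free_basis R S x) = y x"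
proof -
  interpret R: cring R by fact
  interpret N: Module.module R N by fact
  let ?L = "free_mod R S"
  interpret L: Module.module R ?L using free_mod_module[OF R] .
  define s where "s = (\<lambda>c. {x \<in> S. c x \<noteq> \<zero>\<^bsub>R\<^esub>})"
  define h where "h = (\<lambda>c\<in>carrier ?L. \<Oplus>\<^bsub>N\<^esub>x\<in>s c. c x \<odot>\<^bsub>N\<^esub> y x)"
  have car: "c x \<in> carrier R" if "c \<in> carrier ?L" "x \<in> S" for c x
    using that by (auto simp: free_mod_def)
  have V: "(c \<oplus>\<^bsub>?L\<^esub> c') x = c x \<oplus>\<^bsub>R\<^esub> c' x" "(a \<odot>\<^bsub>?L\<^esub> c) x = a \<otimes>\<^bsub>R\<^esub> c x" if "x \<in> S" for c c' x a
    using that by (auto simp: free_mod_def)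
  have fs: "finite (s c)" if "c \<in> carrier ?L" for c using that by (simp add: free_mod_carrier s_def)
  have h: "h c = (\<Oplus>\<^bsub>N\<^esub>x\<in>A. c x \<odot>\<^bsub>N\<^esub> y x)" if "c \<in> carrier ?L" "finite A" "s c \<subseteq> A" "A \<subseteq> S" for c A
    unfolding h_def restrict_apply' [OF that(1)]
    by (rule N.add.finprod_mono_neutral_cong_left)
      (use that car y in \<open>auto simp: s_def subset_iff\<close>)
  have "h \<in> lin_maps R ?L N"
  proof (rule lin_mapsI)
    show "h \<in> carrier ?L \<rightarrow>\<^sub>E carrier N"
      by (auto simp: h_def s_def car y intro!: N.finsum_closed)
  next
    fix c c' assume c: "c \<in> carrier ?L" "c' \<in> carrier ?L"
    let ?A = "s c \<union> s c'"
    have A: "finite ?A" "?A \<subseteq> S" using fs c by (auto simp: s_def)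
    have "h (c \<oplus>\<^bsub>?L\<^esub> c') = (\<Oplus>\<^bsub>N\<^esub>x\<in>?A. (c \<oplus>\<^bsub>?L\<^esub> c') x \<odot>\<^bsub>N\<^esub> y x)"
      by (rule h) (use c A in \<open>auto simp: s_def V\<close>)
    also have "\<dots> = (\<Oplus>\<^bsub>N\<^esub>x\<in>?A. c x \<odot>\<^bsub>N\<^esub> y x \<oplus>\<^bsub>N\<^esub> c' x \<odot>\<^bsub>N\<^esub> y x)"
      by (rule N.finsum_cong') (use c A car y in \<open>auto simp: V N.smult_l_distr subset_iff\<close>)
    also have "\<dots> = (\<Oplus>\<^bsub>N\<^esub>x\<in>?A. c x \<odot>\<^bsub>N\<^esub> y x) \<oplus>\<^bsub>N\<^esub> (\<Oplus>\<^bsub>N\<^esub>x\<in>?A. c' x \<odot>\<^bsub>N\<^esub> y x)"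
      by (rule N.finsum_addf) (use c A car y in \<open>auto simp: subset_iff\<close>)
    also have "\<dots> = h c \<oplus>\<^bsub>N\<^esub> h c'" using h[OF c(1) A(1) _ A(2)] h[OF c(2) A(1) _ A(2)] by simp
    finally show "h (c \<oplus>\<^bsub>?L\<^esub> c') = h c \<oplus>\<^bsub>N\<^esub> h c'" .
  next
    fix a c assume a: "a \<in> carrier R" and c: "c \<in> carrier ?L"
    have A: "finite (s c)" "s c \<subseteq> S" using fs c by (auto simp: s_def)
    have "h (a \<odot>\<^bsub>?L\<^esub> c) = (\<Oplus>\<^bsub>N\<^esub>x\<in>s c. (a \<odot>\<^bsub>?L\<^esub> c) x \<odot>\<^bsub>N\<^esub> y x)"
      by (rule h) (use a c A in \<open>auto simp: s_def V car\<close>)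
    also have "\<dots> = (\<Oplus>\<^bsub>N\<^esub>x\<in>s c. a \<odot>\<^bsub>N\<^esub> (c x \<odot>\<^bsub>N\<^esub> y x))"
      by (rule N.finsum_cong') (use a c A car y in \<open>auto simp: V N.smult_assoc1 subset_iff\<close>)
    also have "\<dots> = a \<odot>\<^bsub>N\<^esub> (\<Oplus>\<^bsub>N\<^esub>x\<in>s c. c x \<odot>\<^bsub>N\<^esub> y x)"
      by (rule N.finsum_smult_ldistr[symmetric]) (use a c A car y in \<open>auto simp: subset_iff\<close>)
    finally show "h (a \<odot>\<^bsub>?L\<^esub> c) = a \<odot>\<^bsub>N\<^esub> h c" using c by (simp add: h_def)
  qed
  moreover have "h (free_basis R S x) = y x" if x: "x \<in> S" for x
  proof -
    have "h (free_basis R S x) = (\<Oplus>\<^bsub>N\<^esub>z\<in>{x}. free_basis R S x z \<odot>\<^bsub>N\<^esub> y z)"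
      by (rule h) (use x free_basis_carrier[OF R x] in \<open>auto simp: s_def free_basis_def\<close>)
    also have "\<dots> = y x" using x y by (simp add: free_basis_def)
    finally show ?thesis .
  qed
  ultimately show ?thesis by blast
qed

lemma fg_projective_lift:
  assumes M: "fg_projective R M" and N: "Module.module R N" "Module.module R N'"
    and e: "e \<in> lin_maps R N N'" "e ` carrier N = carrier N'" and f: "f \<in> lin_maps R M N'"
  shows "\<exists>g \<in> lin_maps R M N. compose (carrier M) e g = f"
proof -
  from M obtain n :: nat and i q where
    mM: "Module.module R M" and i: "i \<in> lin_maps R M (free_mod R {..<n})"
    and q: "q \<in> lin_maps R (free_mod R {..<n}) M" and qi: "\<forall>x\<in>carrier M. q (i x) = x"
    unfolding fg_projective_def by blast
  have R: "cring R" using mM by (rule module.axioms)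
  let ?L = "free_mod R {..<n}"
  have mL: "Module.module R ?L" using free_mod_module[OF R] .
  have fq: "compose (carrier ?L) f q \<in> lin_maps R ?L N'" by (rule lin_maps_compose[OF mL q f])
  define y where "y = (\<lambda>x. inv_into (carrier N) e (f (q (free_basis R {..<n} x))))"
  have r: "f (q (free_basis R {..<n} x)) \<in> e ` carrier N" if "x < n" for x
    using that e f q by (simp add: free_basis_carrier[OF R] lin_maps_carrier)
  have y: "y x \<in> carrier N" "e (y x) = f (q (free_basis R {..<n} x))" if "x < n" for x
    using r[OF that] by (simp_all add: y_def inv_into_into f_inv_into_f)
  from free_mod_lin_ex[OF R N(1), of "{..<n}" y] y
  obtain h where h: "h \<in> lin_maps R ?L N" "\<forall>x<n. h (free_basis R {..<n} x) = y x" by auto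
  have "compose (carrier ?L) e h = compose (carrier ?L) f q"
    by (rule free_mod_lin_eqI[OF R N(2) lin_maps_compose[OF mL h(1) e(1)] fq])
      (use h y in \<open>simp add: compose_def free_basis_carrier[OF R]\<close>)
  then have eh: "e (h c) = f (q c)" if "c \<in> carrier ?L" for c
    using that by (metis compose_eq)
  have "compose (carrier M) e (compose (carrier M) h i) = f"
  proof (rule lin_maps_eqI[of _ R M N'])
    show "compose (carrier M) e (compose (carrier M) h i) \<in> lin_maps R M N'"
      by (rule lin_maps_compose[OF mM lin_maps_compose[OF mM i h(1)] e(1)])
  qed (use f eh i qi in \<open>auto simp: compose_def lin_maps_carrier\<close>)
  then show ?thesis using lin_maps_compose[OF mM i h(1)] by blast
qed

lemma submod_span_incl: "S \<subseteq> submod_span R M S"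
  by (auto simp: submod_span_def)

lemma submod_span_least: "submodule H R M \<Longrightarrow> S \<subseteq> H \<Longrightarrow> submod_span R M S \<subseteq> H"
  by (auto simp: submod_span_def)

lemma submod_span_submodule:
  assumes M: "Module.module R M" and S: "S \<subseteq> carrier M"
  shows "submodule (submod_span R M S) R M"
proof -
  interpret Module.module R M by fact
  have "carrier M \<in> {H. submodule H R M \<and> S \<subseteq> H}" using carrier_is_submodule S by simp
  then have sub: "submod_span R M S \<subseteq> carrier M" unfolding submod_span_def by blast
  show ?thesis
  proof (rule submoduleI[OF sub])
    have "\<zero>\<^bsub>M\<^esub> \<in> H" if "submodule H R M" for H
      using subgroup.one_closed[OF submodule.axioms(1)[OF that]] by simp
    then show "\<zero>\<^bsub>M\<^esub> \<in> submod_span R M S" by (auto simp: submod_span_def)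
  qed (auto simp: submod_span_def submoduleE submodule.smult_closed)
qed

lemma image_submodule:
  assumes M: "Module.module R M" and N: "Module.module R N" and f: "f \<in> lin_maps R M N"
  shows "submodule (f ` carrier M) R N"
proof -
  interpret M: Module.module R M by fact
  interpret N: Module.module R N by fact
  have "\<ominus>\<^bsub>N\<^esub> f x = f (\<ominus>\<^bsub>M\<^esub> x)" if "x \<in> carrier M" for x
  proof (rule N.minus_equality)
    show "f (\<ominus>\<^bsub>M\<^esub> x) \<oplus>\<^bsub>N\<^esub> f x = \<zero>\<^bsub>N\<^esub>"
      using that lin_maps_add[OF f, of "\<ominus>\<^bsub>M\<^esub> x" x] lin_maps_zero[OF M N f] by (simp add: M.l_neg)
  qed (use that f in \<open>auto simp: lin_maps_carrier\<close>)
  then show ?thesis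
    by (intro N.submoduleI)
      (use f lin_maps_zero[OF M N f] in \<open>auto simp: lin_maps_carrier image_iff
         simp flip: lin_maps_add[OF f] lin_maps_smult[OF f]\<close>, metis M.zero_closed)
qed

text \<open>In the following equivalence the lifting property is tested on modules over two fixed types
  only; by \<open>fg_projective_lift\<close> this is no restriction.\<close>

lemma fg_projective_iff:
  fixes M :: "('r, 'a) module"
  shows "fg_projective R M \<longleftrightarrow> Module.module R M \<and>
    (\<exists>S. finite S \<and> S \<subseteq> carrier M \<and> submod_span R M S = carrier M) \<and>
    (\<forall>(N :: ('r, nat \<Rightarrow> 'r) module) (N' :: ('r, 'a) module). \<forall>e \<in> lin_maps R N N'. \<forall>f \<in> lin_maps R M N'.
       Module.module R N \<and> Module.module R N' \<and> e ` carrier N = carrier N' \<longrightarrow>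
       (\<exists>g \<in> lin_maps R M N. compose (carrier M) e g = f))"
    (is "_ \<longleftrightarrow> _ \<and> ?fg \<and> ?lift")
proof (intro iffI conjI)
  assume P: "fg_projective R M"
  then show mM: "Module.module R M" by (simp add: fg_projective_def)
  show ?lift using fg_projective_lift[OF P] by blast
  from P obtain n :: nat and i q where
    i: "i \<in> lin_maps R M (free_mod R {..<n})"
    and q: "q \<in> lin_maps R (free_mod R {..<n}) M" and qi: "\<forall>x\<in>carrier M. q (i x) = x"
    unfolding fg_projective_def by blast
  have R: "cring R" using mM by (rule module.axioms)
  let ?L = "free_mod R {..<n}"
  interpret L: Module.module R ?L using free_mod_module[OF R] .
  interpret M: Module.module R M by fact
  let ?S = "(\<lambda>x. q (free_basis R {..<n} x)) ` {..<n}"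
  have S: "?S \<subseteq> carrier M" using q by (auto simp: lin_maps_carrier free_basis_carrier[OF R])
  have sp: "submodule (submod_span R M ?S) R M" by (rule submod_span_submodule[OF mM S])
  have qsp: "q c \<in> submod_span R M ?S" if "c \<in> carrier ?L" for c
    using R that
  proof (induction rule: free_mod_induct)
    case zero
    then show ?case
      using lin_maps_zero[OF L.module_axioms mM q] subgroup.one_closed[OF submodule.axioms(1)[OF sp]] by simp
  next
    case (step a x c)
    have "q (free_basis R {..<n} x) \<in> submod_span R M ?S" using step(2) by (intro subsetD[OF submod_span_incl]) auto
    then show ?case
      using step q by (simp add: lin_maps_add lin_maps_smult free_basis_carrier[OF R]
        M.submoduleE(5)[OF sp] submodule.smult_closed[OF sp])
  qed
  then have "carrier M \<subseteq> submod_span R M ?S"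
    using qsp[OF lin_maps_carrier[OF i]] qi by force
  then have "submod_span R M ?S = carrier M" using M.submoduleE(1)[OF sp] by blast
  then show ?fg using S by blast
next
  assume "Module.module R M \<and> ?fg \<and> ?lift"
  then have mM: "Module.module R M" and ?fg and l: ?lift by auto
  then obtain S where S: "finite S" "S \<subseteq> carrier M" "submod_span R M S = carrier M" by blast
  have R: "cring R" using mM by (rule module.axioms)
  let ?n = "card S"
  from S(1) obtain y where y: "y ` {..<?n} = S"
    by (metis bij_betw_def bij_betw_from_nat_into_finite)
  let ?L = "free_mod R {..<?n}"
  have mL: "Module.module R ?L" using free_mod_module[OF R] .
  have yM: "y x \<in> carrier M" if "x \<in> {..<?n}" for x
    by (rule subsetD[OF S(2)], rule subsetD[OF equalityD1[OF y]], rule imageI[OF that])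
  have "\<exists>h \<in> lin_maps R ?L M. \<forall>x\<in>{..<?n}. h (free_basis R {..<?n} x) = y x"
    by (rule free_mod_lin_ex[OF R mM yM])
  then obtain q where q: "q \<in> lin_maps R ?L M" "\<forall>x\<in>{..<?n}. q (free_basis R {..<?n} x) = y x" ..
  have "y x \<in> q ` carrier ?L" if "x \<in> {..<?n}" for x
    by (rule image_eqI[of _ q "free_basis R {..<?n} x"])
      (use q(2) that free_basis_carrier[OF R that] in auto)
  then have "S \<subseteq> q ` carrier ?L" by (subst y[symmetric], intro image_subsetI)
  then have "carrier M \<subseteq> q ` carrier ?L"
    using submod_span_least[OF image_submodule[OF mL mM q(1)]] S(3) by blast
  then have "q ` carrier ?L = carrier M" using q(1) by (auto simp: lin_maps_carrier)
  then have "\<exists>g \<in> lin_maps R M ?L. compose (carrier M) q g = (\<lambda>x\<in>carrier M. x)"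
    using l[rule_format, OF q(1) lin_maps_id[OF mM]] mL mM by blast
  then obtain i where i: "i \<in> lin_maps R M ?L" "compose (carrier M) q i = (\<lambda>x\<in>carrier M. x)" by blast
  then have "\<forall>x\<in>carrier M. q (i x) = x" by (metis compose_eq restrict_apply')
  with mM i(1) q(1) show "fg_projective R M" unfolding fg_projective_def by meson
qed

lemma fg_projective_model:
  assumes P: "fg_projective R (M :: ('r, 'a) module)"
  shows "\<exists>(N :: 'r pmod) \<phi>. N \<in> Ob (P_cat R) \<and> \<phi> \<in> lin_maps R M N \<and> bij_betw \<phi> (carrier M) (carrier N)"
proof -
  from P obtain n :: nat and i q where
    mM: "Module.module R M" and i: "i \<in> lin_maps R M (free_mod R {..<n})"
    and q: "q \<in> lin_maps R (free_mod R {..<n}) M" and qi: "\<forall>x\<in>carrier M. q (i x) = x"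
    unfolding fg_projective_def by blast
  have R: "cring R" using mM by (rule module.axioms)
  let ?L = "free_mod R {..<n}"
  have mL: "Module.module R ?L" using free_mod_module[OF R] .
  let ?N = "?L\<lparr>carrier := i ` carrier M\<rparr>"
  have sub: "i ` carrier M \<subseteq> carrier ?L" using i by (auto simp: lin_maps_carrier)
  have mN: "Module.module R ?N"
    by (rule submodule.submodule_is_module[OF image_submodule[OF mM mL i] mL])
  have iN: "i \<in> lin_maps R M ?N" using i by (auto simp: lin_maps_def)
  have "(\<lambda>x\<in>carrier ?N. x) \<in> lin_maps R ?N ?L"
    by (rule lin_mapsI) (use sub i in \<open>auto simp: image_iff simp flip: lin_maps_add lin_maps_smult\<close>,
      (metis lin_maps_add lin_maps_smult module.smult_closed mM abelian_monoid.a_closed abelian_group.axioms(1) module.axioms(2) i)+)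
  moreover have "compose (carrier ?L) i q \<in> lin_maps R ?L ?N"
    by (rule lin_maps_compose[OF mL q iN])
  moreover have "\<forall>x\<in>carrier ?N. compose (carrier ?L) i q ((\<lambda>x\<in>carrier ?N. x) x) = x"
    using sub qi by (auto simp: compose_def)
  ultimately have "fg_projective R ?N" unfolding fg_projective_def using mN by blast
  moreover have "bij_betw i (carrier M) (carrier ?N)"
    using qi by (auto simp: bij_betw_def intro: inj_on_inverseI)
  ultimately show ?thesis using iN unfolding P_cat_def module_cat_def
    by (intro exI[of _ ?N] exI[of _ i]) simp
qed

lemma submodule_abelian_subgroup:
  assumes M: "Module.module R M" and H: "submodule H R M"
  shows "abelian_subgroup H M"
proof -
  interpret M: Module.module R M by (rule M)
  have "additive_subgroup H M"
    using submodule.axioms(1)[OF H] by (simp add: additive_subgroup_def)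
  then show ?thesis by (rule abelian_subgroupI3) (rule M.abelian_group_axioms)
qed

lemma coset_self:
  assumes M: "Module.module R M" and H: "submodule H R M" and x: "x \<in> carrier M"
  shows "x \<in> H +>\<^bsub>M\<^esub> x"
proof -
  interpret Q: abelian_subgroup H M by (rule submodule_abelian_subgroup[OF M H])
  show ?thesis using x by (rule Q.a_rcos_self)
qed

lemma coset_eq_iff:
  assumes M: "Module.module R M" and H: "submodule H R M" and xy: "x \<in> carrier M" "y \<in> carrier M"
  shows "H +>\<^bsub>M\<^esub> x = H +>\<^bsub>M\<^esub> y \<longleftrightarrow> x \<ominus>\<^bsub>M\<^esub> y \<in> H"
proof -
  interpret M: Module.module R M by (rule M)
  interpret Q: abelian_subgroup H M by (rule submodule_abelian_subgroup[OF M H])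
  have "x \<ominus>\<^bsub>M\<^esub> y \<in> H \<longleftrightarrow> x \<in> H +>\<^bsub>M\<^esub> y"
    using Q.a_rcos_module[OF xy(2,1)] by (simp add: a_minus_def)
  also have "\<dots> \<longleftrightarrow> H +>\<^bsub>M\<^esub> x = H +>\<^bsub>M\<^esub> y"
    using Q.a_repr_independence'[OF _ xy(2), of x] Q.a_rcos_self[OF xy(1)] by blast
  finally show ?thesis by blast
qed

lemma quot_mod_carrier: "carrier (quot_mod M H) = (\<lambda>x. H +>\<^bsub>M\<^esub> x) ` carrier M"
  by (auto simp: quot_mod_def A_RCOSETS_def RCOSETS_def a_r_coset_def)

lemma quot_mod_add:
  assumes M: "Module.module R M" and H: "submodule H R M" and xy: "x \<in> carrier M" "y \<in> carrier M"
  shows "(H +>\<^bsub>M\<^esub> x) \<oplus>\<^bsub>quot_mod M H\<^esub> (H +>\<^bsub>M\<^esub> y) = H +>\<^bsub>M\<^esub> (x \<oplus>\<^bsub>M\<^esub> y)"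
proof -
  interpret Q: abelian_subgroup H M by (rule submodule_abelian_subgroup[OF M H])
  show ?thesis using xy by (simp add: quot_mod_def Q.a_rcos_sum)
qed

lemma quot_mod_zero:
  assumes M: "Module.module R M" and H: "submodule H R M"
  shows "\<zero>\<^bsub>quot_mod M H\<^esub> = H +>\<^bsub>M\<^esub> \<zero>\<^bsub>M\<^esub>"
proof -
  interpret Q: abelian_subgroup H M by (rule submodule_abelian_subgroup[OF M H])
  show ?thesis using abelian_group.a_coset_add_zero[OF module.axioms(2)[OF M] Q.a_subset] by (simp add: quot_mod_def)
qed

lemma quot_mod_smult:
  assumes M: "Module.module R M" and H: "submodule H R M" and x: "x \<in> carrier M" and a: "a \<in> carrier R"
  shows "a \<odot>\<^bsub>quot_mod M H\<^esub> (H +>\<^bsub>M\<^esub> x) = H +>\<^bsub>M\<^esub> (a \<odot>\<^bsub>M\<^esub> x)"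
proof -
  interpret M: Module.module R M by (rule M)
  interpret Q: abelian_subgroup H M by (rule submodule_abelian_subgroup[OF M H])
  have eq: "H +>\<^bsub>M\<^esub> (a \<odot>\<^bsub>M\<^esub> z) = H +>\<^bsub>M\<^esub> (a \<odot>\<^bsub>M\<^esub> x)" if z: "z \<in> H +>\<^bsub>M\<^esub> x" for z
  proof -
    have zc: "z \<in> carrier M" using z Q.a_rcosets_carrier[OF abelian_group.a_rcosetsI[OF M.abelian_group_axioms Q.a_subset x]] by blast
    have "z \<ominus>\<^bsub>M\<^esub> x \<in> H" using Q.a_rcos_module[OF x zc] z by (simp add: a_minus_def)
    then have "a \<odot>\<^bsub>M\<^esub> (z \<ominus>\<^bsub>M\<^esub> x) \<in> H" by (rule submodule.smult_closed[OF H a])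
    moreover have "a \<odot>\<^bsub>M\<^esub> (z \<ominus>\<^bsub>M\<^esub> x) = a \<odot>\<^bsub>M\<^esub> z \<ominus>\<^bsub>M\<^esub> a \<odot>\<^bsub>M\<^esub> x"
      using zc x a by (simp add: a_minus_def M.smult_r_distr M.smult_r_minus)
    ultimately show ?thesis using zc x a by (simp add: coset_eq_iff[OF M H])
  qed
  have "(\<Union>z\<in>H +>\<^bsub>M\<^esub> x. H +>\<^bsub>M\<^esub> (a \<odot>\<^bsub>M\<^esub> z)) = (\<Union>z\<in>H +>\<^bsub>M\<^esub> x. H +>\<^bsub>M\<^esub> (a \<odot>\<^bsub>M\<^esub> x))"
    by (rule SUP_cong[OF refl eq])
  also have "\<dots> = H +>\<^bsub>M\<^esub> (a \<odot>\<^bsub>M\<^esub> x)" using Q.a_rcos_self[OF x] by blast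
  finally show ?thesis by (simp add: quot_mod_def)
qed

lemma quot_mod_module:
  assumes M: "Module.module R M" and H: "submodule H R M"
  shows "Module.module R (quot_mod M H)"
proof -
  interpret M: Module.module R M by (rule M)
  note V = quot_mod_carrier quot_mod_add[OF M H] quot_mod_zero[OF M H] quot_mod_smult[OF M H]
  show ?thesis
  proof (rule moduleI)
    show "abelian_group (quot_mod M H)"
    proof (rule abelian_groupI)
      fix X assume "X \<in> carrier (quot_mod M H)"
      then obtain x where x: "x \<in> carrier M" "X = H +>\<^bsub>M\<^esub> x" by (auto simp: V)
      have "(H +>\<^bsub>M\<^esub> (\<ominus>\<^bsub>M\<^esub> x)) \<oplus>\<^bsub>quot_mod M H\<^esub> X = \<zero>\<^bsub>quot_mod M H\<^esub>"
        using x by (simp add: V M.l_neg)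
      then show "\<exists>Y\<in>carrier (quot_mod M H). Y \<oplus>\<^bsub>quot_mod M H\<^esub> X = \<zero>\<^bsub>quot_mod M H\<^esub>"
        using x by (intro bexI[of _ "H +>\<^bsub>M\<^esub> (\<ominus>\<^bsub>M\<^esub> x)"]) (auto simp: V)
    qed (auto simp: V M.add.m_ac)
  qed (use module.axioms(1)[OF M] in \<open>auto simp: V M.smult_l_distr M.smult_r_distr M.smult_assoc1\<close>)
qed

lemma quot_proj_lin:
  assumes M: "Module.module R M" and H: "submodule H R M"
  shows "(\<lambda>x\<in>carrier M. H +>\<^bsub>M\<^esub> x) \<in> lin_maps R M (quot_mod M H)"
proof -
  interpret M: Module.module R M by (rule M)
  show ?thesis
  proof (rule lin_mapsI)
    show "(\<lambda>x\<in>carrier M. H +>\<^bsub>M\<^esub> x) \<in> carrier M \<rightarrow>\<^sub>E carrier (quot_mod M H)"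
      by (intro PiE_I) (simp_all add: quot_mod_carrier imageI)
  qed (simp_all add: quot_mod_add[OF M H] quot_mod_smult[OF M H])
qed

lemma quot_lift:
  assumes M: "Module.module R M" and H: "submodule H R M" and T: "Module.module R T"
    and f: "f \<in> lin_maps R M T" and k: "\<And>z. z \<in> H \<Longrightarrow> f z = \<zero>\<^bsub>T\<^esub>"
  shows "\<exists>h \<in> lin_maps R (quot_mod M H) T. \<forall>x\<in>carrier M. h (H +>\<^bsub>M\<^esub> x) = f x"
proof -
  interpret M: Module.module R M by (rule M)
  interpret T: Module.module R T by (rule T)
  define r where "r = (\<lambda>Z. SOME z. z \<in> carrier M \<and> Z = H +>\<^bsub>M\<^esub> z)"
  have r: "r (H +>\<^bsub>M\<^esub> x) \<in> carrier M \<and> H +>\<^bsub>M\<^esub> x = H +>\<^bsub>M\<^esub> r (H +>\<^bsub>M\<^esub> x)" if "x \<in> carrier M" for x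
  proof -
    from that have "\<exists>z. z \<in> carrier M \<and> H +>\<^bsub>M\<^esub> x = H +>\<^bsub>M\<^esub> z" by blast
    from someI_ex[OF this] show ?thesis unfolding r_def .
  qed
  have wd: "f x = f y" if xy: "x \<in> carrier M" "y \<in> carrier M" and e: "H +>\<^bsub>M\<^esub> x = H +>\<^bsub>M\<^esub> y" for x y
  proof -
    have "x \<ominus>\<^bsub>M\<^esub> y \<in> H" using coset_eq_iff[OF M H xy] e by blast
    then have "f (x \<ominus>\<^bsub>M\<^esub> y) = \<zero>\<^bsub>T\<^esub>" by (rule k)
    moreover have "x = (x \<ominus>\<^bsub>M\<^esub> y) \<oplus>\<^bsub>M\<^esub> y" using xy by (simp add: a_minus_def M.add.m_assoc M.l_neg)
    then have "f x = f (x \<ominus>\<^bsub>M\<^esub> y) \<oplus>\<^bsub>T\<^esub> f y" using xy lin_maps_add[OF f, of "x \<ominus>\<^bsub>M\<^esub> y" y] by simp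
    ultimately show ?thesis using xy lin_maps_carrier[OF f] by simp
  qed
  define h where "h = (\<lambda>Z\<in>carrier (quot_mod M H). f (r Z))"
  have hx: "h (H +>\<^bsub>M\<^esub> x) = f x" if "x \<in> carrier M" for x
  proof -
    have "h (H +>\<^bsub>M\<^esub> x) = f (r (H +>\<^bsub>M\<^esub> x))" using that by (simp add: h_def quot_mod_carrier)
    then show ?thesis using wd[of "r (H +>\<^bsub>M\<^esub> x)" x] r[OF that] that by simp
  qed
  have "h \<in> lin_maps R (quot_mod M H) T"
  proof (rule lin_mapsI)
    show "h \<in> carrier (quot_mod M H) \<rightarrow>\<^sub>E carrier T"
      using r lin_maps_carrier[OF f] by (auto simp: h_def quot_mod_carrier)
  qed (auto simp: quot_mod_carrier quot_mod_add[OF M H] quot_mod_smult[OF M H] hx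
        lin_maps_add[OF f] lin_maps_smult[OF f])
  then show ?thesis using hx by blast
qed

lemma tensor_relations_carrier:
  assumes R: "cring R" and M: "\<And>i. i \<in> I \<Longrightarrow> Module.module R (M i)"
  shows "tensor_relations R I M \<subseteq> carrier (free_mod R (\<Pi>\<^sub>E i\<in>I. carrier (M i)))"
proof -
  let ?X = "\<Pi>\<^sub>E i\<in>I. carrier (M i)"
  interpret L: Module.module R "free_mod R ?X" by (rule free_mod_module[OF R])
  have up: "x(i := a) \<in> ?X" if "x \<in> ?X" "i \<in> I" "a \<in> carrier (M i)" for x i a
    using that by (auto simp: PiE_iff extensional_def)
  have ca: "a \<oplus>\<^bsub>M i\<^esub> b \<in> carrier (M i)" if "i \<in> I" "a \<in> carrier (M i)" "b \<in> carrier (M i)" for i a b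
    using that module.axioms(2)[OF M[OF that(1)]] by (simp add: abelian_group.axioms(1) abelian_monoid.a_closed)
  have cs: "r \<odot>\<^bsub>M i\<^esub> a \<in> carrier (M i)" if "i \<in> I" "a \<in> carrier (M i)" "r \<in> carrier R" for i a r
    using that M[OF that(1)] by (simp add: module.smult_closed)
  note b = free_basis_carrier[OF R, of _ ?X]
  show ?thesis
    unfolding tensor_relations_def Let_def
    by (intro Un_least subsetI; elim CollectE exE conjE; hypsubst;
        intro L.minus_closed L.a_closed L.smult_closed b up ca cs)
qed

lemma tensor_module:
  assumes R: "cring R" and M: "\<And>i. i \<in> I \<Longrightarrow> Module.module R (M i)"
  shows "Module.module R (tensor R I M)"
  unfolding tensor_def Let_def
  by (intro quot_mod_module submod_span_submodule free_mod_module R tensor_relations_carrier M)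

lemma tensor_universal:
  assumes R: "cring R" and M: "\<And>i. i \<in> I \<Longrightarrow> Module.module R (M i)" and T: "Module.module R T"
    and \<phi>: "\<And>x. x \<in> (\<Pi>\<^sub>E i\<in>I. carrier (M i)) \<Longrightarrow> \<phi> x \<in> carrier T"
    and add: "\<And>x i a b. x \<in> (\<Pi>\<^sub>E i\<in>I. carrier (M i)) \<Longrightarrow> i \<in> I \<Longrightarrow> a \<in> carrier (M i) \<Longrightarrow> b \<in> carrier (M i) \<Longrightarrow>
       \<phi> (x(i := a \<oplus>\<^bsub>M i\<^esub> b)) = \<phi> (x(i := a)) \<oplus>\<^bsub>T\<^esub> \<phi> (x(i := b))"
    and smult: "\<And>x i r a. x \<in> (\<Pi>\<^sub>E i\<in>I. carrier (M i)) \<Longrightarrow> i \<in> I \<Longrightarrow> r \<in> carrier R \<Longrightarrow> a \<in> carrier (M i) \<Longrightarrow>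
       \<phi> (x(i := r \<odot>\<^bsub>M i\<^esub> a)) = r \<odot>\<^bsub>T\<^esub> \<phi> (x(i := a))"
  shows "\<exists>!h. h \<in> lin_maps R (tensor R I M) T \<and>
    (\<forall>x \<in> (\<Pi>\<^sub>E i\<in>I. carrier (M i)). h (pure_tensor R I M x) = \<phi> x)"
proof -
  let ?X = "\<Pi>\<^sub>E i\<in>I. carrier (M i)"
  let ?L = "free_mod R ?X" and ?e = "free_basis R ?X"
  let ?H = "submod_span R ?L (tensor_relations R I M)"
  have mL: "Module.module R ?L" by (rule free_mod_module[OF R])
  interpret L: Module.module R ?L by (rule mL)
  interpret T: Module.module R T by (rule T)
  have rel: "tensor_relations R I M \<subseteq> carrier ?L" by (rule tensor_relations_carrier[OF R M])
  have H: "submodule ?H R ?L" by (rule submod_span_submodule[OF mL rel])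
  have up: "x(i := a) \<in> ?X" if "x \<in> ?X" "i \<in> I" "a \<in> carrier (M i)" for x i a
    using that by (auto simp: PiE_iff extensional_def)
  have ca: "a \<oplus>\<^bsub>M i\<^esub> b \<in> carrier (M i)" if "i \<in> I" "a \<in> carrier (M i)" "b \<in> carrier (M i)" for i a b
    using that module.axioms(2)[OF M[OF that(1)]] by (simp add: abelian_group.axioms(1) abelian_monoid.a_closed)
  have cs: "r \<odot>\<^bsub>M i\<^esub> a \<in> carrier (M i)" if "i \<in> I" "a \<in> carrier (M i)" "r \<in> carrier R" for i a r
    using that M[OF that(1)] by (simp add: module.smult_closed)
  note ec = free_basis_carrier[OF R, of _ ?X]
  have tens: "tensor R I M = quot_mod ?L ?H" by (simp add: tensor_def Let_def)
  have pure: "pure_tensor R I M x = ?H +>\<^bsub>?L\<^esub> ?e x" for x by (simp add: pure_tensor_def Let_def)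
  have "\<exists>f \<in> lin_maps R ?L T. \<forall>x\<in>?X. f (?e x) = \<phi> x"
    by (rule free_mod_lin_ex[OF R T \<phi>])
  then obtain f where f: "f \<in> lin_maps R ?L T" and fe: "\<forall>x\<in>?X. f (?e x) = \<phi> x" ..
  have neg: "f (u \<ominus>\<^bsub>?L\<^esub> v) = \<zero>\<^bsub>T\<^esub>" if "u \<in> carrier ?L" "v \<in> carrier ?L" "f u = f v" for u v
  proof -
    have "u = (u \<ominus>\<^bsub>?L\<^esub> v) \<oplus>\<^bsub>?L\<^esub> v" using that by (simp add: a_minus_def L.M.add.m_assoc L.M.l_neg)
    then have "f u = f (u \<ominus>\<^bsub>?L\<^esub> v) \<oplus>\<^bsub>T\<^esub> f v"
      using that lin_maps_add[OF f, of "u \<ominus>\<^bsub>?L\<^esub> v" v] by simp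
    then show ?thesis using that lin_maps_carrier[OF f] by (metis L.M.minus_closed T.M.add.r_cancel_one')
  qed
  let ?K = "{z \<in> carrier ?L. f z = \<zero>\<^bsub>T\<^esub>}"
  have K: "submodule ?K R ?L"
  proof (rule L.submoduleI)
    fix z assume "z \<in> ?K"
    then have z: "z \<in> carrier ?L" "f z = \<zero>\<^bsub>T\<^esub>" by auto
    then have "f (\<ominus>\<^bsub>?L\<^esub> z) \<oplus>\<^bsub>T\<^esub> f z = \<zero>\<^bsub>T\<^esub>"
      using lin_maps_add[OF f, of "\<ominus>\<^bsub>?L\<^esub> z" z] lin_maps_zero[OF mL T f] by (simp add: L.M.l_neg)
    then show "\<ominus>\<^bsub>?L\<^esub> z \<in> ?K" using z lin_maps_carrier[OF f] by simp
  qed (use f lin_maps_zero[OF mL T f] in \<open>auto simp: lin_maps_add lin_maps_smult\<close>)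
  have relK: "tensor_relations R I M \<subseteq> ?K"
  proof
    fix z assume z: "z \<in> tensor_relations R I M"
    have "f z = \<zero>\<^bsub>T\<^esub>"
      using z unfolding tensor_relations_def Let_def
      by (elim UnE CollectE exE conjE; hypsubst; intro neg;
          simp add: ec up ca cs lin_maps_add[OF f] lin_maps_smult[OF f] fe add smult)
    then show "z \<in> ?K" using z rel by blast
  qed
  have "?H \<subseteq> ?K" by (rule submod_span_least[OF K relK])
  then have "\<exists>h \<in> lin_maps R (quot_mod ?L ?H) T. \<forall>x\<in>carrier ?L. h (?H +>\<^bsub>?L\<^esub> x) = f x"
    by (intro quot_lift[OF mL H T f]) blast
  then obtain h where h: "h \<in> lin_maps R (quot_mod ?L ?H) T" "\<forall>x\<in>carrier ?L. h (?H +>\<^bsub>?L\<^esub> x) = f x" ..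
  show ?thesis
  proof (rule ex1I[of _ h])
    show "h \<in> lin_maps R (tensor R I M) T \<and> (\<forall>x \<in> ?X. h (pure_tensor R I M x) = \<phi> x)"
      using h fe by (simp add: tens pure ec)
  next
    fix g assume "g \<in> lin_maps R (tensor R I M) T \<and> (\<forall>x \<in> ?X. g (pure_tensor R I M x) = \<phi> x)"
    then have g: "g \<in> lin_maps R (quot_mod ?L ?H) T" "\<And>x. x \<in> ?X \<Longrightarrow> g (?H +>\<^bsub>?L\<^esub> ?e x) = \<phi> x"
      by (simp_all add: tens pure)
    let ?q = "\<lambda>x\<in>carrier ?L. ?H +>\<^bsub>?L\<^esub> x"
    note q = quot_proj_lin[OF mL H]
    have eq: "compose (carrier ?L) g ?q = compose (carrier ?L) h ?q"
      by (rule free_mod_lin_eqI[OF R T lin_maps_compose[OF mL q g(1)] lin_maps_compose[OF mL q h(1)]])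
        (simp add: compose_def ec g(2) h(2) fe)
    show "g = h"
    proof (rule lin_maps_eqI[OF g(1) h(1)])
      fix Z assume "Z \<in> carrier (quot_mod ?L ?H)"
      then obtain c where c: "c \<in> carrier ?L" "Z = ?H +>\<^bsub>?L\<^esub> c" by (auto simp: quot_mod_carrier)
      then show "g Z = h Z" using fun_cong[OF eq, of c] by (simp add: compose_def)
    qed
  qed
qed

lemma pure_tensor_carrier:
  assumes R: "cring R" and x: "x \<in> (\<Pi>\<^sub>E i\<in>I. carrier (M i))"
  shows "pure_tensor R I M x \<in> carrier (tensor R I M)"
  unfolding pure_tensor_def tensor_def Let_def quot_mod_carrier
  by (rule imageI) (rule free_basis_carrier[OF R x])

lemma pure_tensor_add:
  assumes R: "cring R" and M: "\<And>i. i \<in> I \<Longrightarrow> Module.module R (M i)"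
    and x: "x \<in> (\<Pi>\<^sub>E i\<in>I. carrier (M i))" and i: "i \<in> I" and a: "a \<in> carrier (M i)" and b: "b \<in> carrier (M i)"
  shows "pure_tensor R I M (x(i := a \<oplus>\<^bsub>M i\<^esub> b)) =
    pure_tensor R I M (x(i := a)) \<oplus>\<^bsub>tensor R I M\<^esub> pure_tensor R I M (x(i := b))"
proof -
  let ?X = "\<Pi>\<^sub>E i\<in>I. carrier (M i)"
  let ?L = "free_mod R ?X" and ?e = "free_basis R ?X"
  let ?H = "submod_span R ?L (tensor_relations R I M)"
  have mL: "Module.module R ?L" by (rule free_mod_module[OF R])
  interpret L: Module.module R ?L by (rule mL)
  have H: "submodule ?H R ?L" by (rule submod_span_submodule[OF mL tensor_relations_carrier[OF R M]])
  have up: "x(i := a) \<in> ?X" if "a \<in> carrier (M i)" for a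
    using that x i by (auto simp: PiE_iff extensional_def)
  have ab: "a \<oplus>\<^bsub>M i\<^esub> b \<in> carrier (M i)"
    using a b module.axioms(2)[OF M[OF i]] by (simp add: abelian_group.axioms(1) abelian_monoid.a_closed)
  have "?e (x(i := a \<oplus>\<^bsub>M i\<^esub> b)) \<ominus>\<^bsub>?L\<^esub> (?e (x(i := a)) \<oplus>\<^bsub>?L\<^esub> ?e (x(i := b))) \<in> tensor_relations R I M"
    unfolding tensor_relations_def Let_def
    by (rule UnI1, rule CollectI, rule exI[of _ x], rule exI[of _ i], rule exI[of _ a], rule exI[of _ b])
      (use x i a b in simp)
  then have "?e (x(i := a \<oplus>\<^bsub>M i\<^esub> b)) \<ominus>\<^bsub>?L\<^esub> (?e (x(i := a)) \<oplus>\<^bsub>?L\<^esub> ?e (x(i := b))) \<in> ?H"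
    by (rule subsetD[OF submod_span_incl])
  then show ?thesis
    unfolding pure_tensor_def tensor_def Let_def
    by (simp add: quot_mod_add[OF mL H] free_basis_carrier[OF R] up a b ab coset_eq_iff[OF mL H])
qed

lemma pure_tensor_smult:
  assumes R: "cring R" and M: "\<And>i. i \<in> I \<Longrightarrow> Module.module R (M i)"
    and x: "x \<in> (\<Pi>\<^sub>E i\<in>I. carrier (M i))" and i: "i \<in> I" and r: "r \<in> carrier R" and a: "a \<in> carrier (M i)"
  shows "pure_tensor R I M (x(i := r \<odot>\<^bsub>M i\<^esub> a)) = r \<odot>\<^bsub>tensor R I M\<^esub> pure_tensor R I M (x(i := a))"
proof -
  let ?X = "\<Pi>\<^sub>E i\<in>I. carrier (M i)"
  let ?L = "free_mod R ?X" and ?e = "free_basis R ?X"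
  let ?H = "submod_span R ?L (tensor_relations R I M)"
  have mL: "Module.module R ?L" by (rule free_mod_module[OF R])
  interpret L: Module.module R ?L by (rule mL)
  have H: "submodule ?H R ?L" by (rule submod_span_submodule[OF mL tensor_relations_carrier[OF R M]])
  have up: "x(i := a) \<in> ?X" if "a \<in> carrier (M i)" for a
    using that x i by (auto simp: PiE_iff extensional_def)
  have ra: "r \<odot>\<^bsub>M i\<^esub> a \<in> carrier (M i)"
    using r a M[OF i] by (simp add: module.smult_closed)
  have "?e (x(i := r \<odot>\<^bsub>M i\<^esub> a)) \<ominus>\<^bsub>?L\<^esub> r \<odot>\<^bsub>?L\<^esub> ?e (x(i := a)) \<in> tensor_relations R I M"
    unfolding tensor_relations_def Let_def
    by (rule UnI2, rule CollectI, rule exI[of _ x], rule exI[of _ i], rule exI[of _ r], rule exI[of _ a])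
      (use x i r a in simp)
  then have "?e (x(i := r \<odot>\<^bsub>M i\<^esub> a)) \<ominus>\<^bsub>?L\<^esub> r \<odot>\<^bsub>?L\<^esub> ?e (x(i := a)) \<in> ?H"
    by (rule subsetD[OF submod_span_incl])
  then show ?thesis
    unfolding pure_tensor_def tensor_def Let_def
    by (simp add: quot_mod_smult[OF mL H] free_basis_carrier[OF R] up a ra r coset_eq_iff[OF mL H])
qed

lemma tensor_map_pure:
  assumes R: "cring R" and M: "\<And>i. i \<in> I \<Longrightarrow> Module.module R (M i)"
    and N: "\<And>i. i \<in> I \<Longrightarrow> Module.module R (N i)" and f: "\<And>i. i \<in> I \<Longrightarrow> f i \<in> lin_maps R (M i) (N i)"
  shows "tensor_map R I M N f \<in> lin_maps R (tensor R I M) (tensor R I N)"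
    and "\<And>x. x \<in> (\<Pi>\<^sub>E i\<in>I. carrier (M i)) \<Longrightarrow>
      tensor_map R I M N f (pure_tensor R I M x) = pure_tensor R I N (\<lambda>i\<in>I. f i (x i))"
proof -
  let ?X = "\<Pi>\<^sub>E i\<in>I. carrier (M i)" and ?\<phi> = "\<lambda>x. pure_tensor R I N (\<lambda>i\<in>I. f i (x i))"
  have fx: "(\<lambda>i\<in>I. f i (x i)) \<in> (\<Pi>\<^sub>E i\<in>I. carrier (N i))" if "x \<in> ?X" for x
    using that lin_maps_carrier[OF f] by (auto simp: PiE_iff)
  have up: "(\<lambda>j\<in>I. f j ((x(i := a)) j)) = (\<lambda>j\<in>I. f j (x j))(i := f i a)" if "i \<in> I" for x i a
    using that by auto
  have "\<exists>!h. h \<in> lin_maps R (tensor R I M) (tensor R I N) \<and> (\<forall>x\<in>?X. h (pure_tensor R I M x) = ?\<phi> x)"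
  proof (rule tensor_universal[OF R M tensor_module[OF R N]])
    fix x i a b assume "x \<in> ?X" "i \<in> I" "a \<in> carrier (M i)" "b \<in> carrier (M i)"
    then show "?\<phi> (x(i := a \<oplus>\<^bsub>M i\<^esub> b)) = ?\<phi> (x(i := a)) \<oplus>\<^bsub>tensor R I N\<^esub> ?\<phi> (x(i := b))"
      by (simp only: up lin_maps_add[OF f])
        (rule pure_tensor_add[OF R N fx], simp_all add: lin_maps_carrier[OF f])
  next
    fix x i r a assume "x \<in> ?X" "i \<in> I" "r \<in> carrier R" "a \<in> carrier (M i)"
    then show "?\<phi> (x(i := r \<odot>\<^bsub>M i\<^esub> a)) = r \<odot>\<^bsub>tensor R I N\<^esub> ?\<phi> (x(i := a))"
      by (simp only: up lin_maps_smult[OF f])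
        (rule pure_tensor_smult[OF R N fx], simp_all add: lin_maps_carrier[OF f])
  qed (auto intro: pure_tensor_carrier[OF R fx])
  from theI'[OF this] show "tensor_map R I M N f \<in> lin_maps R (tensor R I M) (tensor R I N)"
    and "\<And>x. x \<in> ?X \<Longrightarrow> tensor_map R I M N f (pure_tensor R I M x) = ?\<phi> x"
    unfolding tensor_map_def by blast+
qed

lemma tensor_lin_eqI:
  assumes R: "cring R" and M: "\<And>i. i \<in> I \<Longrightarrow> Module.module R (M i)" and T: "Module.module R T"
    and f: "f \<in> lin_maps R (tensor R I M) T" and g: "g \<in> lin_maps R (tensor R I M) T"
    and eq: "\<And>x. x \<in> (\<Pi>\<^sub>E i\<in>I. carrier (M i)) \<Longrightarrow> f (pure_tensor R I M x) = g (pure_tensor R I M x)"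
  shows "f = g"
proof -
  have up: "x(i := a) \<in> (\<Pi>\<^sub>E i\<in>I. carrier (M i))"
    if "x \<in> (\<Pi>\<^sub>E i\<in>I. carrier (M i))" "i \<in> I" "a \<in> carrier (M i)" for x i a
    using that by (auto simp: PiE_iff extensional_def)
  note p = pure_tensor_carrier[OF R]
  have "\<exists>!h. h \<in> lin_maps R (tensor R I M) T \<and>
    (\<forall>x \<in> (\<Pi>\<^sub>E i\<in>I. carrier (M i)). h (pure_tensor R I M x) = g (pure_tensor R I M x))"
  proof (rule tensor_universal[OF R M T])
    fix x i a b assume x: "x \<in> (\<Pi>\<^sub>E i\<in>I. carrier (M i))" "i \<in> I" and ab: "a \<in> carrier (M i)" "b \<in> carrier (M i)"
    show "g (pure_tensor R I M (x(i := a \<oplus>\<^bsub>M i\<^esub> b))) =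
        g (pure_tensor R I M (x(i := a))) \<oplus>\<^bsub>T\<^esub> g (pure_tensor R I M (x(i := b)))"
      by (simp only: pure_tensor_add[OF R M x ab] lin_maps_add[OF g p[OF up[OF x ab(1)]] p[OF up[OF x ab(2)]]])
  next
    fix x i r a assume x: "x \<in> (\<Pi>\<^sub>E i\<in>I. carrier (M i))" "i \<in> I" and r: "r \<in> carrier R" and a: "a \<in> carrier (M i)"
    show "g (pure_tensor R I M (x(i := r \<odot>\<^bsub>M i\<^esub> a))) = r \<odot>\<^bsub>T\<^esub> g (pure_tensor R I M (x(i := a)))"
      by (simp only: pure_tensor_smult[OF R M x r a] lin_maps_smult[OF g r p[OF up[OF x a]]])
  qed (assumption | rule lin_maps_carrier[OF g p])+
  with f g eq show ?thesis by blast
qed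

lemma tensor_perm_pure:
  assumes R: "cring R" and M: "Module.module R M" and \<sigma>: "\<sigma> permutes {..<s}"
  shows "tensor_perm R s M \<sigma> \<in> lin_maps R (tensor_power R s M) (tensor_power R s M)"
    and "\<And>x. x \<in> (\<Pi>\<^sub>E i\<in>{..<s}. carrier M) \<Longrightarrow>
      tensor_perm R s M \<sigma> (pure_tensor R {..<s} (\<lambda>_. M) x) = pure_tensor R {..<s} (\<lambda>_. M) (\<lambda>i\<in>{..<s}. x (\<sigma> i))"
proof -
  let ?X = "\<Pi>\<^sub>E i\<in>{..<s}. carrier M" and ?\<phi> = "\<lambda>x. pure_tensor R {..<s} (\<lambda>_. M) (\<lambda>i\<in>{..<s}. x (\<sigma> i))"
  have sb: "\<sigma> i < s \<longleftrightarrow> i < s" for i using permutes_in_image[OF \<sigma>, of i] by simp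
  have fx: "(\<lambda>i\<in>{..<s}. x (\<sigma> i)) \<in> ?X" if "x \<in> ?X" for x
    using that by (auto simp: PiE_iff sb)
  obtain j where j: "\<And>i. \<sigma> (j i) = i" "\<And>i. j (\<sigma> i) = i" "\<And>i. j i < s \<longleftrightarrow> i < s"
    using permutes_inverses[OF \<sigma>] permutes_in_image[OF permutes_inv[OF \<sigma>]] by (metis lessThan_iff)
  have up: "(\<lambda>k\<in>{..<s}. (x(i := a)) (\<sigma> k)) = (\<lambda>k\<in>{..<s}. x (\<sigma> k))(j i := a)" if "i \<in> {..<s}" for x :: "nat \<Rightarrow> 'b" and i a
    using that j by (auto simp: fun_eq_iff)
  have "\<exists>!h. h \<in> lin_maps R (tensor_power R s M) (tensor_power R s M) \<and>
    (\<forall>x\<in>?X. h (pure_tensor R {..<s} (\<lambda>_. M) x) = ?\<phi> x)"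
  proof (rule tensor_universal[OF R M tensor_module[OF R M]])
    fix x i a b assume "x \<in> ?X" "i \<in> {..<s}" "a \<in> carrier M" "b \<in> carrier M"
    then show "?\<phi> (x(i := a \<oplus>\<^bsub>M\<^esub> b)) = ?\<phi> (x(i := a)) \<oplus>\<^bsub>tensor_power R s M\<^esub> ?\<phi> (x(i := b))"
      by (simp only: up) (rule pure_tensor_add[OF R M fx], simp_all add: j)
  next
    fix x i r a assume "x \<in> ?X" "i \<in> {..<s}" "r \<in> carrier R" "a \<in> carrier M"
    then show "?\<phi> (x(i := r \<odot>\<^bsub>M\<^esub> a)) = r \<odot>\<^bsub>tensor_power R s M\<^esub> ?\<phi> (x(i := a))"
      by (simp only: up) (rule pure_tensor_smult[OF R M fx], simp_all add: j)
  qed (auto intro: pure_tensor_carrier[OF R fx])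
  from theI'[OF this] show "tensor_perm R s M \<sigma> \<in> lin_maps R (tensor_power R s M) (tensor_power R s M)"
    and "\<And>x. x \<in> ?X \<Longrightarrow> tensor_perm R s M \<sigma> (pure_tensor R {..<s} (\<lambda>_. M) x) = ?\<phi> x"
    unfolding tensor_perm_def by blast+
qed

text \<open>The tensor powers \<open>f\<^sup>\<otimes>\<^sup>s\<close> define a functor \<open>P_R \<rightarrow> \<Gamma>\<^sup>s P_R\<close>, so that underlying functors of strict
  polynomial functors are indeed objects of \<open>F_cat R\<close>.\<close>

lemma underlying_functor:
  assumes R: "cring R" and G: "G \<in> Ob (strict_poly_cat R s)"
  shows "underlying R s G \<in> Ob (F_cat R)"
proof -
  have G: "is_functor (Schur_cat R s) (Mod_cat R) G"
    using G by (simp add: strict_poly_cat_def full_subcat_def is_linear_functor_def)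
  have obS: "Ob (Schur_cat R s) = Ob (P_cat R)" by (simp add: Schur_cat_def)
  have md: "Module.module R M" if "M \<in> Ob (P_cat R)" for M
    using that by (simp add: P_cat_def module_cat_def fg_projective_def)
  have aP: "arrs (P_cat R) M N = lin_maps R M N" for M N
    by (simp add: P_cat_def module_cat_def hom_mod_def)
  let ?t = "\<lambda>M N f. tensor_map R {..<s} (\<lambda>_. M) (\<lambda>_. N) (\<lambda>_. f)"
  let ?T = "\<lambda>M. tensor_power R s M" and ?p = "\<lambda>M. pure_tensor R {..<s} (\<lambda>_. M)"
  have tl: "?t M N f \<in> lin_maps R (?T M) (?T N)"
    and tp: "\<And>x. x \<in> (\<Pi>\<^sub>E i\<in>{..<s}. carrier M) \<Longrightarrow> ?t M N f (?p M x) = ?p N (\<lambda>i\<in>{..<s}. f (x i))"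
    if "M \<in> Ob (P_cat R)" "N \<in> Ob (P_cat R)" "f \<in> lin_maps R M N" for M N f
    using tensor_map_pure[where I = "{..<s}" and M = "\<lambda>_. M" and N = "\<lambda>_. N" and f = "\<lambda>_. f", OF R md md] that by blast+
  have tm: "Module.module R (?T M)" if "M \<in> Ob (P_cat R)" for M
    by (rule tensor_module[OF R md[OF that]])
  have arr: "?t M N f \<in> arrs (Schur_cat R s) M N"
    if M: "M \<in> Ob (P_cat R)" and N: "N \<in> Ob (P_cat R)" and f: "f \<in> lin_maps R M N" for M N f
  proof -
    have "?t M N f (tensor_perm R s M \<sigma> z) = tensor_perm R s N \<sigma> (?t M N f z)"
      if \<sigma>: "\<sigma> permutes {..<s}" and z: "z \<in> carrier (?T M)" for \<sigma> z
    proof -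
      note pM = tensor_perm_pure[OF R md[OF M] \<sigma>] and pN = tensor_perm_pure[OF R md[OF N] \<sigma>]
      have sb: "\<sigma> i < s \<longleftrightarrow> i < s" for i using permutes_in_image[OF \<sigma>, of i] by simp
      have "compose (carrier (?T M)) (?t M N f) (tensor_perm R s M \<sigma>) = compose (carrier (?T M)) (tensor_perm R s N \<sigma>) (?t M N f)"
      proof (rule tensor_lin_eqI[OF R md[OF M] tm[OF N] lin_maps_compose[OF tm[OF M] pM(1) tl[OF M N f]]
            lin_maps_compose[OF tm[OF M] tl[OF M N f] pN(1)]])
        fix x assume x: "x \<in> (\<Pi>\<^sub>E i\<in>{..<s}. carrier M)"
        have 1: "(\<lambda>i\<in>{..<s}. x (\<sigma> i)) \<in> (\<Pi>\<^sub>E i\<in>{..<s}. carrier M)" using x by (auto simp: PiE_iff sb)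
        have 2: "(\<lambda>i\<in>{..<s}. f (x i)) \<in> (\<Pi>\<^sub>E i\<in>{..<s}. carrier N)"
          using x lin_maps_carrier[OF f] by (auto simp: PiE_iff)
        have 3: "(\<lambda>i\<in>{..<s}. f ((\<lambda>i\<in>{..<s}. x (\<sigma> i)) i)) = (\<lambda>i\<in>{..<s}. (\<lambda>i\<in>{..<s}. f (x i)) (\<sigma> i))"
          by (auto simp: fun_eq_iff sb)
        show "compose (carrier (?T M)) (?t M N f) (tensor_perm R s M \<sigma>) (?p M x) =
           compose (carrier (?T M)) (tensor_perm R s N \<sigma>) (?t M N f) (?p M x)"
          using pure_tensor_carrier[OF R, of x "{..<s}" "\<lambda>_. M"] x
          by (simp only: compose_eq pM(2)[OF x] tp[OF M N f 1] tp[OF M N f x] pN(2)[OF 2] 3)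
      qed
      from fun_cong[OF this, of z] z show ?thesis by (simp add: compose_eq)
    qed
    then show ?thesis using tl[OF that] by (auto simp: Schur_cat_def)
  qed
  have tid: "?t M M (\<lambda>x\<in>carrier M. x) = Idn (Schur_cat R s) M" if M: "M \<in> Ob (P_cat R)" for M
  proof -
    note i = lin_maps_id[OF md[OF M]]
    have "?t M M (\<lambda>x\<in>carrier M. x) = (\<lambda>z\<in>carrier (?T M). z)"
    proof (rule tensor_lin_eqI[OF R md[OF M] tm[OF M] tl[OF M M i] lin_maps_id[OF tm[OF M]]])
      fix x assume x: "x \<in> (\<Pi>\<^sub>E i\<in>{..<s}. carrier M)"
      have "(\<lambda>i\<in>{..<s}. (\<lambda>x\<in>carrier M. x) (x i)) = x"
        using x by (auto simp: fun_eq_iff PiE_iff extensional_def)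
      then show "?t M M (\<lambda>x\<in>carrier M. x) (?p M x) = (\<lambda>z\<in>carrier (?T M). z) (?p M x)"
        using tp[OF M M i x] pure_tensor_carrier[OF R, of x "{..<s}" "\<lambda>_. M"] x by simp
    qed
    then show ?thesis by (simp add: Schur_cat_def)
  qed
  have tcomp: "?t L N (compose (carrier L) g f) = Cmp (Schur_cat R s) L M N (?t M N g) (?t L M f)"
    if L: "L \<in> Ob (P_cat R)" and M: "M \<in> Ob (P_cat R)" and N: "N \<in> Ob (P_cat R)"
      and f: "f \<in> lin_maps R L M" and g: "g \<in> lin_maps R M N" for L M N f g
  proof -
    note gf = lin_maps_compose[OF md[OF L] f g]
    have "?t L N (compose (carrier L) g f) = compose (carrier (?T L)) (?t M N g) (?t L M f)"
    proof (rule tensor_lin_eqI[OF R md[OF L] tm[OF N] tl[OF L N gf] lin_maps_compose[OF tm[OF L] tl[OF L M f] tl[OF M N g]]])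
      fix x assume x: "x \<in> (\<Pi>\<^sub>E i\<in>{..<s}. carrier L)"
      have 2: "(\<lambda>i\<in>{..<s}. f (x i)) \<in> (\<Pi>\<^sub>E i\<in>{..<s}. carrier M)"
        using x lin_maps_carrier[OF f] by (auto simp: PiE_iff)
      have 3: "(\<lambda>i\<in>{..<s}. compose (carrier L) g f (x i)) = (\<lambda>i\<in>{..<s}. g ((\<lambda>i\<in>{..<s}. f (x i)) i))"
        using x by (auto simp: fun_eq_iff compose_def)
      show "?t L N (compose (carrier L) g f) (?p L x) = compose (carrier (?T L)) (?t M N g) (?t L M f) (?p L x)"
        using pure_tensor_carrier[OF R, of x "{..<s}" "\<lambda>_. L"] x
        by (simp only: compose_eq tp[OF L N gf x] tp[OF L M f x] tp[OF M N g 2] 3)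
    qed
    then show ?thesis by (simp add: Schur_cat_def)
  qed
  have idP: "Idn (P_cat R) M = (\<lambda>x\<in>carrier M. x)" and cmP: "Cmp (P_cat R) L M N g f = compose (carrier L) g f"
    for L M N :: "'a pmod" and g f by (simp_all add: P_cat_def module_cat_def)
  have "is_functor (P_cat R) (Mod_cat R) (underlying R s G)"
    using G arr tid tcomp by (simp add: is_functor_def underlying_def obS aP idP cmP)
  then show ?thesis by (simp add: F_cat_def functor_cat_def)
qed

lemma linear_category_F_cat:
  "cring R \<Longrightarrow> linear_category R (F_cat R :: ('r, ('r, 'm) pfunctor, _) lincat)"
  unfolding F_cat_def Mod_cat_def
  by (rule linear_category_functor_cat) (auto intro: linear_category_module_cat)

end

theory Submission
  imports Defs "HOL-Combinatorics.Multiset_Permutations" "HOL-Number_Theory.Residue_Primitive_Roots"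
begin

text \<open>Let \<open>T H = H(- \<oplus> \<dots> \<oplus> -)\<close> (\<open>N\<close> summands); it is the parameterization of \<open>H\<close> by \<open>R\<^sup>N\<close>, hence an
  endofunctor of \<open>A\<close> up to isomorphism, and it is self-adjoint. The projection \<open>\<epsilon>\<close> of \<open>T H\<close> onto its
  \<open>N\<close>-th cross effect is natural and compatible with the adjunction, so if it vanishes on \<open>F\<close>, then a
  dimension shift with injectives shows that it annihilates \<open>Ext(F, T H)\<close>.
  If \<open>G\<close> is strict polynomial of weight \<open>s = a\<^sub>1 + \<dots> + a\<^sub>N\<close> with all \<open>a\<^sub>i > 0\<close>, then the weight
  space of \<open>(a\<^sub>1, \<dots>, a\<^sub>N)\<close> yields natural maps \<open>G \<rightarrow> T G \<rightarrow> G\<close> whose composite is the multinomial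
  coefficient \<open>s! / (a\<^sub>1! \<dots> a\<^sub>N!)\<close> and the first of which is fixed by \<open>\<epsilon>\<close>. So the multinomial
  coefficient kills \<open>Ext(F, G)\<close> as soon as the \<open>N\<close>-th cross effect of \<open>F\<close> vanishes. Part (i) uses
  \<open>s = 1 + \<dots> + 1\<close>; part (ii) uses a decomposition into powers of \<open>p\<close>, whose coefficient has
  \<open>p\<close>-adic valuation \<open>(N - \<Sigma>\<^sub>p(s)) / (p - 1)\<close> by Legendre's formula.
  In (iii), if \<open>s\<close> and \<open>t\<close> are incongruent modulo \<open>p - 1\<close>, then homotheties by a primitive root modulo
  \<open>p\<close> act on \<open>F\<close> and \<open>G\<close> by different scalars; otherwise \<open>t < \<Sigma>\<^sub>p(s)\<close> or \<open>s < \<Sigma>\<^sub>p(t)\<close>, and a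
  decomposition of \<open>s\<close> or \<open>t\<close> with coefficient prime to \<open>p\<close> applies.\<close>

text \<open>The abelian structure of \<open>A\<close> is intrinsic: its kernels and cokernels need
  not be the pointwise ones. Exactness of \<open>T\<close> is therefore drawn from the adjunction
  alone, and exact sequences are handled through factorization properties. The self-adjunction has a
  simple source: Hom(D K, L) and Hom(K, D L) are both the N-th power of Hom(K, L), so the N-fold
  direct sum \<open>D\<close> is its own adjoint, and so is precomposition with \<open>D\<close>.
  All operations on Ext act on the second variable, by composing cochains on one fixed resolution of
  F. Information about F, namely that its cross effect vanishes, reaches the second variable only
  through the adjunction, which moves \<epsilon> from \<open>T H\<close> to \<open>T F\<close>.
  Keeping \<epsilon> as an endomorphism means that no cross effect subfunctor has to be formed
  inside \<open>A\<close>. The shape of the exponent in (ii): replacing one summand p^(k+1) of s by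
  p summands p^k lengthens a decomposition by p - 1, so the available lengths are N = Sigma_p(s) +
  (p - 1) r, with coefficient of valuation r. The ceiling picks the least r \<ge> 0 with N > deg F,
  and deg F < s ensures N \<le> s.\<close>

section \<open>Linear and abelian categories: kernels, exactness, cocycles of resolutions\<close>

context linear_category begin

lemma hom_group: "X \<in> Ob C \<Longrightarrow> Y \<in> Ob C \<Longrightarrow> abelian_group (Hom C X Y)"
  using hom_module by (blast intro: module.axioms)

lemma zero_arr_closed [simp]: "X \<in> Ob C \<Longrightarrow> Y \<in> Ob C \<Longrightarrow> zero_arr C X Y \<in> arrs C X Y"
  by (meson hom_group abelian_group.axioms(1) abelian_monoid.zero_closed)

lemma cmp_zero_left:
  assumes "X \<in> Ob C" "Y \<in> Ob C" "Z \<in> Ob C" "f \<in> arrs C X Y"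
  shows "Cmp C X Y Z (zero_arr C Y Z) f = zero_arr C X Z"
proof -
  interpret YZ: Module.module R "Hom C Y Z" by (rule hom_module) fact+
  interpret XZ: Module.module R "Hom C X Z" by (rule hom_module) fact+
  show ?thesis
    using cmp_smult_left[OF assms(1-3) YZ.R.zero_closed assms(4) YZ.zero_closed]
      cmp_arr[OF assms YZ.zero_closed] by simp
qed

lemma cmp_zero_right:
  assumes "X \<in> Ob C" "Y \<in> Ob C" "Z \<in> Ob C" "g \<in> arrs C Y Z"
  shows "Cmp C X Y Z g (zero_arr C X Y) = zero_arr C X Z"
proof -
  interpret XY: Module.module R "Hom C X Y" by (rule hom_module) fact+
  interpret XZ: Module.module R "Hom C X Z" by (rule hom_module) fact+
  show ?thesis
    using cmp_smult_right[OF assms(1-3) XY.R.zero_closed XY.zero_closed assms(4)]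
      cmp_arr[OF assms(1-3) XY.zero_closed assms(4)] by simp
qed

lemma cmp_minus_left:
  assumes "X \<in> Ob C" "Y \<in> Ob C" "Z \<in> Ob C" "f \<in> arrs C X Y" "g \<in> arrs C Y Z" "h \<in> arrs C Y Z"
  shows "Cmp C X Y Z (g \<ominus>\<^bsub>Hom C Y Z\<^esub> h) f = Cmp C X Y Z g f \<ominus>\<^bsub>Hom C X Z\<^esub> Cmp C X Y Z h f"
proof -
  interpret YZ: Module.module R "Hom C Y Z" by (rule hom_module) fact+
  interpret XZ: Module.module R "Hom C X Z" by (rule hom_module) fact+
  have d: "g \<ominus>\<^bsub>Hom C Y Z\<^esub> h \<in> arrs C Y Z" using assms by simp
  have "Cmp C X Y Z (g \<ominus>\<^bsub>Hom C Y Z\<^esub> h \<oplus>\<^bsub>Hom C Y Z\<^esub> h) f =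
      Cmp C X Y Z (g \<ominus>\<^bsub>Hom C Y Z\<^esub> h) f \<oplus>\<^bsub>Hom C X Z\<^esub> Cmp C X Y Z h f"
    by (rule cmp_add_left[OF assms(1-4) d assms(6)])
  moreover have "g \<ominus>\<^bsub>Hom C Y Z\<^esub> h \<oplus>\<^bsub>Hom C Y Z\<^esub> h = g"
    using assms by (simp add: YZ.minus_eq YZ.a_assoc YZ.l_neg)
  ultimately show ?thesis
    using cmp_arr[OF assms(1-4) d] cmp_arr[OF assms(1-4,6)]
    by (simp add: XZ.minus_eq XZ.a_assoc XZ.r_neg)
qed

lemma cmp_minus_right:
  assumes "X \<in> Ob C" "Y \<in> Ob C" "Z \<in> Ob C" "g \<in> arrs C X Y" "h \<in> arrs C X Y" "f \<in> arrs C Y Z"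
  shows "Cmp C X Y Z f (g \<ominus>\<^bsub>Hom C X Y\<^esub> h) = Cmp C X Y Z f g \<ominus>\<^bsub>Hom C X Z\<^esub> Cmp C X Y Z f h"
proof -
  interpret XY: Module.module R "Hom C X Y" by (rule hom_module) fact+
  interpret XZ: Module.module R "Hom C X Z" by (rule hom_module) fact+
  have d: "g \<ominus>\<^bsub>Hom C X Y\<^esub> h \<in> arrs C X Y" using assms by simp
  have "Cmp C X Y Z f (g \<ominus>\<^bsub>Hom C X Y\<^esub> h \<oplus>\<^bsub>Hom C X Y\<^esub> h) =
      Cmp C X Y Z f (g \<ominus>\<^bsub>Hom C X Y\<^esub> h) \<oplus>\<^bsub>Hom C X Z\<^esub> Cmp C X Y Z f h"
    by (rule cmp_add_right[OF assms(1-3) d assms(5,6)])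
  moreover have "g \<ominus>\<^bsub>Hom C X Y\<^esub> h \<oplus>\<^bsub>Hom C X Y\<^esub> h = g"
    using assms by (simp add: XY.minus_eq XY.a_assoc XY.l_neg)
  ultimately show ?thesis
    using cmp_arr[OF assms(1-3) d assms(6)] cmp_arr[OF assms(1-3) assms(5,6)]
    by (simp add: XZ.minus_eq XZ.a_assoc XZ.r_neg)
qed

lemma minus_arr:
  assumes "X \<in> Ob C" "Y \<in> Ob C" "g \<in> arrs C X Y" "h \<in> arrs C X Y"
  shows "g \<ominus>\<^bsub>Hom C X Y\<^esub> h \<in> arrs C X Y"
proof -
  interpret abelian_group "Hom C X Y" by (rule hom_group) fact+
  show ?thesis using assms by simp
qed

lemma minus_self:
  assumes "X \<in> Ob C" "Y \<in> Ob C" "g \<in> arrs C X Y"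
  shows "g \<ominus>\<^bsub>Hom C X Y\<^esub> g = zero_arr C X Y"
proof -
  interpret abelian_group "Hom C X Y" by (rule hom_group) fact+
  show ?thesis using assms by (simp add: minus_eq r_neg)
qed

lemma minus_zero:
  assumes "X \<in> Ob C" "Y \<in> Ob C" "g \<in> arrs C X Y"
  shows "g \<ominus>\<^bsub>Hom C X Y\<^esub> zero_arr C X Y = g"
proof -
  interpret abelian_group "Hom C X Y" by (rule hom_group) fact+
  show ?thesis using assms by (simp add: minus_eq)
qed

lemma monicD:
  "monic C X Y f \<Longrightarrow> W \<in> Ob C \<Longrightarrow> g \<in> arrs C W X \<Longrightarrow> h \<in> arrs C W X \<Longrightarrow>
    Cmp C W X Y f g = Cmp C W X Y f h \<Longrightarrow> g = h"
  unfolding monic_def by blast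

lemma epicD:
  "epic C X Y f \<Longrightarrow> Z \<in> Ob C \<Longrightarrow> g \<in> arrs C Y Z \<Longrightarrow> h \<in> arrs C Y Z \<Longrightarrow>
    Cmp C X Y Z g f = Cmp C X Y Z h f \<Longrightarrow> g = h"
  unfolding epic_def by blast

lemma kernel_lift:
  assumes "is_kernel C X Y f K k" "W \<in> Ob C" "g \<in> arrs C W X" "Cmp C W X Y f g = zero_arr C W Y"
  obtains h where "h \<in> arrs C W K" "Cmp C W K X k h = g"
  using assms unfolding is_kernel_def by blast

lemma cokernel_desc:
  assumes "is_cokernel C X Y f Q q" "Z \<in> Ob C" "g \<in> arrs C Y Z" "Cmp C X Y Z g f = zero_arr C X Z"
  obtains h where "h \<in> arrs C Q Z" "Cmp C Y Q Z h q = g"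
  using assms unfolding is_cokernel_def by blast

lemma injective_extend:
  assumes "injective_obj C J" "monic C X Y m" "f \<in> arrs C X J"
  obtains g where "g \<in> arrs C Y J" "Cmp C X Y J g m = f"
  using assms unfolding injective_obj_def by blast

lemma projective_lift:
  assumes "projective_obj C P" "epic C X Y e" "f \<in> arrs C P Y"
  obtains g where "g \<in> arrs C P X" "Cmp C P X Y e g = f"
  using assms unfolding projective_obj_def by blast

lemma kernel_monic:
  assumes "X \<in> Ob C" "Y \<in> Ob C" "f \<in> arrs C X Y" and k: "is_kernel C X Y f K k"
  shows "monic C K X k"
  unfolding monic_def
proof (intro conjI ballI impI)
  show K: "K \<in> Ob C" and X: "X \<in> Ob C" and kK: "k \<in> arrs C K X"
    using k assms by (auto simp: is_kernel_def)
  fix W g h assume W: "W \<in> Ob C" and g: "g \<in> arrs C W K" and h: "h \<in> arrs C W K"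
    and eq: "Cmp C W K X k g = Cmp C W K X k h"
  have "Cmp C W X Y f (Cmp C W K X k g) = zero_arr C W Y"
    using cmp_assoc[OF W K X assms(2) g kK assms(3)] cmp_zero_left[OF W K assms(2) g] k
    by (simp add: is_kernel_def)
  then have "\<exists>!u. u \<in> arrs C W K \<and> Cmp C W K X k u = Cmp C W K X k g"
    using k W cmp_arr[OF W K X g kK] by (simp add: is_kernel_def)
  with g h eq show "g = h" by metis
qed

lemma cokernel_epic:
  assumes "X \<in> Ob C" "Y \<in> Ob C" "f \<in> arrs C X Y" and q: "is_cokernel C X Y f Q q"
  shows "epic C Y Q q"
  unfolding epic_def
proof (intro conjI ballI impI)
  show Q: "Q \<in> Ob C" and Y: "Y \<in> Ob C" and qQ: "q \<in> arrs C Y Q"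
    using q assms by (auto simp: is_cokernel_def)
  fix Z g h assume Z: "Z \<in> Ob C" and g: "g \<in> arrs C Q Z" and h: "h \<in> arrs C Q Z"
    and eq: "Cmp C Y Q Z g q = Cmp C Y Q Z h q"
  have "Cmp C X Y Z (Cmp C Y Q Z g q) f = zero_arr C X Z"
    using cmp_assoc[OF assms(1) Y Q Z assms(3) qQ g] cmp_zero_right[OF assms(1) Q Z g] q
    by (simp add: is_cokernel_def)
  then have "\<exists>!u. u \<in> arrs C Q Z \<and> Cmp C Y Q Z u q = Cmp C Y Q Z g q"
    using q Z cmp_arr[OF Y Q Z qQ g] by (simp add: is_cokernel_def)
  with g h eq show "g = h" by metis
qed

end

context abelian_category begin

text \<open>Normality presents \<open>m\<close> as the kernel of some \<open>g\<close>. Since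
  \<open>g\<close> kills \<open>m\<close>, it factors through the cokernel \<open>q\<close>, so
  whatever \<open>q\<close> kills is killed by \<open>g\<close> and lifts along
  \<open>m\<close>.\<close>

lemma monic_kernel_of_cokernel:
  assumes m: "monic C X Y m" and q: "is_cokernel C X Y m Q q"
  shows "is_kernel C Y Q q X m"
proof -
  have X: "X \<in> Ob C" and Y: "Y \<in> Ob C" and mm: "m \<in> arrs C X Y" using m by (auto simp: monic_def)
  have Q: "Q \<in> Ob C" and qQ: "q \<in> arrs C Y Q" and qm: "Cmp C X Y Q q m = zero_arr C X Q"
    using q by (auto simp: is_cokernel_def)
  obtain Z g where Z: "Z \<in> Ob C" and g: "g \<in> arrs C Y Z" and k: "is_kernel C Y Z g X m"
    using monic_normal[OF m] by blast
  then have "Cmp C X Y Z g m = zero_arr C X Z" by (simp add: is_kernel_def)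
  then obtain g' where g': "g' \<in> arrs C Q Z" "Cmp C Y Q Z g' q = g"
    using cokernel_desc[OF q Z g] by blast
  show ?thesis unfolding is_kernel_def
  proof (intro conjI ballI impI X mm qm)
    fix W t assume W: "W \<in> Ob C" and t: "t \<in> arrs C W Y" and z: "Cmp C W Y Q q t = zero_arr C W Q"
    have "Cmp C W Y Z g t = zero_arr C W Z"
      using cmp_assoc[OF W Y Q Z t qQ g'(1)] g'(2) z cmp_zero_right[OF W Q Z g'(1)] by simp
    then show "\<exists>!h. h \<in> arrs C W X \<and> Cmp C W X Y m h = t"
      using k W t by (simp add: is_kernel_def)
  qed
qed

text \<open>By normality \<open>e\<close> is the cokernel of some map, and that map is among the
  \<open>w\<close> on which \<open>c\<close> is tested. Testing on all \<open>w\<close> avoids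
  choosing a kernel of \<open>e\<close>.\<close>

lemma epic_factor:
  assumes e: "epic C X Y e" and Z: "Z \<in> Ob C" and c: "c \<in> arrs C X Z"
    and k: "\<And>W w. W \<in> Ob C \<Longrightarrow> w \<in> arrs C W X \<Longrightarrow> Cmp C W X Y e w = zero_arr C W Y \<Longrightarrow>
      Cmp C W X Z c w = zero_arr C W Z"
  shows "\<exists>c' \<in> arrs C Y Z. Cmp C X Y Z c' e = c"
proof -
  obtain W g where W: "W \<in> Ob C" and g: "g \<in> arrs C W X" and q: "is_cokernel C W X g Y e"
    using epic_normal[OF e] by blast
  then have "Cmp C W X Z c g = zero_arr C W Z" by (intro k) (auto simp: is_cokernel_def)
  then show ?thesis using cokernel_desc[OF q Z c] by blast
qed

lemma exact_image:
  assumes X: "X \<in> Ob C" "Y \<in> Ob C" "Z \<in> Ob C" and ex: "exact_at C X Y Z f g"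
  shows "\<exists>K k h. is_kernel C Y Z g K k \<and> epic C X K h \<and> Cmp C X K Y k h = f"
proof -
  have f: "f \<in> arrs C X Y" and g: "g \<in> arrs C Y Z" and gf: "Cmp C X Y Z g f = zero_arr C X Z"
    using ex by (auto simp: exact_at_def)
  obtain K k where k: "is_kernel C Y Z g K k" using kernel_ex[OF X(2,3) g] by blast
  from kernel_lift[OF k X(1) f gf] obtain h where h: "h \<in> arrs C X K" "Cmp C X K Y k h = f" .
  then have "epic C X K h" using ex k by (simp add: exact_at_def)
  with k h show ?thesis by blast
qed

text \<open>Exactness provides an epimorphism from \<open>X\<close> onto the kernel of
  \<open>g\<close> through which \<open>f\<close> factors; \<open>c\<close> vanishes on the kernel
  because it vanishes after this epimorphism, and \<open>w\<close> lands in the kernel.\<close>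

lemma exact_factor:
  assumes X: "X \<in> Ob C" "Y \<in> Ob C" "Z \<in> Ob C" and ex: "exact_at C X Y Z f g"
    and V: "V \<in> Ob C" and c: "c \<in> arrs C Y V" and cf: "Cmp C X Y V c f = zero_arr C X V"
    and W: "W \<in> Ob C" and w: "w \<in> arrs C W Y" and gw: "Cmp C W Y Z g w = zero_arr C W Z"
  shows "Cmp C W Y V c w = zero_arr C W V"
proof -
  obtain K k h where k: "is_kernel C Y Z g K k" and h: "epic C X K h" and kh: "Cmp C X K Y k h = f"
    using exact_image[OF X ex] by blast
  have K: "K \<in> Ob C" and kK: "k \<in> arrs C K Y" using k by (auto simp: is_kernel_def)
  have hh: "h \<in> arrs C X K" using h by (simp add: epic_def)
  have "Cmp C X K V (Cmp C K Y V c k) h = Cmp C X K V (zero_arr C K V) h"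
    using cmp_assoc[OF X(1) K X(2) V hh kK c] cmp_zero_left[OF X(1) K V hh] kh cf by simp
  then have ck: "Cmp C K Y V c k = zero_arr C K V"
    by (rule epicD[OF h V cmp_arr[OF K X(2) V kK c] zero_arr_closed[OF K V]])
  obtain u where u: "u \<in> arrs C W K" "Cmp C W K Y k u = w"
    using kernel_lift[OF k W w gw] .
  show ?thesis
    using cmp_assoc[OF W K X(2) V u(1) kK c] u(2) ck cmp_zero_left[OF W K V u(1)] by simp
qed

text \<open>The last fact treats exactness at \<open>P i\<close> uniformly: the target
  \<open>Z\<close> is the resolved object for \<open>i = 0\<close> and \<open>P (i - 1)\<close>
  otherwise.\<close>

lemma projective_resolutionD:
  assumes "projective_resolution C F P d e"
  shows "P i \<in> Ob C" "F \<in> Ob C" "epic C (P 0) F e" "exact_at C (P 1) (P 0) F (d 0) e"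
    "d i \<in> arrs C (P (Suc i)) (P i)"
    "Cmp C (P (Suc (Suc i))) (P (Suc i)) (P i) (d i) (d (Suc i)) = zero_arr C (P (Suc (Suc i))) (P i)"
    "\<exists>Z\<in>Ob C. \<exists>g. exact_at C (P (Suc i)) (P i) Z (d i) g"
proof -
  show P: "P i \<in> Ob C" for i using assms by (simp add: projective_resolution_def projective_obj_def)
  show F: "F \<in> Ob C" and "epic C (P 0) F e" and e0: "exact_at C (P 1) (P 0) F (d 0) e"
    using assms by (auto simp: projective_resolution_def epic_def)
  have e1: "exact_at C (P (Suc (Suc i))) (P (Suc i)) (P i) (d (Suc i)) (d i)" for i
    using assms by (simp add: projective_resolution_def)
  show "d i \<in> arrs C (P (Suc i)) (P i)" using e0 e1 by (cases i) (auto simp: exact_at_def)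
  show "Cmp C (P (Suc (Suc i))) (P (Suc i)) (P i) (d i) (d (Suc i)) = zero_arr C (P (Suc (Suc i))) (P i)"
    using e1[of i] by (simp add: exact_at_def)
  show "\<exists>Z\<in>Ob C. \<exists>g. exact_at C (P (Suc i)) (P i) Z (d i) g"
    using e0 e1 P F by (cases i) auto
qed

text \<open>This is left exactness of Hom: a cocycle in degree 0 vanishes on the image of
  \<open>d 0\<close>, which is the kernel of the augmentation.\<close>

lemma cocycle_zero_factor:
  assumes res: "projective_resolution C F P d e" and V: "V \<in> Ob C" and c: "c \<in> cocycles C P d V 0"
  shows "\<exists>c' \<in> arrs C F V. Cmp C (P 0) F V c' e = c"
proof -
  note r = projective_resolutionD[OF res]
  have c: "c \<in> arrs C (P 0) V" "Cmp C (P 1) (P 0) V c (d 0) = zero_arr C (P 1) V"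
    using c by (auto simp: cocycles_def)
  show ?thesis
    by (rule epic_factor[OF r(3) V c(1)])
      (rule exact_factor[OF r(1) r(1) r(2) r(4) V c])
qed

text \<open>This is the vanishing of positive Ext groups into an injective, on cochains. Exactness
  lets \<open>c\<close> descend to the image of \<open>d i\<close>, and injectivity extends it from
  there to \<open>P i\<close>.\<close>

lemma cocycle_injective:
  assumes res: "projective_resolution C F P d e" and J: "injective_obj C J"
    and c: "c \<in> cocycles C P d J (Suc i)"
  shows "\<exists>g \<in> arrs C (P i) J. Cmp C (P (Suc i)) (P i) J g (d i) = c"
proof -
  note r = projective_resolutionD[OF res]
  have JO: "J \<in> Ob C" using J by (simp add: injective_obj_def)
  have c: "c \<in> arrs C (P (Suc i)) J"
    "Cmp C (P (Suc (Suc i))) (P (Suc i)) J c (d (Suc i)) = zero_arr C (P (Suc (Suc i))) J"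
    using c by (auto simp: cocycles_def)
  obtain Z g where Z: "Z \<in> Ob C" and ex: "exact_at C (P (Suc i)) (P i) Z (d i) g" using r(7) by blast
  obtain K k h where k: "is_kernel C (P i) Z g K k" and h: "epic C (P (Suc i)) K h"
    and kh: "Cmp C (P (Suc i)) K (P i) k h = d i"
    using exact_image[OF r(1) r(1) Z ex] by blast
  have K: "K \<in> Ob C" and kK: "k \<in> arrs C K (P i)" using k by (auto simp: is_kernel_def)
  have hh: "h \<in> arrs C (P (Suc i)) K" using h by (simp add: epic_def)
  have ex1: "exact_at C (P (Suc (Suc i))) (P (Suc i)) (P i) (d (Suc i)) (d i)"
    using res by (simp add: projective_resolution_def)
  have "\<exists>c' \<in> arrs C K J. Cmp C (P (Suc i)) K J c' h = c"
  proof (rule epic_factor[OF h JO c(1)])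
    fix W w assume W: "W \<in> Ob C" and w: "w \<in> arrs C W (P (Suc i))"
      and z: "Cmp C W (P (Suc i)) K h w = zero_arr C W K"
    have "Cmp C W (P (Suc i)) (P i) (d i) w = zero_arr C W (P i)"
      using cmp_assoc[OF W r(1) K r(1) w hh kK] z kh cmp_zero_right[OF W K r(1) kK] by simp
    then show "Cmp C W (P (Suc i)) J c w = zero_arr C W J"
      by (rule exact_factor[OF r(1) r(1) r(1) ex1 JO c W w])
  qed
  then obtain c' where c': "c' \<in> arrs C K J" "Cmp C (P (Suc i)) K J c' h = c" by blast
  have "monic C K (P i) k"
    by (rule kernel_monic[OF r(1) Z _ k]) (use ex in \<open>simp add: exact_at_def\<close>)
  then obtain g where g: "g \<in> arrs C (P i) J" "Cmp C K (P i) J g k = c'"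
    using injective_extend[OF J _ c'(1)] by blast
  have "Cmp C (P (Suc i)) (P i) J g (d i) = c"
    using cmp_assoc[OF r(1) K r(1) JO hh kK g(1)] g(2) kh c'(2) by simp
  with g(1) show ?thesis by blast
qed

end

section \<open>Self-adjoint endofunctors and dimension shifting\<close>

text \<open>A single bijection, natural in both variables, makes \<open>T\<close> a left and a right
  adjoint at once. The category is only linear here, since the functor category plays this part
  first; abelianness enters with the subcategory \<open>A\<close>. The natural endomorphism
  \<open>eps\<close> is not yet tied to the adjunction.\<close>

locale self_adjoint_functor = linear_category R C for R and C :: "('r, 'o, 'a) lincat" +
  fixes T :: "'o \<Rightarrow> 'o" and Tm :: "'o \<Rightarrow> 'o \<Rightarrow> 'a \<Rightarrow> 'a" and adj :: "'o \<Rightarrow> 'o \<Rightarrow> 'a \<Rightarrow> 'a" and eps :: "'o \<Rightarrow> 'a"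
  assumes T_ob: "X \<in> Ob C \<Longrightarrow> T X \<in> Ob C"
    and Tm_arr: "\<lbrakk>X \<in> Ob C; Y \<in> Ob C; f \<in> arrs C X Y\<rbrakk> \<Longrightarrow> Tm X Y f \<in> arrs C (T X) (T Y)"
    and Tm_cmp: "\<lbrakk>X \<in> Ob C; Y \<in> Ob C; Z \<in> Ob C; f \<in> arrs C X Y; g \<in> arrs C Y Z\<rbrakk> \<Longrightarrow>
      Tm X Z (Cmp C X Y Z g f) = Cmp C (T X) (T Y) (T Z) (Tm Y Z g) (Tm X Y f)"
    and Tm_zero: "\<lbrakk>X \<in> Ob C; Y \<in> Ob C\<rbrakk> \<Longrightarrow> Tm X Y (zero_arr C X Y) = zero_arr C (T X) (T Y)"
    and adj_bij: "\<lbrakk>X \<in> Ob C; Y \<in> Ob C\<rbrakk> \<Longrightarrow> bij_betw (adj X Y) (arrs C X (T Y)) (arrs C (T X) Y)"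
    and adj_pre: "\<lbrakk>X' \<in> Ob C; X \<in> Ob C; Y \<in> Ob C; h \<in> arrs C X' X; f \<in> arrs C X (T Y)\<rbrakk> \<Longrightarrow>
      adj X' Y (Cmp C X' X (T Y) f h) = Cmp C (T X') (T X) Y (adj X Y f) (Tm X' X h)"
    and adj_post: "\<lbrakk>X \<in> Ob C; Y \<in> Ob C; Y' \<in> Ob C; f \<in> arrs C X (T Y); k \<in> arrs C Y Y'\<rbrakk> \<Longrightarrow>
      adj X Y' (Cmp C X (T Y) (T Y') (Tm Y Y' k) f) = Cmp C (T X) Y Y' k (adj X Y f)"
    and eps_arr: "X \<in> Ob C \<Longrightarrow> eps X \<in> arrs C (T X) (T X)"
    and eps_nat: "\<lbrakk>X \<in> Ob C; Y \<in> Ob C; f \<in> arrs C X Y\<rbrakk> \<Longrightarrow>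
      Cmp C (T X) (T Y) (T Y) (eps Y) (Tm X Y f) = Cmp C (T X) (T X) (T Y) (Tm X Y f) (eps X)"
begin

lemma adj_arr: "\<lbrakk>X \<in> Ob C; Y \<in> Ob C; f \<in> arrs C X (T Y)\<rbrakk> \<Longrightarrow> adj X Y f \<in> arrs C (T X) Y"
  using bij_betwE[OF adj_bij[of X Y]] by simp

lemma adj_inj: "\<lbrakk>X \<in> Ob C; Y \<in> Ob C; f \<in> arrs C X (T Y); g \<in> arrs C X (T Y); adj X Y f = adj X Y g\<rbrakk> \<Longrightarrow> f = g"
  using inj_onD[OF bij_betw_imp_inj_on[OF adj_bij[of X Y]], of f g] by simp

lemma adj_surj:
  assumes "X \<in> Ob C" "Y \<in> Ob C" "g \<in> arrs C (T X) Y"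
  obtains f where "f \<in> arrs C X (T Y)" "adj X Y f = g"
proof -
  have "g \<in> adj X Y ` arrs C X (T Y)" using bij_betw_imp_surj_on[OF adj_bij[OF assms(1,2)]] assms(3) by simp
  then show ?thesis using that by blast
qed

text \<open>Additivity of \<open>adj\<close> is not among the axioms. Instead the zero map is
  written as \<open>T\<close> of a zero map after a zero map, and naturality in the second variable
  moves this zero outside.\<close>

lemma adj_zero:
  assumes X: "X \<in> Ob C" and Y: "Y \<in> Ob C"
  shows "adj X Y (zero_arr C X (T Y)) = zero_arr C (T X) Y"
proof -
  note z = zero_arr_closed[OF X T_ob[OF Y]]
  have "Cmp C X (T Y) (T Y) (Tm Y Y (zero_arr C Y Y)) (zero_arr C X (T Y)) = zero_arr C X (T Y)"
    using z by (simp add: Tm_zero X Y T_ob cmp_zero_left)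
  then show ?thesis
    using adj_post[OF X Y Y z zero_arr_closed[OF Y Y]] cmp_zero_left[OF T_ob[OF X] Y Y adj_arr[OF X Y z]] by simp
qed

end

locale self_adjoint = self_adjoint_functor + abelian_category
begin

text \<open>Here \<open>T\<close> acts as a left adjoint: two maps out of \<open>T Y\<close> are
  compared through their transposes out of \<open>Y\<close>.\<close>

lemma Tm_epic:
  assumes e: "epic C X Y e" shows "epic C (T X) (T Y) (Tm X Y e)"
  unfolding epic_def
proof (intro conjI ballI impI)
  have X: "X \<in> Ob C" and Y: "Y \<in> Ob C" and ee: "e \<in> arrs C X Y" using e by (auto simp: epic_def)
  show "T X \<in> Ob C" "T Y \<in> Ob C" "Tm X Y e \<in> arrs C (T X) (T Y)" by (simp_all add: T_ob X Y Tm_arr ee)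
  fix Z g h assume Z: "Z \<in> Ob C" and g: "g \<in> arrs C (T Y) Z" and h: "h \<in> arrs C (T Y) Z"
    and eq: "Cmp C (T X) (T Y) Z g (Tm X Y e) = Cmp C (T X) (T Y) Z h (Tm X Y e)"
  obtain g' where g': "g' \<in> arrs C Y (T Z)" "adj Y Z g' = g" using adj_surj[OF Y Z g] .
  obtain h' where h': "h' \<in> arrs C Y (T Z)" "adj Y Z h' = h" using adj_surj[OF Y Z h] .
  have "Cmp C X Y (T Z) g' e = Cmp C X Y (T Z) h' e"
    using eq adj_pre[OF X Y Z ee g'(1)] adj_pre[OF X Y Z ee h'(1)] g' h'
    by (intro adj_inj[OF X Z cmp_arr[OF X Y T_ob[OF Z] ee g'(1)] cmp_arr[OF X Y T_ob[OF Z] ee h'(1)]]) simp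
  with epicD[OF e T_ob[OF Z] g'(1) h'(1)] g' h' show "g = h" by simp
qed

text \<open>Here \<open>T\<close> acts as a right adjoint: two maps into \<open>T X\<close> are
  compared through their transposes into \<open>X\<close>.\<close>

lemma Tm_monic:
  assumes m: "monic C X Y m" shows "monic C (T X) (T Y) (Tm X Y m)"
  unfolding monic_def
proof (intro conjI ballI impI)
  have X: "X \<in> Ob C" and Y: "Y \<in> Ob C" and mm: "m \<in> arrs C X Y" using m by (auto simp: monic_def)
  show "T X \<in> Ob C" "T Y \<in> Ob C" "Tm X Y m \<in> arrs C (T X) (T Y)" by (simp_all add: T_ob X Y Tm_arr mm)
  fix W g h assume W: "W \<in> Ob C" and g: "g \<in> arrs C W (T X)" and h: "h \<in> arrs C W (T X)"
    and eq: "Cmp C W (T X) (T Y) (Tm X Y m) g = Cmp C W (T X) (T Y) (Tm X Y m) h"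
  have "Cmp C (T W) X Y m (adj W X g) = Cmp C (T W) X Y m (adj W X h)"
    using adj_post[OF W X Y g mm] adj_post[OF W X Y h mm] eq by simp
  then have "adj W X g = adj W X h"
    by (rule monicD[OF m T_ob[OF W] adj_arr[OF W X g] adj_arr[OF W X h]])
  then show "g = h" by (rule adj_inj[OF W X g h])
qed

text \<open>A right adjoint preserves kernels: transpose, lift along \<open>k\<close>, transpose
  back. Uniqueness of the lift would follow from \<open>Tm_monic\<close>.\<close>

lemma Tm_kernel_factor:
  assumes X: "X \<in> Ob C" "Y \<in> Ob C" "f \<in> arrs C X Y" and k: "is_kernel C X Y f K k"
    and W: "W \<in> Ob C" and g: "g \<in> arrs C W (T X)"
    and z: "Cmp C W (T X) (T Y) (Tm X Y f) g = zero_arr C W (T Y)"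
  shows "\<exists>h \<in> arrs C W (T K). Cmp C W (T K) (T X) (Tm K X k) h = g"
proof -
  have K: "K \<in> Ob C" and kK: "k \<in> arrs C K X" using k by (auto simp: is_kernel_def)
  have "Cmp C (T W) X Y f (adj W X g) = zero_arr C (T W) Y"
    using adj_post[OF W X(1,2) g X(3)] z adj_zero[OF W X(2)] by simp
  from kernel_lift[OF k T_ob[OF W] adj_arr[OF W X(1) g] this]
  obtain h' where h': "h' \<in> arrs C (T W) K" "Cmp C (T W) K X k h' = adj W X g" .
  obtain h where h: "h \<in> arrs C W (T K)" "adj W K h = h'" using adj_surj[OF W K h'(1)] .
  have "Cmp C W (T K) (T X) (Tm K X k) h = g"
    using adj_post[OF W K X(1) h(1) kK] h h'
    by (intro adj_inj[OF W X(1) cmp_arr[OF W T_ob[OF K] T_ob[OF X(1)] h(1) Tm_arr[OF K X(1) kK]] g]) simp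
  with h(1) show ?thesis by blast
qed

text \<open>The extension problem into \<open>T J\<close> along \<open>m\<close> transposes to one
  into \<open>J\<close> along \<open>T m\<close>, and \<open>T m\<close> is again monic.\<close>

lemma T_injective:
  assumes J: "injective_obj C J" shows "injective_obj C (T J)"
  unfolding injective_obj_def
proof (intro conjI allI impI ballI)
  have JO: "J \<in> Ob C" using J by (simp add: injective_obj_def)
  then show "T J \<in> Ob C" by (rule T_ob)
  fix X Y m f assume m: "monic C X Y m" and f: "f \<in> arrs C X (T J)"
  have X: "X \<in> Ob C" and Y: "Y \<in> Ob C" and mm: "m \<in> arrs C X Y" using m by (auto simp: monic_def)
  obtain g where g: "g \<in> arrs C (T Y) J" "Cmp C (T X) (T Y) J g (Tm X Y m) = adj X J f"
    by (rule injective_extend[OF J Tm_monic[OF m] adj_arr[OF X JO f]])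
  obtain g' where g': "g' \<in> arrs C Y (T J)" "adj Y J g' = g" using adj_surj[OF Y JO g(1)] .
  have "Cmp C X Y (T J) g' m = f"
    using adj_pre[OF X Y JO mm g'(1)] g g' by (intro adj_inj[OF X JO cmp_arr[OF X Y T_ob[OF JO] mm g'(1)] f]) simp
  with g'(1) show "\<exists>g\<in>arrs C Y (T J). Cmp C X Y (T J) g m = f" by blast
qed

text \<open>Dimension shifting in the second variable: \<open>T\<close> is exact and preserves injectives, so both the
  cocycle and the action of \<open>eps\<close> can be moved along \<open>0 \<rightarrow> T H \<rightarrow> T J \<rightarrow> T Q \<rightarrow> 0\<close>.\<close>

lemma eps_cocycle:
  assumes inj: "enough_injectives C" and res: "projective_resolution C F P d e"
    and vanish: "\<And>H c. H \<in> Ob C \<Longrightarrow> c \<in> arrs C F (T H) \<Longrightarrow> Cmp C F (T H) (T H) (eps H) c = zero_arr C F (T H)"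
  shows "H \<in> Ob C \<Longrightarrow> c \<in> cocycles C P d (T H) i \<Longrightarrow>
    Cmp C (P i) (T H) (T H) (eps H) c \<in> coboundaries C P d (T H) i"
proof (induction i arbitrary: H c)
  case (0 H c)
  note r = projective_resolutionD[OF res] and TH = T_ob[OF 0(1)]
  have e: "e \<in> arrs C (P 0) F" using r(3) by (simp add: epic_def)
  obtain c' where c': "c' \<in> arrs C F (T H)" "Cmp C (P 0) F (T H) c' e = c"
    using cocycle_zero_factor[OF res TH 0(2)] by blast
  have "Cmp C (P 0) (T H) (T H) (eps H) c = zero_arr C (P 0) (T H)"
    using cmp_assoc[OF r(1) r(2) TH TH e c'(1) eps_arr[OF 0(1)]] c'(2) vanish[OF 0(1) c'(1)]
      cmp_zero_left[OF r(1) r(2) TH e] by simp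
  then show ?case by simp
next
  case (Suc i H c)
  note r = projective_resolutionD[OF res] and H = Suc.prems(1) and TH = T_ob[OF Suc.prems(1)]
  have c: "c \<in> arrs C (P (Suc i)) (T H)"
    "Cmp C (P (Suc (Suc i))) (P (Suc i)) (T H) c (d (Suc i)) = zero_arr C (P (Suc (Suc i))) (T H)"
    using Suc.prems(2) by (auto simp: cocycles_def)
  obtain J m where J: "injective_obj C J" and m: "monic C H J m"
    using inj Suc.prems(1) unfolding enough_injectives_def by blast
  have JO: "J \<in> Ob C" and mm: "m \<in> arrs C H J" using m by (auto simp: monic_def)
  obtain Q q where q: "is_cokernel C H J m Q q" using cokernel_ex[OF H JO mm] by blast
  then have Q: "Q \<in> Ob C" and qq: "q \<in> arrs C J Q" and qm: "Cmp C H J Q q m = zero_arr C H Q"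
    by (auto simp: is_cokernel_def)
  note TJ = T_ob[OF JO] and TQ = T_ob[OF Q]
  note Tmm = Tm_arr[OF H JO mm] and Tqq = Tm_arr[OF JO Q qq]
  have Tqm: "Cmp C (T H) (T J) (T Q) (Tm J Q q) (Tm H J m) = zero_arr C (T H) (T Q)"
    using Tm_cmp[OF H JO Q mm qq] qm Tm_zero[OF H Q] by simp
  \<comment> \<open>Pushed into the injective object \<open>T J\<close>, the cocycle becomes a
    coboundary.\<close>
  let ?c = "Cmp C (P (Suc i)) (T H) (T J) (Tm H J m) c"
  have "?c \<in> cocycles C P d (T J) (Suc i)"
    using cmp_arr[OF r(1) TH TJ c(1) Tmm] cmp_assoc[OF r(1) r(1) TH TJ r(5) c(1) Tmm] c(2)
      cmp_zero_right[OF r(1) TH TJ Tmm] by (simp add: cocycles_def)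
  from cocycle_injective[OF res T_injective[OF J] this]
  obtain g where g: "g \<in> arrs C (P i) (T J)" and gd: "Cmp C (P (Suc i)) (P i) (T J) g (d i) = ?c" by blast
  \<comment> \<open>The connecting homomorphism read backwards: the class of \<open>c\<close> is the
    image of the class of this cocycle, which lies one degree lower and takes values in
    \<open>T Q\<close>.\<close>
  let ?g = "Cmp C (P i) (T J) (T Q) (Tm J Q q) g"
  have ga: "?g \<in> arrs C (P i) (T Q)" by (rule cmp_arr[OF r(1) TJ TQ g Tqq])
  have "Cmp C (P (Suc i)) (P i) (T Q) ?g (d i) = Cmp C (P (Suc i)) (T J) (T Q) (Tm J Q q) ?c"
    using cmp_assoc[OF r(1) r(1) TJ TQ r(5) g Tqq] gd by simp
  also have "\<dots> = zero_arr C (P (Suc i)) (T Q)"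
    using cmp_assoc[OF r(1) TH TJ TQ c(1) Tmm Tqq] Tqm cmp_zero_left[OF r(1) TH TQ c(1)] by simp
  finally have "?g \<in> cocycles C P d (T Q) i" using ga by (simp add: cocycles_def)
  from Suc.IH[OF Q this]
  have cb: "Cmp C (P i) (T Q) (T Q) (eps Q) ?g \<in> coboundaries C P d (T Q) i" .
  \<comment> \<open>The coboundary supplied by the induction hypothesis is lifted along
    \<open>T q\<close> to a cochain that is again closed. In degree 0 the only coboundary is zero
    and \<open>w\<close> is zero; in higher degrees a primitive on the projective \<open>P j\<close>
    is lifted first and then composed with \<open>d j\<close>.\<close>
  have "\<exists>w \<in> arrs C (P i) (T J). Cmp C (P i) (T J) (T Q) (Tm J Q q) w = Cmp C (P i) (T Q) (T Q) (eps Q) ?g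
      \<and> Cmp C (P (Suc i)) (P i) (T J) w (d i) = zero_arr C (P (Suc i)) (T J)"
  proof (cases i)
    case i: 0
    show ?thesis
      using cb cmp_zero_right[OF r(1) TJ TQ Tqq, of i] cmp_zero_left[OF r(1) r(1) TJ r(5), of i]
      by (intro bexI[of _ "zero_arr C (P i) (T J)"]) (simp_all add: i r TJ)
  next
    case i: (Suc j)
    from cb obtain w where w: "w \<in> arrs C (P j) (T Q)"
      and wd: "Cmp C (P i) (P j) (T Q) w (d j) = Cmp C (P i) (T Q) (T Q) (eps Q) ?g"
      by (auto simp: i)
    have "epic C (T J) (T Q) (Tm J Q q)"
      by (rule Tm_epic[OF cokernel_epic[OF H JO mm q]])
    then obtain w' where w': "w' \<in> arrs C (P j) (T J)" "Cmp C (P j) (T J) (T Q) (Tm J Q q) w' = w"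
      using projective_lift[OF _ _ w] res unfolding projective_resolution_def by metis
    have dj: "d j \<in> arrs C (P i) (P j)" using r(5)[of j] i by simp
    have "Cmp C (P (Suc i)) (P i) (T J) (Cmp C (P i) (P j) (T J) w' (d j)) (d i) = zero_arr C (P (Suc i)) (T J)"
      using cmp_assoc[OF r(1) r(1) r(1) TJ r(5) dj w'(1)] r(6)[of j]
        cmp_zero_right[OF r(1) r(1) TJ w'(1)] by (simp add: i)
    then show ?thesis
      using cmp_arr[OF r(1) r(1) TJ dj w'(1)] cmp_assoc[OF r(1) r(1) TJ TQ dj w'(1) Tqq] w'(2) wd
      by (intro bexI[of _ "Cmp C (P i) (P j) (T J) w' (d j)"]) simp_all
  qed
  then obtain w where w: "w \<in> arrs C (P i) (T J)"
    and w1: "Cmp C (P i) (T J) (T Q) (Tm J Q q) w = Cmp C (P i) (T Q) (T Q) (eps Q) ?g"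
    and w2: "Cmp C (P (Suc i)) (P i) (T J) w (d i) = zero_arr C (P (Suc i)) (T J)" by blast
  note eJ = eps_arr[OF JO] and eQ = eps_arr[OF Q] and eH = eps_arr[OF H]
  let ?eg = "Cmp C (P i) (T J) (T J) (eps J) g"
  have ega: "?eg \<in> arrs C (P i) (T J)" by (rule cmp_arr[OF r(1) TJ TJ g eJ])
  \<comment> \<open>After correction by \<open>w\<close> the cochain \<open>eps g\<close> dies in
    \<open>T Q\<close>, hence comes from a cochain \<open>v\<close> in \<open>T H\<close>. This
    \<open>v\<close> is the required primitive of \<open>eps c\<close>.\<close>
  let ?u = "?eg \<ominus>\<^bsub>Hom C (P i) (T J)\<^esub> w"
  have ua: "?u \<in> arrs C (P i) (T J)" by (rule minus_arr[OF r(1) TJ ega w])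
  have "Cmp C (P i) (T J) (T Q) (Tm J Q q) ?eg = Cmp C (P i) (T Q) (T Q) (eps Q) ?g"
    using cmp_assoc[OF r(1) TJ TJ TQ g eJ Tqq] eps_nat[OF JO Q qq] cmp_assoc[OF r(1) TJ TQ TQ g Tqq eQ] by simp
  then have "Cmp C (P i) (T J) (T Q) (Tm J Q q) ?u = zero_arr C (P i) (T Q)"
    using cmp_minus_right[OF r(1) TJ TQ ega w Tqq] w1 minus_self[OF r(1) TQ cmp_arr[OF r(1) TQ TQ ga eQ]] by simp
  from Tm_kernel_factor[OF JO Q qq monic_kernel_of_cokernel[OF m q] r(1) ua this]
  obtain v where v: "v \<in> arrs C (P i) (T H)" and vu: "Cmp C (P i) (T H) (T J) (Tm H J m) v = ?u" by blast
  \<comment> \<open>Since \<open>T m\<close> is monic, the equation for \<open>v\<close> may be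
    verified in \<open>T J\<close>, where \<open>w\<close> contributes nothing because it is
    closed.\<close>
  have "Cmp C (P (Suc i)) (T H) (T J) (Tm H J m) (Cmp C (P (Suc i)) (P i) (T H) v (d i)) =
      Cmp C (P (Suc i)) (P i) (T J) ?u (d i)"
    using cmp_assoc[OF r(1) r(1) TH TJ r(5) v Tmm] vu by simp
  also have "\<dots> = Cmp C (P (Suc i)) (P i) (T J) ?eg (d i)"
    using cmp_minus_left[OF r(1) r(1) TJ r(5) ega w] w2
      minus_zero[OF r(1) TJ cmp_arr[OF r(1) r(1) TJ r(5) ega]] by simp
  also have "\<dots> = Cmp C (P (Suc i)) (T J) (T J) (eps J) ?c"
    using cmp_assoc[OF r(1) r(1) TJ TJ r(5) g eJ] gd by simp
  also have "\<dots> = Cmp C (P (Suc i)) (T H) (T J) (Tm H J m) (Cmp C (P (Suc i)) (T H) (T H) (eps H) c)"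
    using cmp_assoc[OF r(1) TH TJ TJ c(1) Tmm eJ] eps_nat[OF H JO mm] cmp_assoc[OF r(1) TH TH TJ c(1) eH Tmm] by simp
  finally have "Cmp C (P (Suc i)) (P i) (T H) v (d i) = Cmp C (P (Suc i)) (T H) (T H) (eps H) c"
    by (rule monicD[OF Tm_monic[OF m] r(1) cmp_arr[OF r(1) r(1) TH r(5) v] cmp_arr[OF r(1) TH TH c(1) eH]])
  then show ?case using v by simp metis
qed

end

section \<open>Ext as a module, and scalars that annihilate it\<close>

lemma (in abelian_group) diff_zero_right: "x \<in> carrier G \<Longrightarrow> x \<ominus> \<zero> = x"
  by (simp add: minus_eq)

context Module.module begin

lemma submoduleI':
  assumes "H \<subseteq> carrier M" "\<zero>\<^bsub>M\<^esub> \<in> H"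
    and "\<And>x y. x \<in> H \<Longrightarrow> y \<in> H \<Longrightarrow> x \<oplus>\<^bsub>M\<^esub> y \<in> H"
    and "\<And>a x. a \<in> carrier R \<Longrightarrow> x \<in> H \<Longrightarrow> a \<odot>\<^bsub>M\<^esub> x \<in> H"
  shows "submodule H R M"
proof (rule submoduleI)
  fix x assume x: "x \<in> H"
  then have "\<ominus>\<^bsub>M\<^esub> x = (\<ominus>\<^bsub>R\<^esub> \<one>\<^bsub>R\<^esub>) \<odot>\<^bsub>M\<^esub> x"
    using assms(1) smult_l_minus[of "\<one>\<^bsub>R\<^esub>" x] by auto
  then show "\<ominus>\<^bsub>M\<^esub> x \<in> H" using assms(4)[OF _ x] by simp
qed (use assms in auto)

text \<open>This converts integral torsion into annihilation by a scalar of \<open>R\<close>, the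
  form in which the categorical arguments work.\<close>

lemma add_pow_smult:
  fixes n :: nat
  assumes "x \<in> carrier M"
  shows "[n] \<cdot>\<^bsub>M\<^esub> x = ([n] \<cdot>\<^bsub>R\<^esub> \<one>\<^bsub>R\<^esub>) \<odot>\<^bsub>M\<^esub> x"
  by (induction n) (use assms in \<open>simp_all add: smult_l_distr\<close>)

end

context linear_category begin

lemma cocycles_submodule:
  assumes P: "P i \<in> Ob C" "P (Suc i) \<in> Ob C" and d: "d i \<in> arrs C (P (Suc i)) (P i)" and G: "G \<in> Ob C"
  shows "submodule (cocycles C P d G i) R (Hom C (P i) G)"
proof -
  interpret H: Module.module R "Hom C (P i) G" by (rule hom_module[OF P(1) G])
  interpret H': Module.module R "Hom C (P (Suc i)) G" by (rule hom_module[OF P(2) G])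
  show ?thesis
    by (rule H.submoduleI') (auto simp: cocycles_def cmp_zero_left P G d
        cmp_add_left[OF P(2,1) G d] cmp_smult_left[OF P(2,1) G _ d])
qed

lemma coboundaries_submodule:
  assumes P: "\<And>i. P i \<in> Ob C" and d: "\<And>i. d i \<in> arrs C (P (Suc i)) (P i)" and G: "G \<in> Ob C"
  shows "submodule (coboundaries C P d G i) R (Hom C (P i) G)"
proof (cases i)
  case 0
  interpret H: Module.module R "Hom C (P 0) G" by (rule hom_module[OF P G])
  show ?thesis unfolding 0 by (rule H.submoduleI') auto
next
  case (Suc j)
  interpret H: Module.module R "Hom C (P i) G" by (rule hom_module[OF P G])
  interpret H': Module.module R "Hom C (P j) G" by (rule hom_module[OF P G])
  show ?thesis unfolding Suc
  proof (rule H.submoduleI'[unfolded Suc], goal_cases)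
    case 1
    then show ?case by (auto intro: cmp_arr P G d)
  next
    case 2
    have "zero_arr C (P (Suc j)) G = Cmp C (P (Suc j)) (P j) G (zero_arr C (P j) G) (d j)"
      by (simp add: cmp_zero_left P G d)
    then show ?case using zero_arr_closed[OF P G] by auto
  next
    case (3 x y)
    then obtain g h where "g \<in> arrs C (P j) G" "h \<in> arrs C (P j) G"
      "x = Cmp C (P (Suc j)) (P j) G g (d j)" "y = Cmp C (P (Suc j)) (P j) G h (d j)" by auto
    then show ?case using cmp_add_left[OF P P G d, of g j h] H'.a_closed[of g h]
      by (auto intro!: exI[of _ "g \<oplus>\<^bsub>Hom C (P j) G\<^esub> h"])
  next
    case (4 a x)
    then obtain g where "g \<in> arrs C (P j) G" "x = Cmp C (P (Suc j)) (P j) G g (d j)" by auto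
    then show ?case using cmp_smult_left[OF P P G 4(1) d, of g j] H'.smult_closed[OF 4(1), of g]
      by (auto intro!: exI[of _ "a \<odot>\<^bsub>Hom C (P j) G\<^esub> g"])
  qed
qed

lemma coboundaries_subset:
  assumes P: "\<And>i. P i \<in> Ob C" and d: "\<And>i. d i \<in> arrs C (P (Suc i)) (P i)" and G: "G \<in> Ob C"
    and dd: "\<And>i. Cmp C (P (Suc (Suc i))) (P (Suc i)) (P i) (d i) (d (Suc i)) = zero_arr C (P (Suc (Suc i))) (P i)"
  shows "coboundaries C P d G i \<subseteq> cocycles C P d G i"
proof (cases i)
  case 0
  then show ?thesis using zero_arr_closed[OF P G, of 0] cmp_zero_left[OF P P G d, of 0] by (auto simp: cocycles_def)
next
  case (Suc j)
  show ?thesis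
  proof
    fix x assume "x \<in> coboundaries C P d G i"
    then obtain g where g: "g \<in> arrs C (P j) G" "x = Cmp C (P (Suc j)) (P j) G g (d j)" by (auto simp: Suc)
    have "Cmp C (P (Suc (Suc j))) (P (Suc j)) G x (d (Suc j)) = zero_arr C (P (Suc (Suc j))) G"
      using cmp_assoc[OF P P P G d d g(1), symmetric] dd[of j] cmp_zero_right[OF P P G g(1)] by (simp add: g(2))
    then show "x \<in> cocycles C P d G i" using cmp_arr[OF P P G d g(1)] by (simp add: Suc cocycles_def g(2))
  qed
qed

end

context abelian_category begin

text \<open>\<open>exact_at\<close> speaks of every kernel and every factorization, so the
  epimorphism onto one kernel has to be transported to all others.\<close>

lemma exact_atI_kernel:
  assumes X: "X \<in> Ob C" and Y: "Y \<in> Ob C" and Z: "Z \<in> Ob C" and g: "g \<in> arrs C Y Z"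
    and k: "is_kernel C Y Z g K k" and e: "epic C X K e"
  shows "exact_at C X Y Z (Cmp C X K Y k e) g"
  unfolding exact_at_def
proof (intro conjI allI impI ballI g)
  have K: "K \<in> Ob C" and kK: "k \<in> arrs C K Y" and gk: "Cmp C K Y Z g k = zero_arr C K Z"
    using k by (auto simp: is_kernel_def)
  have ee: "e \<in> arrs C X K" using e by (simp add: epic_def)
  show "Cmp C X K Y k e \<in> arrs C X Y" by (rule cmp_arr[OF X K Y ee kK])
  show "Cmp C X Y Z g (Cmp C X K Y k e) = zero_arr C X Z"
    using cmp_assoc[OF X K Y Z ee kK g] gk cmp_zero_left[OF X K Z ee] by simp
  fix K1 k1 h assume k1: "is_kernel C Y Z g K1 k1" and h: "h \<in> arrs C X K1"
    and eq: "Cmp C X K1 Y k1 h = Cmp C X K Y k e"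
  have K1: "K1 \<in> Ob C" and kK1: "k1 \<in> arrs C K1 Y" and gk1: "Cmp C K1 Y Z g k1 = zero_arr C K1 Z"
    using k1 by (auto simp: is_kernel_def)
  obtain u where u: "u \<in> arrs C K K1" "Cmp C K K1 Y k1 u = k" by (rule kernel_lift[OF k1 K kK gk])
  obtain v where v: "v \<in> arrs C K1 K" "Cmp C K1 K Y k v = k1" by (rule kernel_lift[OF k K1 kK1 gk1])
  note m1 = kernel_monic[OF Y Z g k1]
  \<comment> \<open>A one-sided inverse is enough: \<open>h\<close> is \<open>u\<close> after the
    epimorphism \<open>e\<close>, and \<open>u\<close> is split epic.\<close>
  have uv: "Cmp C K1 K K1 u v = Idn C K1"
  proof (rule monicD[OF m1 K1 cmp_arr[OF K1 K K1 v(1) u(1)] idn_arr[OF K1]])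
    show "Cmp C K1 K1 Y k1 (Cmp C K1 K K1 u v) = Cmp C K1 K1 Y k1 (Idn C K1)"
      using cmp_assoc[OF K1 K K1 Y v(1) u(1) kK1] u v cmp_idn[OF K1 Y kK1] by simp
  qed
  have ue: "Cmp C X K K1 u e = h"
  proof (rule monicD[OF m1 X cmp_arr[OF X K K1 ee u(1)] h])
    show "Cmp C X K1 Y k1 (Cmp C X K K1 u e) = Cmp C X K1 Y k1 h"
      using cmp_assoc[OF X K K1 Y ee u(1) kK1] u eq by simp
  qed
  show "epic C X K1 h" unfolding epic_def
  proof (intro conjI ballI impI X K1 h)
    fix V a b assume V: "V \<in> Ob C" and a: "a \<in> arrs C K1 V" and b: "b \<in> arrs C K1 V"
      and ab: "Cmp C X K1 V a h = Cmp C X K1 V b h"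
    have "Cmp C X K V (Cmp C K K1 V a u) e = Cmp C X K V (Cmp C K K1 V b u) e"
      using cmp_assoc[OF X K K1 V ee u(1) a] cmp_assoc[OF X K K1 V ee u(1) b] ue ab by simp
    then have "Cmp C K K1 V a u = Cmp C K K1 V b u"
      by (rule epicD[OF e V cmp_arr[OF K K1 V u(1) a] cmp_arr[OF K K1 V u(1) b]])
    then have "Cmp C K1 K1 V a (Cmp C K1 K K1 u v) = Cmp C K1 K1 V b (Cmp C K1 K K1 u v)"
      using cmp_assoc[OF K1 K K1 V v(1) u(1) a] cmp_assoc[OF K1 K K1 V v(1) u(1) b] by simp
    then show "a = b" using uv cmp_idn[OF K1 V a] cmp_idn[OF K1 V b] by simp
  qed
qed

lemma projective_resolution_exists:
  assumes enough: "enough_projectives C" and F: "F \<in> Ob C"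
  shows "\<exists>P d e. projective_resolution C F P d e"
proof -
  \<comment> \<open>A state of the dependent choice is a projective \<open>X\<close> with its
    outgoing map to \<open>Y\<close>, where \<open>Y\<close> is the previous term of the resolution,
    or \<open>F\<close> at stage 0; \<open>tr\<close> requires exactness between consecutive
    states.\<close>
  define st :: "nat \<Rightarrow> 'b \<times> 'b \<times> 'c \<Rightarrow> bool" where
    "st = (\<lambda>n (X, Y, g). projective_obj C X \<and> Y \<in> Ob C \<and> g \<in> arrs C X Y \<and> (n = 0 \<longrightarrow> Y = F \<and> epic C X Y g))"
  define tr :: "nat \<Rightarrow> 'b \<times> 'b \<times> 'c \<Rightarrow> 'b \<times> 'b \<times> 'c \<Rightarrow> bool" where
    "tr = (\<lambda>n (X, Y, g) (X', Y', g'). Y' = X \<and> exact_at C X' X Y g' g)"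
  have "\<exists>f. \<forall>n. st n (f n) \<and> tr n (f n) (f (Suc n))"
  proof (rule dependent_nat_choice)
    obtain X g where "projective_obj C X" "epic C X F g" using enough F by (auto simp: enough_projectives_def)
    then have "st 0 (X, F, g)" using F by (auto simp: st_def epic_def)
    then show "\<exists>x. st 0 x" ..
  next
    fix x n assume "st n x"
    moreover obtain X Y g where x: "x = (X, Y, g)" by (cases x)
    ultimately have X: "X \<in> Ob C" "Y \<in> Ob C" "g \<in> arrs C X Y" by (auto simp: st_def projective_obj_def)
    obtain K k where k: "is_kernel C X Y g K k" using kernel_ex[OF X] by blast
    then have "K \<in> Ob C" by (simp add: is_kernel_def)
    then obtain X' e where X': "projective_obj C X'" and e: "epic C X' K e"
      using enough by (auto simp: enough_projectives_def)
    have "exact_at C X' X Y (Cmp C X' K X k e) g"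
      by (rule exact_atI_kernel[OF _ X k e]) (use X' in \<open>simp add: projective_obj_def\<close>)
    then have "st (Suc n) (X', X, Cmp C X' K X k e) \<and> tr n x (X', X, Cmp C X' K X k e)"
      using X' X by (auto simp: st_def tr_def x exact_at_def)
    then show "\<exists>y. st (Suc n) y \<and> tr n x y" ..
  qed
  then obtain f where f: "\<And>n. st n (f n)" "\<And>n. tr n (f n) (f (Suc n))" by blast
  let ?P = "\<lambda>n. fst (f n)" and ?Y = "\<lambda>n. fst (snd (f n))" and ?g = "\<lambda>n. snd (snd (f n))"
  have P: "projective_obj C (?P n)" for n using f(1)[of n] by (simp add: st_def split_beta)
  have Y: "?Y (Suc n) = ?P n" and ex: "exact_at C (?P (Suc n)) (?P n) (?Y n) (?g (Suc n)) (?g n)" for n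
    using f(2)[of n] by (simp_all add: tr_def split_beta)
  have "?Y 0 = F" using f(1)[of 0] by (simp add: st_def split_beta)
  moreover have "epic C (?P 0) (?Y 0) (?g 0)" using f(1)[of 0] unfolding st_def split_beta by blast
  ultimately have "projective_resolution C F ?P (\<lambda>n. ?g (Suc n)) (?g 0)"
    using P ex[of 0] ex[of "Suc _"] by (simp add: projective_resolution_def Y)
  then show ?thesis by blast
qed

text \<open>\<open>Ext\<close> is computed from an arbitrarily chosen resolution, about which
  nothing else is known; therefore \<open>kill\<close> ranges over all resolutions, and no
  comparison between resolutions is made.\<close>

lemma Ext_killed:
  assumes enough: "enough_projectives C" and F: "F \<in> Ob C" and G: "G \<in> Ob C" and a: "a \<in> carrier R"
    and kill: "\<And>P d e c. projective_resolution C F P d e \<Longrightarrow> c \<in> cocycles C P d G i \<Longrightarrow>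
      a \<odot>\<^bsub>Hom C (P i) G\<^esub> c \<in> coboundaries C P d G i"
  shows "Module.module R (Ext C i F G)"
    and "x \<in> carrier (Ext C i F G) \<Longrightarrow> a \<odot>\<^bsub>Ext C i F G\<^esub> x = \<zero>\<^bsub>Ext C i F G\<^esub>"
proof -
  let ?s = "SOME (P, d). \<exists>\<epsilon>. projective_resolution C F P d \<epsilon>"
  obtain P d where s: "?s = (P, d)" by (cases ?s)
  have "\<exists>s. case s of (P, d) \<Rightarrow> \<exists>\<epsilon>. projective_resolution C F P d \<epsilon>"
    using projective_resolution_exists[OF enough F] by auto
  from someI_ex[OF this] obtain e where res: "projective_resolution C F P d e" by (auto simp: s)
  note r = projective_resolutionD[OF res]
  let ?Z = "(Hom C (P i) G)\<lparr>carrier := cocycles C P d G i\<rparr>" and ?B = "coboundaries C P d G i"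
  have E: "Ext C i F G = quot_mod ?Z ?B" by (simp add: Ext_def s)
  have Zs: "submodule (cocycles C P d G i) R (Hom C (P i) G)" by (intro cocycles_submodule r(1) r(5) G)
  have Bs: "submodule ?B R (Hom C (P i) G)" by (intro coboundaries_submodule r(1) r(5) G)
  have BZ: "?B \<subseteq> cocycles C P d G i" by (intro coboundaries_subset r(1) r(5) r(6) G)
  note HM = hom_module[OF r(1) G]
  have mZ: "Module.module R ?Z" by (rule submodule.submodule_is_module[OF Zs HM])
  have mB: "submodule ?B R ?Z"
  proof (rule module.submoduleI'[OF mZ], goal_cases)
    case 2
    show ?case using subgroup.one_closed[OF submodule.axioms(1)[OF Bs]] by simp
  qed (use BZ module.submoduleE(4,5)[OF HM Bs] in simp_all)
  show mE: "Module.module R (Ext C i F G)" unfolding E by (rule quot_mod_module[OF mZ mB])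
  assume "x \<in> carrier (Ext C i F G)"
  then obtain c where c: "c \<in> cocycles C P d G i" and x: "x = ?B +>\<^bsub>?Z\<^esub> c" by (auto simp: E quot_mod_carrier)
  have ac: "a \<odot>\<^bsub>Hom C (P i) G\<^esub> c \<in> ?B" by (rule kill[OF res c])
  interpret Z: Module.module R ?Z by (rule mZ)
  have acZ: "a \<odot>\<^bsub>?Z\<^esub> c \<in> carrier ?Z" by (rule Z.smult_closed[OF a]) (simp add: c)
  have "a \<odot>\<^bsub>Ext C i F G\<^esub> x = ?B +>\<^bsub>?Z\<^esub> (a \<odot>\<^bsub>?Z\<^esub> c)"
    unfolding E x by (rule quot_mod_smult[OF mZ mB]) (use c a in simp_all)
  also have "\<dots> = ?B +>\<^bsub>?Z\<^esub> \<zero>\<^bsub>?Z\<^esub>"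
  proof (subst coset_eq_iff[OF mZ mB])
    have "a \<odot>\<^bsub>?Z\<^esub> c \<ominus>\<^bsub>?Z\<^esub> \<zero>\<^bsub>?Z\<^esub> = a \<odot>\<^bsub>?Z\<^esub> c"
      by (rule Z.diff_zero_right[OF acZ])
    then show "a \<odot>\<^bsub>?Z\<^esub> c \<ominus>\<^bsub>?Z\<^esub> \<zero>\<^bsub>?Z\<^esub> \<in> ?B" using ac by simp
  qed (rule acZ Z.zero_closed refl)+
  also have "\<dots> = \<zero>\<^bsub>Ext C i F G\<^esub>" unfolding E by (rule quot_mod_zero[OF mZ mB, symmetric])
  finally show "a \<odot>\<^bsub>Ext C i F G\<^esub> x = \<zero>\<^bsub>Ext C i F G\<^esub>" .
qed

end

section \<open>Transport to the full subcategory, and the annihilation of Ext\<close>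

lemma full_subcat_simps [simp]:
  "Ob (full_subcat C A) = A" "Hom (full_subcat C A) = Hom C"
  "Idn (full_subcat C A) = Idn C" "Cmp (full_subcat C A) = Cmp C"
  by (simp_all add: full_subcat_def)

context self_adjoint_functor begin

text \<open>\<open>T X\<close> is only isomorphic to an object of \<open>A\<close>. A replacement
  \<open>T' X\<close> in \<open>A\<close> and isomorphisms \<open>\<phi>\<close>,
  \<open>\<psi>\<close> are chosen for every \<open>X\<close>, and all the structure is conjugated
  by them.\<close>

lemma self_adjoint_full_subcat:
  assumes A: "A \<subseteq> Ob C" and ab: "abelian_category R (full_subcat C A)"
    and rep: "\<And>X. X \<in> A \<Longrightarrow> \<exists>X'\<in>A. iso_obj C (T X) X'"
  obtains T' Tm' adj' eps' \<phi> \<psi> where "self_adjoint R (full_subcat C A) T' Tm' adj' eps'"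
    and "\<And>X. X \<in> A \<Longrightarrow> \<phi> X \<in> arrs C (T X) (T' X)" and "\<And>X. X \<in> A \<Longrightarrow> \<psi> X \<in> arrs C (T' X) (T X)"
    and "\<And>X. X \<in> A \<Longrightarrow> Cmp C (T X) (T' X) (T X) (\<psi> X) (\<phi> X) = Idn C (T X)"
    and "\<And>X. X \<in> A \<Longrightarrow> eps' X = Cmp C (T' X) (T X) (T' X) (\<phi> X) (Cmp C (T' X) (T X) (T X) (eps X) (\<psi> X))"
proof -
  have "\<forall>X. \<exists>X' f g. X \<in> A \<longrightarrow> X' \<in> A \<and> f \<in> arrs C (T X) X' \<and> g \<in> arrs C X' (T X) \<and>
      Cmp C (T X) X' (T X) g f = Idn C (T X) \<and> Cmp C X' (T X) X' f g = Idn C X'"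
    using rep unfolding iso_obj_def by blast
  then obtain T' \<phi> \<psi> where T': "\<And>X. X \<in> A \<Longrightarrow> T' X \<in> A" and \<phi>: "\<And>X. X \<in> A \<Longrightarrow> \<phi> X \<in> arrs C (T X) (T' X)"
    and \<psi>: "\<And>X. X \<in> A \<Longrightarrow> \<psi> X \<in> arrs C (T' X) (T X)"
    and \<psi>\<phi>: "\<And>X. X \<in> A \<Longrightarrow> Cmp C (T X) (T' X) (T X) (\<psi> X) (\<phi> X) = Idn C (T X)"
    and \<phi>\<psi>: "\<And>X. X \<in> A \<Longrightarrow> Cmp C (T' X) (T X) (T' X) (\<phi> X) (\<psi> X) = Idn C (T' X)"
    by metis
  have O: "X \<in> A \<Longrightarrow> X \<in> Ob C" for X using A by blast
  have TO: "X \<in> A \<Longrightarrow> T X \<in> Ob C" and TO': "X \<in> A \<Longrightarrow> T' X \<in> Ob C" for X using O T_ob T' by auto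
  note obs = O TO TO' T'
  have can1: "Cmp C W (T' X) (T X) (\<psi> X) (Cmp C W (T X) (T' X) (\<phi> X) f) = f"
    if "X \<in> A" "W \<in> Ob C" "f \<in> arrs C W (T X)" for X W f
    using that by (simp add: cmp_assoc[OF _ _ _ _ that(3) \<phi> \<psi>] obs \<psi>\<phi> idn_cmp)
  have can2: "Cmp C W (T X) (T' X) (\<phi> X) (Cmp C W (T' X) (T X) (\<psi> X) f) = f"
    if "X \<in> A" "W \<in> Ob C" "f \<in> arrs C W (T' X)" for X W f
    using that by (simp add: cmp_assoc[OF _ _ _ _ that(3) \<psi> \<phi>] obs \<phi>\<psi> idn_cmp)
  define Tm' where "Tm' X Y f = Cmp C (T' X) (T X) (T' Y) (Cmp C (T X) (T Y) (T' Y) (\<phi> Y) (Tm X Y f)) (\<psi> X)" for X Y f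
  define adj' where "adj' X Y f = Cmp C (T' X) (T X) Y (adj X Y (Cmp C X (T' Y) (T Y) (\<psi> Y) f)) (\<psi> X)" for X Y f
  define eps' where "eps' X = Cmp C (T' X) (T X) (T' X) (\<phi> X) (Cmp C (T' X) (T X) (T X) (eps X) (\<psi> X))" for X
  have assoc: "Cmp C W X Z (Cmp C X Y Z h g) f = Cmp C W Y Z h (Cmp C W X Y g f)"
    if "f \<in> arrs C W X" "g \<in> arrs C X Y" "h \<in> arrs C Y Z" "W \<in> Ob C" "X \<in> Ob C" "Y \<in> Ob C" "Z \<in> Ob C"
    for W X Y Z f g h
    by (rule cmp_assoc[OF that(4,5,6,7,1,2,3), symmetric])
  note ss = obs \<phi> \<psi> can1 can2 assoc cmp_arr Tm_arr eps_arr adj_arr idn_cmp cmp_idn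
  interpret B: abelian_category R "full_subcat C A" by (rule ab)
  have "self_adjoint R (full_subcat C A) T' Tm' adj' eps'"
  proof (rule self_adjoint.intro[OF self_adjoint_functor.intro[OF B.linear_category_axioms] ab],
      unfold self_adjoint_functor_axioms_def, unfold full_subcat_simps, intro conjI allI impI, goal_cases)
    case (1 X)
    then show ?case by (rule T')
  next
    case (2 X Y f)
    then show ?case by (simp add: Tm'_def ss)
  next
    case (3 X Y Z f g)
    then show ?case by (simp add: Tm'_def ss Tm_cmp)
  next
    case (4 X Y)
    then show ?case by (simp add: Tm'_def ss Tm_zero cmp_zero_right cmp_zero_left)
  next
    case (5 X Y)
    show ?case
    proof (rule bij_betwI')
      fix f g assume f: "f \<in> arrs C X (T' Y)" and g: "g \<in> arrs C X (T' Y)"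
      have "f = g" if eq: "adj' X Y f = adj' X Y g"
      proof -
        let ?f = "Cmp C X (T' Y) (T Y) (\<psi> Y) f" and ?g = "Cmp C X (T' Y) (T Y) (\<psi> Y) g"
        have fa: "?f \<in> arrs C X (T Y)" and ga: "?g \<in> arrs C X (T Y)" using 5 f g by (simp_all add: ss)
        \<comment> \<open>As \<open>\<psi>\<close> after \<open>\<phi>\<close> is the identity,
          \<open>adj\<close> can be read off from \<open>adj'\<close>, which reduces injectivity to
          that of \<open>adj\<close>.\<close>
        have rec: "Cmp C (T X) (T' X) Y (adj' X Y h) (\<phi> X) = adj X Y (Cmp C X (T' Y) (T Y) (\<psi> Y) h)"
          if "Cmp C X (T' Y) (T Y) (\<psi> Y) h \<in> arrs C X (T Y)" for h
        proof -
          note h = adj_arr[OF O[OF 5(1)] O[OF 5(2)] that]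
          show ?thesis unfolding adj'_def
            using assoc[OF \<phi>[OF 5(1)] \<psi>[OF 5(1)] h] cmp_idn[OF _ _ h] 5 by (simp add: obs \<psi>\<phi>)
        qed
        have "adj X Y ?f = adj X Y ?g" using rec[OF fa] rec[OF ga] eq by simp
        then have "?f = ?g" by (rule adj_inj[OF O[OF 5(1)] O[OF 5(2)] fa ga])
        then have "Cmp C X (T Y) (T' Y) (\<phi> Y) ?f = Cmp C X (T Y) (T' Y) (\<phi> Y) ?g" by (rule arg_cong)
        then show "f = g" by (simp only: can2[OF 5(2) O[OF 5(1)] f] can2[OF 5(2) O[OF 5(1)] g])
      qed
      then show "adj' X Y f = adj' X Y g \<longleftrightarrow> f = g" by blast
    next
      fix f assume "f \<in> arrs C X (T' Y)"
      then show "adj' X Y f \<in> arrs C (T' X) Y" using 5 by (simp add: adj'_def ss)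
    next
      fix g assume g: "g \<in> arrs C (T' X) Y"
      then have "Cmp C (T X) (T' X) Y g (\<phi> X) \<in> arrs C (T X) Y" using 5 by (simp add: ss)
      from adj_surj[OF O[OF 5(1)] O[OF 5(2)] this] obtain f where
        f: "f \<in> arrs C X (T Y)" "adj X Y f = Cmp C (T X) (T' X) Y g (\<phi> X)" .
      have "adj' X Y (Cmp C X (T Y) (T' Y) (\<phi> Y) f) = g"
        using 5 f g by (simp add: adj'_def ss \<phi>\<psi>)
      moreover have "Cmp C X (T Y) (T' Y) (\<phi> Y) f \<in> arrs C X (T' Y)" using 5 f by (simp add: ss)
      ultimately show "\<exists>f\<in>arrs C X (T' Y). g = adj' X Y f" by metis
    qed
  next
    case (6 X' X Y h f)
    then have e: "Cmp C X' (T' Y) (T Y) (\<psi> Y) (Cmp C X' X (T' Y) f h) = Cmp C X' X (T Y) (Cmp C X (T' Y) (T Y) (\<psi> Y) f) h"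
      by (simp add: ss)
    have "adj X' Y (Cmp C X' X (T Y) (Cmp C X (T' Y) (T Y) (\<psi> Y) f) h) =
        Cmp C (T X') (T X) Y (adj X Y (Cmp C X (T' Y) (T Y) (\<psi> Y) f)) (Tm X' X h)"
      by (rule adj_pre) (use 6 in \<open>simp_all add: ss\<close>)
    with 6 show ?case unfolding adj'_def e by (simp add: Tm'_def ss)
  next
    case (7 X Y Y' f k)
    then have e: "Cmp C X (T' Y') (T Y') (\<psi> Y') (Cmp C X (T' Y) (T' Y') (Tm' Y Y' k) f) =
        Cmp C X (T Y) (T Y') (Tm Y Y' k) (Cmp C X (T' Y) (T Y) (\<psi> Y) f)"
      by (simp add: Tm'_def ss)
    have "adj X Y' (Cmp C X (T Y) (T Y') (Tm Y Y' k) (Cmp C X (T' Y) (T Y) (\<psi> Y) f)) =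
        Cmp C (T X) Y Y' k (adj X Y (Cmp C X (T' Y) (T Y) (\<psi> Y) f))"
      by (rule adj_post) (use 7 in \<open>simp_all add: ss\<close>)
    with 7 show ?case unfolding adj'_def e by (simp add: ss)
  next
    case (8 X)
    then show ?case by (simp add: eps'_def ss)
  next
    case (9 X Y f)
    then have "Cmp C (T' X) (T X) (T Y) (Cmp C (T X) (T Y) (T Y) (eps Y) (Tm X Y f)) (\<psi> X) =
        Cmp C (T' X) (T X) (T Y) (Cmp C (T X) (T X) (T Y) (Tm X Y f) (eps X)) (\<psi> X)"
      by (simp only: eps_nat O)
    with 9 show ?case by (simp add: eps'_def Tm'_def ss)
  qed
  from that[OF this \<phi> \<psi> \<psi>\<phi>] show thesis by (simp add: eps'_def)
qed

text \<open>The hypothesis on \<open>eps\<close> says that it annihilates all morphisms \<open>F \<rightarrow> T H\<close>; a factorization of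
  \<open>a \<cdot> id\<close> through the part of \<open>T G\<close> fixed by \<open>eps\<close> then carries this over to \<open>Ext\<close>.\<close>

lemma Ext_killed_by_retract:
  assumes A: "A \<subseteq> Ob C" and ab: "abelian_category R (full_subcat C A)"
    and rep: "\<And>X. X \<in> A \<Longrightarrow> \<exists>X'\<in>A. iso_obj C (T X) X'"
    and inj: "enough_injectives (full_subcat C A)"
    and F: "F \<in> A" and G: "G \<in> A" and a: "a \<in> carrier R"
    and vanish: "\<And>H c. H \<in> A \<Longrightarrow> c \<in> arrs C F (T H) \<Longrightarrow> Cmp C F (T H) (T H) (eps H) c = zero_arr C F (T H)"
    and u: "u \<in> arrs C G (T G)" and v: "v \<in> arrs C (T G) G"
    and eu: "Cmp C G (T G) (T G) (eps G) u = u" and vu: "Cmp C G (T G) G v u = a \<odot>\<^bsub>Hom C G G\<^esub> Idn C G"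
    and res: "projective_resolution (full_subcat C A) F P d e"
    and c: "c \<in> cocycles (full_subcat C A) P d G i"
  shows "a \<odot>\<^bsub>Hom C (P i) G\<^esub> c \<in> coboundaries (full_subcat C A) P d G i"
proof (rule self_adjoint_full_subcat[OF A ab rep])
  fix T' Tm' adj' eps' \<phi> \<psi>
  assume sa: "self_adjoint R (full_subcat C A) T' Tm' adj' eps'"
    and \<phi>: "\<And>X. X \<in> A \<Longrightarrow> \<phi> X \<in> arrs C (T X) (T' X)" and \<psi>: "\<And>X. X \<in> A \<Longrightarrow> \<psi> X \<in> arrs C (T' X) (T X)"
    and \<psi>\<phi>: "\<And>X. X \<in> A \<Longrightarrow> Cmp C (T X) (T' X) (T X) (\<psi> X) (\<phi> X) = Idn C (T X)"
    and eps': "\<And>X. X \<in> A \<Longrightarrow> eps' X = Cmp C (T' X) (T X) (T' X) (\<phi> X) (Cmp C (T' X) (T X) (T X) (eps X) (\<psi> X))"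
  interpret S: self_adjoint R "full_subcat C A" T' Tm' adj' eps' by (rule sa)
  have O: "X \<in> A \<Longrightarrow> X \<in> Ob C" for X using A by blast
  have TA: "X \<in> A \<Longrightarrow> T' X \<in> A" for X using S.T_ob by simp
  have TO: "X \<in> A \<Longrightarrow> T X \<in> Ob C" and TO': "X \<in> A \<Longrightarrow> T' X \<in> Ob C" for X using O T_ob TA by auto
  have assoc: "Cmp C W X Z (Cmp C X Y Z h g) f = Cmp C W Y Z h (Cmp C W X Y g f)"
    if "f \<in> arrs C W X" "g \<in> arrs C X Y" "h \<in> arrs C Y Z" "W \<in> Ob C" "X \<in> Ob C" "Y \<in> Ob C" "Z \<in> Ob C"
    for W X Y Z f g h
    by (rule cmp_assoc[OF that(4,5,6,7,1,2,3), symmetric])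
  note r = S.projective_resolutionD[OF res, simplified]
  have can1: "Cmp C W (T' X) (T X) (\<psi> X) (Cmp C W (T X) (T' X) (\<phi> X) f) = f"
    if "X \<in> A" "W \<in> Ob C" "f \<in> arrs C W (T X)" for X W f
    using that by (simp add: cmp_assoc[OF _ _ _ _ that(3) \<phi> \<psi>] O TO TO' \<psi>\<phi> idn_cmp)
  note ss = O TO TO' TA \<phi> \<psi> can1 assoc cmp_arr eps_arr idn_cmp cmp_idn F G u v r(1) r(5)
  have cc: "c \<in> arrs C (P i) G" "Cmp C (P (Suc i)) (P i) G c (d i) = zero_arr C (P (Suc i)) G"
    using c by (auto simp: cocycles_def)
  have vanish': "Cmp C F (T' H) (T' H) (eps' H) h = zero_arr C F (T' H)" if H: "H \<in> A" and h: "h \<in> arrs C F (T' H)" for H h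
  proof -
    have "Cmp C F (T H) (T H) (eps H) (Cmp C F (T' H) (T H) (\<psi> H) h) = zero_arr C F (T H)"
      by (rule vanish[OF H]) (use H h in \<open>simp add: ss\<close>)
    with H h show ?thesis by (simp add: eps' ss cmp_zero_right)
  qed
  \<comment> \<open>The image of \<open>c\<close> in \<open>T' G\<close> is fixed by
    \<open>eps'\<close>, so dimension shifting makes it a coboundary; composing with
    \<open>v\<close> turns it into \<open>a\<close> times \<open>c\<close>.\<close>
  let ?u = "Cmp C (P i) G (T' G) (Cmp C G (T G) (T' G) (\<phi> G) u) c"
  have "?u \<in> cocycles (full_subcat C A) P d (T' G) i"
    using cc by (simp add: cocycles_def ss cmp_zero_right)
  with S.eps_cocycle[OF inj res] vanish' G
  have *: "Cmp C (P i) (T' G) (T' G) (eps' G) ?u \<in> coboundaries (full_subcat C A) P d (T' G) i" by simp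
  have "Cmp C (P i) (T' G) (T' G) (eps' G) ?u = Cmp C (P i) (T G) (T' G) (\<phi> G) (Cmp C (P i) G (T G) (Cmp C G (T G) (T G) (eps G) u) c)"
    using cc by (simp add: eps' ss)
  also have "\<dots> = ?u" using cc eu by (simp add: ss)
  finally have ub: "?u \<in> coboundaries (full_subcat C A) P d (T' G) i" using * by simp
  let ?v = "Cmp C (T' G) (T G) G v (\<psi> G)"
  have "Cmp C (P i) (T' G) G ?v ?u = Cmp C (P i) G G (Cmp C G (T G) G v u) c"
    using cc by (simp add: ss)
  also have "\<dots> = a \<odot>\<^bsub>Hom C (P i) G\<^esub> c"
    using cc by (simp add: vu ss cmp_smult_left a idn_arr)
  finally have vu': "Cmp C (P i) (T' G) G ?v ?u = a \<odot>\<^bsub>Hom C (P i) G\<^esub> c" .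
  show ?thesis
  \<comment> \<open>Postcomposition with a map preserves coboundaries; degree 0 is separate because
    its coboundaries are defined separately.\<close>
  proof (cases i)
    case 0
    have va: "?v \<in> arrs C (T' G) G" by (simp add: ss)
    have "?u = zero_arr C (P 0) (T' G)" using ub by (simp add: 0)
    then have "Cmp C (P i) (T' G) G ?v ?u = zero_arr C (P 0) G"
      using cmp_zero_right[OF _ _ _ va, of "P 0"] by (simp add: 0 ss)
    then show ?thesis using vu' by (simp add: 0)
  next
    case (Suc j)
    with ub obtain g where g: "g \<in> arrs C (P j) (T' G)" "?u = Cmp C (P i) (P j) (T' G) g (d j)" by auto
    have dj: "d j \<in> arrs C (P i) (P j)" using r(5)[of j] by (simp add: Suc)
    have "a \<odot>\<^bsub>Hom C (P i) G\<^esub> c = Cmp C (P i) (P j) G (Cmp C (P j) (T' G) G ?v g) (d j)"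
      unfolding vu'[symmetric] g(2) using g(1) dj by (simp add: ss)
    moreover have "Cmp C (P j) (T' G) G ?v g \<in> arrs C (P j) G" using g(1) by (simp add: ss)
    ultimately show ?thesis unfolding Suc by auto
  qed
qed

end

context linear_category begin

text \<open>The case \<open>T = id\<close> of the argument above.\<close>

lemma Ext_killed_by_center:
  assumes A: "A \<subseteq> Ob C" and ab: "abelian_category R (full_subcat C A)"
    and inj: "enough_injectives (full_subcat C A)"
    and F: "F \<in> A" and G: "G \<in> A" and a: "a \<in> carrier R"
    and z: "\<And>X. X \<in> Ob C \<Longrightarrow> z X \<in> arrs C X X"
    and nat: "\<And>X Y f. X \<in> Ob C \<Longrightarrow> Y \<in> Ob C \<Longrightarrow> f \<in> arrs C X Y \<Longrightarrow> Cmp C X Y Y (z Y) f = Cmp C X X Y f (z X)"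
    and zF: "z F = zero_arr C F F" and zG: "z G = a \<odot>\<^bsub>Hom C G G\<^esub> Idn C G"
    and res: "projective_resolution (full_subcat C A) F P d e"
    and c: "c \<in> cocycles (full_subcat C A) P d G i"
  shows "a \<odot>\<^bsub>Hom C (P i) G\<^esub> c \<in> coboundaries (full_subcat C A) P d G i"
proof -
  have O: "X \<in> A \<Longrightarrow> X \<in> Ob C" for X using A by blast
  interpret S: self_adjoint R "full_subcat C A" "\<lambda>X. X" "\<lambda>X Y f. f" "\<lambda>X Y f. f" z
  proof (rule self_adjoint.intro[OF self_adjoint_functor.intro ab])
    show "linear_category R (full_subcat C A)" using ab by (rule abelian_category.axioms)
  qed (unfold self_adjoint_functor_axioms_def, use z nat O in \<open>auto simp: bij_betw_def inj_on_def\<close>)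
  have cc: "c \<in> arrs C (P i) G" using c by (auto simp: cocycles_def)
  have P: "P i \<in> A" using S.projective_resolutionD(1)[OF res] by simp
  have "Cmp C (P i) G G (z G) c \<in> coboundaries (full_subcat C A) P d G i"
    using S.eps_cocycle[OF inj res, of G c i] c G F nat[OF O[OF F] O] zF cmp_zero_right[OF O[OF F] O[OF F] O] by simp
  also have "Cmp C (P i) G G (z G) c = a \<odot>\<^bsub>Hom C (P i) G\<^esub> c"
    using cc P G a by (simp add: zG cmp_smult_left O idn_cmp idn_arr)
  finally show ?thesis .
qed

end

section \<open>Products of complementary idempotents: the cross effect projection\<close>

context linear_category begin

text \<open>\<open>comp_prod X e n\<close> is the product of the complementary idempotents \<open>1 - e k\<close>, \<open>k < n\<close>.\<close>

fun comp_prod :: "'o \<Rightarrow> (nat \<Rightarrow> 'a) \<Rightarrow> nat \<Rightarrow> 'a" where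
  "comp_prod X e 0 = Idn C X"
| "comp_prod X e (Suc n) = comp_prod X e n \<ominus>\<^bsub>Hom C X X\<^esub> Cmp C X X X (comp_prod X e n) (e n)"

lemma comp_prod_arr:
  "X \<in> Ob C \<Longrightarrow> (\<And>k. e k \<in> arrs C X X) \<Longrightarrow> comp_prod X e n \<in> arrs C X X"
  by (induction n) (simp_all add: idn_arr minus_arr cmp_arr)

lemma comp_prod_comm:
  assumes X: "X \<in> Ob C" and e: "\<And>k. e k \<in> arrs C X X"
    and comm: "\<And>j k. Cmp C X X X (e j) (e k) = Cmp C X X X (e k) (e j)"
  shows "Cmp C X X X (e k) (comp_prod X e n) = Cmp C X X X (comp_prod X e n) (e k)"
proof (induction n)
  case 0
  show ?case using X e by (simp add: cmp_idn idn_cmp)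
next
  case (Suc n)
  note p = comp_prod_arr[of X e n, OF X e]
  have "Cmp C X X X (e k) (Cmp C X X X (comp_prod X e n) (e n)) =
      Cmp C X X X (Cmp C X X X (comp_prod X e n) (e n)) (e k)"
    using cmp_assoc[OF X X X X e[of n] p e[of k]] cmp_assoc[OF X X X X e[of n] e[of k] p]
      cmp_assoc[OF X X X X e[of k] e[of n] p]
    by (simp add: Suc comm[of k n])
  then show ?case
    using cmp_minus_right[OF X X X p cmp_arr[OF X X X e[of n] p] e[of k]]
      cmp_minus_left[OF X X X e[of k] p cmp_arr[OF X X X e[of n] p]]
    by (simp add: Suc)
qed

text \<open>Commutativity moves \<open>e k\<close> next to its own factor 1 - \<open>e k\<close>,
  and idempotency makes the product vanish.\<close>

lemma comp_prod_zero:
  assumes X: "X \<in> Ob C" and e: "\<And>k. e k \<in> arrs C X X"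
    and comm: "\<And>j k. Cmp C X X X (e j) (e k) = Cmp C X X X (e k) (e j)"
    and idem: "\<And>k. Cmp C X X X (e k) (e k) = e k"
  shows "k < n \<Longrightarrow> Cmp C X X X (e k) (comp_prod X e n) = zero_arr C X X"
proof (induction n)
  case (Suc n)
  note p = comp_prod_arr[of X e n, OF X e]
  have m: "Cmp C X X X (e k) (comp_prod X e (Suc n)) = Cmp C X X X (e k) (comp_prod X e n)
      \<ominus>\<^bsub>Hom C X X\<^esub> Cmp C X X X (Cmp C X X X (e k) (comp_prod X e n)) (e n)"
    using cmp_minus_right[OF X X X p cmp_arr[OF X X X e[of n] p] e[of k]]
      cmp_assoc[OF X X X X e[of n] p e[of k]] by simp
  show ?case
  proof (cases "k = n")
    case True
    then show ?thesis using m cmp_assoc[OF X X X X e[of n] e[of n] p] minus_self[OF X X cmp_arr[OF X X X e[of n] p]]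
      by (simp add: comp_prod_comm[of X e, OF X e comm] idem)
  next
    case False
    with Suc have "k < n" by simp
    from Suc.IH[OF this] show ?thesis using m cmp_zero_left[OF X X X e[of n]] minus_self[OF X X zero_arr_closed[OF X X]] by simp
  qed
qed simp

lemma comp_prod_fix:
  assumes X: "X \<in> Ob C" and Y: "Y \<in> Ob C" and e: "\<And>k. e k \<in> arrs C X X" and u: "u \<in> arrs C Y X"
  shows "(\<And>k. k < n \<Longrightarrow> Cmp C Y X X (e k) u = zero_arr C Y X) \<Longrightarrow> Cmp C Y X X (comp_prod X e n) u = u"
proof (induction n)
  case 0
  show ?case using X Y u by (simp add: idn_cmp)
next
  case (Suc n)
  note p = comp_prod_arr[of X e n, OF X e]
  have "Cmp C Y X X (comp_prod X e n) u = u" using Suc by simp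
  then show ?case
    using cmp_minus_left[OF Y X X u p cmp_arr[OF X X X e[of n] p]]
      cmp_assoc[OF Y X X X u e[of n] p] Suc.prems[of n] cmp_zero_right[OF Y X X p]
      minus_zero[OF Y X u] by simp
qed

end

text \<open>The axiom \<open>adj_e\<close> says that each idempotent is self-adjoint. Additivity of
  \<open>adj\<close> is imposed in order to carry this over to products of the differences 1 -
  \<open>e k\<close>.\<close>

locale commuting_idempotents = linear_category R C for R and C :: "('r, 'o, 'a) lincat" +
  fixes T :: "'o \<Rightarrow> 'o" and Tm :: "'o \<Rightarrow> 'o \<Rightarrow> 'a \<Rightarrow> 'a" and adj :: "'o \<Rightarrow> 'o \<Rightarrow> 'a \<Rightarrow> 'a"
    and e :: "nat \<Rightarrow> 'o \<Rightarrow> 'a"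
  assumes saf: "self_adjoint_functor R C T Tm adj (e k)"
    and idem: "X \<in> Ob C \<Longrightarrow> Cmp C (T X) (T X) (T X) (e k X) (e k X) = e k X"
    and comm: "X \<in> Ob C \<Longrightarrow> Cmp C (T X) (T X) (T X) (e j X) (e k X) = Cmp C (T X) (T X) (T X) (e k X) (e j X)"
    and adj_e: "\<lbrakk>X \<in> Ob C; Y \<in> Ob C; f \<in> arrs C X (T Y)\<rbrakk> \<Longrightarrow>
      adj X Y (Cmp C X (T Y) (T Y) (e k Y) f) = Cmp C (T X) (T X) Y (adj X Y f) (e k X)"
    and adj_minus: "\<lbrakk>X \<in> Ob C; Y \<in> Ob C; f \<in> arrs C X (T Y); g \<in> arrs C X (T Y)\<rbrakk> \<Longrightarrow>
      adj X Y (f \<ominus>\<^bsub>Hom C X (T Y)\<^esub> g) = adj X Y f \<ominus>\<^bsub>Hom C (T X) Y\<^esub> adj X Y g"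
begin

abbreviation eps :: "nat \<Rightarrow> 'o \<Rightarrow> 'a" where
  "eps n X \<equiv> comp_prod (T X) (\<lambda>k. e k X) n"

lemma T_ob: "X \<in> Ob C \<Longrightarrow> T X \<in> Ob C"
  by (rule self_adjoint_functor.T_ob[OF saf])

lemma e_arr: "X \<in> Ob C \<Longrightarrow> e k X \<in> arrs C (T X) (T X)"
  by (rule self_adjoint_functor.eps_arr[OF saf])

lemma eps_arr: "X \<in> Ob C \<Longrightarrow> eps n X \<in> arrs C (T X) (T X)"
  by (rule comp_prod_arr[OF T_ob e_arr])

lemma eps_comm: "X \<in> Ob C \<Longrightarrow> Cmp C (T X) (T X) (T X) (e k X) (eps n X) = Cmp C (T X) (T X) (T X) (eps n X) (e k X)"
  by (rule comp_prod_comm[OF T_ob e_arr comm])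

lemma e_eps_zero: "X \<in> Ob C \<Longrightarrow> k < n \<Longrightarrow> Cmp C (T X) (T X) (T X) (e k X) (eps n X) = zero_arr C (T X) (T X)"
  by (rule comp_prod_zero[OF T_ob e_arr comm idem])

lemma eps_fix:
  assumes "X \<in> Ob C" "Y \<in> Ob C" "u \<in> arrs C Y (T X)"
    and "\<And>k. k < n \<Longrightarrow> Cmp C Y (T X) (T X) (e k X) u = zero_arr C Y (T X)"
  shows "Cmp C Y (T X) (T X) (eps n X) u = u"
  by (rule comp_prod_fix[OF T_ob[OF assms(1)] assms(2) e_arr[OF assms(1)] assms(3,4)])

lemma eps_nat:
  assumes X: "X \<in> Ob C" and Y: "Y \<in> Ob C" and f: "f \<in> arrs C X Y"
  shows "Cmp C (T X) (T Y) (T Y) (eps n Y) (Tm X Y f) = Cmp C (T X) (T X) (T Y) (Tm X Y f) (eps n X)"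
proof (induction n)
  case 0
  show ?case using self_adjoint_functor.Tm_arr[OF saf X Y f] X Y by (simp add: idn_cmp cmp_idn T_ob)
next
  case (Suc n)
  note TX = T_ob[OF X] and eX = e_arr[OF X] and nX = eps_arr[OF X]
  note TY = T_ob[OF Y] and eY = e_arr[OF Y] and nY = eps_arr[OF Y]
  note Tf = self_adjoint_functor.Tm_arr[OF saf X Y f]
  have "Cmp C (T X) (T Y) (T Y) (Cmp C (T Y) (T Y) (T Y) (eps n Y) (e n Y)) (Tm X Y f) =
      Cmp C (T X) (T X) (T Y) (Tm X Y f) (Cmp C (T X) (T X) (T X) (eps n X) (e n X))"
    using cmp_assoc[OF TX TY TY TY Tf eY nY, of n n] cmp_assoc[OF TX TX TX TY eX nX Tf, of n n]
      cmp_assoc[OF TX TX TY TY eX Tf nY, of n n] self_adjoint_functor.eps_nat[OF saf X Y f, of n] Suc by simp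
  then show ?case
    using cmp_minus_left[OF TX TY TY Tf nY cmp_arr[OF TY TY TY eY nY], of n n n]
      cmp_minus_right[OF TX TX TY nX cmp_arr[OF TX TX TX eX nX] Tf, of n n n] Suc by simp
qed

text \<open>Transposition turns composition on the left into composition on the right and thereby
  reverses the factors of \<open>eps\<close>; this is harmless because they commute.\<close>

lemma eps_adj:
  assumes X: "X \<in> Ob C" and Y: "Y \<in> Ob C"
  shows "f \<in> arrs C X (T Y) \<Longrightarrow>
    adj X Y (Cmp C X (T Y) (T Y) (eps n Y) f) = Cmp C (T X) (T X) Y (adj X Y f) (eps n X)"
proof (induction n arbitrary: f)
  case 0
  then show ?case using self_adjoint_functor.adj_arr[OF saf X Y] X Y by (simp add: idn_cmp cmp_idn T_ob)
next
  case (Suc n f)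
  note f = Suc.prems
  note TX = T_ob[OF X] and eX = e_arr[OF X] and nX = eps_arr[OF X]
  note TY = T_ob[OF Y] and eY = e_arr[OF Y] and nY = eps_arr[OF Y]
  note af = self_adjoint_functor.adj_arr[OF saf X Y f]
  note ef = cmp_arr[OF X TY TY f eY, of n]
  have "adj X Y (Cmp C X (T Y) (T Y) (eps (Suc n) Y) f) =
      adj X Y (Cmp C X (T Y) (T Y) (eps n Y) f) \<ominus>\<^bsub>Hom C (T X) Y\<^esub>
      adj X Y (Cmp C X (T Y) (T Y) (eps n Y) (Cmp C X (T Y) (T Y) (e n Y) f))"
    using cmp_minus_left[OF X TY TY f nY cmp_arr[OF TY TY TY eY nY], of n n n]
      cmp_assoc[OF X TY TY TY f eY nY, of n n]
      adj_minus[OF X Y cmp_arr[OF X TY TY f nY] cmp_arr[OF X TY TY ef nY], of n n] by simp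
  also have "\<dots> = Cmp C (T X) (T X) Y (adj X Y f) (eps n X) \<ominus>\<^bsub>Hom C (T X) Y\<^esub>
      Cmp C (T X) (T X) Y (adj X Y f) (Cmp C (T X) (T X) (T X) (eps n X) (e n X))"
    using Suc.IH[OF f] Suc.IH[OF ef] adj_e[OF X Y f, of n] cmp_assoc[OF TX TX TX Y nX eX af, of n n] eps_comm[OF X, of n n] by simp
  also have "\<dots> = Cmp C (T X) (T X) Y (adj X Y f) (eps (Suc n) X)"
    using cmp_minus_right[OF TX TX Y nX cmp_arr[OF TX TX TX eX nX] af, of n n n] by simp
  finally show ?case .
qed

text \<open>Transposition moves \<open>eps\<close> from the target \<open>T Y\<close> to
  \<open>T X\<close>, where it vanishes. With \<open>X = F\<close> this is the degree 0 input of the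
  dimension shift.\<close>

lemma eps_vanish:
  assumes X: "X \<in> Ob C" and Y: "Y \<in> Ob C" and f: "f \<in> arrs C X (T Y)"
    and z: "eps n X = zero_arr C (T X) (T X)"
  shows "Cmp C X (T Y) (T Y) (eps n Y) f = zero_arr C X (T Y)"
proof (rule self_adjoint_functor.adj_inj[OF saf X Y])
  note TX = T_ob[OF X] and TY = T_ob[OF Y]
  show "Cmp C X (T Y) (T Y) (eps n Y) f \<in> arrs C X (T Y)" by (rule cmp_arr[OF X TY TY f eps_arr[OF Y]])
  show "zero_arr C X (T Y) \<in> arrs C X (T Y)" by (rule zero_arr_closed[OF X TY])
  show "adj X Y (Cmp C X (T Y) (T Y) (eps n Y) f) = adj X Y (zero_arr C X (T Y))"
    using eps_adj[OF X Y f, of n] cmp_zero_right[OF TX TX Y self_adjoint_functor.adj_arr[OF saf X Y f]]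
      self_adjoint_functor.adj_zero[OF saf X Y] by (simp add: z)
qed

lemma eps_self_adjoint: "self_adjoint_functor R C T Tm adj (eps n)"
proof -
  interpret S: self_adjoint_functor R C T Tm adj "e 0" by (rule saf)
  show ?thesis
    by (rule self_adjoint_functor.intro[OF linear_category_axioms], unfold self_adjoint_functor_axioms_def)
      (intro conjI allI impI; rule S.T_ob S.Tm_arr S.Tm_cmp S.Tm_zero S.adj_bij S.adj_pre S.adj_post eps_arr eps_nat; assumption)
qed

end

section \<open>Functor categories and N-fold direct sums\<close>

lemma functor_cat_Ob [simp]: "Ob (functor_cat P E) = {F. is_functor P E F}"
  by (simp add: functor_cat_def)

lemma functor_cat_arrs: "\<alpha> \<in> arrs (functor_cat P E) F G \<longleftrightarrow>
    \<alpha> \<in> extensional (Ob P) \<and> (\<forall>X\<in>Ob P. \<alpha> X \<in> arrs E (fobj F X) (fobj G X)) \<and>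
    (\<forall>X\<in>Ob P. \<forall>Y\<in>Ob P. \<forall>f\<in>arrs P X Y.
      Cmp E (fobj F X) (fobj F Y) (fobj G Y) (\<alpha> Y) (farr F X Y f) =
      Cmp E (fobj F X) (fobj G X) (fobj G Y) (farr G X Y f) (\<alpha> X))"
  by (auto simp: functor_cat_def PiE_def Pi_def)

lemma functor_cat_arr_eqI:
  "\<alpha> \<in> arrs (functor_cat P E) F G \<Longrightarrow> \<beta> \<in> arrs (functor_cat P E) F G \<Longrightarrow>
    (\<And>X. X \<in> Ob P \<Longrightarrow> \<alpha> X = \<beta> X) \<Longrightarrow> \<alpha> = \<beta>"
  by (auto simp: functor_cat_arrs intro: extensionalityI)

lemma functor_cat_app [simp]:
  assumes "X \<in> Ob P"
  shows "Cmp (functor_cat P E) F G H \<beta> \<alpha> X = Cmp E (fobj F X) (fobj G X) (fobj H X) (\<beta> X) (\<alpha> X)"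
    "Idn (functor_cat P E) F X = Idn E (fobj F X)"
    "zero_arr (functor_cat P E) F G X = zero_arr E (fobj F X) (fobj G X)"
    "(\<alpha> \<oplus>\<^bsub>Hom (functor_cat P E) F G\<^esub> \<beta>) X = \<alpha> X \<oplus>\<^bsub>Hom E (fobj F X) (fobj G X)\<^esub> \<beta> X"
    "(a \<odot>\<^bsub>Hom (functor_cat P E) F G\<^esub> \<alpha>) X = a \<odot>\<^bsub>Hom E (fobj F X) (fobj G X)\<^esub> \<alpha> X"
  using assms by (simp_all add: functor_cat_def)

lemma is_functorD:
  assumes "is_functor P E F"
  shows "X \<in> Ob P \<Longrightarrow> fobj F X \<in> Ob E"
    and "X \<in> Ob P \<Longrightarrow> Y \<in> Ob P \<Longrightarrow> f \<in> arrs P X Y \<Longrightarrow> farr F X Y f \<in> arrs E (fobj F X) (fobj F Y)"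
    and "X \<in> Ob P \<Longrightarrow> farr F X X (Idn P X) = Idn E (fobj F X)"
    and "X \<in> Ob P \<Longrightarrow> Y \<in> Ob P \<Longrightarrow> Z \<in> Ob P \<Longrightarrow> f \<in> arrs P X Y \<Longrightarrow> g \<in> arrs P Y Z \<Longrightarrow>
      farr F X Z (Cmp P X Y Z g f) = Cmp E (fobj F X) (fobj F Y) (fobj F Z) (farr F Y Z g) (farr F X Y f)"
  using assms unfolding is_functor_def by blast+

lemma functor_cat_arrsD:
  assumes "\<alpha> \<in> arrs (functor_cat P E) F G"
  shows "X \<in> Ob P \<Longrightarrow> \<alpha> X \<in> arrs E (fobj F X) (fobj G X)"
    and "X \<in> Ob P \<Longrightarrow> Y \<in> Ob P \<Longrightarrow> f \<in> arrs P X Y \<Longrightarrow>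
      Cmp E (fobj F X) (fobj F Y) (fobj G Y) (\<alpha> Y) (farr F X Y f) =
      Cmp E (fobj F X) (fobj G X) (fobj G Y) (farr G X Y f) (\<alpha> X)"
  using assms unfolding functor_cat_arrs by blast+

text \<open>Only sums are pointwise by definition. The difference is characterized as the solution
  of an additive equation, which can then be evaluated at \<open>X\<close>.\<close>

lemma functor_cat_minus_app:
  assumes lin: "linear_category R (functor_cat P E)" and E: "linear_category R E"
    and F: "is_functor P E F" and G: "is_functor P E G"
    and \<alpha>: "\<alpha> \<in> arrs (functor_cat P E) F G" and \<beta>: "\<beta> \<in> arrs (functor_cat P E) F G" and X: "X \<in> Ob P"
  shows "(\<alpha> \<ominus>\<^bsub>Hom (functor_cat P E) F G\<^esub> \<beta>) X = \<alpha> X \<ominus>\<^bsub>Hom E (fobj F X) (fobj G X)\<^esub> \<beta> X"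
proof -
  interpret H: abelian_group "Hom (functor_cat P E) F G"
    using linear_category.hom_group[OF lin] F G by simp
  interpret K: abelian_group "Hom E (fobj F X) (fobj G X)"
    using linear_category.hom_group[OF E] is_functorD(1)[OF F X] is_functorD(1)[OF G X] by simp
  let ?d = "\<alpha> \<ominus>\<^bsub>Hom (functor_cat P E) F G\<^esub> \<beta>"
  have d: "?d \<in> arrs (functor_cat P E) F G" using \<alpha> \<beta> by simp
  have "?d \<oplus>\<^bsub>Hom (functor_cat P E) F G\<^esub> \<beta> = \<alpha>"
    using \<alpha> \<beta> by (simp add: H.minus_eq H.a_assoc H.l_neg)
  then have "?d X \<oplus>\<^bsub>Hom E (fobj F X) (fobj G X)\<^esub> \<beta> X = \<alpha> X"
    using functor_cat_app(4)[OF X, of E F G ?d \<beta>] by simp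
  then show ?thesis
    using functor_cat_arrsD(1)[OF d X] functor_cat_arrsD(1)[OF \<beta> X]
    by (metis K.minus_eq K.a_assoc K.r_neg K.r_zero K.a_inv_closed)
qed

text \<open>\<open>D K\<close> is the \<open>N\<close>-fold direct sum of \<open>K\<close>, given by the universal properties of product and
  coproduct.\<close>

locale power_functor = linear_category R P for R and P :: "('r, 'o, 'a) lincat" +
  fixes N :: nat and D :: "'o \<Rightarrow> 'o" and Dm :: "'o \<Rightarrow> 'o \<Rightarrow> 'a \<Rightarrow> 'a"
    and inj :: "nat \<Rightarrow> 'o \<Rightarrow> 'a" and prj :: "nat \<Rightarrow> 'o \<Rightarrow> 'a"
  assumes D_ob: "K \<in> Ob P \<Longrightarrow> D K \<in> Ob P"
    and Dm_arr: "\<lbrakk>K \<in> Ob P; L \<in> Ob P; f \<in> arrs P K L\<rbrakk> \<Longrightarrow> Dm K L f \<in> arrs P (D K) (D L)"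
    and inj_arr: "\<lbrakk>K \<in> Ob P; i < N\<rbrakk> \<Longrightarrow> inj i K \<in> arrs P K (D K)"
    and prj_arr: "\<lbrakk>K \<in> Ob P; i < N\<rbrakk> \<Longrightarrow> prj i K \<in> arrs P (D K) K"
    and prj_inj: "\<lbrakk>K \<in> Ob P; i < N; j < N\<rbrakk> \<Longrightarrow>
      Cmp P K (D K) K (prj i K) (inj j K) = (if i = j then Idn P K else zero_arr P K K)"
    and prj_Dm: "\<lbrakk>K \<in> Ob P; L \<in> Ob P; f \<in> arrs P K L; i < N\<rbrakk> \<Longrightarrow>
      Cmp P (D K) (D L) L (prj i L) (Dm K L f) = Cmp P (D K) K L f (prj i K)"
    and Dm_inj: "\<lbrakk>K \<in> Ob P; L \<in> Ob P; f \<in> arrs P K L; i < N\<rbrakk> \<Longrightarrow>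
      Cmp P K (D K) (D L) (Dm K L f) (inj i K) = Cmp P K L (D L) (inj i L) f"
    and prj_ext: "\<lbrakk>K \<in> Ob P; X \<in> Ob P; g \<in> arrs P X (D K); h \<in> arrs P X (D K);
      \<And>i. i < N \<Longrightarrow> Cmp P X (D K) K (prj i K) g = Cmp P X (D K) K (prj i K) h\<rbrakk> \<Longrightarrow> g = h"
    and inj_ext: "\<lbrakk>K \<in> Ob P; X \<in> Ob P; g \<in> arrs P (D K) X; h \<in> arrs P (D K) X;
      \<And>i. i < N \<Longrightarrow> Cmp P K (D K) X g (inj i K) = Cmp P K (D K) X h (inj i K)\<rbrakk> \<Longrightarrow> g = h"
    and tuple_ex: "\<lbrakk>K \<in> Ob P; X \<in> Ob P; \<And>i. i < N \<Longrightarrow> fs i \<in> arrs P X K\<rbrakk> \<Longrightarrow>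
      \<exists>g\<in>arrs P X (D K). \<forall>i<N. Cmp P X (D K) K (prj i K) g = fs i"
    and cotuple_ex: "\<lbrakk>K \<in> Ob P; X \<in> Ob P; \<And>i. i < N \<Longrightarrow> fs i \<in> arrs P K X\<rbrakk> \<Longrightarrow>
      \<exists>g\<in>arrs P (D K) X. \<forall>i<N. Cmp P K (D K) X g (inj i K) = fs i"
    and sum_inj_prj: "K \<in> Ob P \<Longrightarrow>
      finsum (Hom P (D K) (D K)) (\<lambda>i. Cmp P (D K) K (D K) (inj i K) (prj i K)) {..<N} = Idn P (D K)"
begin

definition "tuple K X f = (SOME g. g \<in> arrs P X (D K) \<and> (\<forall>i<N. Cmp P X (D K) K (prj i K) g = f i))"
definition "cotuple K X f = (SOME g. g \<in> arrs P (D K) X \<and> (\<forall>i<N. Cmp P K (D K) X g (inj i K) = f i))"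

text \<open>Think of \<open>D (D K)\<close> as N by N matrices with entries in \<open>K\<close>:
  \<open>unit\<close> sends x to the scalar matrix x, and \<open>counit\<close> is the
  trace.\<close>

definition "unit K = tuple (D K) K (\<lambda>i. inj i K)"
definition "counit K = cotuple (D K) K (\<lambda>i. prj i K)"
text \<open>Replacing the k-th coordinate by zero gives commuting idempotents. After applying a
  functor F, the product of the complements 1 - F(\<open>omit k K\<close>) projects onto the N-th
  cross effect.\<close>

definition "omit k K = tuple K (D K) (\<lambda>i. if i = k then zero_arr P (D K) K else prj i K)"

lemma tuple:
  assumes "K \<in> Ob P" "X \<in> Ob P" "\<And>i. i < N \<Longrightarrow> f i \<in> arrs P X K"
  shows "tuple K X f \<in> arrs P X (D K)" and "i < N \<Longrightarrow> Cmp P X (D K) K (prj i K) (tuple K X f) = f i"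
  using someI_ex[of "\<lambda>g. g \<in> arrs P X (D K) \<and> (\<forall>i<N. Cmp P X (D K) K (prj i K) g = f i)"] tuple_ex[of K X f] assms
  unfolding tuple_def by blast+

lemma cotuple:
  assumes "K \<in> Ob P" "X \<in> Ob P" "\<And>i. i < N \<Longrightarrow> f i \<in> arrs P K X"
  shows "cotuple K X f \<in> arrs P (D K) X" and "i < N \<Longrightarrow> Cmp P K (D K) X (cotuple K X f) (inj i K) = f i"
  using someI_ex[of "\<lambda>g. g \<in> arrs P (D K) X \<and> (\<forall>i<N. Cmp P K (D K) X g (inj i K) = f i)"] cotuple_ex[of K X f] assms
  unfolding cotuple_def by blast+

lemma unit:
  assumes K: "K \<in> Ob P"
  shows "unit K \<in> arrs P K (D (D K))" and "i < N \<Longrightarrow> Cmp P K (D (D K)) (D K) (prj i (D K)) (unit K) = inj i K"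
  unfolding unit_def by (rule tuple[OF D_ob[OF K] K]; simp add: inj_arr K)+

lemma counit:
  assumes K: "K \<in> Ob P"
  shows "counit K \<in> arrs P (D (D K)) K" and "i < N \<Longrightarrow> Cmp P (D K) (D (D K)) K (counit K) (inj i (D K)) = prj i K"
  unfolding counit_def by (rule cotuple[OF D_ob[OF K] K]; simp add: prj_arr K)+

lemma omit_aux:
  assumes K: "K \<in> Ob P"
  shows "omit k K \<in> arrs P (D K) (D K)"
    and "i < N \<Longrightarrow> Cmp P (D K) (D K) K (prj i K) (omit k K) = (if i = k then zero_arr P (D K) K else prj i K)"
  unfolding omit_def by (rule tuple[OF K D_ob[OF K]]; simp add: prj_arr K D_ob)+

lemmas omit_arr = omit_aux(1) and prj_omit = omit_aux(2)

lemma assoc: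
  "\<lbrakk>f \<in> arrs P W X; g \<in> arrs P X Y; h \<in> arrs P Y Z; W \<in> Ob P; X \<in> Ob P; Y \<in> Ob P; Z \<in> Ob P\<rbrakk> \<Longrightarrow>
    Cmp P W X Z (Cmp P X Y Z h g) f = Cmp P W Y Z h (Cmp P W X Y g f)"
  using cmp_assoc by simp

lemma assoc_prj:
  assumes "i < N" "K \<in> Ob P" "X \<in> Ob P" "Y \<in> Ob P" "f \<in> arrs P X Y" "g \<in> arrs P Y (D K)"
  shows "Cmp P X (D K) K (prj i K) (Cmp P X Y (D K) g f) = Cmp P X Y K (Cmp P Y (D K) K (prj i K) g) f"
  using assms by (intro cmp_assoc) (simp_all add: D_ob prj_arr)

lemma assoc_inj:
  assumes "i < N" "K \<in> Ob P" "X \<in> Ob P" "Y \<in> Ob P" "f \<in> arrs P (D K) X" "g \<in> arrs P X Y"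
  shows "Cmp P K (D K) Y (Cmp P (D K) X Y g f) (inj i K) = Cmp P K X Y g (Cmp P K (D K) X f (inj i K))"
  using assms by (intro cmp_assoc[symmetric]) (simp_all add: D_ob inj_arr)

lemma omit_inj:
  assumes K: "K \<in> Ob P" and i: "i < N"
  shows "Cmp P K (D K) (D K) (omit k K) (inj i K) = (if i = k then zero_arr P K (D K) else inj i K)"
proof (rule prj_ext[OF K K])
  note ss = K D_ob omit_arr inj_arr prj_arr
  show "Cmp P K (D K) (D K) (omit k K) (inj i K) \<in> arrs P K (D K)"
    by (intro cmp_arr) (simp_all add: ss i)
  show "(if i = k then zero_arr P K (D K) else inj i K) \<in> arrs P K (D K)" by (simp add: ss i)
  fix j assume j: "j < N"
  have "Cmp P K (D K) K (prj j K) (Cmp P K (D K) (D K) (omit k K) (inj i K)) =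
      Cmp P K (D K) K (if j = k then zero_arr P (D K) K else prj j K) (inj i K)"
    by (subst assoc_prj[OF j]) (simp_all add: ss prj_omit j i)
  then show "Cmp P K (D K) K (prj j K) (Cmp P K (D K) (D K) (omit k K) (inj i K)) =
      Cmp P K (D K) K (prj j K) (if i = k then zero_arr P K (D K) else inj i K)"
    using j i by (auto simp: ss prj_inj cmp_zero_left[OF K D_ob[OF K] K] cmp_zero_right[OF K D_ob[OF K] K])
qed

lemma omit_idem:
  assumes K: "K \<in> Ob P"
  shows "Cmp P (D K) (D K) (D K) (omit k K) (omit k K) = omit k K"
  by (rule prj_ext[OF K D_ob[OF K]])
    (auto simp: K D_ob omit_arr prj_arr cmp_arr assoc_prj prj_omit cmp_zero_left)

lemma omit_comm:
  assumes K: "K \<in> Ob P"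
  shows "Cmp P (D K) (D K) (D K) (omit j K) (omit k K) = Cmp P (D K) (D K) (D K) (omit k K) (omit j K)"
  by (rule prj_ext[OF K D_ob[OF K]])
    (auto simp: K D_ob omit_arr prj_arr cmp_arr assoc_prj prj_omit cmp_zero_left)

lemma omit_nat:
  assumes K: "K \<in> Ob P" "L \<in> Ob P" "f \<in> arrs P K L"
  shows "Cmp P (D K) (D L) (D L) (omit k L) (Dm K L f) = Cmp P (D K) (D K) (D L) (Dm K L f) (omit k K)"
proof (rule prj_ext[OF K(2) D_ob[OF K(1)]])
  note ss = K D_ob omit_arr prj_arr cmp_arr Dm_arr
  show "Cmp P (D K) (D L) (D L) (omit k L) (Dm K L f) \<in> arrs P (D K) (D L)"
    "Cmp P (D K) (D K) (D L) (Dm K L f) (omit k K) \<in> arrs P (D K) (D L)" by (simp_all add: ss)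
  fix i assume i: "i < N"
  show "Cmp P (D K) (D L) L (prj i L) (Cmp P (D K) (D L) (D L) (omit k L) (Dm K L f)) =
      Cmp P (D K) (D L) L (prj i L) (Cmp P (D K) (D K) (D L) (Dm K L f) (omit k K))"
    using i by (simp add: ss assoc_prj prj_omit prj_Dm assoc cmp_zero_left cmp_zero_right)
qed

lemma Dm_cmp:
  assumes "K \<in> Ob P" "L \<in> Ob P" "M \<in> Ob P" "f \<in> arrs P K L" "g \<in> arrs P L M"
  shows "Dm K M (Cmp P K L M g f) = Cmp P (D K) (D L) (D M) (Dm L M g) (Dm K L f)"
proof (rule prj_ext[of M "D K"])
  fix i assume i: "i < N"
  show "Cmp P (D K) (D M) M (prj i M) (Dm K M (Cmp P K L M g f)) =
      Cmp P (D K) (D M) M (prj i M) (Cmp P (D K) (D L) (D M) (Dm L M g) (Dm K L f))"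
    using i assms by (simp add: D_ob prj_arr cmp_arr Dm_arr assoc_prj prj_Dm assoc)
qed (use assms in \<open>simp_all add: D_ob cmp_arr Dm_arr\<close>)

lemma Dm_idn:
  assumes "K \<in> Ob P" shows "Dm K K (Idn P K) = Idn P (D K)"
  by (rule prj_ext[of K "D K"]) (use assms in \<open>simp_all add: D_ob prj_arr Dm_arr prj_Dm idn_arr idn_cmp cmp_idn\<close>)

lemma unit_nat:
  assumes K: "K \<in> Ob P" "L \<in> Ob P" "f \<in> arrs P K L"
  shows "Cmp P K L (D (D L)) (unit L) f = Cmp P K (D (D K)) (D (D L)) (Dm (D K) (D L) (Dm K L f)) (unit K)"
  by (rule prj_ext[of "D L" K])
    (use K in \<open>simp_all add: D_ob prj_arr cmp_arr Dm_arr inj_arr assoc_prj prj_Dm assoc unit Dm_inj\<close>)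

lemma counit_nat:
  assumes K: "K \<in> Ob P" "L \<in> Ob P" "f \<in> arrs P K L"
  shows "Cmp P (D (D K)) (D (D L)) L (counit L) (Dm (D K) (D L) (Dm K L f)) = Cmp P (D (D K)) K L f (counit K)"
proof (rule inj_ext[of "D K" L])
  note ss = K D_ob prj_arr cmp_arr Dm_arr inj_arr counit
  fix i assume i: "i < N"
  have "Cmp P (D K) (D (D K)) L (Cmp P (D (D K)) (D (D L)) L (counit L) (Dm (D K) (D L) (Dm K L f))) (inj i (D K)) =
      Cmp P (D K) (D (D L)) L (counit L) (Cmp P (D K) (D L) (D (D L)) (inj i (D L)) (Dm K L f))"
    using i by (simp add: ss assoc_inj Dm_inj)
  also have "\<dots> = Cmp P (D K) (D L) L (prj i L) (Dm K L f)"
    using i by (subst cmp_assoc) (simp_all add: ss)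
  finally show "Cmp P (D K) (D (D K)) L (Cmp P (D (D K)) (D (D L)) L (counit L) (Dm (D K) (D L) (Dm K L f))) (inj i (D K)) =
      Cmp P (D K) (D (D K)) L (Cmp P (D (D K)) K L f (counit K)) (inj i (D K))"
    using i by (simp add: ss assoc_inj prj_Dm)
qed (use K in \<open>simp_all add: D_ob cmp_arr Dm_arr counit\<close>)

text \<open>Together with \<open>triangle2\<close> this exhibits \<open>D\<close> as adjoint to
  itself, with the scalar matrices as unit and the trace as counit.\<close>

lemma triangle1:
  assumes K: "K \<in> Ob P"
  shows "Cmp P (D K) (D (D (D K))) (D K) (counit (D K)) (Dm K (D (D K)) (unit K)) = Idn P (D K)"
proof (rule inj_ext[of K "D K"])
  note ss = K D_ob prj_arr cmp_arr Dm_arr inj_arr counit unit idn_arr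
  fix i assume i: "i < N"
  have "Cmp P K (D K) (D K) (Cmp P (D K) (D (D (D K))) (D K) (counit (D K)) (Dm K (D (D K)) (unit K))) (inj i K) =
      Cmp P K (D (D (D K))) (D K) (counit (D K)) (Cmp P K (D (D K)) (D (D (D K))) (inj i (D (D K))) (unit K))"
    using i by (simp add: ss assoc_inj Dm_inj)
  also have "\<dots> = inj i K"
    using i by (subst cmp_assoc) (simp_all add: ss)
  finally show "Cmp P K (D K) (D K) (Cmp P (D K) (D (D (D K))) (D K) (counit (D K)) (Dm K (D (D K)) (unit K))) (inj i K) =
      Cmp P K (D K) (D K) (Idn P (D K)) (inj i K)"
    using i by (simp add: ss idn_cmp)
qed (use K in \<open>simp_all add: D_ob cmp_arr Dm_arr counit unit idn_arr\<close>)

lemma triangle2: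
  assumes K: "K \<in> Ob P"
  shows "Cmp P (D K) (D (D (D K))) (D K) (Dm (D (D K)) K (counit K)) (unit (D K)) = Idn P (D K)"
  by (rule prj_ext[of K "D K"])
    (use K in \<open>simp_all add: D_ob prj_arr inj_arr cmp_arr Dm_arr counit unit idn_arr assoc_prj prj_Dm assoc cmp_idn\<close>)

text \<open>In the trace it does not matter whether the k-th row or the k-th column is deleted: both
  remove exactly the k-th diagonal entry. This is why the idempotents are compatible with the
  adjunction.\<close>

lemma counit_omit:
  assumes K: "K \<in> Ob P"
  shows "Cmp P (D (D K)) (D (D K)) K (counit K) (omit k (D K)) = Cmp P (D (D K)) (D (D K)) K (counit K) (Dm (D K) (D K) (omit k K))"
proof (rule inj_ext[of "D K" K])
  note ss = K D_ob prj_arr cmp_arr Dm_arr inj_arr counit omit_arr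
  fix i assume i: "i < N"
  have "Cmp P (D K) (D (D K)) K (Cmp P (D (D K)) (D (D K)) K (counit K) (Dm (D K) (D K) (omit k K))) (inj i (D K)) =
      Cmp P (D K) (D (D K)) K (counit K) (Cmp P (D K) (D K) (D (D K)) (inj i (D K)) (omit k K))"
    using i by (simp add: ss assoc_inj Dm_inj)
  also have "\<dots> = (if i = k then zero_arr P (D K) K else prj i K)"
    using i by (subst cmp_assoc) (simp_all add: ss prj_omit)
  also have "\<dots> = Cmp P (D K) (D (D K)) K (Cmp P (D (D K)) (D (D K)) K (counit K) (omit k (D K))) (inj i (D K))"
    using i by (simp add: ss assoc_inj omit_inj cmp_zero_right)
  finally show "Cmp P (D K) (D (D K)) K (Cmp P (D (D K)) (D (D K)) K (counit K) (omit k (D K))) (inj i (D K)) =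
      Cmp P (D K) (D (D K)) K (Cmp P (D (D K)) (D (D K)) K (counit K) (Dm (D K) (D K) (omit k K))) (inj i (D K))" ..
qed (use K in \<open>simp_all add: D_ob cmp_arr Dm_arr counit omit_arr\<close>)

end

section \<open>Precomposition with the power functor\<close>

definition precomp :: "('o \<Rightarrow> 'o) \<Rightarrow> ('o \<Rightarrow> 'o \<Rightarrow> 'a \<Rightarrow> 'a) \<Rightarrow> ('o, 'a, 'p, 'b) ftr \<Rightarrow> ('o, 'a, 'p, 'b) ftr" where
  "precomp D Dm F = \<lparr>fobj = (\<lambda>K. fobj F (D K)), farr = (\<lambda>K L f. farr F (D K) (D L) (Dm K L f))\<rparr>"

lemma precomp_simps [simp]:
  "fobj (precomp D Dm F) K = fobj F (D K)" "farr (precomp D Dm F) K L f = farr F (D K) (D L) (Dm K L f)"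
  by (simp_all add: precomp_def)

locale functor_power = power_functor R P N D Dm inj prj
  for R and P :: "('r, 'o, 'a) lincat" and N D Dm inj prj +
  fixes E :: "('r, 'p, 'b) lincat"
  assumes R: "cring R" and E: "linear_category R E"
begin

abbreviation "FC \<equiv> functor_cat P E"
abbreviation "T \<equiv> precomp D Dm"

definition "Tm F G \<alpha> = (\<lambda>K\<in>Ob P. \<alpha> (D K))"

text \<open>Precomposition reverses the side on which \<open>D\<close> acts but keeps the
  adjunction: the transpose uses G of the counit, its inverse F of the unit.\<close>

definition "adj F G \<alpha> = (\<lambda>K\<in>Ob P. Cmp E (fobj F (D K)) (fobj G (D (D K))) (fobj G K)
  (farr G (D (D K)) K (counit K)) (\<alpha> (D K)))"

definition "coadj F G \<beta> = (\<lambda>K\<in>Ob P. Cmp E (fobj F K) (fobj F (D (D K))) (fobj G (D K))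
  (\<beta> (D K)) (farr F K (D (D K)) (unit K)))"

definition "om k F = (\<lambda>K\<in>Ob P. farr F (D K) (D K) (omit k K))"

lemma FC_linear: "linear_category R FC"
  by (rule linear_category_functor_cat[OF R E])

sublocale E: linear_category R E by (rule E)
sublocale FC: linear_category R FC by (rule FC_linear)

lemma T_functor:
  assumes F: "is_functor P E F" shows "is_functor P E (T F)"
  unfolding is_functor_def
  by (simp add: D_ob Dm_arr Dm_idn Dm_cmp is_functorD[OF F] cmp_arr)

lemma Tm_arr':
  assumes "\<alpha> \<in> arrs FC F G" shows "Tm F G \<alpha> \<in> arrs FC (T F) (T G)"
  unfolding functor_cat_arrs
  by (simp add: Tm_def functor_cat_arrsD[OF assms] D_ob Dm_arr)

lemma adj_arr':
  assumes F: "is_functor P E F" and G: "is_functor P E G" and \<alpha>: "\<alpha> \<in> arrs FC F (T G)"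
  shows "adj F G \<alpha> \<in> arrs FC (T F) G"
  unfolding functor_cat_arrs
proof (intro conjI ballI)
  note f = is_functorD[OF F] and g = is_functorD[OF G] and a = functor_cat_arrsD[OF \<alpha>, unfolded precomp_simps]
  note ss = f g a D_ob Dm_arr counit E.cmp_arr
  show "adj F G \<alpha> \<in> extensional (Ob P)" by (simp add: adj_def)
  fix K assume K: "K \<in> Ob P"
  then show "adj F G \<alpha> K \<in> arrs E (fobj (T F) K) (fobj G K)" by (simp add: adj_def ss)
  fix L u assume L: "L \<in> Ob P" and u: "u \<in> arrs P K L"
  let ?a = "\<alpha> (D L)" and ?u = "Dm K L u"
  have "Cmp E (fobj F (D K)) (fobj F (D L)) (fobj G L)
      (Cmp E (fobj F (D L)) (fobj G (D (D L))) (fobj G L) (farr G (D (D L)) L (counit L)) ?a) (farr F (D K) (D L) ?u) =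
    Cmp E (fobj F (D K)) (fobj G (D (D L))) (fobj G L) (farr G (D (D L)) L (counit L))
      (Cmp E (fobj F (D K)) (fobj F (D L)) (fobj G (D (D L))) ?a (farr F (D K) (D L) ?u))"
    using K L u by (intro E.cmp_assoc[symmetric]) (simp_all add: ss)
  also have "\<dots> = Cmp E (fobj F (D K)) (fobj G (D (D L))) (fobj G L) (farr G (D (D L)) L (counit L))
      (Cmp E (fobj F (D K)) (fobj G (D (D K))) (fobj G (D (D L))) (farr G (D (D K)) (D (D L)) (Dm (D K) (D L) ?u)) (\<alpha> (D K)))"
    using K L u by (simp add: ss)
  also have "\<dots> = Cmp E (fobj F (D K)) (fobj G (D (D K))) (fobj G L)
      (Cmp E (fobj G (D (D K))) (fobj G (D (D L))) (fobj G L) (farr G (D (D L)) L (counit L)) (farr G (D (D K)) (D (D L)) (Dm (D K) (D L) ?u))) (\<alpha> (D K))"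
    using K L u by (intro E.cmp_assoc) (simp_all add: ss)
  also have "\<dots> = Cmp E (fobj F (D K)) (fobj G (D (D K))) (fobj G L)
      (Cmp E (fobj G (D (D K))) (fobj G K) (fobj G L) (farr G K L u) (farr G (D (D K)) K (counit K))) (\<alpha> (D K))"
    using K L u by (simp add: ss flip: g(4)) (simp add: counit_nat)
  also have "\<dots> = Cmp E (fobj F (D K)) (fobj G K) (fobj G L) (farr G K L u)
      (Cmp E (fobj F (D K)) (fobj G (D (D K))) (fobj G K) (farr G (D (D K)) K (counit K)) (\<alpha> (D K)))"
    using K L u by (intro E.cmp_assoc[symmetric]) (simp_all add: ss)
  finally show "Cmp E (fobj (T F) K) (fobj (T F) L) (fobj G L) (adj F G \<alpha> L) (farr (T F) K L u) =
      Cmp E (fobj (T F) K) (fobj G K) (fobj G L) (farr G K L u) (adj F G \<alpha> K)"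
    using K L by (simp add: adj_def)
qed

lemma coadj_arr:
  assumes F: "is_functor P E F" and G: "is_functor P E G" and \<beta>: "\<beta> \<in> arrs FC (T F) G"
  shows "coadj F G \<beta> \<in> arrs FC F (T G)"
  unfolding functor_cat_arrs
proof (intro conjI ballI)
  note f = is_functorD[OF F] and g = is_functorD[OF G] and b = functor_cat_arrsD[OF \<beta>, unfolded precomp_simps]
  note ss = f g b D_ob Dm_arr unit E.cmp_arr
  show "coadj F G \<beta> \<in> extensional (Ob P)" by (simp add: coadj_def)
  fix K assume K: "K \<in> Ob P"
  then show "coadj F G \<beta> K \<in> arrs E (fobj F K) (fobj (T G) K)" by (simp add: coadj_def ss)
  fix L u assume L: "L \<in> Ob P" and u: "u \<in> arrs P K L"
  let ?DD = "farr F (D (D K)) (D (D L)) (Dm (D K) (D L) (Dm K L u))"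
  have "Cmp E (fobj F K) (fobj F L) (fobj G (D L))
      (Cmp E (fobj F L) (fobj F (D (D L))) (fobj G (D L)) (\<beta> (D L)) (farr F L (D (D L)) (unit L))) (farr F K L u) =
    Cmp E (fobj F K) (fobj F (D (D L))) (fobj G (D L)) (\<beta> (D L))
      (Cmp E (fobj F K) (fobj F L) (fobj F (D (D L))) (farr F L (D (D L)) (unit L)) (farr F K L u))"
    using K L u by (intro E.cmp_assoc[symmetric]) (simp_all add: ss)
  also have "\<dots> = Cmp E (fobj F K) (fobj F (D (D L))) (fobj G (D L)) (\<beta> (D L))
      (Cmp E (fobj F K) (fobj F (D (D K))) (fobj F (D (D L))) ?DD (farr F K (D (D K)) (unit K)))"
    using K L u by (simp add: ss flip: f(4)) (simp add: unit_nat)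
  also have "\<dots> = Cmp E (fobj F K) (fobj F (D (D K))) (fobj G (D L))
      (Cmp E (fobj F (D (D K))) (fobj F (D (D L))) (fobj G (D L)) (\<beta> (D L)) ?DD) (farr F K (D (D K)) (unit K))"
    using K L u by (intro E.cmp_assoc) (simp_all add: ss)
  also have "\<dots> = Cmp E (fobj F K) (fobj F (D (D K))) (fobj G (D L))
      (Cmp E (fobj F (D (D K))) (fobj G (D K)) (fobj G (D L)) (farr G (D K) (D L) (Dm K L u)) (\<beta> (D K))) (farr F K (D (D K)) (unit K))"
    using K L u by (simp add: ss)
  also have "\<dots> = Cmp E (fobj F K) (fobj G (D K)) (fobj G (D L)) (farr G (D K) (D L) (Dm K L u))
      (Cmp E (fobj F K) (fobj F (D (D K))) (fobj G (D K)) (\<beta> (D K)) (farr F K (D (D K)) (unit K)))"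
    using K L u by (intro E.cmp_assoc[symmetric]) (simp_all add: ss)
  finally show "Cmp E (fobj F K) (fobj F L) (fobj (T G) L) (coadj F G \<beta> L) (farr F K L u) =
      Cmp E (fobj F K) (fobj (T G) K) (fobj (T G) L) (farr (T G) K L u) (coadj F G \<beta> K)"
    using K L by (simp add: coadj_def)
qed

text \<open>Naturality of \<open>\<alpha>\<close> along \<open>unit K\<close> brings G of the counit
  next to G of \<open>D\<close> of the unit, and these cancel by \<open>triangle1\<close>.\<close>

lemma coadj_adj:
  assumes F: "is_functor P E F" and G: "is_functor P E G" and \<alpha>: "\<alpha> \<in> arrs FC F (T G)"
  shows "coadj F G (adj F G \<alpha>) = \<alpha>"
proof (rule functor_cat_arr_eqI[OF coadj_arr[OF F G adj_arr'[OF F G \<alpha>]] \<alpha>])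
  note f = is_functorD[OF F] and g = is_functorD[OF G] and a = functor_cat_arrsD[OF \<alpha>, unfolded precomp_simps]
  note ss = f g a D_ob Dm_arr counit unit E.cmp_arr cmp_arr
  fix K assume K: "K \<in> Ob P"
  let ?c = "farr G (D (D (D K))) (D K) (counit (D K))" and ?n = "farr F K (D (D K)) (unit K)"
  have "coadj F G (adj F G \<alpha>) K = Cmp E (fobj F K) (fobj F (D (D K))) (fobj G (D K))
      (Cmp E (fobj F (D (D K))) (fobj G (D (D (D K)))) (fobj G (D K)) ?c (\<alpha> (D (D K)))) ?n"
    using K by (simp add: coadj_def adj_def D_ob)
  also have "\<dots> = Cmp E (fobj F K) (fobj G (D (D (D K)))) (fobj G (D K)) ?c
      (Cmp E (fobj F K) (fobj F (D (D K))) (fobj G (D (D (D K)))) (\<alpha> (D (D K))) ?n)"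
    using K by (intro E.cmp_assoc[symmetric]) (simp_all add: ss)
  also have "\<dots> = Cmp E (fobj F K) (fobj G (D (D (D K)))) (fobj G (D K)) ?c
      (Cmp E (fobj F K) (fobj G (D K)) (fobj G (D (D (D K)))) (farr G (D K) (D (D (D K))) (Dm K (D (D K)) (unit K))) (\<alpha> K))"
    using K by (simp add: ss)
  also have "\<dots> = Cmp E (fobj F K) (fobj G (D K)) (fobj G (D K))
      (Cmp E (fobj G (D K)) (fobj G (D (D (D K)))) (fobj G (D K)) ?c (farr G (D K) (D (D (D K))) (Dm K (D (D K)) (unit K)))) (\<alpha> K)"
    using K by (intro E.cmp_assoc) (simp_all add: ss)
  also have "\<dots> = Cmp E (fobj F K) (fobj G (D K)) (fobj G (D K)) (Idn E (fobj G (D K))) (\<alpha> K)"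
    using K by (simp add: ss triangle1 flip: g(4))
  also have "\<dots> = \<alpha> K" using K by (simp add: ss E.idn_cmp)
  finally show "coadj F G (adj F G \<alpha>) K = \<alpha> K" .
qed

text \<open>Naturality of \<open>\<beta>\<close> along \<open>counit K\<close> collects both
  structure maps inside F, where they cancel by \<open>triangle2\<close>.\<close>

lemma adj_coadj:
  assumes F: "is_functor P E F" and G: "is_functor P E G" and \<beta>: "\<beta> \<in> arrs FC (T F) G"
  shows "adj F G (coadj F G \<beta>) = \<beta>"
proof (rule functor_cat_arr_eqI[OF adj_arr'[OF F G coadj_arr[OF F G \<beta>]] \<beta>])
  note f = is_functorD[OF F] and g = is_functorD[OF G] and b = functor_cat_arrsD[OF \<beta>, unfolded precomp_simps]
  note ss = f g b D_ob Dm_arr counit unit E.cmp_arr cmp_arr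
  fix K assume K: "K \<in> Ob P"
  let ?c = "farr G (D (D K)) K (counit K)" and ?n = "farr F (D K) (D (D (D K))) (unit (D K))"
  have "adj F G (coadj F G \<beta>) K = Cmp E (fobj F (D K)) (fobj G (D (D K))) (fobj G K) ?c
      (Cmp E (fobj F (D K)) (fobj F (D (D (D K)))) (fobj G (D (D K))) (\<beta> (D (D K))) ?n)"
    using K by (simp add: coadj_def adj_def D_ob)
  also have "\<dots> = Cmp E (fobj F (D K)) (fobj F (D (D (D K)))) (fobj G K)
      (Cmp E (fobj F (D (D (D K)))) (fobj G (D (D K))) (fobj G K) ?c (\<beta> (D (D K)))) ?n"
    using K by (intro E.cmp_assoc) (simp_all add: ss)
  also have "\<dots> = Cmp E (fobj F (D K)) (fobj F (D (D (D K)))) (fobj G K)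
      (Cmp E (fobj F (D (D (D K)))) (fobj F (D K)) (fobj G K) (\<beta> K) (farr F (D (D (D K))) (D K) (Dm (D (D K)) K (counit K)))) ?n"
    using K by (simp add: ss)
  also have "\<dots> = Cmp E (fobj F (D K)) (fobj F (D K)) (fobj G K) (\<beta> K)
      (Cmp E (fobj F (D K)) (fobj F (D (D (D K)))) (fobj F (D K)) (farr F (D (D (D K))) (D K) (Dm (D (D K)) K (counit K))) ?n)"
    using K by (intro E.cmp_assoc[symmetric]) (simp_all add: ss)
  also have "\<dots> = Cmp E (fobj F (D K)) (fobj F (D K)) (fobj G K) (\<beta> K) (Idn E (fobj F (D K)))"
    using K by (simp add: ss triangle2 flip: f(4))
  also have "\<dots> = \<beta> K" using K by (simp add: ss E.cmp_idn)
  finally show "adj F G (coadj F G \<beta>) K = \<beta> K" .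
qed

lemma om_arr:
  assumes F: "is_functor P E F" shows "om k F \<in> arrs FC (T F) (T F)"
  unfolding functor_cat_arrs
  using is_functorD[OF F] by (simp add: om_def D_ob omit_arr Dm_arr omit_nat flip: is_functorD(4)[OF F])

lemma T_self_adjoint: "self_adjoint_functor R FC T Tm adj (om k)"
proof (rule self_adjoint_functor.intro[OF FC_linear], unfold self_adjoint_functor_axioms_def,
    unfold functor_cat_Ob mem_Collect_eq, intro conjI allI impI, goal_cases)
  case (1 X)
  then show ?case by (rule T_functor)
next
  case (2 X Y f)
  then show ?case by (intro Tm_arr')
next
  case (3 X Y Z f g)
  show ?case
  proof (rule functor_cat_arr_eqI[of _ P E "T X" "T Z"])
    show "Tm X Z (Cmp FC X Y Z g f) \<in> arrs FC (T X) (T Z)"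
      using 3 by (intro Tm_arr' FC.cmp_arr) simp_all
    show "Cmp FC (T X) (T Y) (T Z) (Tm Y Z g) (Tm X Y f) \<in> arrs FC (T X) (T Z)"
      using 3 T_functor by (intro Tm_arr' FC.cmp_arr) simp_all
  qed (simp add: Tm_def D_ob)
next
  case (4 X Y)
  show ?case
  proof (rule functor_cat_arr_eqI[of _ P E "T X" "T Y"])
    show "Tm X Y (zero_arr FC X Y) \<in> arrs FC (T X) (T Y)"
      using 4 by (intro Tm_arr' FC.zero_arr_closed) simp_all
    show "zero_arr FC (T X) (T Y) \<in> arrs FC (T X) (T Y)"
      using 4 T_functor by (intro FC.zero_arr_closed) simp_all
  qed (simp add: Tm_def D_ob)
next
  case (5 X Y)
  show ?case
    by (rule bij_betw_byWitness[where f' = "coadj X Y"], unfold image_subset_iff)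
      (use coadj_adj[OF 5] adj_coadj[OF 5] adj_arr'[OF 5] coadj_arr[OF 5] in blast)+
next
  case (6 X' X Y h f)
  note f = is_functorD[OF 6(1)] is_functorD[OF 6(2)] is_functorD[OF 6(3)] functor_cat_arrsD[OF 6(4)]
    functor_cat_arrsD[OF 6(5), unfolded precomp_simps] D_ob counit
  show ?case
  proof (rule functor_cat_arr_eqI[of _ P E "T X'" Y])
    show "adj X' Y (Cmp FC X' X (T Y) f h) \<in> arrs FC (T X') Y"
      using 6 T_functor by (intro adj_arr' FC.cmp_arr) auto
    show "Cmp FC (T X') (T X) Y (adj X Y f) (Tm X' X h) \<in> arrs FC (T X') Y"
      using 6 T_functor by (intro FC.cmp_arr adj_arr' Tm_arr') auto
    fix K assume K: "K \<in> Ob P"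
    show "adj X' Y (Cmp FC X' X (T Y) f h) K = Cmp FC (T X') (T X) Y (adj X Y f) (Tm X' X h) K"
      using K by (simp add: adj_def Tm_def D_ob) (rule E.cmp_assoc; simp add: f)
  qed
next
  case (7 X Y Y' f k)
  note f = is_functorD[OF 7(1)] is_functorD[OF 7(2)] is_functorD[OF 7(3)] functor_cat_arrsD[OF 7(5)]
    functor_cat_arrsD[OF 7(4), unfolded precomp_simps] D_ob counit
  show ?case
  proof (rule functor_cat_arr_eqI[of _ P E "T X" Y'])
    show "adj X Y' (Cmp FC X (T Y) (T Y') (Tm Y Y' k) f) \<in> arrs FC (T X) Y'"
      using 7 T_functor by (intro adj_arr' FC.cmp_arr Tm_arr') auto
    show "Cmp FC (T X) Y Y' k (adj X Y f) \<in> arrs FC (T X) Y'"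
      using 7 T_functor by (intro FC.cmp_arr adj_arr') auto
    fix K assume K: "K \<in> Ob P"
    have "Cmp E (fobj X (D K)) (fobj Y' (D (D K))) (fobj Y' K) (farr Y' (D (D K)) K (counit K))
        (Cmp E (fobj X (D K)) (fobj Y (D (D K))) (fobj Y' (D (D K))) (k (D (D K))) (f (D K))) =
      Cmp E (fobj X (D K)) (fobj Y (D (D K))) (fobj Y' K)
        (Cmp E (fobj Y (D (D K))) (fobj Y' (D (D K))) (fobj Y' K) (farr Y' (D (D K)) K (counit K)) (k (D (D K)))) (f (D K))"
      using K by (intro E.cmp_assoc) (simp_all add: f)
    also have "\<dots> = Cmp E (fobj X (D K)) (fobj Y (D (D K))) (fobj Y' K)
        (Cmp E (fobj Y (D (D K))) (fobj Y K) (fobj Y' K) (k K) (farr Y (D (D K)) K (counit K))) (f (D K))"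
      using K functor_cat_arrsD(2)[OF 7(5), of "D (D K)" K "counit K"] by (simp add: D_ob counit)
    also have "\<dots> = Cmp E (fobj X (D K)) (fobj Y K) (fobj Y' K) (k K)
        (Cmp E (fobj X (D K)) (fobj Y (D (D K))) (fobj Y K) (farr Y (D (D K)) K (counit K)) (f (D K)))"
      using K by (intro E.cmp_assoc[symmetric]) (simp_all add: f)
    finally show "adj X Y' (Cmp FC X (T Y) (T Y') (Tm Y Y' k) f) K = Cmp FC (T X) Y Y' k (adj X Y f) K"
      using K by (simp add: adj_def Tm_def D_ob)
  qed
next
  case (8 X)
  then show ?case by (rule om_arr)
next
  case (9 X Y f)
  show ?case
  proof (rule functor_cat_arr_eqI[of _ P E "T X" "T Y"])
    show "Cmp FC (T X) (T Y) (T Y) (om k Y) (Tm X Y f) \<in> arrs FC (T X) (T Y)"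
      using 9 T_functor by (intro Tm_arr' om_arr FC.cmp_arr) simp_all
    show "Cmp FC (T X) (T X) (T Y) (Tm X Y f) (om k X) \<in> arrs FC (T X) (T Y)"
      using 9 T_functor by (intro Tm_arr' om_arr FC.cmp_arr) simp_all
  qed (simp add: Tm_def om_def D_ob omit_arr functor_cat_arrsD(2)[OF 9(3)])
qed

sublocale commuting_idempotents R FC T Tm adj om
proof (rule commuting_idempotents.intro[OF FC_linear], unfold commuting_idempotents_axioms_def,
    unfold functor_cat_Ob mem_Collect_eq, intro conjI allI impI, goal_cases)
  case (1 k)
  show ?case by (rule T_self_adjoint)
next
  case (2 X k)
  show ?case
  proof (rule functor_cat_arr_eqI[of _ P E "T X" "T X"])
    show "Cmp FC (T X) (T X) (T X) (om k X) (om k X) \<in> arrs FC (T X) (T X)" "om k X \<in> arrs FC (T X) (T X)"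
      using 2 T_functor om_arr by (simp_all add: FC.cmp_arr)
  qed (simp add: om_def D_ob omit_arr omit_idem flip: is_functorD(4)[OF 2])
next
  case (3 X j k)
  show ?case
  proof (rule functor_cat_arr_eqI[of _ P E "T X" "T X"])
    show "Cmp FC (T X) (T X) (T X) (om j X) (om k X) \<in> arrs FC (T X) (T X)" "Cmp FC (T X) (T X) (T X) (om k X) (om j X) \<in> arrs FC (T X) (T X)"
      using 3 T_functor om_arr by (simp_all add: FC.cmp_arr)
  qed (simp add: om_def D_ob omit_arr omit_comm[of _ j k] flip: is_functorD(4)[OF 3])
next
  case (4 X Y f k)
  note f = is_functorD[OF 4(1)] is_functorD[OF 4(2)] functor_cat_arrsD[OF 4(3), unfolded precomp_simps] D_ob counit omit_arr Dm_arr
  show ?case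
  proof (rule functor_cat_arr_eqI[of _ P E "T X" Y])
    show "adj X Y (Cmp FC X (T Y) (T Y) (om k Y) f) \<in> arrs FC (T X) Y"
      using 4 T_functor om_arr by (intro adj_arr' FC.cmp_arr) auto
    show "Cmp FC (T X) (T X) Y (adj X Y f) (om k X) \<in> arrs FC (T X) Y"
      using 4 T_functor om_arr by (intro FC.cmp_arr adj_arr') auto
    fix K assume K: "K \<in> Ob P"
    let ?c = "farr Y (D (D K)) K (counit K)"
    have "Cmp E (fobj X (D K)) (fobj Y (D (D K))) (fobj Y K) ?c
        (Cmp E (fobj X (D K)) (fobj Y (D (D K))) (fobj Y (D (D K))) (farr Y (D (D K)) (D (D K)) (omit k (D K))) (f (D K))) =
      Cmp E (fobj X (D K)) (fobj Y (D (D K))) (fobj Y K)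
        (Cmp E (fobj Y (D (D K))) (fobj Y (D (D K))) (fobj Y K) ?c (farr Y (D (D K)) (D (D K)) (omit k (D K)))) (f (D K))"
      using K by (intro E.cmp_assoc) (simp_all add: f)
    \<comment> \<open>Under the counit the outer \<open>omit\<close> may be exchanged for the inner
      one, which is of the form \<open>D\<close> of a map of \<open>P\<close>; naturality of
      \<open>f\<close> then carries it to the source.\<close>
    also have "\<dots> = Cmp E (fobj X (D K)) (fobj Y (D (D K))) (fobj Y K)
        (Cmp E (fobj Y (D (D K))) (fobj Y (D (D K))) (fobj Y K) ?c (farr Y (D (D K)) (D (D K)) (Dm (D K) (D K) (omit k K)))) (f (D K))"
      using K by (simp add: f counit_omit flip: is_functorD(4)[OF 4(2)])
    also have "\<dots> = Cmp E (fobj X (D K)) (fobj Y (D (D K))) (fobj Y K) ?c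
        (Cmp E (fobj X (D K)) (fobj Y (D (D K))) (fobj Y (D (D K))) (farr Y (D (D K)) (D (D K)) (Dm (D K) (D K) (omit k K))) (f (D K)))"
      using K by (intro E.cmp_assoc[symmetric]) (simp_all add: f)
    also have "\<dots> = Cmp E (fobj X (D K)) (fobj Y (D (D K))) (fobj Y K) ?c
        (Cmp E (fobj X (D K)) (fobj X (D K)) (fobj Y (D (D K))) (f (D K)) (farr X (D K) (D K) (omit k K)))"
      using K by (simp add: f)
    also have "\<dots> = Cmp E (fobj X (D K)) (fobj X (D K)) (fobj Y K)
        (Cmp E (fobj X (D K)) (fobj Y (D (D K))) (fobj Y K) ?c (f (D K))) (farr X (D K) (D K) (omit k K))"
      using K by (intro E.cmp_assoc) (simp_all add: f)
    finally show "adj X Y (Cmp FC X (T Y) (T Y) (om k Y) f) K = Cmp FC (T X) (T X) Y (adj X Y f) (om k X) K"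
      using K by (simp add: adj_def om_def D_ob)
  qed
next
  case (5 X Y f g)
  note TY = T_functor[OF 5(2)] and TX = T_functor[OF 5(1)]
  note m = FC.minus_arr[of X "T Y" f g] FC.minus_arr[of "T X" Y "adj X Y f" "adj X Y g"]
  show ?case
  proof (rule functor_cat_arr_eqI[of _ P E "T X" Y])
    show "adj X Y (f \<ominus>\<^bsub>Hom FC X (T Y)\<^esub> g) \<in> arrs FC (T X) Y"
      using 5 TY by (intro adj_arr' FC.minus_arr) auto
    show "adj X Y f \<ominus>\<^bsub>Hom FC (T X) Y\<^esub> adj X Y g \<in> arrs FC (T X) Y"
      using 5 TX by (intro adj_arr' FC.minus_arr) auto
    fix K assume K: "K \<in> Ob P"
    note f = is_functorD[OF 5(1)] is_functorD[OF 5(2)] functor_cat_arrsD[OF 5(3), unfolded precomp_simps]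
      functor_cat_arrsD[OF 5(4), unfolded precomp_simps] D_ob counit
    show "adj X Y (f \<ominus>\<^bsub>Hom FC X (T Y)\<^esub> g) K = (adj X Y f \<ominus>\<^bsub>Hom FC (T X) Y\<^esub> adj X Y g) K"
      using K functor_cat_minus_app[OF FC_linear E TX 5(2) adj_arr'[OF 5(1,2,3)] adj_arr'[OF 5(1,2,4)] K]
        functor_cat_minus_app[OF FC_linear E 5(1) TY 5(3,4) D_ob[OF K]]
      by (simp add: adj_def D_ob) (rule E.cmp_minus_right; simp add: f)
  qed
qed

end

section \<open>A criterion for N-fold direct sums\<close>

context linear_category begin

lemma cmp_finsum_right:
  assumes X: "X \<in> Ob C" "Y \<in> Ob C" "Z \<in> Ob C" and g: "g \<in> arrs C Y Z" and A: "finite A"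
    and h: "\<And>i. i \<in> A \<Longrightarrow> h i \<in> arrs C X Y"
  shows "Cmp C X Y Z g (finsum (Hom C X Y) h A) = finsum (Hom C X Z) (\<lambda>i. Cmp C X Y Z g (h i)) A"
proof -
  interpret XY: abelian_group "Hom C X Y" by (rule hom_group[OF X(1,2)])
  interpret XZ: abelian_group "Hom C X Z" by (rule hom_group[OF X(1,3)])
  show ?thesis using A h
  proof (induction A)
    case empty
    then show ?case by (simp add: cmp_zero_right X g)
  next
    case (insert i A)
    then have "h \<in> A \<rightarrow> arrs C X Y" "(\<lambda>i. Cmp C X Y Z g (h i)) \<in> A \<rightarrow> arrs C X Z"
      using cmp_arr[OF X _ g] by auto
    with insert show ?case
      by (simp add: XY.finsum_insert XZ.finsum_insert cmp_arr[OF X _ g] cmp_add_right[OF X _ _ g] XY.finsum_closed)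
  qed
qed

lemma cmp_finsum_left:
  assumes X: "X \<in> Ob C" "Y \<in> Ob C" "Z \<in> Ob C" and g: "g \<in> arrs C X Y" and A: "finite A"
    and h: "\<And>i. i \<in> A \<Longrightarrow> h i \<in> arrs C Y Z"
  shows "Cmp C X Y Z (finsum (Hom C Y Z) h A) g = finsum (Hom C X Z) (\<lambda>i. Cmp C X Y Z (h i) g) A"
proof -
  interpret YZ: abelian_group "Hom C Y Z" by (rule hom_group[OF X(2,3)])
  interpret XZ: abelian_group "Hom C X Z" by (rule hom_group[OF X(1,3)])
  show ?thesis using A h
  proof (induction A)
    case empty
    then show ?case by (simp add: cmp_zero_left X g)
  next
    case (insert i A)
    then have "h \<in> A \<rightarrow> arrs C Y Z" "(\<lambda>i. Cmp C X Y Z (h i) g) \<in> A \<rightarrow> arrs C X Z"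
      using cmp_arr[OF X g] by auto
    with insert show ?case
      by (simp add: YZ.finsum_insert XZ.finsum_insert cmp_arr[OF X g] cmp_add_left[OF X g] YZ.finsum_closed)
  qed
qed

lemma finsum_arr:
  assumes X: "X \<in> Ob C" "Y \<in> Ob C" and h: "\<And>i. i \<in> A \<Longrightarrow> h i \<in> arrs C X Y"
  shows "finsum (Hom C X Y) h A \<in> arrs C X Y"
proof -
  interpret abelian_group "Hom C X Y" by (rule hom_group[OF X])
  show ?thesis using h by (intro finsum_closed) auto
qed

lemma finsum_delta:
  assumes X: "X \<in> Ob C" "Y \<in> Ob C" and A: "finite A" "j \<in> A" and f: "f \<in> arrs C X Y"
    and h: "\<And>i. i \<in> A \<Longrightarrow> h i = (if j = i then f else zero_arr C X Y)"
  shows "finsum (Hom C X Y) h A = f"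
proof -
  interpret abelian_group "Hom C X Y" by (rule hom_group[OF X])
  have "finsum (Hom C X Y) h A = finsum (Hom C X Y) (\<lambda>i. if j = i then f else zero_arr C X Y) A"
    using f by (intro finsum_cong') (auto simp: h)
  also have "\<dots> = f" using finsum_singleton[OF A(2,1), of "\<lambda>_. f"] f by simp
  finally show ?thesis .
qed

text \<open>Only the product side is required. It yields the decomposition of the identity of
  \<open>D K\<close> as the sum of the composites \<open>inj i\<close> after \<open>prj i\<close>,
  and everything on the coproduct side follows from that.\<close>

lemma power_functorI:
  fixes inj prj :: "nat \<Rightarrow> _ \<Rightarrow> _"
  assumes D: "\<And>K. K \<in> Ob C \<Longrightarrow> D K \<in> Ob C"
    and Dm: "\<And>K L f. \<lbrakk>K \<in> Ob C; L \<in> Ob C; f \<in> arrs C K L\<rbrakk> \<Longrightarrow> Dm K L f \<in> arrs C (D K) (D L)"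
    and inj: "\<And>K i. \<lbrakk>K \<in> Ob C; i < N\<rbrakk> \<Longrightarrow> inj i K \<in> arrs C K (D K)"
    and prj: "\<And>K i. \<lbrakk>K \<in> Ob C; i < N\<rbrakk> \<Longrightarrow> prj i K \<in> arrs C (D K) K"
    and prj_inj: "\<And>K i j. \<lbrakk>K \<in> Ob C; i < N; j < N\<rbrakk> \<Longrightarrow>
      Cmp C K (D K) K (prj i K) (inj j K) = (if i = j then Idn C K else zero_arr C K K)"
    and prj_Dm: "\<And>K L f i. \<lbrakk>K \<in> Ob C; L \<in> Ob C; f \<in> arrs C K L; i < N\<rbrakk> \<Longrightarrow>
      Cmp C (D K) (D L) L (prj i L) (Dm K L f) = Cmp C (D K) K L f (prj i K)"
    and prj_ext: "\<And>K X g h. \<lbrakk>K \<in> Ob C; X \<in> Ob C; g \<in> arrs C X (D K); h \<in> arrs C X (D K);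
      \<And>i. i < N \<Longrightarrow> Cmp C X (D K) K (prj i K) g = Cmp C X (D K) K (prj i K) h\<rbrakk> \<Longrightarrow> g = h"
  shows "power_functor R C N D Dm inj prj"
proof -
  \<comment> \<open>Each projection picks exactly one summand, and the projections detect equality
    of maps into \<open>D K\<close>.\<close>
  have id: "finsum (Hom C (D K) (D K)) (\<lambda>i. Cmp C (D K) K (D K) (inj i K) (prj i K)) {..<N} = Idn C (D K)"
    (is "?s = _") if K: "K \<in> Ob C" for K
  proof (rule prj_ext[OF K D[OF K]])
    have ip: "Cmp C (D K) K (D K) (inj i K) (prj i K) \<in> arrs C (D K) (D K)" if "i \<in> {..<N}" for i
      using that K by (intro cmp_arr) (simp_all add: D inj prj)
    then show "?s \<in> arrs C (D K) (D K)" by (intro finsum_arr D K)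
    show "Idn C (D K) \<in> arrs C (D K) (D K)" by (intro idn_arr D K)
    fix j assume j: "j < N"
    have "Cmp C (D K) (D K) K (prj j K) ?s =
        finsum (Hom C (D K) K) (\<lambda>i. Cmp C (D K) (D K) K (prj j K) (Cmp C (D K) K (D K) (inj i K) (prj i K))) {..<N}"
      using K j ip by (intro cmp_finsum_right) (simp_all add: D prj)
    also have "\<dots> = prj j K"
    proof (rule finsum_delta)
      fix i assume "i \<in> {..<N}"
      then show "Cmp C (D K) (D K) K (prj j K) (Cmp C (D K) K (D K) (inj i K) (prj i K)) =
          (if j = i then prj j K else zero_arr C (D K) K)"
        using K j by (subst cmp_assoc) (simp_all add: D inj prj prj_inj idn_cmp cmp_zero_left)
    qed (use K j D prj in auto)
    finally show "Cmp C (D K) (D K) K (prj j K) ?s = Cmp C (D K) (D K) K (prj j K) (Idn C (D K))"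
      using K j by (simp add: cmp_idn D prj)
  qed
  \<comment> \<open>A map out of \<open>D K\<close> is recovered from its restrictions to the
    summands; this gives the extensionality needed for \<open>inj_ext\<close>.\<close>
  have exp: "finsum (Hom C (D K) X) (\<lambda>i. Cmp C (D K) K X (Cmp C K (D K) X g (inj i K)) (prj i K)) {..<N} = g"
    if K: "K \<in> Ob C" and X: "X \<in> Ob C" and g: "g \<in> arrs C (D K) X" for K X g
  proof -
    have "g = Cmp C (D K) (D K) X g (finsum (Hom C (D K) (D K)) (\<lambda>i. Cmp C (D K) K (D K) (inj i K) (prj i K)) {..<N})"
      using K X g by (simp add: id cmp_idn D)
    also have "\<dots> = finsum (Hom C (D K) X) (\<lambda>i. Cmp C (D K) (D K) X g (Cmp C (D K) K (D K) (inj i K) (prj i K))) {..<N}"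
      using K X g by (intro cmp_finsum_right) (simp_all add: D inj prj cmp_arr)
    also have "\<dots> = finsum (Hom C (D K) X) (\<lambda>i. Cmp C (D K) K X (Cmp C K (D K) X g (inj i K)) (prj i K)) {..<N}"
    proof -
      interpret abelian_group "Hom C (D K) X" by (rule hom_group[OF D[OF K] X])
      show ?thesis
        using K X g by (intro finsum_cong') (auto simp: D inj prj cmp_arr intro: cmp_assoc)
    qed
    finally show ?thesis ..
  qed
  show ?thesis
  proof (rule power_functor.intro[OF linear_category_axioms], unfold_locales, goal_cases)
    case (7 K L f i)
    show ?case
    proof (rule prj_ext[OF 7(2,1)])
      fix j assume j: "j < N"
      have "Cmp C K (D L) L (prj j L) (Cmp C K (D K) (D L) (Dm K L f) (inj i K)) =
          Cmp C K (D K) L (Cmp C (D K) K L f (prj j K)) (inj i K)"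
        using 7 j by (subst cmp_assoc) (simp_all add: D Dm inj prj prj_Dm)
      also have "\<dots> = Cmp C K K L f (Cmp C K (D K) K (prj j K) (inj i K))"
        using 7 j by (intro cmp_assoc[symmetric]) (simp_all add: D Dm inj prj)
      also have "\<dots> = Cmp C K L L (Cmp C L (D L) L (prj j L) (inj i L)) f"
        using 7 j by (simp add: prj_inj cmp_idn idn_cmp cmp_zero_left cmp_zero_right)
      also have "\<dots> = Cmp C K (D L) L (prj j L) (Cmp C K L (D L) (inj i L) f)"
        using 7 j by (intro cmp_assoc[symmetric]) (simp_all add: D Dm inj prj)
      finally show "Cmp C K (D L) L (prj j L) (Cmp C K (D K) (D L) (Dm K L f) (inj i K)) =
        Cmp C K (D L) L (prj j L) (Cmp C K L (D L) (inj i L) f)" .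
    qed (use 7 in \<open>simp_all add: D Dm inj cmp_arr\<close>)
  next
    case (9 K X g h)
    from 9(5) have "finsum (Hom C (D K) X) (\<lambda>i. Cmp C (D K) K X (Cmp C K (D K) X g (inj i K)) (prj i K)) {..<N} =
      finsum (Hom C (D K) X) (\<lambda>i. Cmp C (D K) K X (Cmp C K (D K) X h (inj i K)) (prj i K)) {..<N}"
    proof -
      interpret abelian_group "Hom C (D K) X" by (rule hom_group[OF D[OF 9(1)] 9(2)])
      show ?thesis
        using 9 by (intro finsum_cong') (auto simp: D inj prj cmp_arr)
    qed
    then show ?case using exp 9 by simp
  next
    case (10 K X fs)
    let ?g = "finsum (Hom C X (D K)) (\<lambda>i. Cmp C X K (D K) (inj i K) (fs i)) {..<N}"
    have "Cmp C X (D K) K (prj j K) ?g = fs j" if j: "j < N" for j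
    proof -
      have "Cmp C X (D K) K (prj j K) ?g =
          finsum (Hom C X K) (\<lambda>i. Cmp C X (D K) K (prj j K) (Cmp C X K (D K) (inj i K) (fs i))) {..<N}"
        using 10 j by (intro cmp_finsum_right) (simp_all add: D prj inj cmp_arr)
      also have "\<dots> = fs j"
      proof (rule finsum_delta)
        fix i assume "i \<in> {..<N}"
        then show "Cmp C X (D K) K (prj j K) (Cmp C X K (D K) (inj i K) (fs i)) = (if j = i then fs j else zero_arr C X K)"
          using 10 j by (subst cmp_assoc) (simp_all add: D inj prj prj_inj idn_cmp cmp_zero_left)
      qed (use 10 j in auto)
      finally show ?thesis .
    qed
    moreover have "?g \<in> arrs C X (D K)" using 10 by (intro finsum_arr) (simp_all add: D inj cmp_arr)
    ultimately show ?case by blast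
  next
    case (11 K X fs)
    let ?g = "finsum (Hom C (D K) X) (\<lambda>i. Cmp C (D K) K X (fs i) (prj i K)) {..<N}"
    have "Cmp C K (D K) X ?g (inj j K) = fs j" if j: "j < N" for j
    proof -
      have "Cmp C K (D K) X ?g (inj j K) =
          finsum (Hom C K X) (\<lambda>i. Cmp C K (D K) X (Cmp C (D K) K X (fs i) (prj i K)) (inj j K)) {..<N}"
        using 11 j by (intro cmp_finsum_left) (simp_all add: D prj inj cmp_arr)
      also have "\<dots> = fs j"
      proof (rule finsum_delta)
        fix i assume i: "i \<in> {..<N}"
        have "Cmp C K (D K) X (Cmp C (D K) K X (fs i) (prj i K)) (inj j K) = Cmp C K K X (fs i) (Cmp C K (D K) K (prj i K) (inj j K))"
          using 11 i j by (intro cmp_assoc[symmetric]) (simp_all add: D inj prj)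
        then show "Cmp C K (D K) X (Cmp C (D K) K X (fs i) (prj i K)) (inj j K) = (if j = i then fs j else zero_arr C K X)"
          using 11 i j by (auto simp: prj_inj cmp_idn cmp_zero_right)
      qed (use 11 j in auto)
      finally show ?thesis .
    qed
    moreover have "?g \<in> arrs C (D K) X" using 11 by (intro finsum_arr) (simp_all add: D prj cmp_arr)
    ultimately show ?case by blast
  qed (fact D Dm inj prj prj_inj prj_Dm prj_ext id)+
qed

end

section \<open>Closure properties of finitely generated projective modules\<close>

lemma free_mod_fin: "carrier (free_mod R {..<n::nat}) = {..<n} \<rightarrow>\<^sub>E carrier R"
  by (rule Set.set_eqI) (simp add: free_mod_carrier)

lemma free_mod_ops:
  "x \<oplus>\<^bsub>free_mod R S\<^esub> y = (\<lambda>k\<in>S. x k \<oplus>\<^bsub>R\<^esub> y k)"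
  "a \<odot>\<^bsub>free_mod R S\<^esub> x = (\<lambda>k\<in>S. a \<otimes>\<^bsub>R\<^esub> x k)"
  by (simp_all add: free_mod_def)

lemma hom_mod_ops:
  "carrier (hom_mod R M N) = lin_maps R M N"
  "\<zero>\<^bsub>hom_mod R M N\<^esub> = (\<lambda>x\<in>carrier M. \<zero>\<^bsub>N\<^esub>)"
  "f \<oplus>\<^bsub>hom_mod R M N\<^esub> g = (\<lambda>x\<in>carrier M. f x \<oplus>\<^bsub>N\<^esub> g x)"
  "a \<odot>\<^bsub>hom_mod R M N\<^esub> f = (\<lambda>x\<in>carrier M. a \<odot>\<^bsub>N\<^esub> f x)"
  by (simp_all add: hom_mod_def)

lemma prod_mod_ops:
  "carrier (prod_mod M N) = carrier M \<times> carrier N"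
  "\<zero>\<^bsub>prod_mod M N\<^esub> = (\<zero>\<^bsub>M\<^esub>, \<zero>\<^bsub>N\<^esub>)"
  "(x, y) \<oplus>\<^bsub>prod_mod M N\<^esub> (x', y') = (x \<oplus>\<^bsub>M\<^esub> x', y \<oplus>\<^bsub>N\<^esub> y')"
  "a \<odot>\<^bsub>prod_mod M N\<^esub> (x, y) = (a \<odot>\<^bsub>M\<^esub> x, a \<odot>\<^bsub>N\<^esub> y)"
  by (simp_all add: prod_mod_def)

lemma prod_mod_module:
  assumes M: "Module.module R M" and N: "Module.module R N"
  shows "Module.module R (prod_mod M N)"
proof -
  interpret M: Module.module R M by fact
  interpret N: Module.module R N by fact
  show ?thesis
  proof (rule moduleI)
    show "cring R" by (rule M.R.is_cring)
    show "abelian_group (prod_mod M N)"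
    proof (rule abelian_group_negI[where n = "\<lambda>(x, y). (\<ominus>\<^bsub>M\<^esub> x, \<ominus>\<^bsub>N\<^esub> y)"], goal_cases)
      case (3 x y z)
      then show ?case by (cases x; cases y; cases z) (simp add: prod_mod_ops M.a_assoc N.a_assoc)
    next
      case (4 x y)
      then show ?case by (cases x; cases y) (simp add: prod_mod_ops M.a_comm N.a_comm)
    next
      case (6 x)
      then show ?case by (cases x) (simp add: prod_mod_ops M.l_neg N.l_neg)
    qed (auto simp: prod_mod_ops)
  next
    fix a b x assume "a \<in> carrier R" "b \<in> carrier R" "x \<in> carrier (prod_mod M N)"
    then show "(a \<oplus>\<^bsub>R\<^esub> b) \<odot>\<^bsub>prod_mod M N\<^esub> x = a \<odot>\<^bsub>prod_mod M N\<^esub> x \<oplus>\<^bsub>prod_mod M N\<^esub> b \<odot>\<^bsub>prod_mod M N\<^esub> x"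
      by (cases x) (simp add: prod_mod_ops M.smult_l_distr N.smult_l_distr)
  next
    fix a x y assume "a \<in> carrier R" "x \<in> carrier (prod_mod M N)" "y \<in> carrier (prod_mod M N)"
    then show "a \<odot>\<^bsub>prod_mod M N\<^esub> (x \<oplus>\<^bsub>prod_mod M N\<^esub> y) = a \<odot>\<^bsub>prod_mod M N\<^esub> x \<oplus>\<^bsub>prod_mod M N\<^esub> a \<odot>\<^bsub>prod_mod M N\<^esub> y"
      by (cases x; cases y) (simp add: prod_mod_ops M.smult_r_distr N.smult_r_distr)
  next
    fix a b x assume "a \<in> carrier R" "b \<in> carrier R" "x \<in> carrier (prod_mod M N)"
    then show "(a \<otimes>\<^bsub>R\<^esub> b) \<odot>\<^bsub>prod_mod M N\<^esub> x = a \<odot>\<^bsub>prod_mod M N\<^esub> (b \<odot>\<^bsub>prod_mod M N\<^esub> x)"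
      by (cases x) (simp add: prod_mod_ops M.smult_assoc1 N.smult_assoc1)
  qed (auto simp: prod_mod_ops)
qed

lemma lin_maps_free_app:
  assumes "f \<in> lin_maps R M (free_mod R S)" "x \<in> carrier M" "k \<in> S"
  shows "f x k \<in> carrier R" "y \<in> carrier M \<Longrightarrow> f (x \<oplus>\<^bsub>M\<^esub> y) k = f x k \<oplus>\<^bsub>R\<^esub> f y k"
    "a \<in> carrier R \<Longrightarrow> f (a \<odot>\<^bsub>M\<^esub> x) k = a \<otimes>\<^bsub>R\<^esub> f x k"
  using lin_maps_carrier[OF assms(1,2)] assms(3) lin_maps_add[OF assms(1,2), of y] lin_maps_smult[OF assms(1) _ assms(2), of a]
  by (auto simp: free_mod_carrier free_mod_ops)

text \<open>Retracts of R^m and R^n combine to a retract of R^(m + n) by concatenating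
  coordinates.\<close>

lemma fg_projective_prod:
  assumes M: "fg_projective R M" and N: "fg_projective R N"
  shows "fg_projective R (prod_mod M N)"
proof -
  from M obtain m i q where mM: "Module.module R M" and i: "i \<in> lin_maps R M (free_mod R {..<m::nat})"
    and q: "q \<in> lin_maps R (free_mod R {..<m}) M" and qi: "\<forall>x\<in>carrier M. q (i x) = x"
    unfolding fg_projective_def by blast
  from N obtain n j r where mN: "Module.module R N" and j: "j \<in> lin_maps R N (free_mod R {..<n::nat})"
    and r: "r \<in> lin_maps R (free_mod R {..<n}) N" and rj: "\<forall>x\<in>carrier N. r (j x) = x"
    unfolding fg_projective_def by blast
  interpret M: Module.module R M by fact
  interpret N: Module.module R N by fact
  let ?I = "\<lambda>z\<in>carrier (prod_mod M N). \<lambda>k\<in>{..<m + n}. if k < m then i (fst z) k else j (snd z) (k - m)"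
  let ?Q = "\<lambda>c\<in>carrier (free_mod R {..<m + n}). (q (\<lambda>k\<in>{..<m}. c k), r (\<lambda>k\<in>{..<n}. c (k + m)))"
  have ic: "i x k \<in> carrier R" if "x \<in> carrier M" "k < m" for x k
    using lin_maps_free_app(1)[OF i that(1)] that(2) by simp
  have jc: "j x k \<in> carrier R" if "x \<in> carrier N" "k < n" for x k
    using lin_maps_free_app(1)[OF j that(1)] that(2) by simp
  have Il: "?I \<in> lin_maps R (prod_mod M N) (free_mod R {..<m + n})"
  proof (rule lin_mapsI)
    show "?I \<in> carrier (prod_mod M N) \<rightarrow>\<^sub>E carrier (free_mod R {..<m + n})"
      unfolding restrict_PiE_iff free_mod_fin by (auto simp: prod_mod_ops ic jc)
  next
    fix z w assume "z \<in> carrier (prod_mod M N)" "w \<in> carrier (prod_mod M N)"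
    then obtain x y x' y' where "z = (x, y)" "w = (x', y')" "x \<in> carrier M" "y \<in> carrier N" "x' \<in> carrier M" "y' \<in> carrier N"
      by (auto simp: prod_mod_ops)
    then show "?I (z \<oplus>\<^bsub>prod_mod M N\<^esub> w) = ?I z \<oplus>\<^bsub>free_mod R {..<m + n}\<^esub> ?I w"
      by (auto simp: prod_mod_ops free_mod_ops lin_maps_free_app[OF i] lin_maps_free_app[OF j] intro!: restrict_ext)
  next
    fix a z assume "a \<in> carrier R" "z \<in> carrier (prod_mod M N)"
    moreover from this obtain x y where "z = (x, y)" "x \<in> carrier M" "y \<in> carrier N"
      by (auto simp: prod_mod_ops)
    ultimately show "?I (a \<odot>\<^bsub>prod_mod M N\<^esub> z) = a \<odot>\<^bsub>free_mod R {..<m + n}\<^esub> ?I z"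
      by (auto simp: prod_mod_ops free_mod_ops lin_maps_free_app[OF i] lin_maps_free_app[OF j] intro!: restrict_ext)
  qed
  have rs: "(\<lambda>k\<in>{..<m}. c k) \<in> carrier (free_mod R {..<m})" "(\<lambda>k\<in>{..<n}. c (k + m)) \<in> carrier (free_mod R {..<n})"
    if "c \<in> carrier (free_mod R {..<m + n})" for c
    using that by (simp_all add: free_mod_fin PiE_iff)
  have Ql: "?Q \<in> lin_maps R (free_mod R {..<m + n}) (prod_mod M N)"
  proof (rule lin_mapsI)
    show "?Q \<in> carrier (free_mod R {..<m + n}) \<rightarrow>\<^sub>E carrier (prod_mod M N)"
      using rs by (simp add: prod_mod_ops lin_maps_carrier[OF q] lin_maps_carrier[OF r])
    interpret L: Module.module R "free_mod R {..<m + n}" by (rule free_mod_module[OF M.R.is_cring])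
    fix c c' assume c: "c \<in> carrier (free_mod R {..<m + n})" "c' \<in> carrier (free_mod R {..<m + n})"
    have "(\<lambda>k\<in>{..<m}. (c \<oplus>\<^bsub>free_mod R {..<m + n}\<^esub> c') k) = (\<lambda>k\<in>{..<m}. c k) \<oplus>\<^bsub>free_mod R {..<m}\<^esub> (\<lambda>k\<in>{..<m}. c' k)"
      "(\<lambda>k\<in>{..<n}. (c \<oplus>\<^bsub>free_mod R {..<m + n}\<^esub> c') (k + m)) = (\<lambda>k\<in>{..<n}. c (k + m)) \<oplus>\<^bsub>free_mod R {..<n}\<^esub> (\<lambda>k\<in>{..<n}. c' (k + m))"
      by (auto simp: free_mod_ops fun_eq_iff)
    then show "?Q (c \<oplus>\<^bsub>free_mod R {..<m + n}\<^esub> c') = ?Q c \<oplus>\<^bsub>prod_mod M N\<^esub> ?Q c'"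
      using c L.a_closed[OF c] by (simp add: prod_mod_ops lin_maps_add[OF q rs(1) rs(1)] lin_maps_add[OF r rs(2) rs(2)])
  next
    interpret L: Module.module R "free_mod R {..<m + n}" by (rule free_mod_module[OF M.R.is_cring])
    fix a c assume a: "a \<in> carrier R" and c: "c \<in> carrier (free_mod R {..<m + n})"
    have "(\<lambda>k\<in>{..<m}. (a \<odot>\<^bsub>free_mod R {..<m + n}\<^esub> c) k) = a \<odot>\<^bsub>free_mod R {..<m}\<^esub> (\<lambda>k\<in>{..<m}. c k)"
      "(\<lambda>k\<in>{..<n}. (a \<odot>\<^bsub>free_mod R {..<m + n}\<^esub> c) (k + m)) = a \<odot>\<^bsub>free_mod R {..<n}\<^esub> (\<lambda>k\<in>{..<n}. c (k + m))"
      by (auto simp: free_mod_ops fun_eq_iff)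
    then show "?Q (a \<odot>\<^bsub>free_mod R {..<m + n}\<^esub> c) = a \<odot>\<^bsub>prod_mod M N\<^esub> ?Q c"
      using c L.smult_closed[OF a c] by (simp add: prod_mod_ops lin_maps_smult[OF q a rs(1)] lin_maps_smult[OF r a rs(2)])
  qed
  have "?Q (?I z) = z" if z: "z \<in> carrier (prod_mod M N)" for z
  proof -
    obtain x y where xy: "z = (x, y)" "x \<in> carrier M" "y \<in> carrier N" using z by (auto simp: prod_mod_ops)
    have "(\<lambda>k\<in>{..<m}. ?I z k) = i x" "(\<lambda>k\<in>{..<n}. ?I z (k + m)) = j y"
      using lin_maps_carrier[OF i xy(2)] lin_maps_carrier[OF j xy(3)] z
      by (auto simp: xy(1) fun_eq_iff free_mod_fin PiE_iff extensional_def)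
    then show ?thesis using lin_maps_carrier[OF Il z] xy qi rj by simp
  qed
  then show ?thesis unfolding fg_projective_def
    using prod_mod_module[OF mM mN] Il Ql by blast
qed

lemma fg_projective_free: "cring R \<Longrightarrow> fg_projective R (free_mod R {..<n::nat})"
  unfolding fg_projective_def
  by (intro conjI free_mod_module exI[of _ n] bexI[OF _ lin_maps_id[OF free_mod_module]]) simp_all

text \<open>Hom(R^N, M) is the N-th power of M, so it is a retract of R^(N m) if M is one of
  R^m.\<close>

lemma fg_projective_hom_free:
  assumes M: "fg_projective R M"
  shows "fg_projective R (hom_mod R (free_mod R {..<N::nat}) M)"
proof -
  from M obtain m i q where mM: "Module.module R M" and i: "i \<in> lin_maps R M (free_mod R {..<m::nat})"
    and q: "q \<in> lin_maps R (free_mod R {..<m}) M" and qi: "\<forall>x\<in>carrier M. q (i x) = x"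
    unfolding fg_projective_def by blast
  interpret M: Module.module R M by fact
  note R = M.R.is_cring
  let ?F = "free_mod R {..<N}" and ?e = "free_basis R {..<N}"
  have mF: "Module.module R ?F" by (rule free_mod_module[OF R])
  interpret F: Module.module R ?F by (rule mF)
  note mH = hom_mod_module[OF mF mM]
  interpret H: Module.module R "hom_mod R ?F M" by (rule mH)
  have div: "k div m < N" "k mod m < m" if "k < N * m" for k
  proof -
    show "k div m < N" by (rule less_mult_imp_div_less[OF that])
    show "k mod m < m" using that by (cases m) auto
  qed
  have e: "?e k \<in> carrier ?F" if "k < N" for k using that by (simp add: free_basis_carrier[OF R])
  \<comment> \<open>Index k stands for the pair (\<open>k div m\<close>, \<open>k mod m\<close>): a
    basis vector of R^N and a coordinate in R^m.\<close>
  let ?I = "\<lambda>u\<in>lin_maps R ?F M. \<lambda>k\<in>{..<N * m}. i (u (?e (k div m))) (k mod m)"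
  have ic: "i x k \<in> carrier R" if "x \<in> carrier M" "k < m" for x k
    using lin_maps_free_app(1)[OF i that(1)] that(2) by simp
  have Il: "?I \<in> lin_maps R (hom_mod R ?F M) (free_mod R {..<N * m})"
  proof (rule lin_mapsI)
    show "?I \<in> carrier (hom_mod R ?F M) \<rightarrow>\<^sub>E carrier (free_mod R {..<N * m})"
      by (simp add: hom_mod_ops free_mod_fin ic div lin_maps_carrier[OF _ e])
  next
    fix u v assume "u \<in> carrier (hom_mod R ?F M)" "v \<in> carrier (hom_mod R ?F M)"
    with H.a_closed[OF this] show "?I (u \<oplus>\<^bsub>hom_mod R ?F M\<^esub> v) = ?I u \<oplus>\<^bsub>free_mod R {..<N * m}\<^esub> ?I v"
      by (auto simp: hom_mod_ops free_mod_ops div lin_maps_carrier[OF _ e] e lin_maps_free_app[OF i] intro!: restrict_ext)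
  next
    fix a u assume "a \<in> carrier R" "u \<in> carrier (hom_mod R ?F M)"
    with H.smult_closed[OF this] show "?I (a \<odot>\<^bsub>hom_mod R ?F M\<^esub> u) = a \<odot>\<^bsub>free_mod R {..<N * m}\<^esub> ?I u"
      by (auto simp: hom_mod_ops free_mod_ops div lin_maps_carrier[OF _ e] e lin_maps_free_app[OF i] intro!: restrict_ext)
  qed
  let ?r = "\<lambda>c k. \<lambda>l\<in>{..<m}. c (k * m + l)"
  have kl: "k * m + l < N * m" if "k < N" "l < m" for k l
  proof -
    have "k * m + l < Suc k * m" using that by simp
    also have "\<dots> \<le> N * m" using that by (intro mult_right_mono) auto
    finally show ?thesis .
  qed
  have rc: "?r c k \<in> carrier (free_mod R {..<m})" if "c \<in> carrier (free_mod R {..<N * m})" "k < N" for c k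
    using that kl by (simp add: free_mod_fin PiE_iff)
  \<comment> \<open>The block \<open>?r c k\<close> is mapped to M by \<open>q\<close> and
    prescribed as the value on the k-th basis vector.\<close>
  have "\<exists>u. c \<in> carrier (free_mod R {..<N * m}) \<longrightarrow> u \<in> lin_maps R ?F M \<and> (\<forall>k<N. u (?e k) = q (?r c k))" for c
  proof (cases "c \<in> carrier (free_mod R {..<N * m})")
    case True
    have "\<exists>u \<in> lin_maps R ?F M. \<forall>k\<in>{..<N}. u (?e k) = q (?r c k)"
      by (rule free_mod_lin_ex[OF R mM]) (simp add: lin_maps_carrier[OF q rc[OF True]])
    then show ?thesis by auto
  qed simp
  then obtain X where X: "\<And>c. c \<in> carrier (free_mod R {..<N * m}) \<Longrightarrow>
      X c \<in> lin_maps R ?F M \<and> (\<forall>k<N. X c (?e k) = q (?r c k))" by metis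
  let ?Q = "\<lambda>c\<in>carrier (free_mod R {..<N * m}). X c"
  interpret L: Module.module R "free_mod R {..<N * m}" by (rule free_mod_module[OF R])
  have Ql: "?Q \<in> lin_maps R (free_mod R {..<N * m}) (hom_mod R ?F M)"
  proof (rule lin_mapsI)
    show "?Q \<in> carrier (free_mod R {..<N * m}) \<rightarrow>\<^sub>E carrier (hom_mod R ?F M)" using X by (simp add: hom_mod_ops)
  next
    fix c c' assume c: "c \<in> carrier (free_mod R {..<N * m})" "c' \<in> carrier (free_mod R {..<N * m})"
    have rr: "?r (c \<oplus>\<^bsub>free_mod R {..<N * m}\<^esub> c') k = ?r c k \<oplus>\<^bsub>free_mod R {..<m}\<^esub> ?r c' k" if "k < N" for k
      using kl[OF that] by (auto simp: free_mod_ops fun_eq_iff)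
    note XX = X[OF c(1)] X[OF c(2)] X[OF L.a_closed[OF c]]
    have "X (c \<oplus>\<^bsub>free_mod R {..<N * m}\<^esub> c') = X c \<oplus>\<^bsub>hom_mod R ?F M\<^esub> X c'"
    proof (rule free_mod_lin_eqI[OF R mM])
      show "X c \<oplus>\<^bsub>hom_mod R ?F M\<^esub> X c' \<in> lin_maps R ?F M" using XX H.a_closed[of "X c" "X c'"] by (simp add: hom_mod_ops(1))
      fix k assume "k \<in> {..<N}"
      then have "k < N" by simp
      then show "X (c \<oplus>\<^bsub>free_mod R {..<N * m}\<^esub> c') (?e k) = (X c \<oplus>\<^bsub>hom_mod R ?F M\<^esub> X c') (?e k)"
        using XX e by (simp add: hom_mod_ops rr lin_maps_add[OF q rc rc] c)
    qed (use XX in blast)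
    then show "?Q (c \<oplus>\<^bsub>free_mod R {..<N * m}\<^esub> c') = ?Q c \<oplus>\<^bsub>hom_mod R ?F M\<^esub> ?Q c'"
      using c L.a_closed[OF c] by simp
  next
    fix a c assume a: "a \<in> carrier R" and c: "c \<in> carrier (free_mod R {..<N * m})"
    have rr: "?r (a \<odot>\<^bsub>free_mod R {..<N * m}\<^esub> c) k = a \<odot>\<^bsub>free_mod R {..<m}\<^esub> ?r c k" if "k < N" for k
      using kl[OF that] by (auto simp: free_mod_ops fun_eq_iff)
    note XX = X[OF c] X[OF L.smult_closed[OF a c]]
    have "X (a \<odot>\<^bsub>free_mod R {..<N * m}\<^esub> c) = a \<odot>\<^bsub>hom_mod R ?F M\<^esub> X c"
    proof (rule free_mod_lin_eqI[OF R mM])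
      show "a \<odot>\<^bsub>hom_mod R ?F M\<^esub> X c \<in> lin_maps R ?F M" using XX H.smult_closed[OF a, of "X c"] by (simp add: hom_mod_ops(1))
      fix k assume "k \<in> {..<N}"
      then have "k < N" by simp
      then show "X (a \<odot>\<^bsub>free_mod R {..<N * m}\<^esub> c) (?e k) = (a \<odot>\<^bsub>hom_mod R ?F M\<^esub> X c) (?e k)"
        using XX e by (simp add: hom_mod_ops rr lin_maps_smult[OF q a rc] c)
    qed (use XX in blast)
    then show "?Q (a \<odot>\<^bsub>free_mod R {..<N * m}\<^esub> c) = a \<odot>\<^bsub>hom_mod R ?F M\<^esub> ?Q c"
      using c L.smult_closed[OF a c] by simp
  qed
  have "?Q (?I u) = u" if u: "u \<in> carrier (hom_mod R ?F M)" for u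
  proof -
    have u': "u \<in> lin_maps R ?F M" using u by (simp add: hom_mod_ops)
    have c: "?I u \<in> carrier (free_mod R {..<N * m})" by (rule lin_maps_carrier[OF Il u])
    have r: "?r (?I u) k = i (u (?e k))" if k: "k < N" for k
    proof (rule ext)
      fix l
      show "?r (?I u) k l = i (u (?e k)) l"
      proof (cases "l < m")
        case True
        then have "(k * m + l) div m = k" "(k * m + l) mod m = l" by auto
        with True kl[OF k True] u' show ?thesis by simp
      next
        case False
        then show ?thesis using lin_maps_carrier[OF i lin_maps_carrier[OF u' e[OF k]]]
          by (simp add: free_mod_fin PiE_iff extensional_def)
      qed
    qed
    have "X (?I u) = u"
    proof (rule free_mod_lin_eqI[OF R mM conjunct1[OF X[OF c]] u'])
      fix k assume "k \<in> {..<N}"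
      then have k: "k < N" by simp
      have "X (?I u) (?e k) = q (?r (?I u) k)" using X[OF c] k by blast
      also have "\<dots> = u (?e k)" unfolding r[OF k] using qi lin_maps_carrier[OF u' e[OF k]] by blast
      finally show "X (?I u) (?e k) = u (?e k)" .
    qed
    with c show ?thesis by simp
  qed
  then show ?thesis unfolding fg_projective_def using mH Il Ql by blast
qed

section \<open>The category P_R and its power functors\<close>

declare hom_mod_ops(1,2) [simp]

lemma P_cat_simps [simp]:
  "M \<in> Ob (P_cat R) \<longleftrightarrow> fg_projective R M"
  "Hom (P_cat R) M N = hom_mod R M N"
  "Idn (P_cat R) M = (\<lambda>x\<in>carrier M. x)"
  "Cmp (P_cat R) L M N g f = compose (carrier L) g f"
  by (simp_all add: P_cat_def module_cat_def)

lemma Mod_cat_simps [simp]: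
  "M \<in> Ob (Mod_cat R) \<longleftrightarrow> Module.module R M"
  "Hom (Mod_cat R) M N = hom_mod R M N"
  "Idn (Mod_cat R) M = (\<lambda>x\<in>carrier M. x)"
  "Cmp (Mod_cat R) L M N g f = compose (carrier L) g f"
  by (simp_all add: Mod_cat_def module_cat_def)

lemma fg_projective_module: "fg_projective R M \<Longrightarrow> Module.module R M"
  by (simp add: fg_projective_def)

lemma linear_category_P_cat: "linear_category R (P_cat R)"
  unfolding P_cat_def by (rule linear_category_module_cat) (simp add: fg_projective_module)

lemma linear_category_Mod_cat: "linear_category R (Mod_cat R)"
  unfolding Mod_cat_def by (rule linear_category_module_cat) simp

lemma model:
  assumes "fg_projective R X"
  shows "fg_projective R (model R X)" "model_iso R X \<in> lin_maps R X (model R X)"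
    "bij_betw (model_iso R X) (carrier X) (carrier (model R X))"
proof -
  have "\<exists>p. case p of (N, \<phi>) \<Rightarrow> N \<in> Ob (P_cat R) \<and> \<phi> \<in> lin_maps R X N \<and> bij_betw \<phi> (carrier X) (carrier N)"
    using fg_projective_model[OF assms] by simp
  from someI_ex[OF this, folded model_pair_def]
  show "fg_projective R (model R X)" "model_iso R X \<in> lin_maps R X (model R X)"
    "bij_betw (model_iso R X) (carrier X) (carrier (model R X))"
    by (simp_all add: model_def model_iso_def case_prod_beta)
qed

lemma model_inv_iso:
  assumes "fg_projective R X" "x \<in> carrier X"
  shows "model_inv R X (model_iso R X x) = x"
  using model[OF assms(1)] assms(2)
  by (simp add: model_inv_def lin_maps_carrier inv_into_f_f[OF bij_betw_imp_inj_on])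

lemma model_iso_inv:
  assumes "fg_projective R X" "z \<in> carrier (model R X)"
  shows "model_iso R X (model_inv R X z) = z"
  using bij_betw_imp_surj_on[OF model(3)[OF assms(1)]] assms(2) by (simp add: model_inv_def f_inv_into_f)

lemma model_inv_lin:
  assumes X: "fg_projective R X"
  shows "model_inv R X \<in> lin_maps R (model R X) X"
proof (rule lin_mapsI)
  interpret X: Module.module R X by (rule fg_projective_module[OF X])
  have inv: "model_inv R X z \<in> carrier X" if "z \<in> carrier (model R X)" for z
    using bij_betw_imp_surj_on[OF model(3)[OF X]] that by (simp add: model_inv_def inv_into_into)
  have eq: "model_inv R X z = x" if "x \<in> carrier X" "z = model_iso R X x" for x z
    using model_inv_iso[OF X that(1)] that(2) by simp
  show "model_inv R X \<in> carrier (model R X) \<rightarrow>\<^sub>E carrier X"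
    using inv by (simp add: PiE_iff) (simp add: model_inv_def)
  fix z w assume z: "z \<in> carrier (model R X)" and w: "w \<in> carrier (model R X)"
  show "model_inv R X (z \<oplus>\<^bsub>model R X\<^esub> w) = model_inv R X z \<oplus>\<^bsub>X\<^esub> model_inv R X w"
    by (rule eq) (simp_all add: inv z w lin_maps_add[OF model(2)[OF X]] model_iso_inv[OF X])
next
  interpret X: Module.module R X by (rule fg_projective_module[OF X])
  have inv: "model_inv R X z \<in> carrier X" if "z \<in> carrier (model R X)" for z
    using bij_betw_imp_surj_on[OF model(3)[OF X]] that by (simp add: model_inv_def inv_into_into)
  have eq: "model_inv R X z = x" if "x \<in> carrier X" "z = model_iso R X x" for x z
    using model_inv_iso[OF X that(1)] that(2) by simp
  fix a z assume a: "a \<in> carrier R" and z: "z \<in> carrier (model R X)"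
  show "model_inv R X (a \<odot>\<^bsub>model R X\<^esub> z) = a \<odot>\<^bsub>X\<^esub> model_inv R X z"
    by (rule eq) (simp_all add: inv z a lin_maps_smult[OF model(2)[OF X]] model_iso_inv[OF X])
qed

lemma lin_maps_cong:
  assumes "f \<in> lin_maps R M N" "g \<in> extensional (carrier M)" "\<And>x. x \<in> carrier M \<Longrightarrow> g x = f x"
  shows "g \<in> lin_maps R M N"
proof -
  have "g = f" by (rule extensionalityI[OF assms(2) lin_maps_ext[OF assms(1)] assms(3)])
  with assms(1) show ?thesis by simp
qed

text \<open>Linearity is assumed of the restriction because the maps transported later, such as
  \<open>map_prod f id\<close>, are not extensional.\<close>

lemma model_map_lin:
  assumes X: "fg_projective R X" and Y: "fg_projective R Y" and f: "restrict f (carrier X) \<in> lin_maps R X Y"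
  shows "model_map R X Y f \<in> lin_maps R (model R X) (model R Y)"
proof -
  note mX = fg_projective_module[OF model(1)[OF X]]
  have "compose (carrier (model R X)) (compose (carrier X) (model_iso R Y) (restrict f (carrier X))) (model_inv R X)
      \<in> lin_maps R (model R X) (model R Y)"
    by (intro lin_maps_compose[OF mX model_inv_lin[OF X]] lin_maps_compose[OF fg_projective_module[OF X] f] model(2)[OF Y])
  then show ?thesis
    by (rule lin_maps_cong) (simp_all add: model_map_def compose_def lin_maps_carrier[OF model_inv_lin[OF X]])
qed

text \<open>The N-th power is encoded as Hom(R^N, K) rather than as an iterated sum, so that
  precomposing with it is literally the parameterization by R^N. In this form the i-th inclusion
  sends x to the map c \<mapsto> c_i x, and the i-th projection evaluates at the i-th basis
  vector.\<close>

definition pow_obj :: "'r ring \<Rightarrow> nat \<Rightarrow> 'r pmod \<Rightarrow> 'r pmod" where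
  "pow_obj R N K = model R (hom_mod R (free_mod R {..<N}) K)"

definition pow_map :: "'r ring \<Rightarrow> nat \<Rightarrow> 'r pmod \<Rightarrow> 'r pmod \<Rightarrow> ((nat \<Rightarrow> 'r) \<Rightarrow> (nat \<Rightarrow> 'r)) \<Rightarrow> (nat \<Rightarrow> 'r) \<Rightarrow> (nat \<Rightarrow> 'r)" where
  "pow_map R N K L f = model_map R (hom_mod R (free_mod R {..<N}) K) (hom_mod R (free_mod R {..<N}) L)
     (\<lambda>u. compose (carrier (free_mod R {..<N})) f u)"

definition pow_inj :: "'r ring \<Rightarrow> nat \<Rightarrow> nat \<Rightarrow> 'r pmod \<Rightarrow> (nat \<Rightarrow> 'r) \<Rightarrow> (nat \<Rightarrow> 'r)" where
  "pow_inj R N i K = (\<lambda>x\<in>carrier K. model_iso R (hom_mod R (free_mod R {..<N}) K)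
     (\<lambda>c\<in>carrier (free_mod R {..<N}). c i \<odot>\<^bsub>K\<^esub> x))"

definition pow_prj :: "'r ring \<Rightarrow> nat \<Rightarrow> nat \<Rightarrow> 'r pmod \<Rightarrow> (nat \<Rightarrow> 'r) \<Rightarrow> (nat \<Rightarrow> 'r)" where
  "pow_prj R N i K = (\<lambda>z\<in>carrier (pow_obj R N K).
     model_inv R (hom_mod R (free_mod R {..<N}) K) z (free_basis R {..<N} i))"

text \<open>This is the link through which closure of \<open>A\<close> under parameterization
  becomes closure under \<open>T\<close>.\<close>

lemma param_hom_precomp:
  "param_hom R F (free_mod R {..<N}) = precomp (pow_obj R N) (pow_map R N) F"
  by (simp add: param_hom_def precomp_def pow_obj_def pow_map_def)

lemma power_functor_P_cat:
  assumes R: "cring R"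
  shows "power_functor R (P_cat R) N (pow_obj R N) (pow_map R N) (pow_inj R N) (pow_prj R N)"
proof (rule linear_category.power_functorI[OF linear_category_P_cat], unfold P_cat_simps hom_mod_ops(1,2))
  interpret R: cring R by (rule R)
  let ?F = "free_mod R {..<N}" and ?e = "free_basis R {..<N}"
  let ?H = "hom_mod R ?F"
  have mF: "Module.module R ?F" by (rule free_mod_module[OF R])
  interpret F: Module.module R ?F by (rule mF)
  have fH: "fg_projective R (?H K)" if "fg_projective R K" for K :: "'a pmod"
    by (rule fg_projective_hom_free[OF that])
  have e: "i < N \<Longrightarrow> ?e i \<in> carrier ?F" for i by (simp add: free_basis_carrier[OF R])
  have ci: "c i \<in> carrier R" if "c \<in> carrier ?F" "i < N" for c i
    using that by (simp add: free_mod_fin PiE_iff)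
  let ?j = "\<lambda>K i x. \<lambda>c\<in>carrier ?F. c i \<odot>\<^bsub>K\<^esub> x"
  have jl: "?j K i x \<in> lin_maps R ?F K" if K: "fg_projective R K" and i: "i < N" and x: "x \<in> carrier K" for K :: "'a pmod" and i x
  proof -
    interpret K: Module.module R K by (rule fg_projective_module[OF K])
    show ?thesis
    proof (rule lin_mapsI)
      show "?j K i x \<in> carrier ?F \<rightarrow>\<^sub>E carrier K" using x ci[OF _ i] by simp
      fix c c' assume "c \<in> carrier ?F" "c' \<in> carrier ?F"
      moreover from F.a_closed[OF this] have "c \<oplus>\<^bsub>?F\<^esub> c' \<in> carrier ?F" .
      ultimately show "?j K i x (c \<oplus>\<^bsub>?F\<^esub> c') = ?j K i x c \<oplus>\<^bsub>K\<^esub> ?j K i x c'"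
        using ci[OF _ i] i x by (simp add: free_mod_ops K.smult_l_distr)
    next
      fix a c assume "a \<in> carrier R" "c \<in> carrier ?F"
      moreover from F.smult_closed[OF this] have "a \<odot>\<^bsub>?F\<^esub> c \<in> carrier ?F" .
      ultimately show "?j K i x (a \<odot>\<^bsub>?F\<^esub> c) = a \<odot>\<^bsub>K\<^esub> ?j K i x c"
        using ci[OF _ i] i x by (simp add: free_mod_ops K.smult_assoc1)
    qed
  qed
  have je: "?j K i x (?e k) = (if k = i then x else \<zero>\<^bsub>K\<^esub>)" if K: "fg_projective R K" and i: "i < N" "k < N" and x: "x \<in> carrier K" for K :: "'a pmod" and i k x
  proof -
    interpret K: Module.module R K by (rule fg_projective_module[OF K])
    show ?thesis using i x e by (auto simp: free_basis_def)
  qed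
  have inv: "model_inv R (?H K) z \<in> lin_maps R ?F K" if "fg_projective R K" "z \<in> carrier (pow_obj R N K)" for K :: "'a pmod" and z
    using lin_maps_carrier[OF model_inv_lin[OF fH[OF that(1)]]] that(2) by (simp add: pow_obj_def hom_mod_ops)
  show D: "fg_projective R (pow_obj R N K)" if "fg_projective R K" for K
    unfolding pow_obj_def by (rule model[OF fH[OF that]])
  show Dm: "pow_map R N K L f \<in> lin_maps R (pow_obj R N K) (pow_obj R N L)"
    if K: "fg_projective R K" and L: "fg_projective R L" and f: "f \<in> lin_maps R K L" for K L f
    unfolding pow_obj_def pow_map_def
  proof (rule model_map_lin[OF fH[OF K] fH[OF L]])
    interpret HK: Module.module R "?H K" by (rule fg_projective_module[OF fH[OF K]])
    show "restrict (\<lambda>u. compose (carrier ?F) f u) (carrier (?H K)) \<in> lin_maps R (?H K) (?H L)"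
    proof (rule lin_mapsI)
      show "restrict (\<lambda>u. compose (carrier ?F) f u) (carrier (?H K)) \<in> carrier (?H K) \<rightarrow>\<^sub>E carrier (?H L)"
        using lin_maps_compose[OF mF _ f] by (simp add: hom_mod_ops)
    next
      fix u v assume uv: "u \<in> carrier (?H K)" "v \<in> carrier (?H K)"
      with HK.a_closed[OF uv]
      show "restrict (\<lambda>u. compose (carrier ?F) f u) (carrier (?H K)) (u \<oplus>\<^bsub>?H K\<^esub> v) =
          restrict (\<lambda>u. compose (carrier ?F) f u) (carrier (?H K)) u \<oplus>\<^bsub>?H L\<^esub> restrict (\<lambda>u. compose (carrier ?F) f u) (carrier (?H K)) v"
        by (simp add: hom_mod_ops compose_def lin_maps_carrier[of u] lin_maps_carrier[of v] lin_maps_add[OF f] cong: restrict_cong)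
    next
      fix a u assume au: "a \<in> carrier R" "u \<in> carrier (?H K)"
      with HK.smult_closed[OF au]
      show "restrict (\<lambda>u. compose (carrier ?F) f u) (carrier (?H K)) (a \<odot>\<^bsub>?H K\<^esub> u) =
          a \<odot>\<^bsub>?H L\<^esub> restrict (\<lambda>u. compose (carrier ?F) f u) (carrier (?H K)) u"
        by (simp add: hom_mod_ops compose_def lin_maps_carrier[of u] lin_maps_smult[OF f] cong: restrict_cong)
    qed
  qed
  show inj: "pow_inj R N i K \<in> lin_maps R K (pow_obj R N K)" if K: "fg_projective R K" and i: "i < N" for K i
  proof -
    interpret K: Module.module R K by (rule fg_projective_module[OF K])
    have "(\<lambda>x\<in>carrier K. ?j K i x) \<in> lin_maps R K (?H K)"
    proof (rule lin_mapsI)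
      show "(\<lambda>x\<in>carrier K. ?j K i x) \<in> carrier K \<rightarrow>\<^sub>E carrier (?H K)" using jl[OF K i] by (simp add: hom_mod_ops)
    qed (use ci[OF _ i] i in \<open>simp_all add: hom_mod_ops K.smult_r_distr K.smult_assoc1[symmetric] R.m_comm cong: restrict_cong\<close>)
    from lin_maps_compose[OF K.module_axioms this model(2)[OF fH[OF K]]]
    show ?thesis by (simp add: pow_inj_def pow_obj_def compose_def cong: restrict_cong)
  qed
  show prj: "pow_prj R N i K \<in> lin_maps R (pow_obj R N K) K" if K: "fg_projective R K" and i: "i < N" for K i
  proof -
    have "(\<lambda>u\<in>carrier (?H K). u (?e i)) \<in> lin_maps R (?H K) K"
    proof (rule lin_mapsI)
      interpret HK: Module.module R "?H K" by (rule fg_projective_module[OF fH[OF K]])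
      show "(\<lambda>u\<in>carrier (?H K). u (?e i)) \<in> carrier (?H K) \<rightarrow>\<^sub>E carrier K"
        using e[OF i] by (simp add: hom_mod_ops lin_maps_carrier)
      fix u v assume uv: "u \<in> carrier (?H K)" "v \<in> carrier (?H K)"
      then show "(\<lambda>u\<in>carrier (?H K). u (?e i)) (u \<oplus>\<^bsub>?H K\<^esub> v) = (\<lambda>u\<in>carrier (?H K). u (?e i)) u \<oplus>\<^bsub>K\<^esub> (\<lambda>u\<in>carrier (?H K). u (?e i)) v"
        using e[OF i] HK.a_closed[OF uv] by (simp add: hom_mod_ops)
    next
      interpret HK: Module.module R "?H K" by (rule fg_projective_module[OF fH[OF K]])
      fix a u assume au: "a \<in> carrier R" "u \<in> carrier (?H K)"
      then show "(\<lambda>u\<in>carrier (?H K). u (?e i)) (a \<odot>\<^bsub>?H K\<^esub> u) = a \<odot>\<^bsub>K\<^esub> (\<lambda>u\<in>carrier (?H K). u (?e i)) u"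
        using e[OF i] HK.smult_closed[OF au] by (simp add: hom_mod_ops)
    qed
    from lin_maps_compose[OF fg_projective_module[OF D[OF K, unfolded pow_obj_def]] model_inv_lin[OF fH[OF K]] this]
    have *: "compose (carrier (model R (?H K))) (\<lambda>u\<in>carrier (?H K). u (?e i)) (model_inv R (?H K)) \<in> lin_maps R (pow_obj R N K) K"
      by (simp add: pow_obj_def)
    show ?thesis
      by (rule lin_maps_cong[OF *])
        (use inv[OF K] in \<open>simp_all add: pow_prj_def compose_def pow_obj_def\<close>)
  qed
  show "compose (carrier K) (pow_prj R N i K) (pow_inj R N j K) =
      (if i = j then \<lambda>x\<in>carrier K. x else (\<lambda>x\<in>carrier K. \<zero>\<^bsub>K\<^esub>))"
    if K: "fg_projective R K" and ij: "i < N" "j < N" for K i j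
  proof -
    have "pow_prj R N i K (pow_inj R N j K x) = (if i = j then x else \<zero>\<^bsub>K\<^esub>)" if x: "x \<in> carrier K" for x
    proof -
      have "pow_inj R N j K x \<in> carrier (pow_obj R N K)" by (rule lin_maps_carrier[OF inj[OF K ij(2)] x])
      then have "pow_prj R N i K (pow_inj R N j K x) = ?j K j x (?e i)"
        using x jl[OF K ij(2) x] by (simp add: pow_prj_def pow_inj_def model_inv_iso[OF fH[OF K]] hom_mod_ops)
      then show ?thesis using je[OF K ij(2,1) x] by simp
    qed
    then show ?thesis by (auto simp: compose_def restrict_def fun_eq_iff)
  qed
  show "compose (carrier (pow_obj R N K)) (pow_prj R N i L) (pow_map R N K L f) =
      compose (carrier (pow_obj R N K)) f (pow_prj R N i K)"
    if K: "fg_projective R K" and L: "fg_projective R L" and f: "f \<in> lin_maps R K L" and i: "i < N" for K L f i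
  proof -
    have "pow_prj R N i L (pow_map R N K L f z) = f (pow_prj R N i K z)" if z: "z \<in> carrier (pow_obj R N K)" for z
    proof -
      have "compose (carrier ?F) f (model_inv R (?H K) z) \<in> carrier (?H L)"
        using lin_maps_compose[OF mF inv[OF K z] f] by (simp add: hom_mod_ops)
      then show ?thesis
        using lin_maps_carrier[OF Dm[OF K L f] z] z e[OF i]
        by (simp add: pow_prj_def pow_map_def model_map_def pow_obj_def model_inv_iso[OF fH[OF L]] compose_def)
    qed
    then show ?thesis by (simp add: compose_def cong: restrict_cong)
  qed
  \<comment> \<open>A linear map on R^N is determined by its values on the basis, which are what the
    projections record.\<close>
  show "g = h" if K: "fg_projective R K" and X: "fg_projective R X" and g: "g \<in> lin_maps R X (pow_obj R N K)"
      and h: "h \<in> lin_maps R X (pow_obj R N K)"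
      and eq: "\<And>i. i < N \<Longrightarrow> compose (carrier X) (pow_prj R N i K) g = compose (carrier X) (pow_prj R N i K) h" for K X g h
  proof (rule lin_maps_eqI[OF g h])
    fix x assume x: "x \<in> carrier X"
    note gx = lin_maps_carrier[OF g x] and hx = lin_maps_carrier[OF h x]
    have "model_inv R (?H K) (g x) = model_inv R (?H K) (h x)"
    proof (rule free_mod_lin_eqI[OF R fg_projective_module[OF K] inv[OF K gx] inv[OF K hx]])
      fix i assume "i \<in> {..<N}"
      then have "pow_prj R N i K (g x) = pow_prj R N i K (h x)"
        using fun_cong[OF eq, of i x] x by (simp add: compose_def)
      then show "model_inv R (?H K) (g x) (?e i) = model_inv R (?H K) (h x) (?e i)"
        using gx hx by (simp add: pow_prj_def)
    qed
    then have "model_iso R (?H K) (model_inv R (?H K) (g x)) = model_iso R (?H K) (model_inv R (?H K) (h x))" by simp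
    then show "g x = h x" using model_iso_inv[OF fH[OF K]] gx hx by (simp add: pow_obj_def)
  qed
qed

section \<open>Iterated sums, cross effects and degree\<close>

definition P_inl :: "'r ring \<Rightarrow> 'r pmod \<Rightarrow> 'r pmod \<Rightarrow> (nat \<Rightarrow> 'r) \<Rightarrow> (nat \<Rightarrow> 'r)" where
  "P_inl R X Y = (\<lambda>x\<in>carrier X. model_iso R (prod_mod X Y) (x, \<zero>\<^bsub>Y\<^esub>))"

definition P_inr :: "'r ring \<Rightarrow> 'r pmod \<Rightarrow> 'r pmod \<Rightarrow> (nat \<Rightarrow> 'r) \<Rightarrow> (nat \<Rightarrow> 'r)" where
  "P_inr R X Y = (\<lambda>y\<in>carrier Y. model_iso R (prod_mod X Y) (\<zero>\<^bsub>X\<^esub>, y))"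

lemma P_sum_fg_projective:
  "fg_projective R X \<Longrightarrow> fg_projective R Y \<Longrightarrow> fg_projective R (P_sum R X Y)"
  unfolding P_sum_def by (intro model fg_projective_prod)

lemma P_sum_maps:
  assumes X: "fg_projective R X" and Y: "fg_projective R Y"
  shows "P_inl R X Y \<in> lin_maps R X (P_sum R X Y)" "P_inr R X Y \<in> lin_maps R Y (P_sum R X Y)"
    "P_fst R X Y \<in> lin_maps R (P_sum R X Y) X" "P_snd R X Y \<in> lin_maps R (P_sum R X Y) Y"
    "x \<in> carrier X \<Longrightarrow> P_fst R X Y (P_inl R X Y x) = x"
    "x \<in> carrier X \<Longrightarrow> P_snd R X Y (P_inl R X Y x) = \<zero>\<^bsub>Y\<^esub>"
    "y \<in> carrier Y \<Longrightarrow> P_fst R X Y (P_inr R X Y y) = \<zero>\<^bsub>X\<^esub>"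
    "y \<in> carrier Y \<Longrightarrow> P_snd R X Y (P_inr R X Y y) = y"
proof -
  interpret X: Module.module R X by (rule fg_projective_module[OF X])
  interpret Y: Module.module R Y by (rule fg_projective_module[OF Y])
  note P = fg_projective_prod[OF X Y]
  note i = model(2)[OF P] and n = model_inv_lin[OF P]
  note mS = fg_projective_module[OF model(1)[OF P]]
  have "(\<lambda>x\<in>carrier X. (x, \<zero>\<^bsub>Y\<^esub>)) \<in> lin_maps R X (prod_mod X Y)"
    by (rule lin_mapsI) (simp_all add: prod_mod_ops)
  from lin_maps_compose[OF X.module_axioms this i] show inl: "P_inl R X Y \<in> lin_maps R X (P_sum R X Y)"
    by (simp add: P_inl_def P_sum_def compose_def cong: restrict_cong)
  have "(\<lambda>y\<in>carrier Y. (\<zero>\<^bsub>X\<^esub>, y)) \<in> lin_maps R Y (prod_mod X Y)"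
    by (rule lin_mapsI) (simp_all add: prod_mod_ops)
  from lin_maps_compose[OF Y.module_axioms this i] show inr: "P_inr R X Y \<in> lin_maps R Y (P_sum R X Y)"
    by (simp add: P_inr_def P_sum_def compose_def cong: restrict_cong)
  have f: "(\<lambda>z\<in>carrier (prod_mod X Y). fst z) \<in> lin_maps R (prod_mod X Y) X"
    by (rule lin_mapsI) (auto simp: prod_mod_ops)
  show "P_fst R X Y \<in> lin_maps R (P_sum R X Y) X"
    by (rule lin_maps_cong[OF lin_maps_compose[OF mS n f, folded P_sum_def]])
      (simp_all add: P_fst_def compose_def P_sum_def lin_maps_carrier[OF n])
  have f: "(\<lambda>z\<in>carrier (prod_mod X Y). snd z) \<in> lin_maps R (prod_mod X Y) Y"
    by (rule lin_mapsI) (auto simp: prod_mod_ops)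
  show "P_snd R X Y \<in> lin_maps R (P_sum R X Y) Y"
    by (rule lin_maps_cong[OF lin_maps_compose[OF mS n f, folded P_sum_def]])
      (simp_all add: P_snd_def compose_def P_sum_def lin_maps_carrier[OF n])
  show "P_fst R X Y (P_inl R X Y x) = x" "P_snd R X Y (P_inl R X Y x) = \<zero>\<^bsub>Y\<^esub>" if "x \<in> carrier X"
    using that lin_maps_carrier[OF inl that]
    by (simp_all add: P_fst_def P_snd_def P_inl_def model_inv_iso[OF P] prod_mod_ops)
  show "P_fst R X Y (P_inr R X Y y) = \<zero>\<^bsub>X\<^esub>" "P_snd R X Y (P_inr R X Y y) = y" if "y \<in> carrier Y"
    using that lin_maps_carrier[OF inr that]
    by (simp_all add: P_fst_def P_snd_def P_inr_def model_inv_iso[OF P] prod_mod_ops)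
qed

lemma sum_map:
  assumes X: "fg_projective R X" and Y: "fg_projective R Y" and Z: "fg_projective R Z" and f: "f \<in> lin_maps R X Y"
  defines "h \<equiv> model_map R (prod_mod X Z) (prod_mod Y Z) (map_prod f id)"
  shows "h \<in> lin_maps R (P_sum R X Z) (P_sum R Y Z)"
    and "x \<in> carrier X \<Longrightarrow> h (P_inl R X Z x) = P_inl R Y Z (f x)"
proof -
  interpret X: Module.module R X by (rule fg_projective_module[OF X])
  interpret Y: Module.module R Y by (rule fg_projective_module[OF Y])
  interpret Z: Module.module R Z by (rule fg_projective_module[OF Z])
  note XZ = fg_projective_prod[OF X Z] and YZ = fg_projective_prod[OF Y Z]
  have "restrict (map_prod f id) (carrier (prod_mod X Z)) \<in> lin_maps R (prod_mod X Z) (prod_mod Y Z)"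
    by (rule lin_mapsI) (auto simp: prod_mod_ops lin_maps_carrier[OF f] lin_maps_add[OF f] lin_maps_smult[OF f])
  then show "h \<in> lin_maps R (P_sum R X Z) (P_sum R Y Z)"
    unfolding h_def P_sum_def by (rule model_map_lin[OF XZ YZ])
  assume x: "x \<in> carrier X"
  then have "(x, \<zero>\<^bsub>Z\<^esub>) \<in> carrier (prod_mod X Z)" by (simp add: prod_mod_ops)
  then show "h (P_inl R X Z x) = P_inl R Y Z (f x)"
    using x lin_maps_carrier[OF f x] lin_maps_carrier[OF model(2)[OF XZ]]
    by (simp add: h_def model_map_def P_inl_def model_inv_iso[OF XZ])
qed

lemma list_sum_Cons [simp]: "list_sum R X (Z # Zs) = list_sum R (P_sum R X Z) Zs"
  and list_sum_Nil [simp]: "list_sum R X [] = X"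
  by (simp_all add: list_sum_def)

lemma list_sum_fg_projective:
  "fg_projective R X \<Longrightarrow> (\<And>Z. Z \<in> set Zs \<Longrightarrow> fg_projective R Z) \<Longrightarrow> fg_projective R (list_sum R X Zs)"
  by (induction Zs arbitrary: X) (simp_all add: P_sum_fg_projective)

lemma list_sum_map_lin:
  "fg_projective R X \<Longrightarrow> fg_projective R Y \<Longrightarrow> f \<in> lin_maps R X Y \<Longrightarrow> (\<And>Z. Z \<in> set Zs \<Longrightarrow> fg_projective R Z) \<Longrightarrow>
    list_sum_map R X Y f Zs \<in> lin_maps R (list_sum R X Zs) (list_sum R Y Zs)"
  by (induction Zs arbitrary: X Y f) (simp_all add: P_sum_fg_projective sum_map)

text \<open>The summand \<open>X\<close> of \<open>list_sum R X Zs\<close> has index \<open>0\<close>.\<close>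

fun list_inj :: "'r ring \<Rightarrow> 'r pmod \<Rightarrow> 'r pmod list \<Rightarrow> nat \<Rightarrow> (nat \<Rightarrow> 'r) \<Rightarrow> (nat \<Rightarrow> 'r)" where
  "list_inj R X [] i = (\<lambda>x. x)"
| "list_inj R X (Z # Zs) i = (if i = 0 then list_inj R (P_sum R X Z) Zs 0 \<circ> P_inl R X Z
     else if i = 1 then list_inj R (P_sum R X Z) Zs 0 \<circ> P_inr R X Z
     else list_inj R (P_sum R X Z) Zs (i - 1))"

text \<open>Sums are nested to the left: \<open>X\<close> and \<open>Z\<close> both sit inside the
  summand of index 0 of the sum over the shorter list, and all later indices drop by one.\<close>

fun list_prj :: "'r ring \<Rightarrow> 'r pmod \<Rightarrow> 'r pmod list \<Rightarrow> nat \<Rightarrow> (nat \<Rightarrow> 'r) \<Rightarrow> (nat \<Rightarrow> 'r)" where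
  "list_prj R X [] i = (\<lambda>x. x)"
| "list_prj R X (Z # Zs) i = (if i = 0 then P_fst R X Z \<circ> list_prj R (P_sum R X Z) Zs 0
     else if i = 1 then P_snd R X Z \<circ> list_prj R (P_sum R X Z) Zs 0
     else list_prj R (P_sum R X Z) Zs (i - 1))"

text \<open>Linear maps without the extensionality built into \<open>lin_maps\<close>; these compose with \<open>(\<circ>)\<close>.\<close>

definition linear_on :: "'r ring \<Rightarrow> ('r, 'a) module \<Rightarrow> ('r, 'b) module \<Rightarrow> ('a \<Rightarrow> 'b) \<Rightarrow> bool" where
  "linear_on R M N f \<longleftrightarrow> restrict f (carrier M) \<in> lin_maps R M N"

lemma linear_onI: "f \<in> lin_maps R M N \<Longrightarrow> linear_on R M N f"
  unfolding linear_on_def by (erule lin_maps_cong) simp_all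

lemma linear_on_id: "Module.module R M \<Longrightarrow> linear_on R M M (\<lambda>x. x)"
  unfolding linear_on_def by (rule lin_maps_id)

lemma linear_on_carrier: "linear_on R M N f \<Longrightarrow> x \<in> carrier M \<Longrightarrow> f x \<in> carrier N"
  unfolding linear_on_def using lin_maps_carrier by fastforce

lemma linear_on_comp:
  assumes L: "Module.module R L" and f: "linear_on R L M f" and g: "linear_on R M N g"
  shows "linear_on R L N (g \<circ> f)"
  unfolding linear_on_def
  by (rule lin_maps_cong[OF lin_maps_compose[OF L f[unfolded linear_on_def] g[unfolded linear_on_def]]])
    (simp_all add: compose_def linear_on_carrier[OF f])

lemma list_inj_lin:
  "fg_projective R X \<Longrightarrow> (\<And>Z. Z \<in> set Zs \<Longrightarrow> fg_projective R Z) \<Longrightarrow> i \<le> length Zs \<Longrightarrow>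
    linear_on R ((X # Zs) ! i) (list_sum R X Zs) (list_inj R X Zs i)"
proof (induction Zs arbitrary: X i)
  case Nil
  then show ?case by (simp add: linear_on_id fg_projective_module)
next
  case (Cons Z Zs)
  note X = Cons.prems(1) and Z = Cons.prems(2)[of Z, simplified]
  note XZ = P_sum_fg_projective[OF X Z]
  consider "i = 0" | "i = 1" | j where "i = Suc (Suc j)" by (metis One_nat_def not0_implies_Suc)
  then show ?case
  proof cases
    case 1
    have "linear_on R (P_sum R X Z) (list_sum R (P_sum R X Z) Zs) (list_inj R (P_sum R X Z) Zs 0)"
      using Cons.IH[OF XZ, of 0] Cons.prems by simp
    from linear_on_comp[OF fg_projective_module[OF X] linear_onI[OF P_sum_maps(1)[OF X Z]] this]
    show ?thesis by (simp add: 1 comp_def)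
  next
    case 2
    have "linear_on R (P_sum R X Z) (list_sum R (P_sum R X Z) Zs) (list_inj R (P_sum R X Z) Zs 0)"
      using Cons.IH[OF XZ, of 0] Cons.prems by simp
    from linear_on_comp[OF fg_projective_module[OF Z] linear_onI[OF P_sum_maps(2)[OF X Z]] this]
    show ?thesis by (simp add: 2 comp_def)
  next
    case (3 j)
    then show ?thesis using Cons.IH[OF XZ, of "Suc j"] Cons.prems by simp
  qed
qed

lemma list_prj_lin:
  "fg_projective R X \<Longrightarrow> (\<And>Z. Z \<in> set Zs \<Longrightarrow> fg_projective R Z) \<Longrightarrow> i \<le> length Zs \<Longrightarrow>
    linear_on R (list_sum R X Zs) ((X # Zs) ! i) (list_prj R X Zs i)"
proof (induction Zs arbitrary: X i)
  case Nil
  then show ?case by (simp add: linear_on_id fg_projective_module)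
next
  case (Cons Z Zs)
  note X = Cons.prems(1) and Z = Cons.prems(2)[of Z, simplified]
  note XZ = P_sum_fg_projective[OF X Z]
  have L: "fg_projective R (list_sum R (P_sum R X Z) Zs)"
    using Cons.prems(2) by (intro list_sum_fg_projective XZ) simp
  consider "i = 0" | "i = 1" | j where "i = Suc (Suc j)" by (metis One_nat_def not0_implies_Suc)
  then show ?case
  proof cases
    case 1
    have "linear_on R (list_sum R (P_sum R X Z) Zs) (P_sum R X Z) (list_prj R (P_sum R X Z) Zs 0)"
      using Cons.IH[OF XZ, of 0] Cons.prems by simp
    from linear_on_comp[OF fg_projective_module[OF L] this linear_onI[OF P_sum_maps(3)[OF X Z]]]
    show ?thesis by (simp add: 1 comp_def)
  next
    case 2
    have "linear_on R (list_sum R (P_sum R X Z) Zs) (P_sum R X Z) (list_prj R (P_sum R X Z) Zs 0)"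
      using Cons.IH[OF XZ, of 0] Cons.prems by simp
    from linear_on_comp[OF fg_projective_module[OF L] this linear_onI[OF P_sum_maps(4)[OF X Z]]]
    show ?thesis by (simp add: 2 comp_def)
  next
    case (3 j)
    then show ?thesis using Cons.IH[OF XZ, of "Suc j"] Cons.prems by simp
  qed
qed

lemma linear_on_zero: "Module.module R M \<Longrightarrow> Module.module R N \<Longrightarrow> linear_on R M N f \<Longrightarrow> f \<zero>\<^bsub>M\<^esub> = \<zero>\<^bsub>N\<^esub>"
  unfolding linear_on_def using lin_maps_zero[of R M N "restrict f (carrier M)"]
  by (metis abelian_group.axioms(1) abelian_monoid.zero_closed module.axioms(2) restrict_apply')

lemma list_prj_inj:
  "fg_projective R X \<Longrightarrow> (\<And>Z. Z \<in> set Zs \<Longrightarrow> fg_projective R Z) \<Longrightarrow> i \<le> length Zs \<Longrightarrow> j \<le> length Zs \<Longrightarrow>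
    x \<in> carrier ((X # Zs) ! i) \<Longrightarrow>
    list_prj R X Zs j (list_inj R X Zs i x) = (if i = j then x else \<zero>\<^bsub>(X # Zs) ! j\<^esub>)"
proof (induction Zs arbitrary: X i j x)
  case Nil
  then show ?case by simp
next
  case (Cons Z Zs)
  note X = Cons.prems(1) and Z = Cons.prems(2)[of Z, simplified]
  note XZ = P_sum_fg_projective[OF X Z]
  have Zs: "W \<in> set Zs \<Longrightarrow> fg_projective R W" for W using Cons.prems(2) by simp
  note m = P_sum_maps[OF X Z] and mXZ = fg_projective_module[OF XZ]
  have z: "P_fst R X Z \<zero>\<^bsub>P_sum R X Z\<^esub> = \<zero>\<^bsub>X\<^esub>" "P_snd R X Z \<zero>\<^bsub>P_sum R X Z\<^esub> = \<zero>\<^bsub>Z\<^esub>"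
    by (rule lin_maps_zero[OF mXZ fg_projective_module[OF X] m(3)] lin_maps_zero[OF mXZ fg_projective_module[OF Z] m(4)])+
  note IH = Cons.IH[OF XZ Zs]
  have ca: "i = 0 \<or> i = 1 \<or> (\<exists>k. i = Suc (Suc k))" for i by (metis One_nat_def not0_implies_Suc)
  show ?case using ca[of i] ca[of j]
    by (elim disjE exE) (use Cons.prems(3-5) in \<open>simp_all add: IH lin_maps_carrier[OF m(1)] lin_maps_carrier[OF m(2)] m(5-8) z\<close>)
qed

lemma list_sum_map_inj:
  "fg_projective R X \<Longrightarrow> fg_projective R Y \<Longrightarrow> f \<in> lin_maps R X Y \<Longrightarrow> (\<And>Z. Z \<in> set Zs \<Longrightarrow> fg_projective R Z) \<Longrightarrow>
    x \<in> carrier X \<Longrightarrow> list_sum_map R X Y f Zs (list_inj R X Zs 0 x) = list_inj R Y Zs 0 (f x)"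
proof (induction Zs arbitrary: X Y f x)
  case Nil
  then show ?case by simp
next
  case (Cons Z Zs)
  note X = Cons.prems(1) and Y = Cons.prems(2) and f = Cons.prems(3) and Z = Cons.prems(4)[of Z, simplified]
  have Zs: "W \<in> set Zs \<Longrightarrow> fg_projective R W" for W using Cons.prems(4) by simp
  show ?case
    using Cons.IH[OF P_sum_fg_projective[OF X Z] P_sum_fg_projective[OF Y Z] sum_map(1)[OF X Y Z f] Zs
        lin_maps_carrier[OF P_sum_maps(1)[OF X Z] Cons.prems(5)]] sum_map(2)[OF X Y Z f Cons.prems(5)] by (simp add: id_def)
qed

text \<open>Every map in the recursive definition of the cross effect vanishes on a summand:
  \<open>P_fst\<close> on the one of index 1, \<open>P_snd\<close> on the one of index 0, and the
  map to 0 in the base case on the only one. An element killed by all maps that vanish on some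
  summand therefore qualifies.\<close>

lemma cross_effectI:
  assumes F: "is_functor (P_cat R) (Mod_cat R) F"
  shows "fg_projective R X \<Longrightarrow> (\<And>Z. Z \<in> set Zs \<Longrightarrow> fg_projective R Z) \<Longrightarrow> x \<in> carrier (fobj F (list_sum R X Zs)) \<Longrightarrow>
    (\<And>i Y g. i \<le> length Zs \<Longrightarrow> fg_projective R Y \<Longrightarrow> g \<in> lin_maps R (list_sum R X Zs) Y \<Longrightarrow>
      (\<And>z. z \<in> carrier ((X # Zs) ! i) \<Longrightarrow> g (list_inj R X Zs i z) = \<zero>\<^bsub>Y\<^esub>) \<Longrightarrow>
      farr F (list_sum R X Zs) Y g x = \<zero>\<^bsub>fobj F Y\<^esub>) \<Longrightarrow>
    x \<in> cross_effect R F X Zs"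
proof (induction Zs arbitrary: X)
  case (Nil X)
  have fz: "fg_projective R (P_zero R)" if "cring R" using fg_projective_free[OF that, of 0] by (simp add: P_zero_def lessThan_def)
  have R: "cring R" using fg_projective_module[OF Nil(1)] by (rule module.axioms)
  have z: "(\<lambda>x\<in>carrier X. \<zero>\<^bsub>P_zero R\<^esub>) \<in> lin_maps R X (P_zero R)"
    using linear_category.zero_arr_closed[OF linear_category_P_cat, of X R "P_zero R"] Nil(1) fz[OF R] by simp
  have "farr F (list_sum R X []) (P_zero R) (\<lambda>x\<in>carrier X. \<zero>\<^bsub>P_zero R\<^esub>) x = \<zero>\<^bsub>fobj F (P_zero R)\<^esub>"
    by (rule Nil(4)[of 0]) (use fz[OF R] z in \<open>simp_all add: restrict_def\<close>)
  then show ?case using Nil(3) by simp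
next
  case (Cons Z Zs X)
  note X = Cons.prems(1) and Z = Cons.prems(2)[of Z, simplified]
  have Zs: "W \<in> set Zs \<Longrightarrow> fg_projective R W" for W using Cons.prems(2) by simp
  note XZ = P_sum_fg_projective[OF X Z] and m = P_sum_maps[OF X Z]
  have kill: "farr F (list_sum R (P_sum R X Z) Zs) Y g x = \<zero>\<^bsub>fobj F Y\<^esub>"
    if "i \<le> Suc (length Zs)" "fg_projective R Y" "g \<in> lin_maps R (list_sum R (P_sum R X Z) Zs) Y"
      "\<And>z. z \<in> carrier ((X # Z # Zs) ! i) \<Longrightarrow> g (list_inj R X (Z # Zs) i z) = \<zero>\<^bsub>Y\<^esub>" for i Y g
    using Cons.prems(4)[of i Y g] that by simp
  have "x \<in> cross_effect R F (P_sum R X Z) Zs"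
  proof (rule Cons.IH[OF XZ Zs])
    show "x \<in> carrier (fobj F (list_sum R (P_sum R X Z) Zs))" using Cons.prems(3) by simp
    fix i and Y :: "'a pmod" and g assume i: "i \<le> length Zs" and Y: "fg_projective R Y" and g: "g \<in> lin_maps R (list_sum R (P_sum R X Z) Zs) Y"
      and gz: "\<And>z. z \<in> carrier ((P_sum R X Z # Zs) ! i) \<Longrightarrow> g (list_inj R (P_sum R X Z) Zs i z) = \<zero>\<^bsub>Y\<^esub>"
    show "farr F (list_sum R (P_sum R X Z) Zs) Y g x = \<zero>\<^bsub>fobj F Y\<^esub>"
    proof (cases i)
      case 0
      \<comment> \<open>Summand 0 of the shorter list contains \<open>X\<close>, so a map vanishing
        on it vanishes on summand 0 of the longer list.\<close>
      show ?thesis by (rule kill[OF _ Y g, of 0]) (use gz in \<open>simp_all add: 0 lin_maps_carrier[OF m(1)]\<close>)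
    next
      case (Suc j)
      show ?thesis by (rule kill[OF _ Y g, of "Suc i"]) (use gz i in \<open>simp_all add: Suc\<close>)
    qed
  qed
  moreover have "farr F (list_sum R (P_sum R X Z) Zs) (list_sum R X Zs) (list_sum_map R (P_sum R X Z) X (P_fst R X Z) Zs) x
      = \<zero>\<^bsub>fobj F (list_sum R X Zs)\<^esub>"
  proof (rule kill[of 1])
    fix z assume "z \<in> carrier ((X # Z # Zs) ! 1)"
    then have z: "z \<in> carrier Z" by simp
    have "list_inj R X Zs 0 \<zero>\<^bsub>X\<^esub> = \<zero>\<^bsub>list_sum R X Zs\<^esub>"
      using list_inj_lin[of R X Zs 0] X Zs
      by (intro linear_on_zero[of R X "list_sum R X Zs" "list_inj R X Zs 0"] fg_projective_module list_sum_fg_projective) simp_all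
    then show "list_sum_map R (P_sum R X Z) X (P_fst R X Z) Zs (list_inj R X (Z # Zs) 1 z) = \<zero>\<^bsub>list_sum R X Zs\<^esub>"
      using list_sum_map_inj[OF XZ X m(3) Zs lin_maps_carrier[OF m(2) z]] by (simp add: m(7)[OF z])
  qed (simp_all add: list_sum_fg_projective X Zs list_sum_map_lin XZ m)
  moreover have "farr F (list_sum R (P_sum R X Z) Zs) (list_sum R Z Zs) (list_sum_map R (P_sum R X Z) Z (P_snd R X Z) Zs) x
      = \<zero>\<^bsub>fobj F (list_sum R Z Zs)\<^esub>"
  proof (rule kill[of 0])
    fix z assume "z \<in> carrier ((X # Z # Zs) ! 0)"
    then have z: "z \<in> carrier X" by simp
    have "list_inj R Z Zs 0 \<zero>\<^bsub>Z\<^esub> = \<zero>\<^bsub>list_sum R Z Zs\<^esub>"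
      using list_inj_lin[of R Z Zs 0] Z Zs
      by (intro linear_on_zero[of R Z "list_sum R Z Zs" "list_inj R Z Zs 0"] fg_projective_module list_sum_fg_projective) simp_all
    then show "list_sum_map R (P_sum R X Z) Z (P_snd R X Z) Zs (list_inj R X (Z # Zs) 0 z) = \<zero>\<^bsub>list_sum R Z Zs\<^esub>"
      using list_sum_map_inj[OF XZ Z m(4) Zs lin_maps_carrier[OF m(1) z]] by (simp add: m(6)[OF z])
  qed (simp_all add: list_sum_fg_projective Z Zs list_sum_map_lin XZ m)
  ultimately show ?case by simp
qed

text \<open>A map that vanishes on the i-th summand does not see the i-th coordinate.\<close>

lemma (in power_functor) omit_absorb:
  assumes K: "K \<in> Ob P" "Y \<in> Ob P" and h: "h \<in> arrs P (D K) Y" and i: "i < N"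
    and z: "Cmp P K (D K) Y h (inj i K) = zero_arr P K Y"
  shows "Cmp P (D K) (D K) Y h (omit i K) = h"
proof (rule inj_ext[OF K])
  fix j assume "j < N"
  then show "Cmp P K (D K) Y (Cmp P (D K) (D K) Y h (omit i K)) (inj j K) = Cmp P K (D K) Y h (inj j K)"
    using K h z by (simp add: assoc_inj D_ob omit_arr omit_inj cmp_zero_right)
qed (use K h in \<open>simp_all add: D_ob cmp_arr omit_arr\<close>)

lemma functor_power_P_cat:
  assumes R: "cring R"
  shows "functor_power R (P_cat R) N (pow_obj R N) (pow_map R N) (pow_inj R N) (pow_prj R N) (Mod_cat R)"
  by (intro functor_power.intro functor_power_axioms.intro power_functor_P_cat linear_category_Mod_cat R)

text \<open>The parameter \<open>dummy\<close> carries the type of the elements of the functor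
  values, which \<open>R\<close> and \<open>N\<close> do not determine.\<close>

locale power_P_cat =
  fixes R :: "'r ring" and N :: nat and dummy :: "'m itself"
  assumes cring: "cring R"
begin

sublocale functor_power R "P_cat R" N "pow_obj R N" "pow_map R N" "pow_inj R N" "pow_prj R N"
  "Mod_cat R :: ('r, ('r, 'm) module, 'm \<Rightarrow> 'm) lincat"
  by (rule functor_power_P_cat[OF cring])

lemma functor_app:
  assumes F: "is_functor (P_cat R) (Mod_cat R) F"
  shows "fg_projective R X \<Longrightarrow> Module.module R (fobj F X)"
    and "fg_projective R X \<Longrightarrow> fg_projective R Y \<Longrightarrow> f \<in> lin_maps R X Y \<Longrightarrow> farr F X Y f \<in> lin_maps R (fobj F X) (fobj F Y)"
    and "fg_projective R X \<Longrightarrow> fg_projective R Y \<Longrightarrow> fg_projective R Z \<Longrightarrow> f \<in> lin_maps R X Y \<Longrightarrow> g \<in> lin_maps R Y Z \<Longrightarrow>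
      x \<in> carrier (fobj F X) \<Longrightarrow> farr F X Z (compose (carrier X) g f) x = farr F Y Z g (farr F X Y f x)"
    and "fg_projective R X \<Longrightarrow> x \<in> carrier (fobj F X) \<Longrightarrow> farr F X X (\<lambda>x\<in>carrier X. x) x = x"
  using is_functorD[OF F] by (simp_all add: compose_def)

text \<open>The image of \<open>eps\<close> at \<open>K\<close> lies in the cross effect of N copies
  of \<open>K\<close>, once the power of \<open>K\<close> is embedded in the left-nested sum used by
  \<open>cross_effect\<close>.\<close>

lemma eps_zero_if_cross_effect_vanishes:
  assumes F: "is_functor (P_cat R) (Mod_cat R) F" and N: "N \<ge> 1" and van: "cross_effect_vanishes R F N"
  shows "eps N F = zero_arr FC (T F) (T F)"
proof (rule functor_cat_arr_eqI[of _ "P_cat R" "Mod_cat R" "T F" "T F"])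
  have TF: "T F \<in> Ob FC" using T_functor[OF F] by simp
  show ea: "eps N F \<in> arrs FC (T F) (T F)" using eps_arr F by simp
  show "zero_arr FC (T F) (T F) \<in> arrs FC (T F) (T F)" by (rule FC.zero_arr_closed[OF TF TF])
  fix K assume "K \<in> Ob (P_cat R)"
  then have K: "fg_projective R K" by simp
  \<comment> \<open>The first argument of \<open>list_sum\<close> is itself a summand, so N copies
    of \<open>K\<close> need a list of length N - 1.\<close>
  let ?D = "pow_obj R N K" and ?Zs = "replicate (N - 1) K"
  let ?L = "list_sum R K ?Zs"
  have Zs: "Z \<in> set ?Zs \<Longrightarrow> fg_projective R Z" for Z using K by simp
  have L: "fg_projective R ?L" by (rule list_sum_fg_projective[OF K Zs])
  have D: "fg_projective R ?D" using D_ob[of K] K by simp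
  note mK = fg_projective_module[OF K] and mD = fg_projective_module[OF D] and mL = fg_projective_module[OF L]
  have nth: "(K # ?Zs) ! i = K" if "i < N" for i using that by (cases i) auto
  let ?i = "\<lambda>i. restrict (list_inj R K ?Zs i) (carrier K)" and ?p = "\<lambda>i. restrict (list_prj R K ?Zs i) (carrier ?L)"
  have il: "?i i \<in> lin_maps R K ?L" if "i < N" for i
    using list_inj_lin[of R K ?Zs i] K that nth[OF that] by (simp add: linear_on_def)
  have pl: "?p i \<in> lin_maps R ?L K" if "i < N" for i
    using list_prj_lin[of R K ?Zs i] K that nth[OF that] by (simp add: linear_on_def)
  \<comment> \<open>The comparison maps between the power and the iterated sum, built from the
    structure maps of both; only the composite \<open>b\<close> after \<open>a\<close> has to be the
    identity.\<close>
  define a where "a = cotuple K ?L ?i"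
  define b where "b = tuple K ?L ?p"
  have a: "a \<in> lin_maps R ?D ?L" and ai: "i < N \<Longrightarrow> compose (carrier K) a (pow_inj R N i K) = ?i i" for i
    using cotuple[of K ?L ?i] K L il by (simp_all add: a_def)
  have b: "b \<in> lin_maps R ?L ?D" and pb: "i < N \<Longrightarrow> compose (carrier ?L) (pow_prj R N i K) b = ?p i" for i
    using tuple[of K ?L ?p] K L pl by (simp_all add: b_def)
  have "compose (carrier ?D) b a = Idn (P_cat R) ?D"
  proof (rule prj_ext[of K ?D], unfold P_cat_simps mem_Collect_eq hom_mod_ops)
    show "compose (carrier ?D) b a \<in> lin_maps R ?D ?D" by (rule lin_maps_compose[OF mD a b])
    show "(\<lambda>x\<in>carrier ?D. x) \<in> lin_maps R ?D ?D" by (rule lin_maps_id[OF mD])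
    fix i assume i: "i < N"
    show "compose (carrier ?D) (pow_prj R N i K) (compose (carrier ?D) b a) =
        compose (carrier ?D) (pow_prj R N i K) (\<lambda>x\<in>carrier ?D. x)"
    \<comment> \<open>The composite is now compared with the identity entry by entry, as an N by N
      matrix.\<close>
    proof (rule inj_ext[of K K, unfolded P_cat_simps hom_mod_ops, OF K K])
      have pr: "pow_prj R N i K \<in> lin_maps R ?D K" using prj_arr[of K i] K i by simp
      show "compose (carrier ?D) (pow_prj R N i K) (compose (carrier ?D) b a) \<in> lin_maps R ?D K"
        "compose (carrier ?D) (pow_prj R N i K) (\<lambda>x\<in>carrier ?D. x) \<in> lin_maps R ?D K"
        by (rule lin_maps_compose[OF mD lin_maps_compose[OF mD a b] pr] lin_maps_compose[OF mD lin_maps_id[OF mD] pr])+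
      fix j assume j: "j < N"
      have ij: "pow_inj R N j K \<in> lin_maps R K ?D" using inj_arr[of K j] K j by simp
      show "compose (carrier K) (compose (carrier ?D) (pow_prj R N i K) (compose (carrier ?D) b a)) (pow_inj R N j K) =
        compose (carrier K) (compose (carrier ?D) (pow_prj R N i K) (\<lambda>x\<in>carrier ?D. x)) (pow_inj R N j K)"
      proof
        fix x
        show "compose (carrier K) (compose (carrier ?D) (pow_prj R N i K) (compose (carrier ?D) b a)) (pow_inj R N j K) x =
          compose (carrier K) (compose (carrier ?D) (pow_prj R N i K) (\<lambda>x\<in>carrier ?D. x)) (pow_inj R N j K) x"
        proof (cases "x \<in> carrier K")
          case x: True
          have ix: "pow_inj R N j K x \<in> carrier ?D" by (rule lin_maps_carrier[OF ij x])
          have 1: "a (pow_inj R N j K x) = list_inj R K ?Zs j x" using fun_cong[OF ai[OF j], of x] x by (simp add: compose_def)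
          have 2: "pow_prj R N i K (b y) = list_prj R K ?Zs i y" if "y \<in> carrier ?L" for y
            using fun_cong[OF pb[OF i], of y] that by (simp add: compose_def)
          have "pow_prj R N i K (b (a (pow_inj R N j K x))) = (if j = i then x else \<zero>\<^bsub>K\<^esub>)"
            using 2[OF lin_maps_carrier[OF a ix]] list_prj_inj[of R K ?Zs j i x] K i j x nth by (simp add: 1)
          moreover have "pow_prj R N i K (pow_inj R N j K x) = (if j = i then x else \<zero>\<^bsub>K\<^esub>)"
            using fun_cong[OF prj_inj[of K i j], of x] K i j x by (auto simp: compose_def)
          ultimately show ?thesis using x ix by (simp add: compose_def)
        qed (simp add: compose_def)
      qed
    qed
  qed (use K D in simp_all)
  then have ba: "compose (carrier ?D) b a = (\<lambda>x\<in>carrier ?D. x)" by simp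
  have "eps N F K y = \<zero>\<^bsub>fobj F ?D\<^esub>" if y: "y \<in> carrier (fobj F ?D)" for y
  proof -
    let ?z = "eps N F K y"
    note fn = functor_app[OF F]
    have eK: "eps N F K \<in> lin_maps R (fobj F ?D) (fobj F ?D)" using functor_cat_arrsD(1)[OF ea, of K] K by simp
    have z: "?z \<in> carrier (fobj F ?D)" by (rule lin_maps_carrier[OF eK y])
    \<comment> \<open>Elements in the image of \<open>eps\<close> are annihilated by every
      idempotent F(\<open>omit i K\<close>), \<open>i < N\<close>.\<close>
    have oz: "farr F ?D ?D (omit i K) ?z = \<zero>\<^bsub>fobj F ?D\<^esub>" if i: "i < N" for i
    proof -
      have "Cmp FC (T F) (T F) (T F) (om i F) (eps N F) K y = zero_arr FC (T F) (T F) K y"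
        using e_eps_zero[of F i N] F i by simp
      then show ?thesis using K y by (simp add: om_def compose_def)
    qed
    have "farr F ?D ?L a ?z \<in> cross_effect R F K ?Zs"
    proof (rule cross_effectI[OF F K Zs])
      show "farr F ?D ?L a ?z \<in> carrier (fobj F ?L)" by (rule lin_maps_carrier[OF fn(2)[OF D L a] z])
      fix i and Y :: "'r pmod" and g assume i: "i \<le> length ?Zs" and Y: "fg_projective R Y" and g: "g \<in> lin_maps R ?L Y"
        and gz: "\<And>x. x \<in> carrier ((K # ?Zs) ! i) \<Longrightarrow> g (list_inj R K ?Zs i x) = \<zero>\<^bsub>Y\<^esub>"
      have iN: "i < N" using i N by simp
      let ?h = "compose (carrier ?D) g a"
      have h: "?h \<in> lin_maps R ?D Y" by (rule lin_maps_compose[OF mD a g])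
      have ij: "pow_inj R N i K \<in> lin_maps R K ?D" using inj_arr[of K i] K iN by simp
      have "compose (carrier K) ?h (pow_inj R N i K) = (\<lambda>x\<in>carrier K. \<zero>\<^bsub>Y\<^esub>)"
      proof
        fix x
        show "compose (carrier K) ?h (pow_inj R N i K) x = (\<lambda>x\<in>carrier K. \<zero>\<^bsub>Y\<^esub>) x"
          using fun_cong[OF ai[OF iN], of x] gz[of x] nth[OF iN] lin_maps_carrier[OF ij, of x] by (cases "x \<in> carrier K") (simp_all add: compose_def)
      qed
      \<comment> \<open>A map vanishing on the i-th summand factors through \<open>omit i K\<close>,
        which already annihilates \<open>?z\<close>.\<close>
      then have ho: "compose (carrier ?D) ?h (omit i K) = ?h"
        using omit_absorb[of K Y ?h i] K Y h iN by simp
      have o: "omit i K \<in> lin_maps R ?D ?D" using omit_arr[of K i] K by simp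
      have "farr F ?L Y g (farr F ?D ?L a ?z) = farr F ?D Y ?h ?z" using fn(3)[OF D L Y a g z] by simp
      also have "\<dots> = farr F ?D Y ?h (farr F ?D ?D (omit i K) ?z)" using fn(3)[OF D D Y o h z] by (simp add: ho)
      also have "\<dots> = \<zero>\<^bsub>fobj F Y\<^esub>" unfolding oz[OF iN] by (rule lin_maps_zero[OF fn(1)[OF D] fn(1)[OF Y] fn(2)[OF D Y h]])
      finally show "farr F ?L Y g (farr F ?D ?L a ?z) = \<zero>\<^bsub>fobj F Y\<^esub>" .
    qed
    moreover have "cross_effect R F K ?Zs = {\<zero>\<^bsub>fobj F ?L\<^esub>}"
      by (rule van[unfolded cross_effect_vanishes_def, rule_format]) (use K N in auto)
    ultimately have az: "farr F ?D ?L a ?z = \<zero>\<^bsub>fobj F ?L\<^esub>" by blast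
    have "?z = farr F ?D ?D (\<lambda>x\<in>carrier ?D. x) ?z" by (rule fn(4)[OF D z, symmetric])
    also have "\<dots> = farr F ?L ?D b (farr F ?D ?L a ?z)" unfolding ba[symmetric] by (rule fn(3)[OF D L D a b z])
    also have "\<dots> = \<zero>\<^bsub>fobj F ?D\<^esub>" unfolding az by (rule lin_maps_zero[OF fn(1)[OF L] fn(1)[OF D] fn(2)[OF L D b]])
    finally show ?thesis .
  qed
  moreover have "eps N F K \<in> extensional (carrier (fobj F ?D))"
    using lin_maps_ext[of "eps N F K"] functor_cat_arrsD(1)[OF ea, of K] K by fastforce
  ultimately show "eps N F K = zero_arr FC (T F) (T F) K"
    using K by (auto simp: fun_eq_iff extensional_def)
qed

end

text \<open>By definition the cross effect of (X, Z, ...) is a subset of that of (X \<oplus> Z,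
  ...), which has one argument less.\<close>

lemma cross_effect_vanishes_Suc:
  assumes F: "is_functor (P_cat R) (Mod_cat R) F" and van: "cross_effect_vanishes R F n" and n: "n \<ge> 1"
  shows "cross_effect_vanishes R F (Suc n)"
  unfolding cross_effect_vanishes_def
proof (intro ballI allI impI)
  fix X :: "'a pmod" and Xs assume "X \<in> Ob (P_cat R)" and Xs: "set Xs \<subseteq> Ob (P_cat R) \<and> length Xs + 1 = Suc n"
  then have X: "fg_projective R X" by simp
  from Xs n obtain Z Zs where Z: "Xs = Z # Zs" by (cases Xs) auto
  have Z': "fg_projective R Z" "W \<in> set Xs \<Longrightarrow> fg_projective R W" for W using Xs Z by auto
  have "cross_effect R F (P_sum R X Z) Zs = {\<zero>\<^bsub>fobj F (list_sum R (P_sum R X Z) Zs)\<^esub>}"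
    using van Xs Z P_sum_fg_projective[OF X Z'(1)] unfolding cross_effect_vanishes_def by auto
  then have "cross_effect R F X Xs \<subseteq> {\<zero>\<^bsub>fobj F (list_sum R X Xs)\<^esub>}" by (auto simp: Z)
  moreover have "\<zero>\<^bsub>fobj F (list_sum R X Xs)\<^esub> \<in> cross_effect R F X Xs"
  proof (rule cross_effectI[OF F X Z'(2)])
    have L: "fg_projective R (list_sum R X Xs)" by (rule list_sum_fg_projective[OF X Z'(2)])
    interpret Module.module R "fobj F (list_sum R X Xs)" using is_functorD(1)[OF F] L by simp
    show "\<zero>\<^bsub>fobj F (list_sum R X Xs)\<^esub> \<in> carrier (fobj F (list_sum R X Xs))" by simp
    fix i and Y :: "'a pmod" and g assume Y: "fg_projective R Y" and g: "g \<in> lin_maps R (list_sum R X Xs) Y"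
    show "farr F (list_sum R X Xs) Y g \<zero>\<^bsub>fobj F (list_sum R X Xs)\<^esub> = \<zero>\<^bsub>fobj F Y\<^esub>"
      using is_functorD[OF F] L Y g by (intro lin_maps_zero[of R]) simp_all
  qed
  ultimately show "cross_effect R F X Xs = {\<zero>\<^bsub>fobj F (list_sum R X Xs)\<^esub>}" by blast
qed

lemma cross_effect_vanishes_mono:
  assumes F: "is_functor (P_cat R) (Mod_cat R) F" and van: "cross_effect_vanishes R F n" and n: "1 \<le> n" "n \<le> m"
  shows "cross_effect_vanishes R F m"
  using n(2)
proof (induction m rule: dec_induct)
  case (step m)
  then show ?case using cross_effect_vanishes_Suc[OF F] n by simp
qed (rule van)

lemma zero_functor_cross_effect_vanishes:
  assumes F: "is_functor (P_cat R) (Mod_cat R) F" and z: "zero_functor R F" and n: "n \<ge> 1"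
  shows "cross_effect_vanishes R F n"
proof -
  have "cross_effect_vanishes R F 1"
    unfolding cross_effect_vanishes_def
  proof (intro ballI allI impI)
    fix X :: "'a pmod" and Xs :: "'a pmod list"
    assume X: "X \<in> Ob (P_cat R)" and "set Xs \<subseteq> Ob (P_cat R) \<and> length Xs + 1 = 1"
    then have Xs: "Xs = []" by simp
    have "cross_effect R F X [] \<subseteq> {\<zero>\<^bsub>fobj F X\<^esub>}" using z X by (auto simp: zero_functor_def)
    moreover have "\<zero>\<^bsub>fobj F X\<^esub> \<in> cross_effect R F X []"
    proof (rule cross_effectI[OF F])
      show "fg_projective R X" using X by simp
      show "\<zero>\<^bsub>fobj F X\<^esub> \<in> carrier (fobj F (list_sum R X []))" using z X by (simp add: zero_functor_def)
      fix i and Y :: "'a pmod" and g assume Y: "fg_projective R Y" and g: "g \<in> lin_maps R (list_sum R X []) Y"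
      show "farr F (list_sum R X []) Y g \<zero>\<^bsub>fobj F X\<^esub> = \<zero>\<^bsub>fobj F Y\<^esub>"
        using is_functorD[OF F] X Y g by (simp, intro lin_maps_zero[of R]) simp_all
    qed simp_all
    ultimately show "cross_effect R F X Xs = {\<zero>\<^bsub>fobj F (list_sum R X Xs)\<^esub>}" by (auto simp: Xs)
  qed
  then show ?thesis using cross_effect_vanishes_mono[OF F _ _ n] by simp
qed

text \<open>Monotonicity of vanishing gives meaning to the definite description in
  \<open>eml_degree\<close>: the least admissible d satisfies it, and no other d does.\<close>

lemma eml_degree_cases:
  assumes F: "is_functor (P_cat R) (Mod_cat R) F" and poly: "polynomial_functor R F"
  obtains "eml_degree R F = - \<infinity>" and "\<And>n. n \<ge> 1 \<Longrightarrow> cross_effect_vanishes R F n"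
  | d :: nat where "eml_degree R F = ereal (real d)" and "\<And>n. n > d \<Longrightarrow> cross_effect_vanishes R F n"
proof (cases "zero_functor R F")
  case True
  then show ?thesis using that(1) zero_functor_cross_effect_vanishes[OF F] by (simp add: eml_degree_def)
next
  case False
  let ?P = "\<lambda>d. cross_effect_vanishes R F (d + 1) \<and> (d > 0 \<longrightarrow> \<not> cross_effect_vanishes R F d)"
  define d where "d = (LEAST d. cross_effect_vanishes R F (d + 1))"
  have d1: "cross_effect_vanishes R F (d + 1)"
    using poly LeastI_ex[of "\<lambda>d. cross_effect_vanishes R F (d + 1)"] unfolding polynomial_functor_def d_def by blast
  have dP: "?P d"
  proof (intro conjI impI d1)
    assume "d > 0"
    then have "\<not> cross_effect_vanishes R F (d - 1 + 1)"
      using not_less_Least[of "d - 1" "\<lambda>d. cross_effect_vanishes R F (d + 1)"] unfolding d_def by simp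
    then show "\<not> cross_effect_vanishes R F d" using \<open>d > 0\<close> by simp
  qed
  have uniq: "d' = d" if "?P d'" for d'
  proof (rule ccontr)
    assume "d' \<noteq> d"
    then consider "d' < d" | "d < d'" by linarith
    then show False
    proof cases
      case 1
      then show False using cross_effect_vanishes_mono[OF F, of "d' + 1" d] that dP by simp
    next
      case 2
      then show False using cross_effect_vanishes_mono[OF F, of "d + 1" d'] that dP by simp
    qed
  qed
  have "(THE d. ?P d) = d" using dP uniq by (rule the_equality)
  then show ?thesis
    using that(2)[of d] False cross_effect_vanishes_mono[OF F d1] by (simp add: eml_degree_def)
qed

section \<open>Tensor powers of modules and the Schur category\<close>

lemma lin_maps_finsum:
  assumes M: "Module.module R M" and N: "Module.module R N" and f: "f \<in> lin_maps R M N"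
    and A: "finite A" and h: "\<And>i. i \<in> A \<Longrightarrow> h i \<in> carrier M"
  shows "f (finsum M h A) = finsum N (\<lambda>i. f (h i)) A"
proof -
  interpret M: Module.module R M by (rule M)
  interpret N: Module.module R N by (rule N)
  show ?thesis using A h
  proof (induction A)
    case empty
    then show ?case by (simp add: lin_maps_zero[OF M N f])
  next
    case (insert i A)
    then have "h \<in> A \<rightarrow> carrier M" "(\<lambda>i. f (h i)) \<in> A \<rightarrow> carrier N" using lin_maps_carrier[OF f] by auto
    with insert show ?case
      by (simp add: M.finsum_insert N.finsum_insert lin_maps_carrier[OF f] lin_maps_add[OF f] M.finsum_closed)
  qed
qed

text \<open>Evaluation at x is itself a linear map on the Hom module, so it commutes with finite
  sums.\<close>

lemma hom_mod_finsum_app: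
  assumes M: "Module.module R M" and N: "Module.module R N" and x: "x \<in> carrier M"
    and A: "finite A" and h: "\<And>i. i \<in> A \<Longrightarrow> h i \<in> lin_maps R M N"
  shows "finsum (hom_mod R M N) h A x = finsum N (\<lambda>i. h i x) A"
proof -
  interpret H: Module.module R "hom_mod R M N" by (rule hom_mod_module[OF M N])
  have "(\<lambda>f\<in>carrier (hom_mod R M N). f x) \<in> lin_maps R (hom_mod R M N) N"
    by (rule lin_mapsI) (use x H.a_closed H.smult_closed in \<open>auto simp: lin_maps_carrier hom_mod_ops\<close>)
  from lin_maps_finsum[OF H.module_axioms N this A, of h] h
  have "(\<lambda>f\<in>carrier (hom_mod R M N). f x) (finsum (hom_mod R M N) h A) =
      finsum N (\<lambda>i. (\<lambda>f\<in>carrier (hom_mod R M N). f x) (h i)) A" by simp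
  moreover have "finsum (hom_mod R M N) h A \<in> carrier (hom_mod R M N)" using h by (intro H.finsum_closed) auto
  moreover have "finsum N (\<lambda>i. (\<lambda>f\<in>carrier (hom_mod R M N). f x) (h i)) A = finsum N (\<lambda>i. h i x) A"
  proof -
    interpret N: Module.module R N by (rule N)
    show ?thesis using lin_maps_carrier[OF h x] h by (intro N.finsum_cong') auto
  qed
  ultimately show ?thesis by simp
qed

abbreviation (input) tmap :: "'r ring \<Rightarrow> nat \<Rightarrow> ('r, 'a) module \<Rightarrow> ('r, 'b) module \<Rightarrow> (nat \<Rightarrow> 'a \<Rightarrow> 'b) \<Rightarrow>
    ((nat \<Rightarrow> 'a) \<Rightarrow> 'r) set \<Rightarrow> ((nat \<Rightarrow> 'b) \<Rightarrow> 'r) set" where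
  "tmap R s M N f \<equiv> tensor_map R {..<s} (\<lambda>_. M) (\<lambda>_. N) f"

abbreviation (input) tpure :: "'r ring \<Rightarrow> nat \<Rightarrow> ('r, 'a) module \<Rightarrow> (nat \<Rightarrow> 'a) \<Rightarrow> ((nat \<Rightarrow> 'a) \<Rightarrow> 'r) set" where
  "tpure R s M x \<equiv> pure_tensor R {..<s} (\<lambda>_. M) x"

locale tensor_powers =
  fixes R :: "'r ring" and s :: nat
  assumes R: "cring R"
begin

lemma tp_module: "Module.module R M \<Longrightarrow> Module.module R (tensor_power R s M)"
  by (rule tensor_module[OF R])

lemma tmap_lin:
  assumes "Module.module R M" "Module.module R N" "\<And>i. i < s \<Longrightarrow> f i \<in> lin_maps R M N"
  shows "tmap R s M N f \<in> lin_maps R (tensor_power R s M) (tensor_power R s N)"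
  by (rule tensor_map_pure[OF R]) (use assms in auto)

lemma tmap_pure:
  assumes "Module.module R M" "Module.module R N" "\<And>i. i < s \<Longrightarrow> f i \<in> lin_maps R M N"
    and "x \<in> (\<Pi>\<^sub>E i\<in>{..<s}. carrier M)"
  shows "tmap R s M N f (tpure R s M x) = tpure R s N (\<lambda>i\<in>{..<s}. f i (x i))"
  using tensor_map_pure(2)[OF R, where I = "{..<s}" and M = "\<lambda>_. M" and N = "\<lambda>_. N" and f = f] assms by simp

lemma tpure_carrier: "x \<in> (\<Pi>\<^sub>E i\<in>{..<s}. carrier M) \<Longrightarrow> tpure R s M x \<in> carrier (tensor_power R s M)"
  by (rule pure_tensor_carrier[OF R])

lemma tensor_power_eqI:
  assumes "Module.module R M" "Module.module R T" "f \<in> lin_maps R (tensor_power R s M) T" "g \<in> lin_maps R (tensor_power R s M) T"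
    and "\<And>x. x \<in> (\<Pi>\<^sub>E i\<in>{..<s}. carrier M) \<Longrightarrow> f (tpure R s M x) = g (tpure R s M x)"
  shows "f = g"
  by (rule tensor_lin_eqI[OF R assms(1,2,3,4)]) (use assms(5) in auto)

lemma family_closed:
  assumes f: "\<And>i. i < s \<Longrightarrow> f i \<in> lin_maps R M N" and x: "x \<in> (\<Pi>\<^sub>E i\<in>{..<s}. carrier M)"
  shows "(\<lambda>i\<in>{..<s}. f i (x i)) \<in> (\<Pi>\<^sub>E i\<in>{..<s}. carrier N)"
  using x lin_maps_carrier[OF f] by (simp add: PiE_iff)

lemma tmap_cmp:
  assumes L: "Module.module R L" and M: "Module.module R M" and N: "Module.module R N"
    and f: "\<And>i. i < s \<Longrightarrow> f i \<in> lin_maps R L M" and g: "\<And>i. i < s \<Longrightarrow> g i \<in> lin_maps R M N"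
  shows "compose (carrier (tensor_power R s L)) (tmap R s M N g) (tmap R s L M f) =
    tmap R s L N (\<lambda>i. compose (carrier L) (g i) (f i))"
proof (rule tensor_power_eqI[OF L tp_module[OF N] lin_maps_compose[OF tp_module[OF L] tmap_lin[OF L M f] tmap_lin[OF M N g]] tmap_lin[OF L N]])
  fix x assume x: "x \<in> (\<Pi>\<^sub>E i\<in>{..<s}. carrier L)"
  have "(\<lambda>i\<in>{..<s}. g i ((\<lambda>i\<in>{..<s}. f i (x i)) i)) = (\<lambda>i\<in>{..<s}. compose (carrier L) (g i) (f i) (x i))"
    using x by (intro restrict_ext) (simp add: compose_def PiE_iff)
  then show "compose (carrier (tensor_power R s L)) (tmap R s M N g) (tmap R s L M f) (tpure R s L x) =
      tmap R s L N (\<lambda>i. compose (carrier L) (g i) (f i)) (tpure R s L x)"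
    using tmap_pure[OF L M f x] tmap_pure[OF M N g family_closed[OF f x]] tpure_carrier[OF x]
      tmap_pure[OF L N lin_maps_compose[OF L f g] x]
    by (simp add: compose_eq)
qed (use lin_maps_compose[OF L f g] in auto)

lemma tmap_cong: "(\<And>i. i < s \<Longrightarrow> f i = g i) \<Longrightarrow> tmap R s M N f = tmap R s M N g"
  unfolding tensor_map_def by (simp cong: restrict_cong)

lemma tmap_id:
  assumes M: "Module.module R M"
  shows "tmap R s M M (\<lambda>_. \<lambda>x\<in>carrier M. x) = (\<lambda>z\<in>carrier (tensor_power R s M). z)"
proof (rule tensor_power_eqI[OF M tp_module[OF M] tmap_lin[OF M M lin_maps_id[OF M]] lin_maps_id[OF tp_module[OF M]]])
  fix x assume x: "x \<in> (\<Pi>\<^sub>E i\<in>{..<s}. carrier M)"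
  have "(\<lambda>i\<in>{..<s}. (\<lambda>x\<in>carrier M. x) (x i)) = x"
    using x by (auto simp: fun_eq_iff PiE_iff extensional_def)
  then show "tmap R s M M (\<lambda>_. \<lambda>x\<in>carrier M. x) (tpure R s M x) = (\<lambda>z\<in>carrier (tensor_power R s M). z) (tpure R s M x)"
    using tmap_pure[OF M M lin_maps_id[OF M] x] tpure_carrier[OF x] by simp
qed

text \<open>The zero entry is rewritten as 0 times zero, and linearity in that entry pulls the
  scalar out.\<close>

lemma tpure_zero:
  assumes M: "Module.module R M" and x: "x \<in> (\<Pi>\<^sub>E i\<in>{..<s}. carrier M)" and i: "i < s" and z: "x i = \<zero>\<^bsub>M\<^esub>"
  shows "tpure R s M x = \<zero>\<^bsub>tensor_power R s M\<^esub>"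
proof -
  interpret M: Module.module R M by (rule M)
  interpret T: Module.module R "tensor_power R s M" by (rule tp_module[OF M])
  have "x = x(i := \<zero>\<^bsub>R\<^esub> \<odot>\<^bsub>M\<^esub> \<zero>\<^bsub>M\<^esub>)" using z by (simp add: fun_eq_iff)
  then have "tpure R s M x = tpure R s M (x(i := \<zero>\<^bsub>R\<^esub> \<odot>\<^bsub>M\<^esub> \<zero>\<^bsub>M\<^esub>))" by simp
  also have "\<dots> = \<zero>\<^bsub>R\<^esub> \<odot>\<^bsub>tensor_power R s M\<^esub> tpure R s M (x(i := \<zero>\<^bsub>M\<^esub>))"
    by (rule pure_tensor_smult[OF R]) (use M x i in auto)
  also have "\<dots> = \<zero>\<^bsub>tensor_power R s M\<^esub>"
    using tpure_carrier[of "x(i := \<zero>\<^bsub>M\<^esub>)" M] x z by (intro T.smult_l_null) (simp add: fun_upd_idem)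
  finally show ?thesis .
qed

lemma tmap_zero:
  assumes M: "Module.module R M" and N: "Module.module R N" and f: "\<And>i. i < s \<Longrightarrow> f i \<in> lin_maps R M N"
    and i: "i < s" "f i = (\<lambda>x\<in>carrier M. \<zero>\<^bsub>N\<^esub>)"
  shows "tmap R s M N f = (\<lambda>z\<in>carrier (tensor_power R s M). \<zero>\<^bsub>tensor_power R s N\<^esub>)"
proof (rule tensor_power_eqI[OF M tp_module[OF N] tmap_lin[OF M N f]])
  interpret H: Module.module R "hom_mod R (tensor_power R s M) (tensor_power R s N)"
    by (rule hom_mod_module[OF tp_module[OF M] tp_module[OF N]])
  show "(\<lambda>z\<in>carrier (tensor_power R s M). \<zero>\<^bsub>tensor_power R s N\<^esub>) \<in> lin_maps R (tensor_power R s M) (tensor_power R s N)"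
    using H.zero_closed by simp
  fix x assume x: "x \<in> (\<Pi>\<^sub>E i\<in>{..<s}. carrier M)"
  have "tpure R s N (\<lambda>i\<in>{..<s}. f i (x i)) = \<zero>\<^bsub>tensor_power R s N\<^esub>"
    by (rule tpure_zero[OF N family_closed[OF f x] i(1)]) (use i x in \<open>simp_all add: PiE_iff\<close>)
  then show "tmap R s M N f (tpure R s M x) = (\<lambda>z\<in>carrier (tensor_power R s M). \<zero>\<^bsub>tensor_power R s N\<^esub>) (tpure R s M x)"
    using tmap_pure[OF M N f x] tpure_carrier[OF x] by simp
qed

text \<open>Permuting the tensor factors amounts to reindexing the family of maps. For constant
  families this is the equivariance of tensor powers of a map; for sums over all arrangements it
  reduces equivariance to reindexing the sum.\<close>

lemma tmap_perm:
  assumes M: "Module.module R M" and N: "Module.module R N" and \<sigma>: "\<sigma> permutes {..<s}"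
    and f: "\<And>i. i < s \<Longrightarrow> f i \<in> lin_maps R M N" and g: "\<And>i. i < s \<Longrightarrow> g i \<in> lin_maps R M N"
    and fg: "\<And>i. i < s \<Longrightarrow> f i = g (\<sigma> i)"
  shows "compose (carrier (tensor_power R s M)) (tmap R s M N f) (tensor_perm R s M \<sigma>) =
    compose (carrier (tensor_power R s M)) (tensor_perm R s N \<sigma>) (tmap R s M N g)"
proof -
  note pM = tensor_perm_pure[OF R M \<sigma>] and pN = tensor_perm_pure[OF R N \<sigma>]
  have sb: "\<sigma> i < s \<longleftrightarrow> i < s" for i using permutes_in_image[OF \<sigma>, of i] by simp
  show ?thesis
  proof (rule tensor_power_eqI[OF M tp_module[OF N] lin_maps_compose[OF tp_module[OF M] pM(1) tmap_lin[OF M N f]]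
      lin_maps_compose[OF tp_module[OF M] tmap_lin[OF M N g] pN(1)]])
    fix x assume x: "x \<in> (\<Pi>\<^sub>E i\<in>{..<s}. carrier M)"
    then have 1: "(\<lambda>i\<in>{..<s}. x (\<sigma> i)) \<in> (\<Pi>\<^sub>E i\<in>{..<s}. carrier M)" by (simp add: PiE_iff sb)
    have 3: "(\<lambda>i\<in>{..<s}. f i ((\<lambda>i\<in>{..<s}. x (\<sigma> i)) i)) = (\<lambda>i\<in>{..<s}. (\<lambda>i\<in>{..<s}. g i (x i)) (\<sigma> i))"
      by (intro restrict_ext) (simp add: sb fg)
    show "compose (carrier (tensor_power R s M)) (tmap R s M N f) (tensor_perm R s M \<sigma>) (tpure R s M x) =
        compose (carrier (tensor_power R s M)) (tensor_perm R s N \<sigma>) (tmap R s M N g) (tpure R s M x)"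
      using tpure_carrier[OF x]
      by (simp only: compose_eq pM(2)[OF x] tmap_pure[OF M N f 1] tmap_pure[OF M N g x] pN(2)[OF family_closed[OF g x]] 3)
  qed
qed

text \<open>The induction scales the entries one at a time, n being the number already scaled. The
  case n = s yields the action of a homothety on the whole tensor power.\<close>

lemma tpure_scale:
  assumes M: "Module.module R M" and x: "x \<in> (\<Pi>\<^sub>E i\<in>{..<s}. carrier M)" and a: "a \<in> carrier R"
  shows "n \<le> s \<Longrightarrow> tpure R s M (\<lambda>i\<in>{..<s}. if i < n then a \<odot>\<^bsub>M\<^esub> x i else x i) =
    (a [^]\<^bsub>R\<^esub> n) \<odot>\<^bsub>tensor_power R s M\<^esub> tpure R s M x"
proof (induction n)
  interpret M: Module.module R M by (rule M)
  interpret T: Module.module R "tensor_power R s M" by (rule tp_module[OF M])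
  case 0
  have "(\<lambda>i\<in>{..<s}. x i) = x" using x by (simp add: PiE_iff extensional_restrict)
  then show ?case using tpure_carrier[OF x] by (simp add: T.smult_one)
next
  interpret M: Module.module R M by (rule M)
  interpret T: Module.module R "tensor_power R s M" by (rule tp_module[OF M])
  case (Suc n)
  let ?y = "\<lambda>n. \<lambda>i\<in>{..<s}. if i < n then a \<odot>\<^bsub>M\<^esub> x i else x i"
  have y: "?y n \<in> (\<Pi>\<^sub>E i\<in>{..<s}. carrier M)" using x a by (simp add: PiE_iff)
  have xn: "x n \<in> carrier M" using x Suc.prems by (simp add: PiE_iff)
  have "?y (Suc n) = (?y n)(n := a \<odot>\<^bsub>M\<^esub> x n)" using Suc.prems by (auto simp: fun_eq_iff)
  then have "tpure R s M (?y (Suc n)) = tpure R s M ((?y n)(n := a \<odot>\<^bsub>M\<^esub> x n))" by simp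
  also have "\<dots> = a \<odot>\<^bsub>tensor_power R s M\<^esub> tpure R s M ((?y n)(n := x n))"
    by (rule pure_tensor_smult[OF R]) (use M y xn a Suc.prems in auto)
  also have "(?y n)(n := x n) = ?y n" using Suc.prems by (auto simp: fun_eq_iff)
  also have "a \<odot>\<^bsub>tensor_power R s M\<^esub> tpure R s M (?y n) = (a [^]\<^bsub>R\<^esub> Suc n) \<odot>\<^bsub>tensor_power R s M\<^esub> tpure R s M x"
    unfolding Suc.IH[OF Suc_leD[OF Suc.prems]]
    using a tpure_carrier[OF x] M.R.m_comm[OF a M.R.nat_pow_closed[OF a]]
    by (simp add: T.smult_assoc1[symmetric])
  finally show ?case .
qed

lemma tmap_scale:
  assumes M: "Module.module R M" and a: "a \<in> carrier R"
  shows "tmap R s M M (\<lambda>_. \<lambda>x\<in>carrier M. a \<odot>\<^bsub>M\<^esub> x) =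
    (\<lambda>z\<in>carrier (tensor_power R s M). (a [^]\<^bsub>R\<^esub> s) \<odot>\<^bsub>tensor_power R s M\<^esub> z)"
proof -
  interpret M: Module.module R M by (rule M)
  interpret T: Module.module R "tensor_power R s M" by (rule tp_module[OF M])
  have l: "(\<lambda>x\<in>carrier M. a \<odot>\<^bsub>M\<^esub> x) \<in> lin_maps R M M"
    by (rule lin_mapsI) (use a in \<open>simp_all add: M.smult_r_distr M.smult_assoc1[symmetric] M.R.m_comm\<close>)
  have l': "(\<lambda>z\<in>carrier (tensor_power R s M). (a [^]\<^bsub>R\<^esub> s) \<odot>\<^bsub>tensor_power R s M\<^esub> z) \<in> lin_maps R (tensor_power R s M) (tensor_power R s M)"
    by (rule lin_mapsI) (use a in \<open>simp_all add: T.smult_r_distr T.smult_assoc1[symmetric] M.R.m_comm\<close>)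
  show ?thesis
  proof (rule tensor_power_eqI[OF M tp_module[OF M] tmap_lin[OF M M l] l'])
    fix x assume x: "x \<in> (\<Pi>\<^sub>E i\<in>{..<s}. carrier M)"
    have "(\<lambda>i\<in>{..<s}. (\<lambda>x\<in>carrier M. a \<odot>\<^bsub>M\<^esub> x) (x i)) = (\<lambda>i\<in>{..<s}. if i < s then a \<odot>\<^bsub>M\<^esub> x i else x i)"
      using x by (intro restrict_ext) (simp add: PiE_iff)
    then show "tmap R s M M (\<lambda>_. \<lambda>x\<in>carrier M. a \<odot>\<^bsub>M\<^esub> x) (tpure R s M x) =
        (\<lambda>z\<in>carrier (tensor_power R s M). (a [^]\<^bsub>R\<^esub> s) \<odot>\<^bsub>tensor_power R s M\<^esub> z) (tpure R s M x)"
      using tmap_pure[OF M M l x] tpure_scale[OF M x a order_refl] tpure_carrier[OF x] by simp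
  qed
qed

lemma Schur_simps [simp]:
  "M \<in> Ob (Schur_cat R s) \<longleftrightarrow> fg_projective R M"
  "Idn (Schur_cat R s) M = (\<lambda>x\<in>carrier (tensor_power R s M). x)"
  "Cmp (Schur_cat R s) L M N g f = compose (carrier (tensor_power R s L)) g f"
  "zero_arr (Schur_cat R s) M N = (\<lambda>x\<in>carrier (tensor_power R s M). \<zero>\<^bsub>tensor_power R s N\<^esub>)"
  "f \<oplus>\<^bsub>Hom (Schur_cat R s) M N\<^esub> g = f \<oplus>\<^bsub>hom_mod R (tensor_power R s M) (tensor_power R s N)\<^esub> g"
  "a \<odot>\<^bsub>Hom (Schur_cat R s) M N\<^esub> f = a \<odot>\<^bsub>hom_mod R (tensor_power R s M) (tensor_power R s N)\<^esub> f"
  by (simp_all add: Schur_cat_def)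

lemma Schur_arrs:
  assumes M: "Module.module R M" and N: "Module.module R N"
  shows "h \<in> arrs (Schur_cat R s) M N \<longleftrightarrow> h \<in> lin_maps R (tensor_power R s M) (tensor_power R s N) \<and>
    (\<forall>\<sigma>. \<sigma> permutes {..<s} \<longrightarrow> compose (carrier (tensor_power R s M)) h (tensor_perm R s M \<sigma>) =
      compose (carrier (tensor_power R s M)) (tensor_perm R s N \<sigma>) h)"
  by (auto simp: Schur_cat_def compose_def restrict_def fun_eq_iff)

text \<open>The Hom modules are the submodules of equivariant maps between tensor powers; once
  closure is known, the axioms are inherited from the category of modules.\<close>

lemma Schur_linear: "linear_category R (Schur_cat R s)"
proof -
  let ?T = "tensor_power R s"
  let ?C = "Mod_cat R :: ('r, ('r, ((nat \<Rightarrow> nat \<Rightarrow> 'r) \<Rightarrow> 'r) set) module, _) lincat"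
  interpret C: linear_category R ?C by (rule linear_category_Mod_cat)
  have T: "?T M \<in> Ob ?C" if "fg_projective R M" for M :: "'r pmod" using tp_module[OF fg_projective_module[OF that]] by simp
  have lin: "f \<in> arrs ?C (?T M) (?T N)" if "f \<in> arrs (Schur_cat R s) M N" for f M N
    using that by (simp add: Schur_cat_def)
  have pc: "tensor_perm R s M \<sigma> \<in> arrs ?C (?T M) (?T M)" if "fg_projective R M" "\<sigma> permutes {..<s}" for M \<sigma>
    using tensor_perm_pure(1)[OF R fg_projective_module[OF that(1)] that(2)] by simp
  have eqv: "f \<in> arrs (Schur_cat R s) M N \<longleftrightarrow> f \<in> arrs ?C (?T M) (?T N) \<and>
      (\<forall>\<sigma>. \<sigma> permutes {..<s} \<longrightarrow> Cmp ?C (?T M) (?T M) (?T N) f (tensor_perm R s M \<sigma>) =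
        Cmp ?C (?T M) (?T N) (?T N) (tensor_perm R s N \<sigma>) f)"
    if "fg_projective R M" "fg_projective R N" for f M N
    using Schur_arrs[OF fg_projective_module[OF that(1)] fg_projective_module[OF that(2)]] by simp
  have H: "Hom (Schur_cat R s) M N = (Hom ?C (?T M) (?T N))\<lparr>carrier := arrs (Schur_cat R s) M N\<rparr>" for M N
    by (simp add: Schur_cat_def)
  show ?thesis
  proof (rule linear_category.intro, goal_cases)
    case (1 M N)
    then have M: "fg_projective R M" and N: "fg_projective R N" by simp_all
    have "submodule (arrs (Schur_cat R s) M N) R (Hom ?C (?T M) (?T N))"
    proof (rule module.submoduleI'[OF C.hom_module[OF T[OF M] T[OF N]]])
      interpret HM: Module.module R "Hom ?C (?T M) (?T N)" by (rule C.hom_module[OF T[OF M] T[OF N]])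
      show "arrs (Schur_cat R s) M N \<subseteq> arrs ?C (?T M) (?T N)" using lin by blast
      show "zero_arr ?C (?T M) (?T N) \<in> arrs (Schur_cat R s) M N"
        unfolding eqv[OF M N]
      proof (intro conjI allI impI)
        show "zero_arr ?C (?T M) (?T N) \<in> arrs ?C (?T M) (?T N)" by (rule C.zero_arr_closed[OF T[OF M] T[OF N]])
        fix \<sigma> assume \<sigma>: "\<sigma> permutes {..<s}"
        show "Cmp ?C (?T M) (?T M) (?T N) (zero_arr ?C (?T M) (?T N)) (tensor_perm R s M \<sigma>) =
            Cmp ?C (?T M) (?T N) (?T N) (tensor_perm R s N \<sigma>) (zero_arr ?C (?T M) (?T N))"
          unfolding C.cmp_zero_left[OF T[OF M] T[OF M] T[OF N] pc[OF M \<sigma>]]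
            C.cmp_zero_right[OF T[OF M] T[OF N] T[OF N] pc[OF N \<sigma>]] ..
      qed
      fix f g assume fg: "f \<in> arrs (Schur_cat R s) M N" "g \<in> arrs (Schur_cat R s) M N"
      show "f \<oplus>\<^bsub>Hom ?C (?T M) (?T N)\<^esub> g \<in> arrs (Schur_cat R s) M N"
        unfolding eqv[OF M N]
      proof (intro conjI allI impI)
        show "f \<oplus>\<^bsub>Hom ?C (?T M) (?T N)\<^esub> g \<in> arrs ?C (?T M) (?T N)" by (rule HM.a_closed[OF lin[OF fg(1)] lin[OF fg(2)]])
        fix \<sigma> assume \<sigma>: "\<sigma> permutes {..<s}"
        have e: "Cmp ?C (?T M) (?T M) (?T N) h (tensor_perm R s M \<sigma>) = Cmp ?C (?T M) (?T N) (?T N) (tensor_perm R s N \<sigma>) h"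
          if "h \<in> arrs (Schur_cat R s) M N" for h using that \<sigma> unfolding eqv[OF M N] by blast
        show "Cmp ?C (?T M) (?T M) (?T N) (f \<oplus>\<^bsub>Hom ?C (?T M) (?T N)\<^esub> g) (tensor_perm R s M \<sigma>) =
            Cmp ?C (?T M) (?T N) (?T N) (tensor_perm R s N \<sigma>) (f \<oplus>\<^bsub>Hom ?C (?T M) (?T N)\<^esub> g)"
          unfolding C.cmp_add_left[OF T[OF M] T[OF M] T[OF N] pc[OF M \<sigma>] lin[OF fg(1)] lin[OF fg(2)]]
            C.cmp_add_right[OF T[OF M] T[OF N] T[OF N] lin[OF fg(1)] lin[OF fg(2)] pc[OF N \<sigma>]] e[OF fg(1)] e[OF fg(2)] ..
      qed
    next
      interpret HM: Module.module R "Hom ?C (?T M) (?T N)" by (rule C.hom_module[OF T[OF M] T[OF N]])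
      fix a f assume a: "a \<in> carrier R" and f: "f \<in> arrs (Schur_cat R s) M N"
      show "a \<odot>\<^bsub>Hom ?C (?T M) (?T N)\<^esub> f \<in> arrs (Schur_cat R s) M N"
        unfolding eqv[OF M N]
      proof (intro conjI allI impI)
        show "a \<odot>\<^bsub>Hom ?C (?T M) (?T N)\<^esub> f \<in> arrs ?C (?T M) (?T N)" by (rule HM.smult_closed[OF a lin[OF f]])
        fix \<sigma> assume \<sigma>: "\<sigma> permutes {..<s}"
        have e: "Cmp ?C (?T M) (?T M) (?T N) f (tensor_perm R s M \<sigma>) = Cmp ?C (?T M) (?T N) (?T N) (tensor_perm R s N \<sigma>) f"
          using f \<sigma> unfolding eqv[OF M N] by blast
        show "Cmp ?C (?T M) (?T M) (?T N) (a \<odot>\<^bsub>Hom ?C (?T M) (?T N)\<^esub> f) (tensor_perm R s M \<sigma>) =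
            Cmp ?C (?T M) (?T N) (?T N) (tensor_perm R s N \<sigma>) (a \<odot>\<^bsub>Hom ?C (?T M) (?T N)\<^esub> f)"
          unfolding C.cmp_smult_left[OF T[OF M] T[OF M] T[OF N] a pc[OF M \<sigma>] lin[OF f]]
            C.cmp_smult_right[OF T[OF M] T[OF N] T[OF N] a lin[OF f] pc[OF N \<sigma>]] e ..
      qed
    qed
    from submodule.submodule_is_module[OF this C.hom_module[OF T[OF M] T[OF N]]]
    show ?case unfolding H[symmetric] .
  next
    case (2 M)
    then have M: "fg_projective R M" by simp
    show ?case unfolding eqv[OF M M]
      using C.idn_arr[OF T[OF M]] C.cmp_idn[OF T[OF M] T[OF M] pc[OF M]] C.idn_cmp[OF T[OF M] T[OF M] pc[OF M]] by simp
  next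
    case (3 L M N f g)
    then have L: "fg_projective R L" and M: "fg_projective R M" and N: "fg_projective R N" by simp_all
    note fg = 3(4,5)[unfolded eqv[OF L M] eqv[OF M N]]
    have fa: "f \<in> arrs ?C (?T L) (?T M)" and ga: "g \<in> arrs ?C (?T M) (?T N)" using fg by blast+
    have "Cmp ?C (?T L) (?T L) (?T N) (Cmp ?C (?T L) (?T M) (?T N) g f) (tensor_perm R s L \<sigma>) =
        Cmp ?C (?T L) (?T N) (?T N) (tensor_perm R s N \<sigma>) (Cmp ?C (?T L) (?T M) (?T N) g f)" if \<sigma>: "\<sigma> permutes {..<s}" for \<sigma>
    proof -
      have "Cmp ?C (?T L) (?T L) (?T N) (Cmp ?C (?T L) (?T M) (?T N) g f) (tensor_perm R s L \<sigma>) =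
          Cmp ?C (?T L) (?T M) (?T N) g (Cmp ?C (?T L) (?T L) (?T M) f (tensor_perm R s L \<sigma>))"
        by (rule C.cmp_assoc[OF T[OF L] T[OF L] T[OF M] T[OF N] pc[OF L \<sigma>] fa ga, symmetric])
      also have "\<dots> = Cmp ?C (?T L) (?T M) (?T N) g (Cmp ?C (?T L) (?T M) (?T M) (tensor_perm R s M \<sigma>) f)" using fg(1) \<sigma> by metis
      also have "\<dots> = Cmp ?C (?T L) (?T M) (?T N) (Cmp ?C (?T M) (?T M) (?T N) g (tensor_perm R s M \<sigma>)) f"
        by (rule C.cmp_assoc[OF T[OF L] T[OF M] T[OF M] T[OF N] fa pc[OF M \<sigma>] ga])
      also have "\<dots> = Cmp ?C (?T L) (?T M) (?T N) (Cmp ?C (?T M) (?T N) (?T N) (tensor_perm R s N \<sigma>) g) f" using fg(2) \<sigma> by metis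
      also have "\<dots> = Cmp ?C (?T L) (?T N) (?T N) (tensor_perm R s N \<sigma>) (Cmp ?C (?T L) (?T M) (?T N) g f)"
        by (rule C.cmp_assoc[OF T[OF L] T[OF M] T[OF N] T[OF N] fa ga pc[OF N \<sigma>], symmetric])
      finally show ?thesis .
    qed
    then show ?case unfolding eqv[OF L N] using C.cmp_arr[OF T[OF L] T[OF M] T[OF N] fa ga] by simp
  next
    case (4 M N f)
    show ?case unfolding Schur_simps
      by (rule C.cmp_idn[OF T T lin, unfolded Mod_cat_simps]) (use 4 in simp_all)
  next
    case (5 M N f)
    show ?case unfolding Schur_simps
      by (rule C.idn_cmp[OF T T lin, unfolded Mod_cat_simps]) (use 5 in simp_all)
  next
    case (6 K L M N f g h)
    show ?case unfolding Schur_simps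
      by (rule C.cmp_assoc[OF T T T T lin lin lin, unfolded Mod_cat_simps]) (use 6 in simp_all)
  next
    case (7 L M N f g g')
    show ?case unfolding Schur_simps
      by (rule C.cmp_add_left[OF T T T lin lin lin, unfolded Mod_cat_simps]) (use 7 in simp_all)
  next
    case (8 L M N f f' g)
    show ?case unfolding Schur_simps
      by (rule C.cmp_add_right[OF T T T lin lin lin, unfolded Mod_cat_simps]) (use 8 in simp_all)
  next
    case (9 L M N a f g)
    show ?case unfolding Schur_simps
      by (rule C.cmp_smult_left[OF T T T _ lin lin, unfolded Mod_cat_simps]) (use 9 in simp_all)
  next
    case (10 L M N a f g)
    show ?case unfolding Schur_simps
      by (rule C.cmp_smult_right[OF T T T _ lin lin, unfolded Mod_cat_simps]) (use 10 in simp_all)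
  qed
qed

end

section \<open>Strict polynomial functors: weight maps, scalars and degree\<close>

lemma is_linear_functorD:
  assumes "is_linear_functor R C D F"
  shows "is_functor C D F"
    and "X \<in> Ob C \<Longrightarrow> Y \<in> Ob C \<Longrightarrow> f \<in> arrs C X Y \<Longrightarrow> g \<in> arrs C X Y \<Longrightarrow>
      farr F X Y (f \<oplus>\<^bsub>Hom C X Y\<^esub> g) = farr F X Y f \<oplus>\<^bsub>Hom D (fobj F X) (fobj F Y)\<^esub> farr F X Y g"
    and "X \<in> Ob C \<Longrightarrow> Y \<in> Ob C \<Longrightarrow> f \<in> arrs C X Y \<Longrightarrow> a \<in> carrier R \<Longrightarrow>
      farr F X Y (a \<odot>\<^bsub>Hom C X Y\<^esub> f) = a \<odot>\<^bsub>Hom D (fobj F X) (fobj F Y)\<^esub> farr F X Y f"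
  using assms unfolding is_linear_functor_def by blast+

lemma linear_functor_zero:
  assumes C: "linear_category R C" and D: "linear_category R D" and F: "is_linear_functor R C D F"
    and X: "X \<in> Ob C" and Y: "Y \<in> Ob C"
  shows "farr F X Y (zero_arr C X Y) = zero_arr D (fobj F X) (fobj F Y)"
proof -
  note f = is_functorD[OF is_linear_functorD(1)[OF F]]
  interpret A: Module.module R "Hom C X Y" by (rule linear_category.hom_module[OF C X Y])
  interpret B: Module.module R "Hom D (fobj F X) (fobj F Y)" by (rule linear_category.hom_module[OF D f(1)[OF X] f(1)[OF Y]])
  show ?thesis
    using is_linear_functorD(3)[OF F X Y A.zero_closed A.R.zero_closed] f(2)[OF X Y A.zero_closed] by simp
qed

lemma linear_functor_minus:
  assumes C: "linear_category R C" and D: "linear_category R D" and F: "is_linear_functor R C D F"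
    and X: "X \<in> Ob C" and Y: "Y \<in> Ob C" and g: "g \<in> arrs C X Y" and h: "h \<in> arrs C X Y"
  shows "farr F X Y (g \<ominus>\<^bsub>Hom C X Y\<^esub> h) = farr F X Y g \<ominus>\<^bsub>Hom D (fobj F X) (fobj F Y)\<^esub> farr F X Y h"
proof -
  note f = is_functorD[OF is_linear_functorD(1)[OF F]]
  interpret A: Module.module R "Hom C X Y" by (rule linear_category.hom_module[OF C X Y])
  interpret B: Module.module R "Hom D (fobj F X) (fobj F Y)" by (rule linear_category.hom_module[OF D f(1)[OF X] f(1)[OF Y]])
  have d: "g \<ominus>\<^bsub>Hom C X Y\<^esub> h \<in> arrs C X Y" using g h by simp
  have "farr F X Y (g \<ominus>\<^bsub>Hom C X Y\<^esub> h \<oplus>\<^bsub>Hom C X Y\<^esub> h) =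
      farr F X Y (g \<ominus>\<^bsub>Hom C X Y\<^esub> h) \<oplus>\<^bsub>Hom D (fobj F X) (fobj F Y)\<^esub> farr F X Y h"
    by (rule is_linear_functorD(2)[OF F X Y d h])
  moreover have "g \<ominus>\<^bsub>Hom C X Y\<^esub> h \<oplus>\<^bsub>Hom C X Y\<^esub> h = g"
    using g h by (simp add: A.minus_eq A.a_assoc A.l_neg)
  ultimately show ?thesis
    using f(2)[OF X Y d] f(2)[OF X Y h] by (simp add: B.minus_eq B.a_assoc B.r_neg)
qed

lemma (in Module.module) finsum_const_smult:
  assumes "finite A" "x \<in> carrier M"
  shows "finsum M (\<lambda>_. x) A = ([card A] \<cdot>\<^bsub>R\<^esub> \<one>\<^bsub>R\<^esub>) \<odot>\<^bsub>M\<^esub> x"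
  using assms(1)
proof (induction A)
  case (insert a A)
  then show ?case using assms(2) by (simp add: finsum_insert smult_l_distr a_comm)
qed (use assms(2) in simp)

locale strict_power = power_P_cat R N dummy
  for R :: "'r ring" and N :: nat and dummy :: "'m itself" +
  fixes s :: nat
begin

sublocale tensor_powers R s by (rule tensor_powers.intro[OF cring])

sublocale S: linear_category R "Schur_cat R s" by (rule Schur_linear)

abbreviation "TP \<equiv> tensor_power R s"
abbreviation "DD \<equiv> pow_obj R N"
abbreviation "tens M L f \<equiv> tmap R s M L (\<lambda>_. f)"

lemma DD_fg: "fg_projective R K \<Longrightarrow> fg_projective R (DD K)"
  using D_ob[of K] by simp

lemma tens_arr:
  assumes M: "fg_projective R M" and L: "fg_projective R L" and f: "f \<in> lin_maps R M L"
  shows "tens M L f \<in> arrs (Schur_cat R s) M L"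
proof -
  note m = fg_projective_module[OF M] and l = fg_projective_module[OF L]
  show ?thesis unfolding Schur_arrs[OF m l]
    using tmap_lin[OF m l, of "\<lambda>_. f"] tmap_perm[OF m l, of _ "\<lambda>_. f" "\<lambda>_. f"] f by blast
qed

text \<open>With a_i the multiplicity of i in \<open>A\<close>, this is the product of the divided
  powers of order a_i of the inclusions, an element of Gamma^s(Hom(K, D K)). Listing the distinct
  arrangements avoids dividing by factorials.\<close>

definition sym_map :: "nat multiset \<Rightarrow> 'r pmod \<Rightarrow> 'r tpow \<Rightarrow> 'r tpow" where
  "sym_map A K = finsum (hom_mod R (TP K) (TP (DD K)))
     (\<lambda>xs. tmap R s K (DD K) (\<lambda>j. pow_inj R N (xs ! j) K)) (permutations_of_multiset A)"

lemma inj_lin: "fg_projective R K \<Longrightarrow> i < N \<Longrightarrow> pow_inj R N i K \<in> lin_maps R K (DD K)"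
  using inj_arr[of K i] by simp

lemma TP_Mod: "fg_projective R K \<Longrightarrow> Module.module R (TP K)"
  by (rule tp_module[OF fg_projective_module])

lemma compose_finsum_left:
  fixes X Y Z :: "('r, 'z) module"
  assumes "Module.module R X" "Module.module R Y" "Module.module R Z" "g \<in> lin_maps R Y Z" "finite B"
    "\<And>i. i \<in> B \<Longrightarrow> h i \<in> lin_maps R X Y"
  shows "compose (carrier X) g (finsum (hom_mod R X Y) h B) = finsum (hom_mod R X Z) (\<lambda>i. compose (carrier X) g (h i)) B"
  using linear_category.cmp_finsum_right[OF linear_category_Mod_cat, of X R Y Z g B h] assms by simp

lemma compose_finsum_right:
  fixes X Y Z :: "('r, 'z) module"
  assumes "Module.module R X" "Module.module R Y" "Module.module R Z" "g \<in> lin_maps R X Y" "finite B"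
    "\<And>i. i \<in> B \<Longrightarrow> h i \<in> lin_maps R Y Z"
  shows "compose (carrier X) (finsum (hom_mod R Y Z) h B) g = finsum (hom_mod R X Z) (\<lambda>i. compose (carrier X) (h i) g) B"
  using linear_category.cmp_finsum_left[OF linear_category_Mod_cat, of X R Y Z g B h] assms by simp

lemma finsum_hom_cong:
  assumes "Module.module R X" "Module.module R Y" "\<And>i. i \<in> B \<Longrightarrow> h i = h' i" "\<And>i. i \<in> B \<Longrightarrow> h' i \<in> lin_maps R X Y"
  shows "finsum (hom_mod R X Y) h B = finsum (hom_mod R X Y) h' B"
proof -
  interpret H: Module.module R "hom_mod R X Y" by (rule hom_mod_module[OF assms(1,2)])
  show ?thesis using assms(3,4) by (intro H.finsum_cong') auto
qed

text \<open>The codiagonal of the N-fold sum.\<close>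

definition "fold_map K = cotuple K K (\<lambda>_. Idn (P_cat R) K)"

lemma fold_map:
  assumes K: "fg_projective R K"
  shows "fold_map K \<in> lin_maps R (DD K) K" and "i < N \<Longrightarrow> compose (carrier K) (fold_map K) (pow_inj R N i K) = (\<lambda>x\<in>carrier K. x)"
  using cotuple[of K K "\<lambda>_. Idn (P_cat R) K"] K lin_maps_id[OF fg_projective_module[OF K]] by (simp_all add: fold_map_def)

context
  fixes A :: "nat multiset"
  assumes A: "size A = s" "set_mset A = {..<N}"
begin

lemma perm_A:
  assumes "xs \<in> permutations_of_multiset A"
  shows "length xs = s" "set xs = {..<N}" "j < s \<Longrightarrow> xs ! j < N"
proof -
  have m: "mset xs = A" using assms by (simp add: permutations_of_multiset_def)
  show l: "length xs = s" using A(1) m by (metis size_mset)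
  show st: "set xs = {..<N}" using A(2) m by (metis set_mset_mset)
  show "j < s \<Longrightarrow> xs ! j < N" using nth_mem[of j xs] l st by simp
qed

lemma summand_lin:
  assumes K: "fg_projective R K" and xs: "xs \<in> permutations_of_multiset A"
  shows "tmap R s K (DD K) (\<lambda>j. pow_inj R N (xs ! j) K) \<in> lin_maps R (TP K) (TP (DD K))"
  by (rule tmap_lin[OF fg_projective_module[OF K] fg_projective_module[OF DD_fg[OF K]]])
    (rule inj_lin[OF K perm_A(3)[OF xs]])

lemma sym_map_lin:
  assumes K: "fg_projective R K" shows "sym_map A K \<in> lin_maps R (TP K) (TP (DD K))"
proof -
  interpret H: Module.module R "hom_mod R (TP K) (TP (DD K))"
    by (rule hom_mod_module[OF TP_Mod[OF K] TP_Mod[OF DD_fg[OF K]]])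
  show ?thesis unfolding sym_map_def using H.finsum_closed[of _ "permutations_of_multiset A"] summand_lin[OF K] by (simp add: Pi_iff)
qed

lemma tens_sym_map:
  fixes K L :: "'r pmod"
  assumes K: "fg_projective R K" and L: "fg_projective R L" and g: "g \<in> lin_maps R (DD K) L"
  shows "compose (carrier (TP K)) (tens (DD K) L g) (sym_map A K) =
    finsum (hom_mod R (TP K) (TP L)) (\<lambda>xs. tmap R s K L (\<lambda>j. compose (carrier K) g (pow_inj R N (xs ! j) K))) (permutations_of_multiset A)"
proof -
  note mK = fg_projective_module[OF K] and mD = fg_projective_module[OF DD_fg[OF K]] and mL = fg_projective_module[OF L]
  have "compose (carrier (TP K)) (tens (DD K) L g) (sym_map A K) = finsum (hom_mod R (TP K) (TP L))
      (\<lambda>xs. compose (carrier (TP K)) (tens (DD K) L g) (tmap R s K (DD K) (\<lambda>j. pow_inj R N (xs ! j) K))) (permutations_of_multiset A)"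
    unfolding sym_map_def
    by (rule compose_finsum_left[OF TP_Mod[OF K] TP_Mod[OF DD_fg[OF K]] TP_Mod[OF L] tmap_lin[OF mD mL g]]) (simp_all add: summand_lin[OF K])
  also have "\<dots> = finsum (hom_mod R (TP K) (TP L)) (\<lambda>xs. tmap R s K L (\<lambda>j. compose (carrier K) g (pow_inj R N (xs ! j) K))) (permutations_of_multiset A)"
  proof (rule finsum_hom_cong[OF TP_Mod[OF K] TP_Mod[OF L]])
    fix xs assume xs: "xs \<in> permutations_of_multiset A"
    show "compose (carrier (TP K)) (tens (DD K) L g) (tmap R s K (DD K) (\<lambda>j. pow_inj R N (xs ! j) K)) =
        tmap R s K L (\<lambda>j. compose (carrier K) g (pow_inj R N (xs ! j) K))"
      by (rule tmap_cmp[OF mK mD mL inj_lin[OF K perm_A(3)[OF xs]] g])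
    show "tmap R s K L (\<lambda>j. compose (carrier K) g (pow_inj R N (xs ! j) K)) \<in> lin_maps R (TP K) (TP L)"
      by (rule tmap_lin[OF mK mL lin_maps_compose[OF mK inj_lin[OF K perm_A(3)[OF xs]] g]])
  qed
  finally show ?thesis .
qed

lemma sym_map_tens:
  fixes K L :: "'r pmod"
  assumes K: "fg_projective R K" and L: "fg_projective R L" and f: "f \<in> lin_maps R K L"
  shows "compose (carrier (TP K)) (sym_map A L) (tens K L f) =
    finsum (hom_mod R (TP K) (TP (DD L))) (\<lambda>xs. tmap R s K (DD L) (\<lambda>j. compose (carrier K) (pow_inj R N (xs ! j) L) f)) (permutations_of_multiset A)"
proof -
  note mK = fg_projective_module[OF K] and mD = fg_projective_module[OF DD_fg[OF L]] and mL = fg_projective_module[OF L]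
  have "compose (carrier (TP K)) (sym_map A L) (tens K L f) = finsum (hom_mod R (TP K) (TP (DD L)))
      (\<lambda>xs. compose (carrier (TP K)) (tmap R s L (DD L) (\<lambda>j. pow_inj R N (xs ! j) L)) (tens K L f)) (permutations_of_multiset A)"
    unfolding sym_map_def
    by (rule compose_finsum_right[OF TP_Mod[OF K] TP_Mod[OF L] TP_Mod[OF DD_fg[OF L]] tmap_lin[OF mK mL f]]) (simp_all add: summand_lin[OF L])
  also have "\<dots> = finsum (hom_mod R (TP K) (TP (DD L))) (\<lambda>xs. tmap R s K (DD L) (\<lambda>j. compose (carrier K) (pow_inj R N (xs ! j) L) f)) (permutations_of_multiset A)"
  proof (rule finsum_hom_cong[OF TP_Mod[OF K] TP_Mod[OF DD_fg[OF L]]])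
    fix xs assume xs: "xs \<in> permutations_of_multiset A"
    show "compose (carrier (TP K)) (tmap R s L (DD L) (\<lambda>j. pow_inj R N (xs ! j) L)) (tens K L f) =
        tmap R s K (DD L) (\<lambda>j. compose (carrier K) (pow_inj R N (xs ! j) L) f)"
      by (rule tmap_cmp[OF mK mL mD f inj_lin[OF L perm_A(3)[OF xs]]])
    show "tmap R s K (DD L) (\<lambda>j. compose (carrier K) (pow_inj R N (xs ! j) L) f) \<in> lin_maps R (TP K) (TP (DD L))"
      by (rule tmap_lin[OF mK mD lin_maps_compose[OF mK f inj_lin[OF L perm_A(3)[OF xs]]]])
  qed
  finally show ?thesis .
qed

text \<open>Each single summand is not equivariant, but a permutation of the tensor factors merely
  permutes the arrangements among themselves.\<close>

lemma sym_map_arr: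
  assumes K: "fg_projective R K" shows "sym_map A K \<in> arrs (Schur_cat R s) K (DD K)"
proof -
  note mK = fg_projective_module[OF K] and mD = fg_projective_module[OF DD_fg[OF K]]
  let ?t = "\<lambda>xs. tmap R s K (DD K) (\<lambda>j. pow_inj R N (xs ! j) K)"
  let ?P = "permutations_of_multiset A"
  let ?H = "hom_mod R (TP K) (TP (DD K))"
  have "compose (carrier (TP K)) (sym_map A K) (tensor_perm R s K \<sigma>) =
      compose (carrier (TP K)) (tensor_perm R s (DD K) \<sigma>) (sym_map A K)" if \<sigma>: "\<sigma> permutes {..<s}" for \<sigma>
  proof -
    note pK = tensor_perm_pure(1)[OF cring mK \<sigma>] and pD = tensor_perm_pure(1)[OF cring mD \<sigma>]
    let ?f = "\<lambda>xs. compose (carrier (TP K)) (?t xs) (tensor_perm R s K \<sigma>)"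
    interpret H: Module.module R ?H by (rule hom_mod_module[OF TP_Mod[OF K] TP_Mod[OF DD_fg[OF K]]])
    have pl: "permute_list \<tau> xs \<in> ?P" if "xs \<in> ?P" "\<tau> permutes {..<s}" for \<tau> xs
      using that perm_A(1)[OF that(1)] by (simp add: permutations_of_multiset_def)
    have inv: "inv_into UNIV \<sigma> permutes {..<s}" by (rule permutes_inv[OF \<sigma>])
    \<comment> \<open>The inverse permutation gives the inverse map on arrangements, so the sum can
      be reindexed.\<close>
    have bij: "bij_betw (permute_list \<sigma>) ?P ?P"
    proof (rule bij_betw_byWitness[where f' = "permute_list (inv_into UNIV \<sigma>)"])
      show "\<forall>xs\<in>?P. permute_list (inv_into UNIV \<sigma>) (permute_list \<sigma> xs) = xs"
        using perm_A(1) permute_list_compose[of "inv_into UNIV \<sigma>" _ \<sigma>] inv permutes_inv_o[OF \<sigma>] by (metis permute_list_id)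
      show "\<forall>xs\<in>?P. permute_list \<sigma> (permute_list (inv_into UNIV \<sigma>) xs) = xs"
        using perm_A(1) permute_list_compose[of \<sigma> _ "inv_into UNIV \<sigma>"] \<sigma> permutes_inv_o[OF \<sigma>] by (metis permute_list_id)
    qed (use pl \<sigma> inv in blast)+
    have fl: "?f xs \<in> lin_maps R (TP K) (TP (DD K))" if "xs \<in> ?P" for xs
      by (rule lin_maps_compose[OF TP_Mod[OF K] pK summand_lin[OF K that]])
    have "compose (carrier (TP K)) (sym_map A K) (tensor_perm R s K \<sigma>) = finsum ?H ?f ?P"
      unfolding sym_map_def
      by (rule compose_finsum_right[OF TP_Mod[OF K] TP_Mod[OF K] TP_Mod[OF DD_fg[OF K]] pK]) (simp_all add: summand_lin[OF K])
    also have "\<dots> = finsum ?H (\<lambda>xs. ?f (permute_list \<sigma> xs)) ?P"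
    proof -
      note im = bij_betw_imp_surj_on[OF bij]
      have "finsum ?H ?f (permute_list \<sigma> ` ?P) = finsum ?H (\<lambda>xs. ?f (permute_list \<sigma> xs)) ?P"
        by (rule H.finsum_reindex[OF _ bij_betw_imp_inj_on[OF bij]]) (unfold im hom_mod_ops, use fl in blast)
      then show ?thesis unfolding im .
    qed
    also have "\<dots> = finsum ?H (\<lambda>xs. compose (carrier (TP K)) (tensor_perm R s (DD K) \<sigma>) (?t xs)) ?P"
    proof (rule finsum_hom_cong[OF TP_Mod[OF K] TP_Mod[OF DD_fg[OF K]]])
      fix xs assume xs: "xs \<in> ?P"
      show "?f (permute_list \<sigma> xs) = compose (carrier (TP K)) (tensor_perm R s (DD K) \<sigma>) (?t xs)"
        by (rule tmap_perm[OF mK mD \<sigma> inj_lin[OF K perm_A(3)[OF pl[OF xs \<sigma>]]] inj_lin[OF K perm_A(3)[OF xs]]])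
          (use \<sigma> perm_A(1)[OF xs] in \<open>simp_all add: permute_list_nth\<close>)
      show "compose (carrier (TP K)) (tensor_perm R s (DD K) \<sigma>) (?t xs) \<in> lin_maps R (TP K) (TP (DD K))"
        by (rule lin_maps_compose[OF TP_Mod[OF K] summand_lin[OF K xs] pD])
    qed
    also have "\<dots> = compose (carrier (TP K)) (tensor_perm R s (DD K) \<sigma>) (sym_map A K)"
      unfolding sym_map_def
      by (rule compose_finsum_left[OF TP_Mod[OF K] TP_Mod[OF DD_fg[OF K]] TP_Mod[OF DD_fg[OF K]] pD, symmetric]) (simp_all add: summand_lin[OF K])
    finally show ?thesis .
  qed
  then show ?thesis unfolding Schur_arrs[OF mK mD] using sym_map_lin[OF K] by blast
qed

lemma sym_map_nat:
  assumes K: "fg_projective R K" and L: "fg_projective R L" and f: "f \<in> lin_maps R K L"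
  shows "compose (carrier (TP K)) (tens (DD K) (DD L) (pow_map R N K L f)) (sym_map A K) =
    compose (carrier (TP K)) (sym_map A L) (tens K L f)"
proof -
  have Df: "pow_map R N K L f \<in> lin_maps R (DD K) (DD L)" using Dm_arr[of K L f] K L f by simp
  note mK = fg_projective_module[OF K] and mD = fg_projective_module[OF DD_fg[OF L]]
  show ?thesis unfolding tens_sym_map[OF K DD_fg[OF L] Df] sym_map_tens[OF K L f]
  proof (rule finsum_hom_cong[OF TP_Mod[OF K] TP_Mod[OF DD_fg[OF L]]])
    fix xs assume xs: "xs \<in> permutations_of_multiset A"
    show "tmap R s K (DD L) (\<lambda>j. compose (carrier K) (pow_map R N K L f) (pow_inj R N (xs ! j) K)) =
      tmap R s K (DD L) (\<lambda>j. compose (carrier K) (pow_inj R N (xs ! j) L) f)"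
      by (rule tmap_cong) (use Dm_inj[of K L f] K L f perm_A(3)[OF xs] in simp)
    show "tmap R s K (DD L) (\<lambda>j. compose (carrier K) (pow_inj R N (xs ! j) L) f) \<in> lin_maps R (TP K) (TP (DD L))"
      by (rule tmap_lin[OF mK mD lin_maps_compose[OF mK f inj_lin[OF L perm_A(3)[OF xs]]]])
  qed
qed

text \<open>Here the condition that every index \<open>i < N\<close> occurs in \<open>A\<close>
  enters: each summand then has a tensor factor \<open>inj i\<close>, which \<open>omit i K\<close>
  turns into zero.\<close>

lemma omit_sym_map:
  assumes K: "fg_projective R K" and i: "i < N"
  shows "compose (carrier (TP K)) (tens (DD K) (DD K) (omit i K)) (sym_map A K) = zero_arr (Schur_cat R s) K (DD K)"
proof -
  have o: "omit i K \<in> lin_maps R (DD K) (DD K)" using omit_arr[of K i] K by simp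
  note mK = fg_projective_module[OF K] and mD = fg_projective_module[OF DD_fg[OF K]]
  interpret H: Module.module R "hom_mod R (TP K) (TP (DD K))"
    by (rule hom_mod_module[OF TP_Mod[OF K] TP_Mod[OF DD_fg[OF K]]])
  have "compose (carrier (TP K)) (tens (DD K) (DD K) (omit i K)) (sym_map A K) =
    finsum (hom_mod R (TP K) (TP (DD K))) (\<lambda>xs. \<zero>\<^bsub>hom_mod R (TP K) (TP (DD K))\<^esub>) (permutations_of_multiset A)"
    unfolding tens_sym_map[OF K DD_fg[OF K] o]
  proof (rule finsum_hom_cong[OF TP_Mod[OF K] TP_Mod[OF DD_fg[OF K]]])
    fix xs assume xs: "xs \<in> permutations_of_multiset A"
    then obtain j where j: "j < s" "xs ! j = i" using perm_A[OF xs] i by (metis in_set_conv_nth lessThan_iff)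
    show "tmap R s K (DD K) (\<lambda>j. compose (carrier K) (omit i K) (pow_inj R N (xs ! j) K)) = \<zero>\<^bsub>hom_mod R (TP K) (TP (DD K))\<^esub>"
      unfolding hom_mod_ops
      by (rule tmap_zero[OF mK mD lin_maps_compose[OF mK inj_lin[OF K perm_A(3)[OF xs]] o] j(1)])
        (use omit_inj[of K i i] K i j in simp_all)
    show "\<zero>\<^bsub>hom_mod R (TP K) (TP (DD K))\<^esub> \<in> lin_maps R (TP K) (TP (DD K))" using H.zero_closed unfolding hom_mod_ops(1) .
  qed
  also have "\<dots> = \<zero>\<^bsub>hom_mod R (TP K) (TP (DD K))\<^esub>" by (rule H.finsum_zero)
  finally show ?thesis by simp
qed

text \<open>The codiagonal undoes every inclusion, so each arrangement contributes an identity;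
  their number is the multinomial coefficient.\<close>

lemma fold_sym_map:
  assumes K: "fg_projective R K"
  shows "compose (carrier (TP K)) (tens (DD K) K (fold_map K)) (sym_map A K) =
    ([card (permutations_of_multiset A)] \<cdot>\<^bsub>R\<^esub> \<one>\<^bsub>R\<^esub>) \<odot>\<^bsub>Hom (Schur_cat R s) K K\<^esub> Idn (Schur_cat R s) K"
proof -
  note mK = fg_projective_module[OF K]
  interpret H: Module.module R "hom_mod R (TP K) (TP K)" by (rule hom_mod_module[OF TP_Mod[OF K] TP_Mod[OF K]])
  note i = lin_maps_id[OF TP_Mod[OF K]]
  have "compose (carrier (TP K)) (tens (DD K) K (fold_map K)) (sym_map A K) =
    finsum (hom_mod R (TP K) (TP K)) (\<lambda>xs. \<lambda>z\<in>carrier (TP K). z) (permutations_of_multiset A)"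
    unfolding tens_sym_map[OF K K fold_map(1)[OF K]]
  proof (rule finsum_hom_cong[OF TP_Mod[OF K] TP_Mod[OF K]])
    fix xs assume xs: "xs \<in> permutations_of_multiset A"
    have "tmap R s K K (\<lambda>j. compose (carrier K) (fold_map K) (pow_inj R N (xs ! j) K)) = tmap R s K K (\<lambda>_. \<lambda>x\<in>carrier K. x)"
      by (rule tmap_cong) (rule fold_map(2)[OF K perm_A(3)[OF xs]])
    then show "tmap R s K K (\<lambda>j. compose (carrier K) (fold_map K) (pow_inj R N (xs ! j) K)) = (\<lambda>z\<in>carrier (TP K). z)"
      using tmap_id[OF mK] by simp
  qed (rule i)
  also have "\<dots> = ([card (permutations_of_multiset A)] \<cdot>\<^bsub>R\<^esub> \<one>\<^bsub>R\<^esub>) \<odot>\<^bsub>hom_mod R (TP K) (TP K)\<^esub> (\<lambda>z\<in>carrier (TP K). z)"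
    by (rule H.finsum_const_smult) (simp_all add: i)
  finally show ?thesis by simp
qed

end

end

context strict_power begin

lemma tens_cmp:
  assumes "fg_projective R L" "fg_projective R M" "fg_projective R K" "f \<in> lin_maps R L M" "g \<in> lin_maps R M K"
  shows "compose (carrier (TP L)) (tens M K g) (tens L M f) = tens L K (compose (carrier L) g f)"
  using assms by (intro tmap_cmp fg_projective_module)

lemma fold_map_nat:
  assumes K: "fg_projective R K" and L: "fg_projective R L" and f: "f \<in> lin_maps R K L"
  shows "compose (carrier (DD K)) (fold_map L) (pow_map R N K L f) = compose (carrier (DD K)) f (fold_map K)"
proof -
  note mD = fg_projective_module[OF DD_fg[OF K]]
  have Df: "pow_map R N K L f \<in> lin_maps R (DD K) (DD L)" using Dm_arr[of K L f] K L f by simp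
  note c = lin_maps_compose[OF mD Df fold_map(1)[OF L]] lin_maps_compose[OF mD fold_map(1)[OF K] f]
  have "Cmp (P_cat R) (DD K) (DD L) L (fold_map L) (pow_map R N K L f) = Cmp (P_cat R) (DD K) K L f (fold_map K)"
  proof (rule inj_ext[of K L])
    fix i assume i: "i < N"
    have il: "pow_inj R N i K \<in> lin_maps R K (DD K)" "pow_inj R N i L \<in> lin_maps R L (DD L)"
      using inj_arr[of K i] inj_arr[of L i] K L i by simp_all
    have d: "pow_map R N K L f (pow_inj R N i K x) = pow_inj R N i L (f x)" if "x \<in> carrier K" for x
      using fun_cong[OF Dm_inj[of K L f i], of x] K L f i that by (simp add: compose_def)
    have fk: "fold_map M (pow_inj R N i M x) = x" if "fg_projective R M" "x \<in> carrier M" for M :: "'r pmod" and x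
      using fun_cong[OF fold_map(2)[OF that(1) i], of x] that(2) by (simp add: compose_def)
    have "compose (carrier K) (compose (carrier (DD K)) (fold_map L) (pow_map R N K L f)) (pow_inj R N i K) x =
        compose (carrier K) (compose (carrier (DD K)) f (fold_map K)) (pow_inj R N i K) x" for x
      by (cases "x \<in> carrier K")
        (simp_all add: compose_def lin_maps_carrier[OF il(1)] d fk[OF K] fk[OF L] lin_maps_carrier[OF f])
    then show "Cmp (P_cat R) K (DD K) L (Cmp (P_cat R) (DD K) (DD L) L (fold_map L) (pow_map R N K L f)) (pow_inj R N i K) =
        Cmp (P_cat R) K (DD K) L (Cmp (P_cat R) (DD K) K L f (fold_map K)) (pow_inj R N i K)" by auto
  qed (use K L c in simp_all)
  then show ?thesis by simp
qed

text \<open>By naturality \<open>eps\<close> on F factors through \<open>eps\<close> on H as soon as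
  F is a retract of H. It serves sources that are only isomorphic to an underlying functor.\<close>

lemma eps_zero_iso:
  assumes iso: "iso_obj FC F H" and z: "eps N H = zero_arr FC (T H) (T H)"
  shows "eps N F = zero_arr FC (T F) (T F)"
proof -
  obtain f g where F: "F \<in> Ob FC" and H: "H \<in> Ob FC" and f: "f \<in> arrs FC F H" and g: "g \<in> arrs FC H F"
    and gf: "Cmp FC F H F g f = Idn FC F"
    using iso unfolding iso_obj_def by blast
  note S = T_self_adjoint[of 0]
  note TF = T_ob[OF F] and TH = T_ob[OF H]
  note Tf = self_adjoint_functor.Tm_arr[OF S F H f] and Tg = self_adjoint_functor.Tm_arr[OF S H F g]
  have "Tm F F (Idn FC F) = Idn FC (T F)"
    by (rule functor_cat_arr_eqI[OF self_adjoint_functor.Tm_arr[OF S F F FC.idn_arr[OF F]] FC.idn_arr[OF TF]])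
      (use D_ob in \<open>simp add: Tm_def\<close>)
  then have id: "Cmp FC (T F) (T H) (T F) (Tm H F g) (Tm F H f) = Idn FC (T F)"
    using self_adjoint_functor.Tm_cmp[OF S F H F f g] gf by simp
  have "eps N F = Cmp FC (T F) (T F) (T F) (eps N F) (Cmp FC (T F) (T H) (T F) (Tm H F g) (Tm F H f))"
    unfolding id by (rule FC.cmp_idn[OF TF TF eps_arr[OF F], symmetric])
  also have "\<dots> = Cmp FC (T F) (T H) (T F) (Cmp FC (T H) (T F) (T F) (eps N F) (Tm H F g)) (Tm F H f)"
    by (rule FC.cmp_assoc[OF TF TH TF TF Tf Tg eps_arr[OF F]])
  also have "\<dots> = Cmp FC (T F) (T H) (T F) (Cmp FC (T H) (T H) (T F) (Tm H F g) (zero_arr FC (T H) (T H))) (Tm F H f)"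
    unfolding eps_nat[OF H F g] z ..
  also have "\<dots> = zero_arr FC (T F) (T F)"
    unfolding FC.cmp_zero_right[OF TH TH TF Tg] by (rule FC.cmp_zero_left[OF TF TH TF Tf])
  finally show ?thesis .
qed

definition "scale_map a K = (\<lambda>x\<in>carrier K. a \<odot>\<^bsub>K\<^esub> x)"

lemma scale_map_lin:
  assumes K: "fg_projective R K" and a: "a \<in> carrier R"
  shows "scale_map a K \<in> lin_maps R K K"
proof -
  interpret K: Module.module R K by (rule fg_projective_module[OF K])
  show ?thesis unfolding scale_map_def
    by (rule lin_mapsI) (use a in \<open>simp_all add: K.smult_r_distr K.smult_assoc1[symmetric] K.R.m_comm\<close>)
qed

text \<open>Homotheties commute with all linear maps, so they define an element of the center of the
  functor category.\<close>

definition "scale_nat a X = (\<lambda>K\<in>Ob (P_cat R). farr X K K (scale_map a K))"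

lemma scale_nat_arr:
  assumes X: "is_functor (P_cat R) (Mod_cat R) X" and a: "a \<in> carrier R"
  shows "scale_nat a X \<in> arrs FC X X"
  unfolding functor_cat_arrs
proof (intro conjI ballI)
  show "scale_nat a X \<in> extensional (Ob (P_cat R))" by (simp add: scale_nat_def)
  fix K assume K: "K \<in> Ob (P_cat R)"
  then have "scale_map a K \<in> arrs (P_cat R) K K" using scale_map_lin[OF _ a] by simp
  from is_functorD(2)[OF X K K this] K
  show "scale_nat a X K \<in> arrs (Mod_cat R) (fobj X K) (fobj X K)" by (simp add: scale_nat_def)
  fix L f assume L: "L \<in> Ob (P_cat R)" and f: "f \<in> arrs (P_cat R) K L"
  interpret K: Module.module R K by (rule fg_projective_module) (use K in simp)
  have "Cmp (P_cat R) K L L (scale_map a L) f = Cmp (P_cat R) K K L f (scale_map a K)"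
    using f a by (simp add: scale_map_def compose_def lin_maps_carrier[of f] lin_maps_smult[of f] cong: restrict_cong)
  moreover have sk: "scale_map a K \<in> arrs (P_cat R) K K" and sl: "scale_map a L \<in> arrs (P_cat R) L L"
    using K L scale_map_lin[OF _ a] by simp_all
  ultimately show "Cmp (Mod_cat R) (fobj X K) (fobj X L) (fobj X L) (scale_nat a X L) (farr X K L f) =
      Cmp (Mod_cat R) (fobj X K) (fobj X K) (fobj X L) (farr X K L f) (scale_nat a X K)"
    using K L is_functorD(4)[OF X K L L f sl] is_functorD(4)[OF X K K L sk f] by (simp add: scale_nat_def)
qed

lemma scale_nat_natural:
  assumes X: "is_functor (P_cat R) (Mod_cat R) X" and Y: "is_functor (P_cat R) (Mod_cat R) Y"
    and c: "c \<in> arrs FC X Y" and a: "a \<in> carrier R"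
  shows "Cmp FC X Y Y (scale_nat a Y) c = Cmp FC X X Y c (scale_nat a X)"
proof (rule functor_cat_arr_eqI[of _ "P_cat R" "Mod_cat R" X Y])
  show "Cmp FC X Y Y (scale_nat a Y) c \<in> arrs FC X Y" "Cmp FC X X Y c (scale_nat a X) \<in> arrs FC X Y"
    using X Y c scale_nat_arr[OF X a] scale_nat_arr[OF Y a] by (simp_all add: FC.cmp_arr)
  fix K assume K: "K \<in> Ob (P_cat R)"
  then have "scale_map a K \<in> arrs (P_cat R) K K" using scale_map_lin[OF _ a] by simp
  from functor_cat_arrsD(2)[OF c K K this] K
  show "Cmp FC X Y Y (scale_nat a Y) c K = Cmp FC X X Y c (scale_nat a X) K" by (simp add: scale_nat_def)
qed

context
  fixes G :: "('r, 'm) strict_functor"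
  assumes G: "G \<in> Ob (strict_poly_cat R s)"
begin

abbreviation "U \<equiv> underlying R s G"

lemma G_linear: "is_linear_functor R (Schur_cat R s) (Mod_cat R) G"
  using G by (simp add: strict_poly_cat_def)

lemma U_functor: "is_functor (P_cat R) (Mod_cat R) U"
  using underlying_functor[OF cring G] by (simp add: F_cat_def)

lemma U_Ob: "U \<in> Ob FC"
  using U_functor by simp

lemma U_simps [simp]: "fobj U K = fobj G K" "farr U K L f = farr G K L (tens K L f)"
  by (simp_all add: underlying_def)

lemma G_cmp:
  assumes "fg_projective R L" "fg_projective R M" "fg_projective R K"
    and "f \<in> arrs (Schur_cat R s) L M" "g \<in> arrs (Schur_cat R s) M K"
  shows "compose (carrier (fobj G L)) (farr G M K g) (farr G L M f) = farr G L K (compose (carrier (TP L)) g f)"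
  using is_functorD(4)[OF is_linear_functorD(1)[OF G_linear], of L M K f g] assms by simp

lemma G_arr:
  assumes "fg_projective R L" "fg_projective R M" "f \<in> arrs (Schur_cat R s) L M"
  shows "farr G L M f \<in> lin_maps R (fobj G L) (fobj G M)"
  using is_functorD(2)[OF is_linear_functorD(1)[OF G_linear], of L M f] assms by simp

lemma G_zero:
  assumes "fg_projective R L" "fg_projective R M"
  shows "farr G L M (zero_arr (Schur_cat R s) L M) = zero_arr (Mod_cat R) (fobj G L) (fobj G M)"
  using linear_functor_zero[OF Schur_linear linear_category_Mod_cat G_linear] assms by simp

lemma G_scalar:
  assumes K: "fg_projective R K" and a: "a \<in> carrier R"
  shows "farr G K K (a \<odot>\<^bsub>Hom (Schur_cat R s) K K\<^esub> Idn (Schur_cat R s) K) =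
    a \<odot>\<^bsub>Hom (Mod_cat R) (fobj G K) (fobj G K)\<^esub> Idn (Mod_cat R) (fobj G K)"
proof -
  have K': "K \<in> Ob (Schur_cat R s)" using K by simp
  show ?thesis
    unfolding is_linear_functorD(3)[OF G_linear K' K' S.idn_arr[OF K'] a]
      is_functorD(3)[OF is_linear_functorD(1)[OF G_linear] K'] ..
qed

text \<open>The s-th tensor power of a homothety is multiplication by a^s, and linearity of G on the
  Schur category passes this scalar on.\<close>

lemma scale_nat_U:
  assumes a: "a \<in> carrier R"
  shows "scale_nat a U = (a [^]\<^bsub>R\<^esub> s) \<odot>\<^bsub>Hom FC U U\<^esub> Idn FC U"
proof (rule functor_cat_arr_eqI[OF scale_nat_arr[OF U_functor a]])
  interpret R: cring R by (rule cring)
  interpret H: Module.module R "Hom FC U U" by (rule FC.hom_module[OF U_Ob U_Ob])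
  have as: "a [^]\<^bsub>R\<^esub> s \<in> carrier R" using a by simp
  show "(a [^]\<^bsub>R\<^esub> s) \<odot>\<^bsub>Hom FC U U\<^esub> Idn FC U \<in> arrs FC U U"
    by (rule H.smult_closed[OF as FC.idn_arr[OF U_Ob]])
  fix K assume K: "K \<in> Ob (P_cat R)"
  then have K': "fg_projective R K" by simp
  have "tens K K (scale_map a K) = (a [^]\<^bsub>R\<^esub> s) \<odot>\<^bsub>Hom (Schur_cat R s) K K\<^esub> Idn (Schur_cat R s) K"
    using tmap_scale[OF fg_projective_module[OF K'] a] by (simp add: scale_map_def hom_mod_ops cong: restrict_cong)
  then have "scale_nat a U K = farr G K K ((a [^]\<^bsub>R\<^esub> s) \<odot>\<^bsub>Hom (Schur_cat R s) K K\<^esub> Idn (Schur_cat R s) K)"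
    using K by (simp add: scale_nat_def)
  also have "\<dots> = ((a [^]\<^bsub>R\<^esub> s) \<odot>\<^bsub>Hom FC U U\<^esub> Idn FC U) K"
    unfolding G_scalar[OF K' as] functor_cat_app(5)[OF K] functor_cat_app(2)[OF K] by simp
  finally show "scale_nat a U K = ((a [^]\<^bsub>R\<^esub> s) \<odot>\<^bsub>Hom FC U U\<^esub> Idn FC U) K" .
qed

definition "fold_nat = (\<lambda>K\<in>Ob (P_cat R). farr U (DD K) K (fold_map K))"

lemma fold_nat_arr: "fold_nat \<in> arrs FC (T U) U"
  unfolding functor_cat_arrs
proof (intro conjI ballI)
  show "fold_nat \<in> extensional (Ob (P_cat R))" by (simp add: fold_nat_def)
  fix K assume "K \<in> Ob (P_cat R)"
  then have K: "fg_projective R K" by simp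
  note tK = tens_arr[OF DD_fg[OF K] K fold_map(1)[OF K]]
  show "fold_nat K \<in> arrs (Mod_cat R) (fobj (T U) K) (fobj U K)"
    using G_arr[OF DD_fg[OF K] K tK] K by (simp add: fold_nat_def)
  fix L f assume "L \<in> Ob (P_cat R)" and "f \<in> arrs (P_cat R) K L"
  then have L: "fg_projective R L" and f: "f \<in> lin_maps R K L" by simp_all
  have Df: "pow_map R N K L f \<in> lin_maps R (DD K) (DD L)" using Dm_arr[of K L f] K L f by simp
  show "Cmp (Mod_cat R) (fobj (T U) K) (fobj (T U) L) (fobj U L) (fold_nat L) (farr (T U) K L f) =
      Cmp (Mod_cat R) (fobj (T U) K) (fobj U K) (fobj U L) (farr U K L f) (fold_nat K)"
    using K L G_cmp[OF DD_fg[OF K] DD_fg[OF L] L tens_arr[OF DD_fg[OF K] DD_fg[OF L] Df] tens_arr[OF DD_fg[OF L] L fold_map(1)[OF L]]]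
      G_cmp[OF DD_fg[OF K] K L tK tens_arr[OF K L f]]
      tens_cmp[OF DD_fg[OF K] DD_fg[OF L] L Df fold_map(1)[OF L]] tens_cmp[OF DD_fg[OF K] K L fold_map(1)[OF K] f]
      fold_map_nat[OF K L f]
    by (simp add: fold_nat_def)
qed

text \<open>Since \<open>sym_map\<close> is a morphism of the Schur category, G may be applied to it
  although it is not a tensor power of a linear map; this is where strictness is exploited. The
  three relations are the images under G of those for \<open>sym_map\<close>.\<close>

lemma sym_nat:
  assumes A: "size A = s" "set_mset A = {..<N}"
  defines "u \<equiv> (\<lambda>K\<in>Ob (P_cat R). farr G K (DD K) (sym_map A K))"
  shows "u \<in> arrs FC U (T U)" and "i < N \<Longrightarrow> Cmp FC U (T U) (T U) (om i U) u = zero_arr FC U (T U)"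
    and "Cmp FC U (T U) U fold_nat u = ([card (permutations_of_multiset A)] \<cdot>\<^bsub>R\<^esub> \<one>\<^bsub>R\<^esub>) \<odot>\<^bsub>Hom FC U U\<^esub> Idn FC U"
proof -
  have TU: "T U \<in> Ob FC" by (rule T_ob[OF U_Ob])
  show u: "u \<in> arrs FC U (T U)"
    unfolding functor_cat_arrs
  proof (intro conjI ballI)
    show "u \<in> extensional (Ob (P_cat R))" by (simp add: u_def)
    fix K assume "K \<in> Ob (P_cat R)"
    then have K: "fg_projective R K" by simp
    show "u K \<in> arrs (Mod_cat R) (fobj U K) (fobj (T U) K)"
      using G_arr[OF K DD_fg[OF K] sym_map_arr[OF A K]] K by (simp add: u_def)
    fix L f assume "L \<in> Ob (P_cat R)" and "f \<in> arrs (P_cat R) K L"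
    then have L: "fg_projective R L" and f: "f \<in> lin_maps R K L" by simp_all
    have Df: "pow_map R N K L f \<in> lin_maps R (DD K) (DD L)" using Dm_arr[of K L f] K L f by simp
    show "Cmp (Mod_cat R) (fobj U K) (fobj U L) (fobj (T U) L) (u L) (farr U K L f) =
        Cmp (Mod_cat R) (fobj U K) (fobj (T U) K) (fobj (T U) L) (farr (T U) K L f) (u K)"
      using K L G_cmp[OF K L DD_fg[OF L] tens_arr[OF K L f] sym_map_arr[OF A L]]
        G_cmp[OF K DD_fg[OF K] DD_fg[OF L] sym_map_arr[OF A K] tens_arr[OF DD_fg[OF K] DD_fg[OF L] Df]]
        sym_map_nat[OF A K L f]
      by (simp add: u_def)
  qed
  show "Cmp FC U (T U) (T U) (om i U) u = zero_arr FC U (T U)" if i: "i < N"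
  proof (rule functor_cat_arr_eqI[OF FC.cmp_arr[OF U_Ob TU TU u om_arr[OF U_functor]] FC.zero_arr_closed[OF U_Ob TU]])
    fix K assume "K \<in> Ob (P_cat R)"
    then have K: "fg_projective R K" by simp
    have o: "omit i K \<in> lin_maps R (DD K) (DD K)" using omit_arr[of K i] K by simp
    have "Cmp FC U (T U) (T U) (om i U) u K = farr G K (DD K) (zero_arr (Schur_cat R s) K (DD K))"
      using K G_cmp[OF K DD_fg[OF K] DD_fg[OF K] sym_map_arr[OF A K] tens_arr[OF DD_fg[OF K] DD_fg[OF K] o]]
        omit_sym_map[OF A K i]
      by (simp add: u_def om_def)
    also have "\<dots> = zero_arr FC U (T U) K" unfolding G_zero[OF K DD_fg[OF K]] using K by simp
    finally show "Cmp FC U (T U) (T U) (om i U) u K = zero_arr FC U (T U) K" .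
  qed
  interpret R: cring R by (rule cring)
  interpret H: Module.module R "Hom FC U U" by (rule FC.hom_module[OF U_Ob U_Ob])
  let ?m = "[card (permutations_of_multiset A)] \<cdot>\<^bsub>R\<^esub> \<one>\<^bsub>R\<^esub>"
  have m: "?m \<in> carrier R" by simp
  show "Cmp FC U (T U) U fold_nat u = ?m \<odot>\<^bsub>Hom FC U U\<^esub> Idn FC U"
  proof (rule functor_cat_arr_eqI[OF FC.cmp_arr[OF U_Ob TU U_Ob u fold_nat_arr] H.smult_closed[OF m FC.idn_arr[OF U_Ob]]])
    fix K assume K0: "K \<in> Ob (P_cat R)"
    then have K: "fg_projective R K" by simp
    have "Cmp FC U (T U) U fold_nat u K = farr G K K (?m \<odot>\<^bsub>Hom (Schur_cat R s) K K\<^esub> Idn (Schur_cat R s) K)"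
      using K G_cmp[OF K DD_fg[OF K] K sym_map_arr[OF A K] tens_arr[OF DD_fg[OF K] K fold_map(1)[OF K]]]
      unfolding fold_sym_map[OF A K, symmetric]
      by (simp add: u_def fold_nat_def)
    also have "\<dots> = (?m \<odot>\<^bsub>Hom FC U U\<^esub> Idn FC U) K"
      unfolding G_scalar[OF K m] functor_cat_app(5)[OF K0] functor_cat_app(2)[OF K0] by simp
    finally show "Cmp FC U (T U) U fold_nat u K = (?m \<odot>\<^bsub>Hom FC U U\<^esub> Idn FC U) K" .
  qed
qed

lemma multinomial_factorization:
  assumes A: "size A = s" "set_mset A = {..<N}"
  shows "\<exists>u\<in>arrs FC U (T U). \<exists>v\<in>arrs FC (T U) U. Cmp FC U (T U) (T U) (eps N U) u = u \<and>
    Cmp FC U (T U) U v u = ([card (permutations_of_multiset A)] \<cdot>\<^bsub>R\<^esub> \<one>\<^bsub>R\<^esub>) \<odot>\<^bsub>Hom FC U U\<^esub> Idn FC U"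
  using sym_nat[OF A] fold_nat_arr eps_fix[OF U_Ob U_Ob sym_nat(1)[OF A], of N] by blast

context
  fixes K :: "'r pmod"
  assumes K: "fg_projective R K"
begin

abbreviation "omt k \<equiv> tens (DD K) (DD K) (omit k K)"
abbreviation "E n \<equiv> S.comp_prod (DD K) omt n"

lemma omit_lin: "omit k K \<in> lin_maps R (DD K) (DD K)"
  using omit_arr[of K k] K by simp

lemma omt_arr: "omt k \<in> arrs (Schur_cat R s) (DD K) (DD K)"
  by (rule tens_arr[OF DD_fg[OF K] DD_fg[OF K] omit_lin])

lemma DD_Schur: "DD K \<in> Ob (Schur_cat R s)"
  using DD_fg[OF K] by simp

lemma E_arr: "E n \<in> arrs (Schur_cat R s) (DD K) (DD K)"
  by (rule S.comp_prod_arr[OF DD_Schur omt_arr])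

lemma E_lin: "E n \<in> lin_maps R (TP (DD K)) (TP (DD K))"
  using E_arr[of n] unfolding Schur_arrs[OF fg_projective_module[OF DD_fg[OF K]] fg_projective_module[OF DD_fg[OF K]]] by blast

text \<open>The underlying functor need not be additive on P_R, so the product of the differences 1
  - F(\<open>omit k K\<close>) cannot be formed inside P_R. It can be formed in the Schur category,
  on which G is linear.\<close>

lemma eps_U_app: "eps n U K = farr G (DD K) (DD K) (E n)"
proof (induction n)
  case 0
  have K0: "K \<in> Ob (P_cat R)" using K by simp
  show ?case
    unfolding FC.comp_prod.simps S.comp_prod.simps functor_cat_app(2)[OF K0] precomp_simps U_simps
    by (rule is_functorD(3)[OF is_linear_functorD(1)[OF G_linear] DD_Schur, symmetric])
next
  case (Suc n)
  have K0: "K \<in> Ob (P_cat R)" using K by simp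
  note TU = T_functor[OF U_functor]
  have TUO: "T U \<in> Ob FC" by (rule T_ob[OF U_Ob])
  note a1 = eps_arr[OF U_Ob, of n] and a2 = FC.cmp_arr[OF TUO TUO TUO om_arr[OF U_functor, of n] eps_arr[OF U_Ob, of n]]
  have "eps (Suc n) U K = eps n U K \<ominus>\<^bsub>Hom (Mod_cat R) (fobj (T U) K) (fobj (T U) K)\<^esub>
      Cmp FC (T U) (T U) (T U) (eps n U) (om n U) K"
    unfolding FC.comp_prod.simps by (rule functor_cat_minus_app[OF FC_linear E TU TU a1 a2 K0])
  also have "Cmp FC (T U) (T U) (T U) (eps n U) (om n U) K =
      farr G (DD K) (DD K) (Cmp (Schur_cat R s) (DD K) (DD K) (DD K) (E n) (omt n))"
    unfolding functor_cat_app(1)[OF K0] Suc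
    using K G_cmp[OF DD_fg[OF K] DD_fg[OF K] DD_fg[OF K] omt_arr E_arr] by (simp add: om_def)
  also have "eps n U K \<ominus>\<^bsub>Hom (Mod_cat R) (fobj (T U) K) (fobj (T U) K)\<^esub> \<dots> =
      farr G (DD K) (DD K) (E (Suc n))"
    unfolding S.comp_prod.simps Suc
      linear_functor_minus[OF Schur_linear linear_category_Mod_cat G_linear DD_Schur DD_Schur E_arr S.cmp_arr[OF DD_Schur DD_Schur DD_Schur omt_arr E_arr]]
    by simp
  finally show ?case .
qed

text \<open>The idempotents \<open>omt k\<close> commute with \<open>E N\<close>, so
  \<open>E N\<close> annihilates their images as well as being annihilated by them.\<close>

lemma E_omt:
  assumes k: "k < N" and z: "z \<in> carrier (TP (DD K))"
  shows "E N (omt k z) = \<zero>\<^bsub>TP (DD K)\<^esub>"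
proof -
  have idem: "Cmp (Schur_cat R s) (DD K) (DD K) (DD K) (omt k) (omt k) = omt k" for k
    using tens_cmp[OF DD_fg[OF K] DD_fg[OF K] DD_fg[OF K] omit_lin omit_lin, of k k] omit_idem[of K k] K by simp
  have comm: "Cmp (Schur_cat R s) (DD K) (DD K) (DD K) (omt j) (omt k) = Cmp (Schur_cat R s) (DD K) (DD K) (DD K) (omt k) (omt j)" for j k
    using tens_cmp[OF DD_fg[OF K] DD_fg[OF K] DD_fg[OF K] omit_lin omit_lin] omit_comm[of K j k] K by simp
  have "Cmp (Schur_cat R s) (DD K) (DD K) (DD K) (E N) (omt k) = zero_arr (Schur_cat R s) (DD K) (DD K)"
    unfolding S.comp_prod_comm[where e = omt, OF DD_Schur omt_arr comm, symmetric]
    by (rule S.comp_prod_zero[where e = omt, OF DD_Schur omt_arr comm idem k])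
  from fun_cong[OF this, of z] z show ?thesis by (simp add: compose_def)
qed

text \<open>If all entries of a pure tensor lie in summands \<open>K\<close> of \<open>D K\<close>, then one of the \<open>N > s\<close> summands
  is missed, so that the tensor is fixed by \<open>omt k\<close> for some \<open>k\<close>. The general case follows by
  decomposing one entry after the other.\<close>

lemma E_tpure:
  assumes sN: "s < N"
  shows "n \<le> s \<Longrightarrow> x \<in> (\<Pi>\<^sub>E i\<in>{..<s}. carrier (DD K)) \<Longrightarrow>
    (\<And>j. n \<le> j \<Longrightarrow> j < s \<Longrightarrow> \<exists>i<N. x j \<in> pow_inj R N i K ` carrier K) \<Longrightarrow> E N (tpure R s (DD K) x) = \<zero>\<^bsub>TP (DD K)\<^esub>"
proof (induction n arbitrary: x)
  case 0
  have "\<forall>j. \<exists>i. j < s \<longrightarrow> i < N \<and> x j \<in> pow_inj R N i K ` carrier K" using 0(3) by blast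
  then obtain c where c: "\<And>j. j < s \<Longrightarrow> c j < N \<and> x j \<in> pow_inj R N (c j) K ` carrier K" by metis
  have "card (c ` {..<s}) < card {..<N}" using card_image_le[of "{..<s}" c] sN by simp
  then have "\<not> {..<N} \<subseteq> c ` {..<s}" using card_mono[of "c ` {..<s}" "{..<N}"] by auto
  then obtain k where k: "k < N" "k \<notin> c ` {..<s}" by auto
  have omit_x: "omit k K (x j) = x j" if j: "j < s" for j
  proof -
    obtain y where y: "y \<in> carrier K" "x j = pow_inj R N (c j) K y" using c[OF j] by blast
    have "c j \<noteq> k" using k(2) j by auto
    then have "compose (carrier K) (omit k K) (pow_inj R N (c j) K) = pow_inj R N (c j) K"
      using omit_inj[of K "c j" k] K c[OF j] by simp
    from fun_cong[OF this, of y] y show ?thesis by (simp add: compose_def)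
  qed
  note mD = fg_projective_module[OF DD_fg[OF K]]
  have "(\<lambda>i\<in>{..<s}. omit k K (x i)) = x"
    using 0(2) omit_x by (simp add: fun_eq_iff PiE_iff extensional_def)
  then have "omt k (tpure R s (DD K) x) = tpure R s (DD K) x"
    using tmap_pure[OF mD mD, of "\<lambda>_. omit k K" x] omit_lin 0(2) by simp
  then show ?case using E_omt[OF k(1) tpure_carrier[OF 0(2)]] by simp
next
  case (Suc n)
  note mD = fg_projective_module[OF DD_fg[OF K]] and mK = fg_projective_module[OF K]
  have n: "n < s" using Suc.prems(1) by simp
  note x = Suc.prems(2)
  interpret DK: Module.module R "DD K" by (rule mD)
  interpret TD: Module.module R "TP (DD K)" by (rule tp_module[OF mD])
  have xn: "x n \<in> carrier (DD K)" using x n by (simp add: PiE_iff)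
  have up: "x(n := y) \<in> (\<Pi>\<^sub>E i\<in>{..<s}. carrier (DD K))" if "y \<in> carrier (DD K)" for y
    using x n that by (simp add: PiE_iff extensional_def)
  let ?f = "\<lambda>y\<in>carrier (DD K). E N (tpure R s (DD K) (x(n := y)))"
  have fl: "?f \<in> lin_maps R (DD K) (TP (DD K))"
  proof (rule lin_mapsI)
    show "?f \<in> carrier (DD K) \<rightarrow>\<^sub>E carrier (TP (DD K))" using lin_maps_carrier[OF E_lin tpure_carrier[OF up]] by simp
    fix y z assume yz: "y \<in> carrier (DD K)" "z \<in> carrier (DD K)"
    have "tpure R s (DD K) (x(n := y \<oplus>\<^bsub>DD K\<^esub> z)) =
        tpure R s (DD K) (x(n := y)) \<oplus>\<^bsub>TP (DD K)\<^esub> tpure R s (DD K) (x(n := z))"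
      by (rule pure_tensor_add[OF cring]) (use mD x n yz in auto)
    then show "?f (y \<oplus>\<^bsub>DD K\<^esub> z) = ?f y \<oplus>\<^bsub>TP (DD K)\<^esub> ?f z"
      using yz lin_maps_add[OF E_lin tpure_carrier[OF up] tpure_carrier[OF up]] by simp
  next
    fix a y assume ay: "a \<in> carrier R" "y \<in> carrier (DD K)"
    have "tpure R s (DD K) (x(n := a \<odot>\<^bsub>DD K\<^esub> y)) = a \<odot>\<^bsub>TP (DD K)\<^esub> tpure R s (DD K) (x(n := y))"
      by (rule pure_tensor_smult[OF cring]) (use mD x n ay in auto)
    then show "?f (a \<odot>\<^bsub>DD K\<^esub> y) = a \<odot>\<^bsub>TP (DD K)\<^esub> ?f y"
      using ay lin_maps_smult[OF E_lin _ tpure_carrier[OF up]] by simp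
  qed
  have il: "pow_inj R N i K \<in> lin_maps R K (DD K)" and pl: "pow_prj R N i K \<in> lin_maps R (DD K) K" if "i < N" for i
    using inj_arr[of K i] prj_arr[of K i] K that by simp_all
  have ip: "compose (carrier (DD K)) (pow_inj R N i K) (pow_prj R N i K) \<in> lin_maps R (DD K) (DD K)" if "i < N" for i
    by (rule lin_maps_compose[OF mD pl[OF that] il[OF that]])
  let ?y = "\<lambda>i. pow_inj R N i K (pow_prj R N i K (x n))"
  have yc: "?y i \<in> carrier (DD K)" if "i < N" for i
    by (rule lin_maps_carrier[OF il[OF that] lin_maps_carrier[OF pl[OF that] xn]])
  \<comment> \<open>The identity of \<open>DD K\<close> is decomposed along the summands and
    evaluated at the entry \<open>x n\<close>.\<close>
  have "finsum (hom_mod R (DD K) (DD K)) (\<lambda>i. compose (carrier (DD K)) (pow_inj R N i K) (pow_prj R N i K)) {..<N} (x n) = x n"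
    using fun_cong[OF sum_inj_prj[of K], of "x n"] K xn by simp
  then have "x n = finsum (DD K) (\<lambda>i. compose (carrier (DD K)) (pow_inj R N i K) (pow_prj R N i K) (x n)) {..<N}"
    using hom_mod_finsum_app[OF mD mD xn, of "{..<N}" "\<lambda>i. compose (carrier (DD K)) (pow_inj R N i K) (pow_prj R N i K)"] ip by simp
  also have "\<dots> = finsum (DD K) ?y {..<N}"
    using xn by (simp add: compose_def)
  finally have xs: "x n = finsum (DD K) ?y {..<N}" .
  have "?f (x n) = finsum (TP (DD K)) (\<lambda>i. ?f (?y i)) {..<N}"
    by (subst xs, rule lin_maps_finsum[OF mD TD.module_axioms fl]) (use yc in simp_all)
  also have "\<dots> = finsum (TP (DD K)) (\<lambda>i. \<zero>\<^bsub>TP (DD K)\<^esub>) {..<N}"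
  proof (rule TD.finsum_cong')
    fix i assume "i \<in> {..<N}"
    then have i: "i < N" by simp
    have "E N (tpure R s (DD K) (x(n := ?y i))) = \<zero>\<^bsub>TP (DD K)\<^esub>"
    proof (rule Suc.IH[OF _ up[OF yc[OF i]]])
      fix j assume j: "n \<le> j" "j < s"
      show "\<exists>i'<N. (x(n := ?y i)) j \<in> pow_inj R N i' K ` carrier K"
      proof (cases "j = n")
        case True
        then show ?thesis using i lin_maps_carrier[OF pl[OF i] xn] by auto
      next
        case False
        then show ?thesis using Suc.prems(3)[of j] j by simp
      qed
    qed (use n in simp)
    then show "?f (?y i) = \<zero>\<^bsub>TP (DD K)\<^esub>" using yc[OF i] by simp
  qed simp_all
  also have "\<dots> = \<zero>\<^bsub>TP (DD K)\<^esub>" by (rule TD.finsum_zero)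
  finally show ?case using xn by simp
qed

lemma eps_U_app_zero:
  assumes "s < N" shows "eps N U K = zero_arr FC (T U) (T U) K"
proof -
  note mD = fg_projective_module[OF DD_fg[OF K]]
  have "E N = zero_arr (Schur_cat R s) (DD K) (DD K)"
  proof (rule tensor_power_eqI[OF mD tp_module[OF mD] E_lin])
    show "zero_arr (Schur_cat R s) (DD K) (DD K) \<in> lin_maps R (TP (DD K)) (TP (DD K))"
      using S.zero_arr_closed[OF DD_Schur DD_Schur] unfolding Schur_arrs[OF mD mD] by blast
    fix x assume x: "x \<in> (\<Pi>\<^sub>E i\<in>{..<s}. carrier (DD K))"
    show "E N (tpure R s (DD K) x) = zero_arr (Schur_cat R s) (DD K) (DD K) (tpure R s (DD K) x)"
      using E_tpure[OF assms order_refl x] tpure_carrier[OF x] by simp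
  qed
  then have "eps N U K = farr G (DD K) (DD K) (zero_arr (Schur_cat R s) (DD K) (DD K))"
    by (simp only: eps_U_app)
  also have "\<dots> = zero_arr FC (T U) (T U) K"
    unfolding G_zero[OF DD_fg[OF K] DD_fg[OF K]] using K by simp
  finally show ?thesis .
qed

end

text \<open>This expresses that weight s implies degree at most s, directly in the form that the Ext
  argument consumes, without passing through \<open>cross_effect\<close>.\<close>

lemma eps_U_zero:
  assumes "s < N" shows "eps N U = zero_arr FC (T U) (T U)"
proof (rule functor_cat_arr_eqI[OF eps_arr[OF U_Ob] FC.zero_arr_closed[OF T_ob[OF U_Ob] T_ob[OF U_Ob]]])
  fix K assume "K \<in> Ob (P_cat R)"
  then show "eps N U K = zero_arr FC (T U) (T U) K" using eps_U_app_zero[OF _ assms] by simp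
qed

end

end

section \<open>Digit sums, Legendre's formula and sums of prime powers\<close>

lemma digit_sum_eq:
  assumes p: "p \<ge> 2" and m: "s \<le> m"
  shows "digit_sum p s = (\<Sum>k\<le>m. s div p ^ k mod p)"
proof -
  have "s div p ^ k mod p = 0" if "s < k" for k
  proof -
    have "s < p ^ k" using that p power_gt_expt[of p k] by linarith
    then show ?thesis by simp
  qed
  then show ?thesis unfolding digit_sum_def by (intro sum.mono_neutral_left) (use m in auto)
qed

lemma digit_sum_0 [simp]: "digit_sum p 0 = 0"
  by (simp add: digit_sum_def)

lemma digit_sum_rec:
  assumes p: "p \<ge> 2"
  shows "digit_sum p n = n mod p + digit_sum p (n div p)"
proof -
  have "digit_sum p n = (\<Sum>k\<le>Suc n. n div p ^ k mod p)" by (rule digit_sum_eq[OF p]) simp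
  also have "\<dots> = n mod p + (\<Sum>k\<le>n. n div p ^ Suc k mod p)"
    by (subst sum.atMost_Suc_shift) simp
  also have "(\<Sum>k\<le>n. n div p ^ Suc k mod p) = (\<Sum>k\<le>n. n div p div p ^ k mod p)"
    by (simp add: div_mult2_eq)
  also have "\<dots> = digit_sum p (n div p)" by (rule digit_sum_eq[OF p, symmetric]) simp
  finally show ?thesis .
qed

lemma digit_sum_small: "p \<ge> 2 \<Longrightarrow> n < p \<Longrightarrow> digit_sum p n = n"
  by (subst digit_sum_rec) auto

lemma digit_sum_power [simp]: "p \<ge> 2 \<Longrightarrow> digit_sum p (p ^ k) = 1"
proof (induction k)
  case 0
  then show ?case by (simp add: digit_sum_small)
next
  case (Suc k)
  then show ?case by (subst digit_sum_rec) auto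
qed

lemma digit_sum_pos: "p \<ge> 2 \<Longrightarrow> n > 0 \<Longrightarrow> digit_sum p n > 0"
proof (induction n rule: less_induct)
  case (less n)
  show ?case
  proof (cases "n mod p = 0")
    case True
    then have "n div p > 0" using less.prems by (metis div_eq_0_iff mod_eq_self_iff_div_eq_0 gr0I)
    then have "digit_sum p (n div p) > 0" using less by simp
    then show ?thesis using digit_sum_rec[of p n] less.prems by simp
  next
    case False
    then show ?thesis using digit_sum_rec[of p n] less.prems by simp
  qed
qed

text \<open>If m ends in v zeros in base p, then subtracting 1 turns them into v digits p - 1 and
  lowers the next digit by one. The induction strips one trailing zero at a time.\<close>

lemma digit_sum_pred:
  assumes p: "prime p" and m: "m > 0"
  shows "digit_sum p m + (p - 1) * multiplicity p m = digit_sum p (m - 1) + 1"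
  using m
proof (induction m rule: less_induct)
  case (less m)
  have p2: "p \<ge> 2" using p by (rule prime_ge_2_nat)
  show ?case
  proof (cases "p dvd m")
    case False
    then have "m mod p > 0" by (simp add: mod_greater_zero_iff_not_dvd)
    moreover obtain j where j: "m mod p = Suc j" using calculation gr0_implies_Suc by blast
    have jp: "Suc j < p" using j p2 by (metis mod_less_divisor less_le_trans pos2)
    have "m - 1 = j + p * (m div p)" using j div_mult_mod_eq[of m p] by (simp add: mult.commute)
    then have "(m - 1) mod p = j" "(m - 1) div p = m div p" using jp by simp_all
    then show ?thesis
      using digit_sum_rec[OF p2, of m] digit_sum_rec[OF p2, of "m - 1"] j not_dvd_imp_multiplicity_0[OF False] by simp
  next
    case True
    then obtain q where q: "m = p * q" ..
    then have q0: "q > 0" and qm: "q < m" using less.prems p2 by auto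
    have v: "multiplicity p m = Suc (multiplicity p q)"
      unfolding q by (rule multiplicity_times_same) (use p q0 in auto)
    \<comment> \<open>The borrow: the last digit becomes p - 1, and the remaining digits are those
      of q - 1.\<close>
    have "m - 1 = (p - 1) + p * (q - 1)" using q q0 p2 by (cases q) (auto simp: algebra_simps)
    moreover have "(j + p * b) mod p = j" "(j + p * b) div p = b" if "j < p" for j b
      using that by simp_all
    from this[of "p - 1" "q - 1"] have "((p - 1) + p * (q - 1)) mod p = p - 1" "((p - 1) + p * (q - 1)) div p = q - 1"
      using p2 by linarith+
    ultimately have "digit_sum p (m - 1) = (p - 1) + digit_sum p (q - 1)"
      using digit_sum_rec[OF p2, of "m - 1"] by metis
    moreover have "digit_sum p m = digit_sum p q" using digit_sum_rec[OF p2, of m] q p2 by simp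
    ultimately show ?thesis using less.IH[OF qm q0] p2 unfolding v mult_Suc_right by linarith
  qed
qed

text \<open>Summing \<open>digit_sum_pred\<close> over 1, ..., n telescopes the digit sums and
  collects the valuations into that of n!.\<close>

lemma legendre_digit_sum:
  assumes p: "prime p"
  shows "(p - 1) * multiplicity p (fact n :: nat) + digit_sum p n = n"
proof (induction n)
  case (Suc n)
  have "multiplicity p (fact (Suc n) :: nat) = multiplicity p (Suc n) + multiplicity p (fact n :: nat)"
    using p by (simp only: fact_Suc of_nat_id) (intro prime_elem_multiplicity_mult_distrib, auto)
  then show ?case using Suc digit_sum_pred[OF p, of "Suc n"] by (simp add: algebra_simps)
qed simp

lemma digit_sum_le: "prime p \<Longrightarrow> digit_sum p n \<le> n"
  using legendre_digit_sum[of p n] by simp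

lemma digit_sum_mod: "prime p \<Longrightarrow> digit_sum p n mod (p - 1) = n mod (p - 1)"
  using legendre_digit_sum[of p n] by (metis mod_mult_self4)

lemma sum_powers_minimal:
  assumes p: "p \<ge> 2"
  shows "\<exists>ks. length ks = digit_sum p s \<and> (\<Sum>k\<leftarrow>ks. p ^ k) = s"
proof (induction s rule: less_induct)
  case (less s)
  show ?case
  proof (cases "s = 0")
    case False
    then have "s div p < s" using p by simp
    from less[OF this] obtain ks where ks: "length ks = digit_sum p (s div p)" "(\<Sum>k\<leftarrow>ks. p ^ k) = s div p" by blast
    have "(\<Sum>k\<leftarrow>map Suc ks. p ^ k) = p * (s div p)"
      by (simp add: o_def ks(2)[symmetric] sum_list_const_mult)
    then show ?thesis using ks(1) digit_sum_rec[OF p, of s]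
      by (intro exI[of _ "replicate (s mod p) 0 @ map Suc ks"]) (simp add: sum_list_replicate)
  qed simp
qed

text \<open>Replacing one power p^(j + 1) by p copies of p^j adds p - 1 terms. Such a power exists
  while there are fewer than s terms, since otherwise all terms would be 1 and their number would be
  s.\<close>

lemma sum_powers:
  assumes p: "p \<ge> 2"
  shows "digit_sum p s + (p - 1) * r \<le> s \<Longrightarrow>
    \<exists>ks. length ks = digit_sum p s + (p - 1) * r \<and> (\<Sum>k\<leftarrow>ks. p ^ k) = s"
proof (induction r)
  case 0
  then show ?case using sum_powers_minimal[OF p] by simp
next
  case (Suc r)
  then obtain ks where ks: "length ks = digit_sum p s + (p - 1) * r" "(\<Sum>k\<leftarrow>ks. p ^ k) = s" by auto
  have "length ks < s" using ks(1) Suc.prems p by simp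
  have "\<exists>k\<in>set ks. k \<noteq> 0"
  proof (rule ccontr)
    assume "\<not> ?thesis"
    then have "(\<Sum>k\<leftarrow>ks. p ^ k) = (\<Sum>k\<leftarrow>ks. 1)" by (intro arg_cong[of _ _ sum_list]) auto
    then have "s = length ks" using ks(2) by (simp add: sum_list_triv)
    with \<open>length ks < s\<close> show False by simp
  qed
  then obtain j where "Suc j \<in> set ks" using not0_implies_Suc by blast
  then obtain us vs where us: "ks = us @ Suc j # vs" by (meson split_list)
  then have "length (us @ replicate p j @ vs) = digit_sum p s + (p - 1) * Suc r"
    using ks(1) p unfolding mult_Suc_right by simp
  moreover have "(\<Sum>k\<leftarrow>us @ replicate p j @ vs. p ^ k) = s"
    using us ks(2) by (simp add: sum_list_replicate)
  ultimately show ?case by blast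
qed

text \<open>Each power of p has digit sum 1, so by Legendre's formula (p - 1) times the valuation of
  s! / (product of the factorials) is the number of parts minus the digit sum of s.\<close>

lemma multinomial_with_multiplicity:
  assumes p: "prime p" and r: "digit_sum p s + (p - 1) * r \<le> s"
  shows "\<exists>A. size A = s \<and> set_mset A = {..<digit_sum p s + (p - 1) * r} \<and>
    multiplicity p (card (permutations_of_multiset A)) = r"
proof -
  define N where "N = digit_sum p s + (p - 1) * r"
  have p2: "p \<ge> 2" using p by (rule prime_ge_2_nat)
  obtain ks where ks: "length ks = N" "(\<Sum>k\<leftarrow>ks. p ^ k) = s"
    using sum_powers[OF p2 r] unfolding N_def by blast
  \<comment> \<open>The index i is taken with multiplicity equal to the i-th power, so that
    arrangements of \<open>A\<close> are counted by the multinomial coefficient of the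
    decomposition.\<close>
  define A where "A = (\<Sum>i<N. replicate_mset (p ^ (ks ! i)) i)"
  have count: "count A i = (if i < N then p ^ (ks ! i) else 0)" for i
    by (simp add: A_def count_sum sum.delta)
  have setA: "set_mset A = {..<N}"
    using p2 by (auto simp: set_mset_def count)
  have "size A = (\<Sum>i<N. p ^ (ks ! i))" by (simp add: size_multiset_overloaded_eq setA count)
  also have "\<dots> = s" using ks by (simp add: sum_list_sum_nth atLeast0LessThan)
  finally have sizeA: "size A = s" .
  have prod0: "(\<Prod>i<N. fact (p ^ (ks ! i)) :: nat) \<noteq> 0" by simp
  have c: "card (permutations_of_multiset A) * (\<Prod>i<N. fact (p ^ (ks ! i))) = fact s"
    using card_permutations_of_multiset_aux[of A] by (simp add: setA sizeA count)
  have "card (permutations_of_multiset A) \<noteq> 0" using c by (metis fact_nonzero mult_zero_left)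
  then have m: "multiplicity p (fact s :: nat) =
      multiplicity p (card (permutations_of_multiset A)) + (\<Sum>i<N. multiplicity p (fact (p ^ (ks ! i)) :: nat))"
    using prime_elem_multiplicity_mult_distrib[OF prime_imp_prime_elem[OF p] _ prod0, of "card (permutations_of_multiset A)"] c
      prime_elem_multiplicity_prod_distrib[OF prime_imp_prime_elem[OF p], of "\<lambda>i. fact (p ^ (ks ! i))" "{..<N}"]
    by (simp add: image_iff)
  have "(p - 1) * (\<Sum>i<N. multiplicity p (fact (p ^ (ks ! i)) :: nat)) + N =
      (\<Sum>i<N. (p - 1) * multiplicity p (fact (p ^ (ks ! i)) :: nat) + digit_sum p (p ^ (ks ! i)))"
    using p2 by (simp add: sum_Suc sum_distrib_left)
  also have "\<dots> = (\<Sum>i<N. p ^ (ks ! i))" by (intro sum.cong refl legendre_digit_sum[OF p])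
  also have "\<dots> = s" using ks by (simp add: sum_list_sum_nth atLeast0LessThan)
  finally have "(p - 1) * multiplicity p (card (permutations_of_multiset A)) + digit_sum p s = N"
    using m legendre_digit_sum[OF p, of s] by (simp add: algebra_simps)
  then have "multiplicity p (card (permutations_of_multiset A)) = r" using p2 unfolding N_def by simp
  with setA sizeA show ?thesis unfolding N_def by blast
qed

section \<open>Torsion elements, primitive roots and transport along isomorphisms\<close>

text \<open>The annihilators p^k and m combine to their gcd, a power of p dividing m, hence dividing
  p^r.\<close>

lemma (in abelian_group) add_pow_coprime_zero:
  assumes x: "x \<in> carrier G" and k: "[(p ^ k)] \<cdot> x = \<zero>" and m: "[(m::nat)] \<cdot> x = \<zero>" "m > 0"
    and p: "prime p" and r: "multiplicity p m \<le> r"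
  shows "[(p ^ r :: nat)] \<cdot> x = \<zero>"
proof -
  have dvd: "[b] \<cdot> x = \<zero>" if "[a] \<cdot> x = \<zero>" "a dvd b" for a b :: nat
  proof -
    obtain c where "b = a * c" using \<open>a dvd b\<close> ..
    then have "[b] \<cdot> x = [c] \<cdot> ([a] \<cdot> x)" using add.nat_pow_pow[OF x, of c a] by simp
    then show ?thesis using that(1) by simp
  qed
  \<comment> \<open>Bezout over the natural numbers writes a multiple of p^k as a multiple of m plus
    the gcd, which avoids negative coefficients.\<close>
  have "[(gcd (p ^ k) m)] \<cdot> x = \<zero>"
  proof -
    obtain a b where "p ^ k * a = m * b + gcd (p ^ k) m" using bezout_nat[of "p ^ k" m] p by (auto simp: prime_gt_0_nat)
    then have "[(p ^ k * a)] \<cdot> x = [(m * b)] \<cdot> x \<oplus> [(gcd (p ^ k) m)] \<cdot> x"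
      using add.nat_pow_mult[OF x, of "m * b" "gcd (p ^ k) m"] by simp
    moreover have "[(p ^ k * a)] \<cdot> x = \<zero>" "[(m * b)] \<cdot> x = \<zero>" using dvd k m by auto
    ultimately show ?thesis using x by simp
  qed
  moreover have "gcd (p ^ k) m dvd p ^ r"
  proof -
    obtain j where j: "gcd (p ^ k) m = p ^ j"
      using divides_primepow_nat[OF p, of "gcd (p ^ k) m" k] by auto
    then have "p ^ j dvd m" by (metis gcd_dvd2)
    then have "j \<le> multiplicity p m" using p m(2) by (intro multiplicity_geI) (auto simp: prime_gt_1_nat)
    then show ?thesis unfolding j using r by (intro le_imp_power_dvd) simp
  qed
  ultimately show ?thesis by (rule dvd)
qed

lemma primitive_root_powers_incongruent:
  assumes p: "prime p" and st: "s mod (p - 1) \<noteq> t mod (p - 1)"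
  shows "\<exists>g. \<not> [g ^ s = g ^ t] (mod p)"
proof -
  \<comment> \<open>For p = 2 all numbers agree modulo p - 1 = 1, which contradicts the
    hypothesis.\<close>
  have "odd p" using st p prime_odd_nat[of p] prime_ge_2_nat[OF p] by (cases "p = 2") auto
  then obtain g where "\<And>k. k > 0 \<Longrightarrow> residue_primroot (p ^ k) g"
    using residue_primroot_odd_prime_power_exists[OF p] by metis
  from this[of 1] have g: "residue_primroot p g" by simp
  then have "ord p g = p - 1" "coprime p g" by (auto simp: residue_primroot_def totient_prime p)
  then have "\<not> [g ^ s = g ^ t] (mod p)" using order_divides_expdiff[of p g s t] st by (auto simp: cong_def)
  then show ?thesis ..
qed

text \<open>The difference of a and b annihilates x and is prime to p, so it acts injectively on
  p-primary elements.\<close>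

lemma (in abelian_group) add_pow_diff_zero:
  assumes x: "x \<in> carrier G" and k: "[(p ^ k)] \<cdot> x = \<zero>" and ab: "[(a::nat)] \<cdot> x = [(b::nat)] \<cdot> x"
    and p: "prime p" and ncong: "\<not> [a = b] (mod p)"
  shows "x = \<zero>"
proof -
  \<comment> \<open>The larger multiple is put first because subtraction of natural numbers is
    truncated.\<close>
  have main: "x = \<zero>" if "b < a" "[a] \<cdot> x = [b] \<cdot> x" "\<not> [a = b] (mod p)" for a b :: nat
  proof -
    have "[a] \<cdot> x = [b] \<cdot> x \<oplus> [(a - b)] \<cdot> x" using add.nat_pow_mult[OF x, of b "a - b"] that(1) by simp
    then have "[(a - b)] \<cdot> x = \<zero>" using that(2) x by simp
    moreover have "\<not> p dvd a - b" using that by (simp add: cong_altdef_nat)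
    ultimately have "[(p ^ 0)] \<cdot> x = \<zero>"
      using that(1) by (intro add_pow_coprime_zero[OF x k, of "a - b"] p) (simp_all add: not_dvd_imp_multiplicity_0)
    then show ?thesis using x by simp
  qed
  show ?thesis using main[of b a] main[of a b] ab ncong by (metis cong_sym_eq cong_refl linorder_neqE_nat)
qed

lemma iso_obj_sym: "iso_obj C X Y \<Longrightarrow> iso_obj C Y X"
  unfolding iso_obj_def by blast

lemma (in cring) add_pow_one_nat_pow: "([(g::nat)] \<cdot> \<one>) [^] (s::nat) = [(g ^ s)] \<cdot> \<one>"
proof (induction s)
  case (Suc s)
  have "[(g ^ s)] \<cdot> \<one> \<otimes> [g] \<cdot> \<one> = [(g ^ s)] \<cdot> (\<one> \<otimes> [g] \<cdot> \<one>)"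
    by (rule add_pow_ldistr) simp_all
  also have "\<dots> = [(g ^ Suc s)] \<cdot> \<one>" using add.nat_pow_pow[of \<one> "g ^ s" g] by simp
  finally show ?case using Suc by simp
qed simp

text \<open>Insert the composite of the two isomorphisms and move \<open>z\<close> across by
  naturality; a central element that vanishes on H vanishes on every isomorphic F.\<close>

lemma (in linear_category) natural_zero_iso:
  assumes iso: "iso_obj C F H" and zF: "z F \<in> arrs C F F" and zH: "z H = zero_arr C H H"
    and nat: "\<And>f. f \<in> arrs C F H \<Longrightarrow> Cmp C F H H (z H) f = Cmp C F F H f (z F)"
  shows "z F = zero_arr C F F"
proof -
  obtain f g where F: "F \<in> Ob C" and H: "H \<in> Ob C" and f: "f \<in> arrs C F H" and g: "g \<in> arrs C H F"
    and gf: "Cmp C F H F g f = Idn C F"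
    using iso unfolding iso_obj_def by blast
  have "z F = Cmp C F F F (Cmp C F H F g f) (z F)"
    unfolding gf by (rule idn_cmp[OF F F zF, symmetric])
  also have "\<dots> = Cmp C F H F g (Cmp C F F H f (z F))"
    by (rule cmp_assoc[OF F F H F zF f g, symmetric])
  also have "\<dots> = Cmp C F H F g (zero_arr C F H)"
    unfolding nat[OF f, symmetric] zH cmp_zero_left[OF F H H f] ..
  also have "\<dots> = zero_arr C F F" by (rule cmp_zero_right[OF F H F g])
  finally show ?thesis .
qed

lemma (in linear_category) smult_idn_natural:
  assumes X: "X \<in> Ob C" and Y: "Y \<in> Ob C" and f: "f \<in> arrs C X Y" and a: "a \<in> carrier R"
  shows "Cmp C X Y Y (a \<odot>\<^bsub>Hom C Y Y\<^esub> Idn C Y) f = Cmp C X X Y f (a \<odot>\<^bsub>Hom C X X\<^esub> Idn C X)"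
  unfolding cmp_smult_left[OF X Y Y a f idn_arr[OF Y]] cmp_smult_right[OF X X Y a idn_arr[OF X] f]
    idn_cmp[OF X Y f] cmp_idn[OF X Y f] ..

lemma (in linear_category) smult_arr:
  assumes X: "X \<in> Ob C" and Y: "Y \<in> Ob C" and f: "f \<in> arrs C X Y" and a: "a \<in> carrier R"
  shows "a \<odot>\<^bsub>Hom C X Y\<^esub> f \<in> arrs C X Y"
proof -
  interpret Module.module R "Hom C X Y" by (rule hom_module[OF X Y])
  show ?thesis using f a by simp
qed

section \<open>Annihilation of Ext by multinomial coefficients and by homotheties\<close>

context strict_power begin

context
  fixes A :: "('r, 'm) pfunctor set" and F :: "('r, 'm) pfunctor" and G :: "('r, 'm) strict_functor"
  assumes A: "A \<subseteq> Ob FC" and ab: "abelian_category R (full_subcat FC A)"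
    and proj: "enough_projectives (full_subcat FC A)" and inj: "enough_injectives (full_subcat FC A)"
    and param: "\<forall>M\<in>Ob (P_cat R). \<forall>H\<in>A. \<exists>H'\<in>A. iso_obj FC (param_hom R H M) H'"
    and F: "F \<in> A" and G: "G \<in> Ob (strict_poly_cat R s)" and GA: "underlying R s G \<in> A"
begin

abbreviation "EE i \<equiv> Ext (full_subcat FC A) i F (underlying R s G)"


text \<open>The module structure is read off from \<open>Ext_killed\<close> with the scalar 0, for
  which the annihilation condition is trivial.\<close>

lemma Ext_module: "Module.module R (EE i)"
proof -
  interpret AC: abelian_category R "full_subcat FC A" by (rule ab)
  interpret R: cring R by (rule cring)
  have FGO: "F \<in> Ob (full_subcat FC A)" "underlying R s G \<in> Ob (full_subcat FC A)" using F GA by simp_all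
  show ?thesis
  proof (rule AC.Ext_killed(1)[OF proj FGO R.zero_closed])
    fix P d e c
    assume res: "projective_resolution (full_subcat FC A) F P d e"
      and c: "c \<in> cocycles (full_subcat FC A) P d (underlying R s G) i"
    note r = AC.projective_resolutionD[OF res]
    interpret H: Module.module R "Hom (full_subcat FC A) (P i) (underlying R s G)"
      by (rule AC.hom_module[OF r(1) FGO(2)])
    have "submodule (coboundaries (full_subcat FC A) P d (underlying R s G) i) R (Hom (full_subcat FC A) (P i) (underlying R s G))"
      by (intro AC.coboundaries_submodule r(1) r(5) FGO)
    from subgroup.one_closed[OF submodule.axioms(1)[OF this]]
    have "\<zero>\<^bsub>Hom (full_subcat FC A) (P i) (underlying R s G)\<^esub> \<in> coboundaries (full_subcat FC A) P d (underlying R s G) i" by simp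
    moreover have cc: "c \<in> carrier (Hom (full_subcat FC A) (P i) (underlying R s G))" using c by (simp add: cocycles_def)
    ultimately show "\<zero>\<^bsub>R\<^esub> \<odot>\<^bsub>Hom (full_subcat FC A) (P i) (underlying R s G)\<^esub> c
        \<in> coboundaries (full_subcat FC A) P d (underlying R s G) i" unfolding H.smult_l_null[OF cc] by simp
  qed
qed

lemma multinomial_kills_Ext:
  assumes M: "size M = s" "set_mset M = {..<N}"
    and van: "eps N F = zero_arr FC (T F) (T F)" and x: "x \<in> carrier (EE i)"
  shows "[card (permutations_of_multiset M)] \<cdot>\<^bsub>EE i\<^esub> x = \<zero>\<^bsub>EE i\<^esub>"
proof -
  interpret AC: abelian_category R "full_subcat FC A" by (rule ab)
  interpret R: cring R by (rule cring)
  define a where "a = [card (permutations_of_multiset M)] \<cdot>\<^bsub>R\<^esub> \<one>\<^bsub>R\<^esub>"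
  have a: "a \<in> carrier R" by (simp add: a_def)
  \<comment> \<open>The parameterization is used with the free module R^N.\<close>
  have rep: "\<exists>H'\<in>A. iso_obj FC (T H) H'" if "H \<in> A" for H
    using bspec[OF param, of "free_mod R {..<N}"] that fg_projective_free[OF cring]
    by (simp add: param_hom_precomp)
  have vanish: "Cmp FC F (T H) (T H) (eps N H) c = zero_arr FC F (T H)" if "H \<in> A" "c \<in> arrs FC F (T H)" for H c
    by (rule eps_vanish[OF _ _ that(2) van]) (use A F that(1) in blast)+
  obtain u v where u: "u \<in> arrs FC (underlying R s G) (T (underlying R s G))"
    and v: "v \<in> arrs FC (T (underlying R s G)) (underlying R s G)"
    and eu: "Cmp FC (underlying R s G) (T (underlying R s G)) (T (underlying R s G)) (eps N (underlying R s G)) u = u"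
    and vu: "Cmp FC (underlying R s G) (T (underlying R s G)) (underlying R s G) v u =
      a \<odot>\<^bsub>Hom FC (underlying R s G) (underlying R s G)\<^esub> Idn FC (underlying R s G)"
    using multinomial_factorization[OF G M] unfolding a_def by blast
  have k: "a \<odot>\<^bsub>Hom (full_subcat FC A) (P i) (underlying R s G)\<^esub> c \<in> coboundaries (full_subcat FC A) P d (underlying R s G) i"
    if "projective_resolution (full_subcat FC A) F P d e" "c \<in> cocycles (full_subcat FC A) P d (underlying R s G) i" for P d e c
    unfolding full_subcat_simps
    by (rule self_adjoint_functor.Ext_killed_by_retract[OF eps_self_adjoint A ab _ inj F GA a _ u v eu vu that])
      (erule rep, erule (1) vanish)
  interpret E: Module.module R "EE i" using AC.Ext_killed(1)[OF proj _ _ a k] F GA by simp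
  show ?thesis using AC.Ext_killed(2)[OF proj _ _ a k x] F GA unfolding E.add_pow_smult[OF x] a_def[symmetric] by simp
qed

text \<open>A central element acts on Ext equally through either variable. It is zero on F, by
  transport from the isomorphic H, and it is the scalar a on the second variable.\<close>

lemma center_kills_Ext:
  assumes a: "a \<in> carrier R"
    and z: "\<And>X. X \<in> Ob FC \<Longrightarrow> z X \<in> arrs FC X X"
    and nat: "\<And>X Y f. X \<in> Ob FC \<Longrightarrow> Y \<in> Ob FC \<Longrightarrow> f \<in> arrs FC X Y \<Longrightarrow> Cmp FC X Y Y (z Y) f = Cmp FC X X Y f (z X)"
    and iso: "iso_obj FC F H" and zH: "z H = zero_arr FC H H"
    and zG: "z (underlying R s G) = a \<odot>\<^bsub>Hom FC (underlying R s G) (underlying R s G)\<^esub> Idn FC (underlying R s G)"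
  shows "Module.module R (EE i)" and "x \<in> carrier (EE i) \<Longrightarrow> a \<odot>\<^bsub>EE i\<^esub> x = \<zero>\<^bsub>EE i\<^esub>"
proof -
  interpret AC: abelian_category R "full_subcat FC A" by (rule ab)
  have "F \<in> Ob FC" "H \<in> Ob FC" using iso unfolding iso_obj_def by blast+
  then have zF: "z F = zero_arr FC F F" by (intro FC.natural_zero_iso[OF iso, of z] z zH nat)
  have k: "a \<odot>\<^bsub>Hom (full_subcat FC A) (P i) (underlying R s G)\<^esub> c \<in> coboundaries (full_subcat FC A) P d (underlying R s G) i"
    if "projective_resolution (full_subcat FC A) F P d e" "c \<in> cocycles (full_subcat FC A) P d (underlying R s G) i" for P d e c
    using FC.Ext_killed_by_center[OF A ab inj F GA a z nat zF zG that] by simp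
  show "Module.module R (EE i)" using AC.Ext_killed(1)[OF proj _ _ a k] F GA by simp
  show "x \<in> carrier (EE i) \<Longrightarrow> a \<odot>\<^bsub>EE i\<^esub> x = \<zero>\<^bsub>EE i\<^esub>"
    using AC.Ext_killed(2)[OF proj _ _ a k] F GA by simp
qed

text \<open>If \<open>F\<close> itself is strict polynomial, the factorization applied to \<open>F\<close> shows that the multinomial
  coefficient kills \<open>F\<close>.\<close>

lemma source_multinomial_kills_Ext:
  assumes t: "S \<in> Ob (strict_poly_cat R t)" and iso: "iso_obj FC F (underlying R t S)"
    and M: "size M = t" "set_mset M = {..<N}"
    and van: "eps N F = zero_arr FC (T F) (T F)" and x: "x \<in> carrier (EE i)"
  shows "[card (permutations_of_multiset M)] \<cdot>\<^bsub>EE i\<^esub> x = \<zero>\<^bsub>EE i\<^esub>"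
proof -
  interpret R: cring R by (rule cring)
  let ?H = "underlying R t S"
  let ?a = "[card (permutations_of_multiset M)] \<cdot>\<^bsub>R\<^esub> \<one>\<^bsub>R\<^esub>"
  let ?z = "\<lambda>X. ?a \<odot>\<^bsub>Hom FC X X\<^esub> Idn FC X"
  have a: "?a \<in> carrier R" by simp
  have H: "?H \<in> Ob FC" using iso unfolding iso_obj_def by blast
  have eH: "eps N ?H = zero_arr FC (T ?H) (T ?H)" by (rule eps_zero_iso[OF iso_obj_sym[OF iso] van])
  obtain u v where u: "u \<in> arrs FC ?H (T ?H)" and v: "v \<in> arrs FC (T ?H) ?H"
    and eu: "Cmp FC ?H (T ?H) (T ?H) (eps N ?H) u = u" and vu: "Cmp FC ?H (T ?H) ?H v u = ?z ?H"
    using strict_power.multinomial_factorization[OF strict_power_axioms t M] by blast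
  \<comment> \<open>\<open>eps\<close> fixes \<open>u\<close> and is zero on \<open>?H\<close>, so
    \<open>u\<close> vanishes, and with it the scalar endomorphism of \<open>?H\<close> given by
    \<open>v\<close> after \<open>u\<close>.\<close>
  have "u = zero_arr FC ?H (T ?H)"
    using eu FC.cmp_zero_left[OF H T_ob[OF H] T_ob[OF H] u] unfolding eH by simp
  then have zH: "?z ?H = zero_arr FC ?H ?H"
    using vu FC.cmp_zero_right[OF H T_ob[OF H] H v] by simp
  note k = center_kills_Ext[of ?a ?z, OF a FC.smult_arr[OF _ _ FC.idn_arr a] FC.smult_idn_natural[OF _ _ _ a] iso zH refl]
  interpret E: Module.module R "EE i" by (rule k)
  show ?thesis unfolding E.add_pow_smult[OF x] by (rule k(2)[OF _ _ _ _ _ _ x])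
qed

text \<open>The homothety by g acts through the second variable as g^s and through the first as g^t,
  because weights are the exponents of homotheties.\<close>

lemma scaling_on_Ext:
  assumes t: "S \<in> Ob (strict_poly_cat R t)" and iso: "iso_obj FC F (underlying R t S)"
    and x: "x \<in> carrier (EE i)"
  shows "[(g ^ s :: nat)] \<cdot>\<^bsub>EE i\<^esub> x = [(g ^ t)] \<cdot>\<^bsub>EE i\<^esub> x"
proof -
  interpret R: cring R by (rule cring)
  let ?H = "underlying R t S" and ?U = "underlying R s G"
  let ?g = "[g] \<cdot>\<^bsub>R\<^esub> \<one>\<^bsub>R\<^esub>"
  let ?a = "?g [^]\<^bsub>R\<^esub> s" and ?b = "?g [^]\<^bsub>R\<^esub> t"
  \<comment> \<open>Subtracting g^t from the homothety gives a central element that is zero on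
    weight t and equals g^s - g^t on weight s.\<close>
  define z where "z = (\<lambda>X. scale_nat ?g X \<ominus>\<^bsub>Hom FC X X\<^esub> (?b \<odot>\<^bsub>Hom FC X X\<^esub> Idn FC X))"
  have g: "?g \<in> carrier R" and b: "?b \<in> carrier R" by simp_all
  have a: "?a \<ominus>\<^bsub>R\<^esub> ?b \<in> carrier R" by simp
  have H: "?H \<in> Ob FC" using iso unfolding iso_obj_def by blast
  have U: "?U \<in> Ob FC" using A GA by blast
  have sc: "scale_nat ?g X \<in> arrs FC X X" if "X \<in> Ob FC" for X
    by (rule scale_nat_arr[OF _ g]) (use that in simp)
  have bI: "?b \<odot>\<^bsub>Hom FC X X\<^esub> Idn FC X \<in> arrs FC X X" if "X \<in> Ob FC" for X
    by (rule FC.smult_arr[OF that that FC.idn_arr[OF that] b])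
  have z: "z X \<in> arrs FC X X" if "X \<in> Ob FC" for X
    unfolding z_def by (rule FC.minus_arr[OF that that sc[OF that] bI[OF that]])
  have nat: "Cmp FC X Y Y (z Y) f = Cmp FC X X Y f (z X)" if X: "X \<in> Ob FC" and Y: "Y \<in> Ob FC" and f: "f \<in> arrs FC X Y" for X Y f
    unfolding z_def FC.cmp_minus_left[OF X Y Y f sc[OF Y] bI[OF Y]] FC.cmp_minus_right[OF X X Y sc[OF X] bI[OF X] f]
      FC.smult_idn_natural[OF X Y f b] scale_nat_natural[OF X[unfolded functor_cat_Ob mem_Collect_eq] Y[unfolded functor_cat_Ob mem_Collect_eq] f g] ..
  have zH: "z ?H = zero_arr FC ?H ?H"
    unfolding z_def strict_power.scale_nat_U[OF strict_power_axioms t g] by (rule FC.minus_self[OF H H bI[OF H]])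
  have zG: "z ?U = (?a \<ominus>\<^bsub>R\<^esub> ?b) \<odot>\<^bsub>Hom FC ?U ?U\<^esub> Idn FC ?U"
  proof -
    interpret UU: Module.module R "Hom FC ?U ?U" by (rule FC.hom_module[OF U U])
    show ?thesis unfolding z_def scale_nat_U[OF G g]
      using FC.idn_arr[OF U] by (simp add: R.minus_eq UU.minus_eq UU.smult_l_distr UU.smult_l_minus)
  qed
  interpret E: Module.module R "EE i" by (rule center_kills_Ext(1)[of _ z, OF a z nat iso zH zG])
  have "(?a \<ominus>\<^bsub>R\<^esub> ?b) \<odot>\<^bsub>EE i\<^esub> x = \<zero>\<^bsub>EE i\<^esub>"
    by (rule center_kills_Ext(2)[of _ z, OF a z nat iso zH zG x])
  then have "?a \<odot>\<^bsub>EE i\<^esub> x \<ominus>\<^bsub>EE i\<^esub> ?b \<odot>\<^bsub>EE i\<^esub> x = \<zero>\<^bsub>EE i\<^esub>"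
    using x by (simp add: R.minus_eq E.minus_eq E.smult_l_distr E.smult_l_minus)
  then have "?a \<odot>\<^bsub>EE i\<^esub> x = ?b \<odot>\<^bsub>EE i\<^esub> x"
    using x E.minus_equality[of "?a \<odot>\<^bsub>EE i\<^esub> x" "\<ominus>\<^bsub>EE i\<^esub> (?b \<odot>\<^bsub>EE i\<^esub> x)"] by (simp add: E.minus_eq)
  then show ?thesis
    unfolding E.add_pow_smult[OF x, of "g ^ s"] E.add_pow_smult[OF x, of "g ^ t"] R.add_pow_one_nat_pow .
qed

end

end

section \<open>Numerical bounds and assembly of the three statements\<close>

text \<open>With N = Sigma_p(s) + (p - 1) r, the lower bound is the defining inequality of the
  ceiling. The upper bound is r \<le> v, where v is the valuation of s!.\<close>

lemma torsion_exponent_bounds: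
  assumes p: "prime p" and d: "d < s" and r: "r = nat (torsion_exponent p s (ereal (real d)))"
  shows "d < digit_sum p s + (p - 1) * r" and "digit_sum p s + (p - 1) * r \<le> s"
proof -
  define q where "q = (real d + 1 - real (digit_sum p s)) / (real p - 1)"
  have p1: "real p - 1 > 0" using prime_gt_1_nat[OF p] by simp
  have pr: "real (p - 1) = real p - 1" using prime_gt_0_nat[OF p] by (simp add: of_nat_diff)
  have rq: "r = nat \<lceil>q\<rceil>" unfolding r q_def by (simp add: torsion_exponent_def)
  then have "q \<le> real r" by linarith
  then have "real d + 1 - real (digit_sum p s) \<le> (real p - 1) * real r"
    using p1 unfolding q_def by (simp add: divide_le_eq mult.commute)
  then have "real (d + 1) \<le> real (digit_sum p s + (p - 1) * r)" using pr by simp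
  then show "d < digit_sum p s + (p - 1) * r" unfolding of_nat_le_iff by simp
  \<comment> \<open>By Legendre's formula v equals (s - Sigma_p(s)) / (p - 1). It is an integer and
    dominates q because d + 1 \<le> s, so rounding q up does not pass it.\<close>
  define v where "v = multiplicity p (fact s :: nat)"
  have v: "(p - 1) * v + digit_sum p s = s" unfolding v_def by (rule legendre_digit_sum[OF p])
  have "real ((p - 1) * v + digit_sum p s) = real s" unfolding v ..
  then have "real d + 1 - real (digit_sum p s) \<le> real v * (real p - 1)"
    using d pr by (simp add: mult.commute)
  then have "q \<le> real v" using p1 unfolding q_def by (simp add: divide_le_eq)
  then have "r \<le> v" unfolding rq by linarith
  then have "(p - 1) * r \<le> (p - 1) * v" by simp
  then show "digit_sum p s + (p - 1) * r \<le> s" using v by linarith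
qed

text \<open>If all three alternatives fail, the larger of the two digit sums is a common
  element.\<close>

lemma I_set_disjointE:
  assumes p: "prime p" and dis: "I_set p t \<inter> I_set p s = {}"
  obtains "s mod (p - 1) \<noteq> t mod (p - 1)" | "t < digit_sum p s" | "s < digit_sum p t"
proof (cases "s mod (p - 1) = t mod (p - 1) \<and> digit_sum p s \<le> t \<and> digit_sum p t \<le> s")
  case True
  \<comment> \<open>Both digit sums have the common residue of s and t modulo p - 1; neither exceeds
    s or t.\<close>
  then have "max (digit_sum p s) (digit_sum p t) \<in> I_set p t \<inter> I_set p s"
    using digit_sum_mod[OF p] digit_sum_le[OF p, of s] digit_sum_le[OF p, of t] by (auto simp: I_set_def max_def)
  with dis show ?thesis by blast
next
  case False
  then show ?thesis using that by linarith
qed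

theorem theorem4p17:
  fixes R :: "'r ring"
    and A :: "('r, 'm) pfunctor set"
    and F :: "('r, 'm) pfunctor"
    and G :: "('r, 'm) strict_functor"
    and s :: nat
  assumes "cring R"
    and "A \<subseteq> Ob (F_cat R)"
    and "abelian_category R (full_subcat (F_cat R) A)"
    and "enough_projectives (full_subcat (F_cat R) A)"
    and "enough_injectives (full_subcat (F_cat R) A)"
    and "\<forall>M\<in>Ob (P_cat R). \<forall>H\<in>A. \<exists>H'\<in>A. iso_obj (F_cat R) (param_hom R H M) H'"
    and "\<forall>M\<in>Ob (P_cat R). \<forall>H\<in>A. \<exists>H'\<in>A. iso_obj (F_cat R) (param_tensor R H M) H'"
    and "s > 0"
    and "F \<in> A" and "polynomial_functor R F"
    and "G \<in> Ob (strict_poly_cat R s)" and "underlying R s G \<in> A"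
    and "eml_degree R F < ereal (real s)"
  shows "let E = (\<lambda>i. Ext (full_subcat (F_cat R) A) i F (underlying R s G)) in
    (\<forall>i. torsion_group (E i)) \<and>
    (\<forall>p i. prime p \<longrightarrow>
       (\<forall>x \<in> primary_part p (E i).
          [(p ^ nat (torsion_exponent p s (eml_degree R F)))] \<cdot>\<^bsub>E i\<^esub> x = \<zero>\<^bsub>E i\<^esub>)) \<and>
    (\<forall>t (T :: ('r, 'm) strict_functor).
       t > 0 \<and> T \<in> Ob (strict_poly_cat R t) \<and> iso_obj (F_cat R) F (underlying R t T) \<longrightarrow>
       (\<forall>p. prime p \<and> I_set p t \<inter> I_set p s = {} \<longrightarrow> (\<forall>i. primary_part p (E i) = {\<zero>\<^bsub>E i\<^esub>})))"
proof -
  let ?E = "\<lambda>i. Ext (full_subcat (F_cat R) A) i F (underlying R s G)"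
  let ?m = "\<lambda>M. card (permutations_of_multiset M)"
  have pc: "power_P_cat R" by (rule power_P_cat.intro[OF assms(1)])
  have sp: "strict_power R" by (rule strict_power.intro[OF pc])
  have Ff: "is_functor (P_cat R) (Mod_cat R) F" using assms(2,9) by (auto simp: F_cat_def)
  note setting = assms(2-6)[unfolded F_cat_def] assms(9,11,12)
  have E: "Module.module R (?E i)" for i
    using strict_power.Ext_module[OF sp setting] unfolding F_cat_def .
  then have Eg: "abelian_group (?E i)" for i by (rule module.axioms)
  have kills: "[?m M] \<cdot>\<^bsub>?E i\<^esub> x = \<zero>\<^bsub>?E i\<^esub>"
    if "size M = s" "set_mset M = {..<N}" "N \<ge> 1" "cross_effect_vanishes R F N" "x \<in> carrier (?E i)" for M N x i
    using strict_power.multinomial_kills_Ext[OF sp setting that(1,2)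
      power_P_cat.eps_zero_if_cross_effect_vanishes[OF pc Ff that(3,4)]] that(5) unfolding F_cat_def .
  have m0: "?m M > 0" for M :: "nat multiset" by (simp add: card_gt_0_iff)
  have van: "cross_effect_vanishes R F n" if "n \<ge> s" for n
    by (rule eml_degree_cases[OF Ff assms(10)]) (use assms(8,13) that in auto)
  have tor: "torsion_group (?E i)" for i
    unfolding torsion_group_def
    \<comment> \<open>The decomposition s = 1 + ... + 1, whose coefficient is s!; the s-th cross
      effect of F vanishes because deg F < s.\<close>
    using kills[of "mset_set {..<s}" s, OF _ _ _ van[OF order_refl]] m0 assms(8) by fastforce
  have bound: "[(p ^ nat (torsion_exponent p s (eml_degree R F)))] \<cdot>\<^bsub>?E i\<^esub> x = \<zero>\<^bsub>?E i\<^esub>"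
    if p: "prime p" and x: "x \<in> primary_part p (?E i)" for p i x
  proof -
    define r where "r = nat (torsion_exponent p s (eml_degree R F))"
    let ?N = "digit_sum p s + (p - 1) * r"
    have N1: "?N \<ge> 1" using digit_sum_pos[OF prime_ge_2_nat[OF p] assms(8)] by linarith
    have N: "?N \<le> s \<and> cross_effect_vanishes R F ?N"
    proof (rule eml_degree_cases[OF Ff assms(10)])
      assume "eml_degree R F = - \<infinity>" and v: "\<And>n. n \<ge> 1 \<Longrightarrow> cross_effect_vanishes R F n"
      \<comment> \<open>For the zero functor the number of parts is just the digit sum of s, which
        is positive, and every cross effect vanishes.\<close>
      then have "r = 0" by (simp add: r_def torsion_exponent_def)
      then show ?thesis using v[OF N1] digit_sum_le[OF p, of s] by simp
    next
      fix d :: nat assume d: "eml_degree R F = ereal (real d)" and v: "\<And>n. n > d \<Longrightarrow> cross_effect_vanishes R F n"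
      have "d < s" using assms(13) d by simp
      from torsion_exponent_bounds[OF p this r_def[unfolded d]] show ?thesis using v by simp
    qed
    then obtain M where M: "size M = s" "set_mset M = {..<?N}" and r: "multiplicity p (?m M) = r"
      using multinomial_with_multiplicity[OF p] by blast
    obtain k where xc: "x \<in> carrier (?E i)" and k: "[(p ^ k)] \<cdot>\<^bsub>?E i\<^esub> x = \<zero>\<^bsub>?E i\<^esub>"
      using x by (auto simp: primary_part_def)
    show ?thesis unfolding r_def[symmetric]
      by (rule abelian_group.add_pow_coprime_zero[OF Eg xc k kills[OF M N1 conjunct2[OF N] xc] m0 p eq_refl[OF r]])
  qed
  have zero: "primary_part p (?E i) = {\<zero>\<^bsub>?E i\<^esub>}"
    if T: "T \<in> Ob (strict_poly_cat R t)" and iso: "iso_obj (F_cat R) F (underlying R t T)"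
      and p: "prime p" and dis: "I_set p t \<inter> I_set p s = {}" for t and T :: "('r, 'm) strict_functor" and p i
  proof -
    interpret E: abelian_group "?E i" by (rule Eg)
    note iso' = iso[unfolded F_cat_def]
    have "x = \<zero>\<^bsub>?E i\<^esub>" if x: "x \<in> carrier (?E i)" and k: "[(p ^ k)] \<cdot>\<^bsub>?E i\<^esub> x = \<zero>\<^bsub>?E i\<^esub>" for x k
    proof -
      \<comment> \<open>The previous bound with exponent 0: an annihilator prime to p leaves no
        p-primary torsion.\<close>
      have prime_to_p: ?thesis if "[n] \<cdot>\<^bsub>?E i\<^esub> x = \<zero>\<^bsub>?E i\<^esub>" "n > 0" "multiplicity p n = 0" for n :: nat
        using E.add_pow_coprime_zero[OF x k that(1,2) p, of 0] that(3) x by simp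
      from p dis show ?thesis
      proof (cases rule: I_set_disjointE)
        case 1
        then obtain g where g: "\<not> [g ^ s = g ^ t] (mod p)" using primitive_root_powers_incongruent[OF p] by blast
        have "[(g ^ s)] \<cdot>\<^bsub>?E i\<^esub> x = [(g ^ t)] \<cdot>\<^bsub>?E i\<^esub> x"
          using strict_power.scaling_on_Ext[OF sp setting T iso'] x unfolding F_cat_def .
        then show ?thesis by (rule E.add_pow_diff_zero[OF x k _ p g])
      next
        case 2
        obtain M where M: "size M = s" "set_mset M = {..<digit_sum p s}" and r: "multiplicity p (?m M) = 0"
          using multinomial_with_multiplicity[OF p, of s 0] digit_sum_le[OF p, of s] by auto
        \<comment> \<open>F has weight t, less than the number Sigma_p(s) of parts, so the cross
          effect projection for that many parts vanishes on F, and the decomposition of s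
          applies.\<close>
        note e = strict_power.eps_zero_iso[OF sp iso' strict_power.eps_U_zero[OF sp T 2]]
        have "[?m M] \<cdot>\<^bsub>?E i\<^esub> x = \<zero>\<^bsub>?E i\<^esub>"
          using strict_power.multinomial_kills_Ext[OF sp setting M e] x unfolding F_cat_def .
        then show ?thesis using prime_to_p m0 r by blast
      next
        case 3
        obtain M where M: "size M = t" "set_mset M = {..<digit_sum p t}" and r: "multiplicity p (?m M) = 0"
          using multinomial_with_multiplicity[OF p, of t 0] digit_sum_le[OF p, of t] by auto
        have N: "digit_sum p t \<ge> 1" "digit_sum p t \<ge> s" using 3 by simp_all
        \<comment> \<open>The number of parts is now Sigma_p(t), which exceeds s and hence deg F.
          The projection vanishes on F, and the coefficient of the decomposition of t annihilates F
          itself.\<close>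
        note e = power_P_cat.eps_zero_if_cross_effect_vanishes[OF pc Ff N(1) van[OF N(2)]]
        have "[?m M] \<cdot>\<^bsub>?E i\<^esub> x = \<zero>\<^bsub>?E i\<^esub>"
          using strict_power.source_multinomial_kills_Ext[OF sp setting T iso' M e] x unfolding F_cat_def .
        then show ?thesis using prime_to_p m0 r by blast
      qed
    qed
    moreover have "\<zero>\<^bsub>?E i\<^esub> \<in> primary_part p (?E i)" by (auto simp: primary_part_def intro: exI[of _ 0])
    ultimately show ?thesis by (auto simp: primary_part_def)
  qed
  show ?thesis unfolding Let_def using tor bound zero by blast
qed

end
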